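(* Let $p,q$ be real numbers with $1<q<p<\phi_0$, and assume that $$\phi^0<\min\left\{N,\frac{N\phi_0}{N-\phi_0}\right\}.$$ Then there exists $\lambda^\star>0$ such that for all $\lambda>\lambda^\star$ the problem $$\left\{\begin{array}{ll}-\mathrm{div}(a(|\nabla u|)\nabla u)=\lambda(u^{p-1}-u^{q-1}), & x\in\Omega,\\ u=0, & x\in\partial\Omega,\\ u\ge 0, & x\in\Omega,\end{array}\right.$$ has at least two distinct non-negative, nontrivial weak solutions in $E=W_0^1L_\Phi(\Omega)$.
   Context: $\Omega\subset\mathbb{R}^N$ ($N\ge 3$) is a bounded domain with smooth boundary $\partial\Omega$. $a:(0,\infty)\to\mathbb{R}$ is a function such that $\phi:\mathbb{R}\to\mathbb{R}$, $\phi(t)=a(|t|)t$ for $t\ne0$, $\phi(0)=0$, is an odd, increasing homeomorphism from $\mathbb{R}$ onto $\mathbb{R}$; the vector $a(|\xi|)\xi$ is understood as $0$ when $\xi=0$. Put $\Phi(t)=\int_0^t\phi(s)\,ds$ and $$\phi_0=\inf_{t>0}\frac{t\phi(t)}{\Phi(t)},\qquad \phi^0=\sup_{t>0}\frac{t\phi(t)}{\Phi(t)}.$$ Standing assumptions: $1<\phi_0\le\phi^0<\infty$, and the function $[0,\infty)\ni t\mapsto\Phi(\sqrt t)$ is convex. The Orlicz space $L_\Phi(\Omega)$ is the space of measurable $u:\Omega\to\mathbb{R}$ with finite Luxemburg norm $\|u\|_\Phi=\inf\{k>0:\int_\Omega\Phi(u(x)/k)\,dx\le1\}$. $W^1L_\Phi(\Omega)$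 is the space of $u\in L_\Phi(\Omega)$ whose weak partial derivatives $\partial u/\partial x_i$, $i=1,\dots,N$, lie in $L_\Phi(\Omega)$, with norm $\|u\|_{1,\Phi}=\|u\|_\Phi+\||\nabla u|\|_\Phi$. $E=W_0^1L_\Phi(\Omega)$ is the closure of $C_0^\infty(\Omega)$ in $W^1L_\Phi(\Omega)$, equipped with the equivalent norm $\|u\|=\||\nabla u|\|_\Phi$. A function $u\in E$ is a weak solution of the problem if $u\ge0$ a.e. in $\Omega$ and $$\int_\Omega a(|\nabla u|)\nabla u\cdot\nabla v\,dx-\lambda\int_\Omega u^{p-1}v\,dx+\lambda\int_\Omega u^{q-1}v\,dx=0\quad\text{for all }v\in E.$$ *)

theory Defs
  imports "HOL-Analysis.Analysis"
begin

section \<open>Smooth functions, test functions, smooth bounded domains\<close>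

definition partial_deriv :: "'n::finite \<Rightarrow> (real^'n \<Rightarrow> real) \<Rightarrow> real^'n \<Rightarrow> real" where
  "partial_deriv i f x = frechet_derivative f (at x) (axis i 1)"

primrec Ck :: "nat \<Rightarrow> (real^'n::finite \<Rightarrow> real) \<Rightarrow> bool" where
  "Ck 0 f \<longleftrightarrow> continuous_on UNIV f"
| "Ck (Suc k) f \<longleftrightarrow> f differentiable_on UNIV \<and> (\<forall>i. Ck k (partial_deriv i f))"

definition smooth :: "(real^'n::finite \<Rightarrow> real) \<Rightarrow> bool" where
  "smooth f \<longleftrightarrow> (\<forall>k. Ck k f)"

text \<open>Elements of \<open>C\<^sub>0\<^sup>\<infinity>(\<Omega>)\<close> are represented by their extension by zero to the whole space.\<close>

definition test_functions :: "(real^'n::finite) set \<Rightarrow> (real^'n \<Rightarrow> real) set" where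
  "test_functions \<Omega> =
     {\<zeta>. smooth \<zeta> \<and> compact (closure {x. \<zeta> x \<noteq> 0}) \<and> closure {x. \<zeta> x \<noteq> 0} \<subseteq> \<Omega>}"

text \<open>
  The boundary is smooth if, near each of its points and after relabelling and reorienting
  the coordinate axes, \<open>\<Omega>\<close> is the region above the graph of a smooth function \<open>\<gamma>\<close> of the
  other \<open>N - 1\<close> coordinates. Such a \<open>\<gamma>\<close> is given here as a smooth function on the whole space
  that is only evaluated at points whose \<open>i\<close>-th coordinate has been replaced by \<open>0\<close>; the
  sign \<open>s\<close> is the orientation of the \<open>i\<close>-th axis.
\<close>

definition smooth_boundary :: "(real^'n::finite) set \<Rightarrow> bool" where
  "smooth_boundary \<Omega> \<longleftrightarrow>
     (\<forall>x0 \<in> frontier \<Omega>. \<exists>r>0. \<exists>i. \<exists>s\<in>{-1, 1::real}. \<exists>\<gamma>. smooth \<gamma> \<and>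
        \<Omega> \<inter> ball x0 r =
          {x \<in> ball x0 r. s * x $ i > \<gamma> (\<chi> j. if j = i then 0 else x $ j)})"

definition smooth_bounded_domain :: "(real^'n::finite) set \<Rightarrow> bool" where
  "smooth_bounded_domain \<Omega> \<longleftrightarrow>
     open \<Omega> \<and> connected \<Omega> \<and> \<Omega> \<noteq> {} \<and> bounded \<Omega> \<and> smooth_boundary \<Omega>"


section \<open>The functions \<open>\<phi>\<close>, \<open>\<Phi>\<close> and their indices\<close>

text \<open>Only the values of \<open>a\<close> on \<open>(0, \<infinity>)\<close> matter.\<close>

definition phi :: "(real \<Rightarrow> real) \<Rightarrow> real \<Rightarrow> real" where
  "phi a t = (if t = 0 then 0 else a \<bar>t\<bar> * t)"

text \<open>The interval integral is oriented, so this is also the intended value for \<open>t < 0\<close>.\<close>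

definition Phi :: "(real \<Rightarrow> real) \<Rightarrow> real \<Rightarrow> real" where
  "Phi a t = (LBINT s=0..ereal t. phi a s)"

definition phi_lower :: "(real \<Rightarrow> real) \<Rightarrow> ereal" where
  "phi_lower a = (INF t\<in>{0<..}. ereal (t * phi a t / Phi a t))"

definition phi_upper :: "(real \<Rightarrow> real) \<Rightarrow> ereal" where
  "phi_upper a = (SUP t\<in>{0<..}. ereal (t * phi a t / Phi a t))"


section \<open>Orlicz and Orlicz--Sobolev spaces\<close>

text \<open>
  A function on \<open>\<Omega>\<close> is represented by a function on the whole space whose values outside
  \<open>\<Omega>\<close> are irrelevant. The parameter \<open>F\<close> is the (nonnegative) Young function. The norm is
  \<open>\<infinity>\<close> if there is no admissible \<open>k\<close>.
\<close>

definition luxemburg_norm ::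
    "(real \<Rightarrow> real) \<Rightarrow> (real^'n::finite) set \<Rightarrow> (real^'n \<Rightarrow> real) \<Rightarrow> ennreal" where
  "luxemburg_norm F \<Omega> u =
     Inf {ennreal k | k. k > 0 \<and> (\<integral>\<^sup>+ x. ennreal (F (u x / k)) \<partial>lebesgue_on \<Omega>) \<le> 1}"

definition orlicz_space ::
    "(real \<Rightarrow> real) \<Rightarrow> (real^'n::finite) set \<Rightarrow> (real^'n \<Rightarrow> real) set" where
  "orlicz_space F \<Omega> =
     {u. u \<in> borel_measurable (lebesgue_on \<Omega>) \<and> luxemburg_norm F \<Omega> u < \<infinity>}"

definition locally_integrable :: "(real^'n::finite) set \<Rightarrow> (real^'n \<Rightarrow> real) \<Rightarrow> bool" where
  "locally_integrable \<Omega> u \<longleftrightarrow> (\<forall>K. compact K \<and> K \<subseteq> \<Omega> \<longrightarrow> integrable (lebesgue_on K) u)"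

definition has_weak_partial ::
    "(real^'n::finite) set \<Rightarrow> 'n \<Rightarrow> (real^'n \<Rightarrow> real) \<Rightarrow> (real^'n \<Rightarrow> real) \<Rightarrow> bool" where
  "has_weak_partial \<Omega> i u g \<longleftrightarrow>
     locally_integrable \<Omega> u \<and> locally_integrable \<Omega> g \<and>
     (\<forall>\<zeta> \<in> test_functions \<Omega>.
        (\<integral>x. u x * partial_deriv i \<zeta> x \<partial>lebesgue_on \<Omega>) = - (\<integral>x. g x * \<zeta> x \<partial>lebesgue_on \<Omega>))"

text \<open>
  Weak derivatives are unique up to null sets. The definition below picks a representative,
  and is meaningful only for weakly differentiable \<open>u\<close>.
\<close>

definition weak_grad :: "(real^'n::finite) set \<Rightarrow> (real^'n \<Rightarrow> real) \<Rightarrow> real^'n \<Rightarrow> real^'n" where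
  "weak_grad \<Omega> u x = (\<chi> i. (SOME g. has_weak_partial \<Omega> i u g) x)"

definition W1L :: "(real \<Rightarrow> real) \<Rightarrow> (real^'n::finite) set \<Rightarrow> (real^'n \<Rightarrow> real) set" where
  "W1L F \<Omega> =
     {u \<in> orlicz_space F \<Omega>. \<forall>i. \<exists>g \<in> orlicz_space F \<Omega>. has_weak_partial \<Omega> i u g}"

definition W1L_norm ::
    "(real \<Rightarrow> real) \<Rightarrow> (real^'n::finite) set \<Rightarrow> (real^'n \<Rightarrow> real) \<Rightarrow> ennreal" where
  "W1L_norm F \<Omega> u =
     luxemburg_norm F \<Omega> u + luxemburg_norm F \<Omega> (\<lambda>x. norm (weak_grad \<Omega> u x))"

definition W01L :: "(real \<Rightarrow> real) \<Rightarrow> (real^'n::finite) set \<Rightarrow> (real^'n \<Rightarrow> real) set" where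
  "W01L F \<Omega> =
     {u \<in> W1L F \<Omega>. \<forall>\<epsilon>>0. \<exists>\<zeta> \<in> test_functions \<Omega>. W1L_norm F \<Omega> (\<lambda>x. u x - \<zeta> x) < \<epsilon>}"


section \<open>Weak solutions\<close>

text \<open>
  Integrability is required explicitly because the Bochner integral of a non-integrable
  function is \<open>0\<close> by convention. The vector \<open>a (norm \<xi>) *\<^sub>R \<xi>\<close> is \<open>0\<close> for \<open>\<xi> = 0\<close>, whatever
  the value \<open>a 0\<close>.
\<close>

definition weak_solution ::
    "(real^'n::finite) set \<Rightarrow> (real \<Rightarrow> real) \<Rightarrow> real \<Rightarrow> real \<Rightarrow> real \<Rightarrow> (real^'n \<Rightarrow> real) \<Rightarrow> bool"
where
  "weak_solution \<Omega> a p q \<mu> u \<longleftrightarrow>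
     u \<in> W01L (Phi a) \<Omega> \<and>
     (AE x in lebesgue_on \<Omega>. u x \<ge> 0) \<and>
     (\<forall>v \<in> W01L (Phi a) \<Omega>.
        integrable (lebesgue_on \<Omega>)
          (\<lambda>x. (a (norm (weak_grad \<Omega> u x)) *\<^sub>R weak_grad \<Omega> u x) \<bullet> weak_grad \<Omega> v x) \<and>
        integrable (lebesgue_on \<Omega>) (\<lambda>x. u x powr (p - 1) * v x) \<and>
        integrable (lebesgue_on \<Omega>) (\<lambda>x. u x powr (q - 1) * v x) \<and>
        (\<integral>x. (a (norm (weak_grad \<Omega> u x)) *\<^sub>R weak_grad \<Omega> u x) \<bullet> weak_grad \<Omega> v x
            \<partial>lebesgue_on \<Omega>)
          - \<mu> * (\<integral>x. u x powr (p - 1) * v x \<partial>lebesgue_on \<Omega>)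
          + \<mu> * (\<integral>x. u x powr (q - 1) * v x \<partial>lebesgue_on \<Omega>) = 0)"

end

theory Submission
  imports Defs
begin

text \<open>
  The solutions are nonnegative critical points of
  \<open>J(u) = \<integral> \<Phi>(|\<nabla>u|) - \<mu> \<integral> (u\<^sub>+\<^sup>p / p - u\<^sub>+\<^sup>q / q)\<close>: for large \<open>\<mu>\<close> a global minimum
  of negative energy and a mountain pass point of positive energy. Both are obtained as Galerkin
  limits. On the span of finitely many test functions, \<open>J\<close> is coercive, and convexity alone bounds
  its finite differences; this gives a minimizer and, by iterating a one-step deformation, a
  mountain pass point. The mountain pass geometry needs no Sobolev embedding: if
  \<open>\<integral> \<Phi>(|\<nabla>u|)\<close> is small, then so is the set where the nonlinearity contributes to the descent,
  and the Poincare constant of a function supported in a small set is small. Poincare, small-set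
  and compactness estimates all follow from
  \<open>\<integral> \<Phi>(u(x + h) - u(x)) dx \<le> \<integral> \<Phi>(|h| |\<nabla>u|) dx\<close>. Approximate critical points converge strongly,
  since the convexity of \<open>\<Phi>(\<surd>t)\<close> yields a Clarkson inequality; no weak topology or reflexivity
  is used. Because of the bound \<open>t \<phi>(t) \<le> \<sigma> \<Phi>(t)\<close>, norm convergence is the same as
  convergence of the modulars \<open>\<integral> \<Phi>\<close>, which always yields a subsequence that converges almost
  everywhere and is dominated.
\<close>

section \<open>Smooth functions and test functions\<close>

text \<open>Since p < \<phi>_0, t^p = o(\<Phi>(t)): the whole nonlinearity is of lower order than
  the modular of the gradient, and both coercivity and the integrability of every term come from
  \<Phi> alone. The obstacle is that J is a difference of convex terms and is never shown to be
  differentiable on E. Hence inequalities come from tangent lines, and limits are of one kind: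
  almost everywhere convergence of functions and gradients below one function of finite modular
  (\<open>dlim\<close>), where dominated convergence settles each term of J and of its variation. A
  Galerkin equation holds only against a finite span, so two density steps lead to all of E: from a
  countable family of test functions to all test functions, and from these to E. The two limits are
  told apart by the sign of J, which is why gradients have to converge strongly and why the bounds J
  <= J(e) < 0 and J >= \<delta> > 0 must not depend on the dimension. The threshold for \<mu> only
  has to ensure J(e) < 0 for one fixed scaled bump e.\<close>

definition grad :: "(real^'n::finite \<Rightarrow> real) \<Rightarrow> real^'n \<Rightarrow> real^'n" where
  "grad f x = (\<chi> i. partial_deriv i f x)"

lemma partial_deriv_eqI:
  "(f has_derivative f') (at x) \<Longrightarrow> partial_deriv i f x = f' (axis i 1)"
  unfolding partial_deriv_def by (simp flip: frechet_derivative_at)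

lemma grad_has_derivative:
  assumes "f differentiable (at x)"
  shows "(f has_derivative (\<lambda>h. grad f x \<bullet> h)) (at x)"
proof -
  let ?D = "frechet_derivative f (at x)"
  have D: "(f has_derivative ?D) (at x)"
    using assms frechet_derivative_works by blast
  then have lin: "linear ?D"
    by (rule has_derivative_linear)
  have "?D h = grad f x \<bullet> h" for h
  proof -
    have "?D h = ?D (\<Sum>i\<in>UNIV. (h $ i) *\<^sub>R axis i 1)"
      by (simp add: basis_expansion flip: scalar_mult_eq_scaleR)
    also have "\<dots> = (\<Sum>i\<in>UNIV. (h $ i) * ?D (axis i 1))"
      by (simp add: linear_sum[OF lin] linear_cmul[OF lin])
    also have "\<dots> = grad f x \<bullet> h"
      by (simp add: inner_vec_def grad_def partial_deriv_def mult.commute)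
    finally show ?thesis .
  qed
  then have "?D = (\<lambda>h. grad f x \<bullet> h)" by auto
  with D show ?thesis by simp
qed

lemma grad_eqI:
  assumes "(f has_derivative (\<lambda>h. g \<bullet> h)) (at x)"
  shows "grad f x = g"
  unfolding grad_def vec_eq_iff using partial_deriv_eqI[OF assms] by (simp add: inner_axis)

lemma Ck_Suc_differentiable: "Ck (Suc k) f \<Longrightarrow> f differentiable (at x)"
  by (simp add: differentiable_on_def)

lemma Ck_SucD: "Ck (Suc k) f \<Longrightarrow> Ck k f"
proof (induction k arbitrary: f)
  case 0
  then show ?case by (auto intro: differentiable_imp_continuous_on)
next
  case (Suc k)
  then show ?case by (metis Ck.simps(2))
qed

lemma Ck_const: "Ck k (\<lambda>x::real^'n::finite. c)"
proof (induction k arbitrary: c)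
  case (Suc k)
  have "partial_deriv i (\<lambda>x::real^'n. c) = (\<lambda>x. 0)" for i
    by (rule ext) (simp add: partial_deriv_eqI[OF has_derivative_const])
  with Suc show ?case by (simp add: differentiable_on_def)
qed auto

lemma Ck_add: "Ck k f \<Longrightarrow> Ck k g \<Longrightarrow> Ck k (\<lambda>x. f x + g x)"
proof (induction k arbitrary: f g)
  case (Suc k)
  have "partial_deriv i (\<lambda>x. f x + g x) = (\<lambda>x. partial_deriv i f x + partial_deriv i g x)" for i
  proof
    fix x
    show "partial_deriv i (\<lambda>x. f x + g x) x = partial_deriv i f x + partial_deriv i g x"
      using partial_deriv_eqI[OF has_derivative_add[OF
          grad_has_derivative[OF Ck_Suc_differentiable[OF Suc.prems(1)]]
          grad_has_derivative[OF Ck_Suc_differentiable[OF Suc.prems(2)]]]]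
      by (simp add: inner_axis grad_def)
  qed
  with Suc show ?case by (auto simp: differentiable_on_def)
qed (auto intro: continuous_intros)

lemma Ck_mult: "Ck k f \<Longrightarrow> Ck k g \<Longrightarrow> Ck k (\<lambda>x. f x * g x)"
proof (induction k arbitrary: f g)
  case (Suc k)
  have "partial_deriv i (\<lambda>x. f x * g x) = (\<lambda>x. f x * partial_deriv i g x + partial_deriv i f x * g x)" for i
  proof
    fix x
    show "partial_deriv i (\<lambda>x. f x * g x) x = f x * partial_deriv i g x + partial_deriv i f x * g x"
      using partial_deriv_eqI[OF has_derivative_mult[OF
          grad_has_derivative[OF Ck_Suc_differentiable[OF Suc.prems(1)]]
          grad_has_derivative[OF Ck_Suc_differentiable[OF Suc.prems(2)]]]]
      by (simp add: inner_axis grad_def)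
  qed
  moreover have "Ck k f" "Ck k g"
    using Suc.prems Ck_SucD by auto
  ultimately show ?case using Suc by (auto simp: differentiable_on_def intro!: Ck_add)
qed (auto intro: continuous_intros)

text \<open>The outer function is given together with all its derivatives, as a sequence
  \<open>H\<close>; differentiating moves from \<open>H j\<close> to \<open>H (Suc j)\<close>, so
  the induction on \<open>k\<close> runs with \<open>j\<close> arbitrary.\<close>

lemma Ck_compose:
  fixes H :: "nat \<Rightarrow> real \<Rightarrow> real"
  assumes H: "\<And>j t. (H j has_real_derivative H (Suc j) t) (at t)"
  shows "Ck k f \<Longrightarrow> Ck k (\<lambda>x. H j (f x))"
proof (induction k arbitrary: j)
  case 0
  have "continuous_on UNIV (H j)"
    using H by (meson DERIV_isCont continuous_at_imp_continuous_on)
  with 0 show ?case by (auto intro: continuous_on_compose2)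
next
  case (Suc k)
  have der: "((\<lambda>x. H j (f x)) has_derivative (\<lambda>h. H (Suc j) (f x) * (grad f x \<bullet> h))) (at x)" for x
    using has_derivative_compose[OF grad_has_derivative[OF Ck_Suc_differentiable[OF Suc.prems]]
        H[unfolded has_field_derivative_def], of j x]
    by simp
  have "partial_deriv i (\<lambda>x. H j (f x)) = (\<lambda>x. H (Suc j) (f x) * partial_deriv i f x)" for i
  proof
    fix x
    show "partial_deriv i (\<lambda>x. H j (f x)) x = H (Suc j) (f x) * partial_deriv i f x"
      using partial_deriv_eqI[OF der] by (simp add: inner_axis grad_def)
  qed
  moreover have "(\<lambda>x. H j (f x)) differentiable_on UNIV"
    using der by (auto simp: differentiable_on_def differentiable_def)
  moreover have "Ck k f" using Suc.prems Ck_SucD by auto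
  ultimately show ?case using Suc by (auto intro!: Ck_mult)
qed

lemma smooth_const: "smooth (\<lambda>x::real^'n::finite. c)"
  by (simp add: smooth_def Ck_const)

lemma smooth_add: "smooth f \<Longrightarrow> smooth g \<Longrightarrow> smooth (\<lambda>x. f x + g x)"
  by (simp add: smooth_def Ck_add)

lemma smooth_mult: "smooth f \<Longrightarrow> smooth g \<Longrightarrow> smooth (\<lambda>x. f x * g x)"
  by (simp add: smooth_def Ck_mult)

lemma smooth_compose:
  fixes H :: "nat \<Rightarrow> real \<Rightarrow> real"
  assumes "\<And>j t. (H j has_real_derivative H (Suc j) t) (at t)" "smooth f"
  shows "smooth (\<lambda>x. H j (f x))"
  unfolding smooth_def
proof
  show "Ck k (\<lambda>x. H j (f x))" for k
    using assms(2) by (intro Ck_compose[where H=H] assms(1)) (simp add: smooth_def)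
qed

lemma smooth_prod:
  assumes "finite S" "\<And>i. i \<in> S \<Longrightarrow> smooth (f i)"
  shows "smooth (\<lambda>x. \<Prod>i\<in>S. f i x)"
  using assms by (induction S rule: finite_induct) (simp_all add: smooth_const smooth_mult)

lemma smooth_nth: "smooth (\<lambda>x::real^'n::finite. x $ i)"
  unfolding smooth_def
proof
  fix k
  have der: "((\<lambda>x. x $ i) has_derivative (\<lambda>h::real^'n. h $ i)) (at x)" for x
    by (rule bounded_linear_imp_has_derivative) (rule bounded_linear_vec_nth)
  have "partial_deriv j (\<lambda>x::real^'n. x $ i) = (\<lambda>x. if i = j then 1 else 0)" for j
    using partial_deriv_eqI[OF der] by (auto simp: axis_def)
  then show "Ck k (\<lambda>x::real^'n. x $ i)"
    using der Ck_const by (cases k)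
      (auto simp: differentiable_on_def differentiable_def intro!: continuous_intros)
qed

lemma smooth_differentiable: "smooth f \<Longrightarrow> f differentiable (at x)"
  using Ck_Suc_differentiable smooth_def by blast

lemma smooth_has_derivative: "smooth f \<Longrightarrow> (f has_derivative (\<lambda>h. grad f x \<bullet> h)) (at x)"
  by (simp add: grad_has_derivative smooth_differentiable)

lemma smooth_partial_deriv: "smooth f \<Longrightarrow> smooth (partial_deriv i f)"
  unfolding smooth_def by (metis Ck.simps(2))

lemma smooth_continuous: "smooth f \<Longrightarrow> continuous_on S f"
  by (metis Ck.simps(1) continuous_on_subset smooth_def subset_UNIV)

lemma smooth_continuous_grad: "smooth f \<Longrightarrow> continuous_on S (grad f)"
  unfolding grad_def[abs_def]
  by (intro continuous_on_vec_lambda smooth_continuous smooth_partial_deriv)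

lemma test_functionI:
  assumes "smooth f" "compact K" "K \<subseteq> \<Omega>" "\<And>x. x \<notin> K \<Longrightarrow> f x = 0"
  shows "f \<in> test_functions \<Omega>"
proof -
  have "closure {x. f x \<noteq> 0} \<subseteq> K"
    using assms by (intro closure_minimal compact_imp_closed) auto
  moreover from this have "compact (closure {x. f x \<noteq> 0})"
    by (meson assms(2) bounded_subset closed_closure compact_eq_bounded_closed)
  ultimately show ?thesis
    using assms by (auto simp: test_functions_def)
qed

text \<open>The set \<open>K\<close> is the closed support. Its complement is open and
  \<open>f\<close> vanishes on it, hence the derivatives vanish there too.\<close>

lemma test_functionE:
  assumes "f \<in> test_functions \<Omega>"
  obtains K where "smooth f" "compact K" "K \<subseteq> \<Omega>" "\<And>x. x \<notin> K \<Longrightarrow> f x = 0"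
    "\<And>x i. x \<notin> K \<Longrightarrow> partial_deriv i f x = 0" "\<And>x. x \<notin> K \<Longrightarrow> grad f x = 0"
proof
  let ?K = "closure {x. f x \<noteq> 0}"
  show "smooth f" "compact ?K" "?K \<subseteq> \<Omega>"
    using assms by (auto simp: test_functions_def)
  show "f x = 0" if "x \<notin> ?K" for x
    using that closure_subset[of "{x. f x \<noteq> 0}"] by auto
  show *: "grad f x = 0" if "x \<notin> ?K" for x
  proof -
    have "(f has_derivative (\<lambda>h. 0)) (at x)"
    proof (rule has_derivative_transform_within_open[where f="\<lambda>x. 0"])
      show "open (- ?K)" by (simp add: open_Compl)
      show "x \<in> - ?K" using that by simp
      show "0 = f y" if "y \<in> - ?K" for y
        using that closure_subset[of "{x. f x \<noteq> 0}"] by auto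
    qed auto
    then show ?thesis by (intro grad_eqI) simp
  qed
  show "partial_deriv i f x = 0" if "x \<notin> ?K" for x i
    using *[OF that] by (simp add: grad_def vec_eq_iff)
qed

lemma test_function_smooth: "f \<in> test_functions \<Omega> \<Longrightarrow> smooth f"
  by (simp add: test_functions_def)

lemma test_function_zero: "f \<in> test_functions \<Omega> \<Longrightarrow> x \<notin> \<Omega> \<Longrightarrow> f x = 0"
  by (metis test_functionE subsetD)

lemma test_function_grad_zero: "f \<in> test_functions \<Omega> \<Longrightarrow> x \<notin> \<Omega> \<Longrightarrow> grad f x = 0"
  by (metis test_functionE subsetD)

lemma test_function_partial_deriv:
  assumes "f \<in> test_functions \<Omega>" shows "partial_deriv i f \<in> test_functions \<Omega>"
  by (rule test_functionE[OF assms]) (auto intro!: test_functionI smooth_partial_deriv)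

lemma zero_test_function: "(\<lambda>x. 0) \<in> test_functions \<Omega>"
  by (rule test_functionI[where K="{}"]) (auto simp: smooth_const)

lemma test_function_add:
  assumes "f \<in> test_functions \<Omega>" "g \<in> test_functions \<Omega>"
  shows "(\<lambda>x. f x + g x) \<in> test_functions \<Omega>"
proof -
  obtain K where K: "smooth f" "compact K" "K \<subseteq> \<Omega>" "\<And>x. x \<notin> K \<Longrightarrow> f x = 0"
    using test_functionE[OF assms(1)] by metis
  obtain L where L: "smooth g" "compact L" "L \<subseteq> \<Omega>" "\<And>x. x \<notin> L \<Longrightarrow> g x = 0"
    using test_functionE[OF assms(2)] by metis
  show ?thesis
    using K L by (intro test_functionI[where K="K \<union> L"]) (auto intro: smooth_add)
qed

lemma test_function_cmult:
  assumes "f \<in> test_functions \<Omega>" shows "(\<lambda>x. c * f x) \<in> test_functions \<Omega>"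
  by (rule test_functionE[OF assms]) (auto intro!: test_functionI smooth_mult smooth_const)

lemma test_function_diff:
  assumes "f \<in> test_functions \<Omega>" "g \<in> test_functions \<Omega>"
  shows "(\<lambda>x. f x - g x) \<in> test_functions \<Omega>"
  using test_function_add[OF assms(1) test_function_cmult[OF assms(2), of "-1"]] by simp

lemma test_function_sum:
  assumes "finite S" "\<And>i. i \<in> S \<Longrightarrow> f i \<in> test_functions \<Omega>"
  shows "(\<lambda>x. \<Sum>i\<in>S. c i * f i x) \<in> test_functions \<Omega>"
  using assms by (induction S rule: finite_induct)
    (simp_all add: zero_test_function test_function_add test_function_cmult)

lemma test_function_compose:
  fixes H :: "nat \<Rightarrow> real \<Rightarrow> real"
  assumes "\<And>j t. (H j has_real_derivative H (Suc j) t) (at t)" "H j 0 = 0"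
    and "f \<in> test_functions \<Omega>"
  shows "(\<lambda>x. H j (f x)) \<in> test_functions \<Omega>"
  using assms(3)
proof (rule test_functionE)
  fix K
  assume "smooth f" "compact K" "K \<subseteq> \<Omega>" "\<And>x. x \<notin> K \<Longrightarrow> f x = 0"
  then show ?thesis
    using assms(2) by (intro test_functionI[where K=K] smooth_compose[where H=H] assms(1)) auto
qed

lemma grad_compose:
  assumes "(h has_real_derivative d) (at (f x))" "smooth f"
  shows "grad (\<lambda>x. h (f x)) x = d *\<^sub>R grad f x"
  using has_derivative_compose[OF smooth_has_derivative[OF assms(2)]
      assms(1)[unfolded has_field_derivative_def]]
  by (intro grad_eqI) simp

lemma grad_add: "smooth f \<Longrightarrow> smooth g \<Longrightarrow> grad (\<lambda>x. f x + g x) x = grad f x + grad g x"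
  by (rule grad_eqI) (auto intro!: derivative_eq_intros smooth_has_derivative simp: inner_add_left)

lemma grad_cmult: "smooth f \<Longrightarrow> grad (\<lambda>x. c * f x) x = c *\<^sub>R grad f x"
  by (rule grad_eqI) (auto intro!: derivative_eq_intros smooth_has_derivative)

lemma grad_diff: "smooth f \<Longrightarrow> smooth g \<Longrightarrow> grad (\<lambda>x. f x - g x) x = grad f x - grad g x"
  by (rule grad_eqI) (auto intro!: derivative_eq_intros smooth_has_derivative simp: inner_diff_left)

lemma grad_sum:
  assumes "finite S" "\<And>i. i \<in> S \<Longrightarrow> smooth (f i)"
  shows "grad (\<lambda>x. \<Sum>i\<in>S. c i * f i x) x = (\<Sum>i\<in>S. c i *\<^sub>R grad (f i) x)"
  by (rule grad_eqI) (use assms in \<open>auto intro!: derivative_eq_intros smooth_has_derivative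
        simp: inner_sum_left\<close>)

lemma grad_nth: "grad f x $ i = partial_deriv i f x"
  by (simp add: grad_def)

lemma continuous_zero_outside_compact_bounded:
  fixes f :: "'a::topological_space \<Rightarrow> 'b::real_normed_vector"
  assumes "continuous_on K f" "compact K" "\<And>x. x \<notin> K \<Longrightarrow> f x = 0"
  obtains B where "B > 0" "\<And>x. norm (f x) \<le> B"
proof -
  have "bounded (f ` K)" using assms by (simp add: compact_continuous_image compact_imp_bounded)
  then obtain B where "B > 0" "\<And>x. x \<in> K \<Longrightarrow> norm (f x) \<le> B"
    by (auto simp: bounded_pos)
  with assms(3) show ?thesis by (intro that[of B]) (metis norm_zero order_less_imp_le)+
qed

lemma test_function_bounded:
  assumes "f \<in> test_functions \<Omega>"
  obtains B where "B > 0" "\<And>x. \<bar>f x\<bar> \<le> B" "\<And>x. norm (grad f x) \<le> B"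
proof -
  obtain K where K: "smooth f" "compact K" "\<And>x. x \<notin> K \<Longrightarrow> f x = 0" "\<And>x. x \<notin> K \<Longrightarrow> grad f x = 0"
    using test_functionE[OF assms] by metis
  obtain B1 where B1: "B1 > 0" "\<And>x. norm (f x) \<le> B1"
    using continuous_zero_outside_compact_bounded[OF smooth_continuous[OF K(1)] K(2,3)] by blast
  obtain B2 where "B2 > 0" "\<And>x. norm (grad f x) \<le> B2"
    using continuous_zero_outside_compact_bounded[OF smooth_continuous_grad[OF K(1)] K(2,4)] by blast
  with B1 that[of "max B1 B2"] show ?thesis
    by (metis less_max_iff_disj max.coboundedI1 max.coboundedI2 real_norm_def)
qed

lemma smooth_lipschitz:
  assumes "smooth f" "\<And>x. norm (grad f x) \<le> B"
  shows "\<bar>f x - f y\<bar> \<le> B * norm (x - y)"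
proof -
  have "norm (f x - f y) \<le> B * norm (x - y)"
  proof (rule differentiable_bound[OF convex_UNIV])
    show "(f has_derivative (\<lambda>h. grad f z \<bullet> h)) (at z within UNIV)" for z
      using smooth_has_derivative[OF assms(1)] by simp
    show "onorm (\<lambda>h. grad f z \<bullet> h) \<le> B" for z
      using assms(2)[of z] by (intro onorm_le)
        (metis Cauchy_Schwarz_ineq2 mult_right_mono norm_ge_zero order_trans real_norm_def)
  qed auto
  then show ?thesis by simp
qed

text \<open>Partial derivatives of a test function are again test functions, hence Lipschitz. The
  bound sorts the test functions into countably many equi-Lipschitz classes in
  \<open>countable_dense_test_functions\<close>.\<close>

lemma test_function_grad_lipschitz:
  assumes "f \<in> test_functions \<Omega>"
  obtains B where "B > 0" "\<And>x y. norm (grad f x - grad f y) \<le> B * norm (x - y)"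
proof -
  have "\<exists>B>0. \<forall>x y. \<bar>partial_deriv i f x - partial_deriv i f y\<bar> \<le> B * norm (x - y)" for i
  proof -
    have t: "partial_deriv i f \<in> test_functions \<Omega>"
      by (rule test_function_partial_deriv[OF assms])
    obtain B where "B > 0" "\<And>x. norm (grad (partial_deriv i f) x) \<le> B"
      using test_function_bounded[OF t] by metis
    then show ?thesis
      using smooth_lipschitz[OF test_function_smooth[OF t]] by blast
  qed
  then obtain B where B: "\<And>i. B i > 0"
    "\<And>i x y. \<bar>partial_deriv i f x - partial_deriv i f y\<bar> \<le> B i * norm (x - y)"
    by metis
  have "norm (grad f x - grad f y) \<le> (\<Sum>i\<in>UNIV. B i) * norm (x - y)" for x y
  proof -
    have "norm (grad f x - grad f y) \<le> (\<Sum>i\<in>UNIV. \<bar>(grad f x - grad f y) $ i\<bar>)"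
      by (rule norm_le_l1_cart)
    also have "\<dots> \<le> (\<Sum>i\<in>UNIV. B i * norm (x - y))"
      using B(2) by (intro sum_mono) (simp add: grad_def)
    finally show ?thesis by (simp add: sum_distrib_right)
  qed
  moreover have "(\<Sum>i\<in>UNIV. B i) > 0"
    using B(1) by (intro sum_pos) auto
  ultimately show ?thesis using that by blast
qed

subsection \<open>Bump functions\<close>

text \<open>Products of a polynomial in 1/t with exp(-1/t), continued by 0, form a class closed
  under differentiation; the polynomial is therefore a parameter.\<close>

definition exp_recip :: "real poly \<Rightarrow> real \<Rightarrow> real" where
  "exp_recip P t = (if t > 0 then poly P (1 / t) * exp (- 1 / t) else 0)"

lemma poly_div_exp_tendsto_0: "((\<lambda>x. poly P x / exp x) \<longlongrightarrow> (0::real)) at_top"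
proof -
  have "((\<lambda>x. \<Sum>i\<le>degree P. coeff P i * (x ^ i / exp x)) \<longlongrightarrow> (\<Sum>i\<le>degree P. coeff P i * 0)) at_top"
    by (intro tendsto_intros tendsto_power_div_exp_0)
  then show ?thesis by (simp add: poly_altdef sum_divide_distrib)
qed

lemma exp_recip_tendsto_0: "((\<lambda>t. exp_recip P t) \<longlongrightarrow> 0) (at 0)"
proof -
  have "((\<lambda>t. poly P (inverse t) / exp (inverse t)) \<longlongrightarrow> 0) (at_right 0)"
    by (rule filterlim_compose[OF poly_div_exp_tendsto_0 filterlim_inverse_at_top_right])
  then have "(exp_recip P \<longlongrightarrow> 0) (at_right 0)"
    by (rule Lim_transform_eventually)
      (auto simp: eventually_at_filter exp_recip_def exp_minus divide_simps)
  moreover have "(exp_recip P \<longlongrightarrow> 0) (at_left 0)"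
    by (rule Lim_transform_eventually[OF tendsto_const])
      (auto simp: eventually_at_filter exp_recip_def)
  ultimately show ?thesis by (simp add: filterlim_at_split)
qed

lemma exp_recip_deriv:
  "(exp_recip P has_real_derivative exp_recip (monom 1 2 * (P - pderiv P)) t) (at t)"
proof -
  consider "t > 0" | "t < 0" | "t = 0" by linarith
  then show ?thesis
  proof cases
    case 1
    have "((\<lambda>t. poly P (1 / t) * exp (- 1 / t)) has_real_derivative
        exp_recip (monom 1 2 * (P - pderiv P)) t) (at t)"
      using 1 by (auto intro!: derivative_eq_intros
        DERIV_chain2[OF poly_DERIV] simp: exp_recip_def poly_monom field_simps power2_eq_square)
    then show ?thesis
      by (rule has_field_derivative_transform_within_open[where S="{0<..}"])
        (use 1 in \<open>auto simp: exp_recip_def\<close>)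
  next
    case 2
    have "((\<lambda>t. 0) has_real_derivative exp_recip (monom 1 2 * (P - pderiv P)) t) (at t)"
      using 2 by (simp add: exp_recip_def)
    then show ?thesis
      by (rule has_field_derivative_transform_within_open[where S="{..<0}"])
        (use 2 in \<open>auto simp: exp_recip_def\<close>)
  next
    case 3
    \<comment> \<open>Dividing by \<open>h\<close> multiplies the polynomial by its variable 1/h, so
      the difference quotient at 0 is again in the class and tends to 0.\<close>
    have "(\<lambda>h. (exp_recip P (0 + h) - exp_recip P 0) / h) = exp_recip (pCons 0 P)"
      by (auto simp: exp_recip_def)
    then have "((\<lambda>h. (exp_recip P (0 + h) - exp_recip P 0) / h) \<longlongrightarrow> 0) (at 0)"
      using exp_recip_tendsto_0 by metis
    then show ?thesis
      using 3 by (simp add: DERIV_def exp_recip_def)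
  qed
qed

definition bump_poly :: "nat \<Rightarrow> real poly" where
  "bump_poly j = ((\<lambda>P. monom 1 2 * (P - pderiv P)) ^^ j) 1"

text \<open>This is the \<open>j\<close>-th derivative of exp(-1/t) continued by 0, in the sequence
  form that \<open>smooth_compose\<close> expects.\<close>

definition bump_deriv :: "nat \<Rightarrow> real \<Rightarrow> real" where
  "bump_deriv j = exp_recip (bump_poly j)"

lemma bump_deriv_deriv: "(bump_deriv j has_real_derivative bump_deriv (Suc j) t) (at t)"
  unfolding bump_deriv_def bump_poly_def using exp_recip_deriv by simp

lemma bump_deriv_0: "bump_deriv 0 t = (if t > 0 then exp (- 1 / t) else 0)"
  by (simp add: bump_deriv_def exp_recip_def bump_poly_def)

lemma bump_deriv_1: "bump_deriv (Suc 0) t = (if t > 0 then exp (- 1 / t) / t\<^sup>2 else 0)"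
  by (simp add: bump_deriv_def exp_recip_def bump_poly_def poly_monom power2_eq_square)

text \<open>As \<open>k\<close> grows the edges steepen and the functions tend to the indicator of
  the open box, so integrals over boxes can be recovered from test functions.\<close>

definition box_bump :: "real^'n::finite \<Rightarrow> real^'n \<Rightarrow> nat \<Rightarrow> real^'n \<Rightarrow> real" where
  "box_bump c d k x =
     (\<Prod>i\<in>UNIV. bump_deriv 0 (real k * (x $ i - c $ i)) * bump_deriv 0 (real k * (d $ i - x $ i)))"

lemma smooth_box_bump:
  fixes c :: "real^'n::finite" shows "smooth (box_bump c d k)"
proof -
  have s: "smooth (\<lambda>x::real^'n. bump_deriv 0 (\<alpha> * x $ i + \<beta>))" for \<alpha> \<beta> and i :: 'n
    by (rule smooth_compose[where H=bump_deriv, OF bump_deriv_deriv]) (intro smooth_add smooth_mult smooth_const smooth_nth)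
  have "smooth (\<lambda>x::real^'n. \<Prod>i\<in>UNIV. bump_deriv 0 (real k * x $ i + (- real k * c $ i)) *
        bump_deriv 0 ((- real k) * x $ i + real k * d $ i))"
    by (intro smooth_prod smooth_mult s) auto
  then show ?thesis
    unfolding box_bump_def[abs_def] by (simp add: algebra_simps)
qed

lemma box_bump_outside:
  assumes "x \<notin> box c d" shows "box_bump c d k x = 0"
proof -
  obtain i where "\<not> (c $ i < x $ i \<and> x $ i < d $ i)"
    using assms by (auto simp: mem_box_cart)
  then have "\<not> (real k * (x $ i - c $ i) > 0 \<and> real k * (d $ i - x $ i) > 0)"
    by (auto simp: zero_less_mult_iff)
  then have "bump_deriv 0 (real k * (x $ i - c $ i)) * bump_deriv 0 (real k * (d $ i - x $ i)) = 0"
    by (auto simp: bump_deriv_0)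
  then show ?thesis unfolding box_bump_def by (intro prod_zero) auto
qed

lemma box_bump_inside:
  assumes "x \<in> box c d" "k > 0" shows "box_bump c d k x > 0"
  unfolding box_bump_def using assms by (auto intro!: prod_pos simp: bump_deriv_0 mem_box_cart)

lemma bump_deriv_0_bounds: "0 \<le> bump_deriv 0 t" "bump_deriv 0 t \<le> 1"
  by (auto simp: bump_deriv_0)

lemma box_bump_bounds: "0 \<le> box_bump c d k x" "box_bump c d k x \<le> 1"
  unfolding box_bump_def
  by (auto intro!: prod_nonneg prod_le_1 mult_le_one bump_deriv_0_bounds mult_nonneg_nonneg)

lemma box_bump_tendsto: "(\<lambda>k. box_bump c d k x) \<longlonglongrightarrow> indicator (box c d) x"
proof (cases "x \<in> box c d")
  case True
  have *: "(\<lambda>k. bump_deriv 0 (real k * s)) \<longlonglongrightarrow> 1" if "s > 0" for s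
  proof -
    have "(\<lambda>k. exp (- (inverse (real k)) / s)) \<longlonglongrightarrow> exp (- 0 / s)"
      by (intro tendsto_intros lim_inverse_n) (use that in auto)
    moreover have "\<forall>\<^sub>F k in sequentially. exp (- (inverse (real k)) / s) = bump_deriv 0 (real k * s)"
      using eventually_gt_at_top[of 0] by eventually_elim (use that in \<open>auto simp: bump_deriv_0 field_simps\<close>)
    ultimately show ?thesis by (simp add: Lim_transform_eventually)
  qed
  have "(\<lambda>k. box_bump c d k x) \<longlonglongrightarrow> (\<Prod>i\<in>(UNIV::'a set). 1 * 1)"
    unfolding box_bump_def by (intro tendsto_intros *) (use True in \<open>auto simp: mem_box_cart\<close>)
  with True show ?thesis by simp
next
  case False
  then show ?thesis by (simp add: box_bump_outside)
qed

lemma box_bump_test_function: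
  assumes "cbox c d \<subseteq> \<Omega>" shows "box_bump c d k \<in> test_functions \<Omega>"
  using assms box_subset_cbox[of c d]
  by (intro test_functionI[where K="cbox c d"] smooth_box_bump box_bump_outside) auto

section \<open>Young functions and modular convergence\<close>

text \<open>The hypotheses on \<open>a\<close> in the form in which they act:
  \<open>upper_index\<close> is a doubling condition, obtained with a real \<open>\<sigma>\<close>
  above the upper index, and \<open>growth\<close> states t^p = o(\<Phi>(t)), the effect of p <
  \<phi>_0.\<close>

locale young =
  fixes \<Phi> \<phi> :: "real \<Rightarrow> real" and p \<sigma> :: real
  assumes phi_cont: "continuous_on UNIV \<phi>"
    and phi_odd: "\<phi> (- t) = - \<phi> t"
    and phi_mono: "strict_mono \<phi>"
    and Phi_deriv: "(\<Phi> has_real_derivative \<phi> t) (at t)"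
    and Phi_0: "\<Phi> 0 = 0"
    and upper_index: "0 < t \<Longrightarrow> t * \<phi> t \<le> \<sigma> * \<Phi> t"
    and p_gt_1: "1 < p"
    and growth: "0 < c \<Longrightarrow> \<exists>C. \<forall>t\<ge>0. t powr p \<le> c * \<Phi> t + C"
    and sqrt_convex: "convex_on {0..} (\<lambda>t. \<Phi> (sqrt t))"
begin

lemma phi_0: "\<phi> 0 = 0"
  using phi_odd[of 0] by simp

lemma phi_le: "s \<le> t \<Longrightarrow> \<phi> s \<le> \<phi> t"
  using phi_mono by (simp add: strict_mono_less_eq)

lemma phi_pos: "t > 0 \<Longrightarrow> \<phi> t > 0"
  using phi_mono phi_0 by (metis strict_monoD)

lemma phi_nonneg: "t \<ge> 0 \<Longrightarrow> \<phi> t \<ge> 0"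
  using phi_le[of 0 t] phi_0 by simp

lemma Phi_cont: "continuous_on S \<Phi>"
  using Phi_deriv by (meson DERIV_isCont continuous_at_imp_continuous_on)

lemma Phi_measurable [measurable]: "\<Phi> \<in> borel_measurable borel"
  by (intro borel_measurable_continuous_onI Phi_cont)

lemma phi_measurable [measurable]: "\<phi> \<in> borel_measurable borel"
  by (intro borel_measurable_continuous_onI phi_cont)

lemma Phi_convex: "convex_on UNIV \<Phi>"
  by (rule convex_on_realI[OF _ Phi_deriv phi_le]) auto

lemma Phi_tangent: "\<Phi> s + \<phi> s * (t - s) \<le> \<Phi> t"
  using convex_on_imp_above_tangent[OF Phi_convex _ _ _ Phi_deriv, of s t] by simp

lemma Phi_even: "\<Phi> (- t) = \<Phi> t"
proof -
  have "((\<lambda>x. \<Phi> (- x) - \<Phi> x) has_real_derivative 0) (at x)" for x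
    by (rule derivative_eq_intros DERIV_chain2[OF Phi_deriv] Phi_deriv refl | simp add: phi_odd)+
  then have "\<Phi> (- t) - \<Phi> t = \<Phi> (- 0) - \<Phi> 0"
    using DERIV_isconst_all[of "\<lambda>x. \<Phi> (- x) - \<Phi> x" t 0] by blast
  then show ?thesis by simp
qed

lemma Phi_abs [simp]: "\<Phi> \<bar>t\<bar> = \<Phi> t"
  using Phi_even[of t] by (simp add: abs_if)

lemma Phi_nonneg [simp]: "0 \<le> \<Phi> t"
  using Phi_tangent[of 0 t] by (simp add: phi_0 Phi_0)

lemma Phi_mono: assumes "\<bar>s\<bar> \<le> \<bar>t\<bar>" shows "\<Phi> s \<le> \<Phi> t"
proof -
  have "\<phi> \<bar>s\<bar> * (\<bar>t\<bar> - \<bar>s\<bar>) \<ge> 0"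
    using assms phi_nonneg by simp
  then show ?thesis using Phi_tangent[of "\<bar>s\<bar>" "\<bar>t\<bar>"] by simp
qed

lemma Phi_pos: assumes "t \<noteq> 0" shows "\<Phi> t > 0"
proof -
  have "\<phi> (\<bar>t\<bar> / 2) * (\<bar>t\<bar> - \<bar>t\<bar> / 2) > 0"
    using assms phi_pos by simp
  then show ?thesis using Phi_tangent[of "\<bar>t\<bar> / 2" "\<bar>t\<bar>"] Phi_nonneg[of "\<bar>t\<bar> / 2"]
    unfolding Phi_abs by linarith
qed

lemma Phi_eq_0_iff [simp]: "\<Phi> t = 0 \<longleftrightarrow> t = 0"
  using Phi_pos Phi_0 by force

lemma Phi_shrink:
  assumes "0 \<le> k" "k \<le> 1" shows "\<Phi> (k * t) \<le> k * \<Phi> t"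
  using convex_onD[OF Phi_convex, of k 0 t] assms by (simp add: Phi_0)

lemma Phi_midpoint: "\<Phi> ((s + t) / 2) \<le> (\<Phi> s + \<Phi> t) / 2"
  using convex_onD[OF Phi_convex, of "1/2" s t] by (simp add: field_simps)

lemma mult_phi_le: "0 \<le> t \<Longrightarrow> t * \<phi> t \<le> \<sigma> * \<Phi> t"
  using upper_index by (cases "t = 0") (auto simp: Phi_0)

text \<open>By \<open>upper_index\<close> the function \<Phi>(x) x^(-\<sigma>) has nonpositive
  derivative on x > 0. The resulting doubling bound makes scaling harmless for finiteness and for
  smallness of a modular.\<close>

lemma Phi_scale:
  assumes k: "1 \<le> k" shows "\<Phi> (k * t) \<le> k powr \<sigma> * \<Phi> t"
proof (cases "t = 0")
  case False
  define s where "s = \<bar>t\<bar>"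
  have s: "s > 0" using False by (simp add: s_def)
  define r where "r x = \<Phi> x * x powr (- \<sigma>)" for x
  have "r (k * s) \<le> r s"
  proof (rule DERIV_nonpos_imp_nonincreasing[of s "k * s" r])
    show "s \<le> k * s" using k s by simp
    fix x assume "s \<le> x" "x \<le> k * s"
    then have x: "x > 0" using s by simp
    have "(r has_real_derivative (\<phi> x * x powr (- \<sigma>) + \<Phi> x * (- \<sigma> * x powr (- \<sigma> - 1)))) (at x)"
      unfolding r_def using x
      by (auto intro!: derivative_eq_intros Phi_deriv simp: powr_diff)
    moreover have "\<phi> x * x powr (- \<sigma>) + \<Phi> x * (- \<sigma> * x powr (- \<sigma> - 1)) =
        x powr (- \<sigma> - 1) * (x * \<phi> x - \<sigma> * \<Phi> x)"
      using x by (simp add: powr_diff field_simps)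
    moreover have "\<dots> \<le> 0"
      using upper_index[OF x] by (intro mult_nonneg_nonpos) auto
    ultimately show "\<exists>y. (r has_real_derivative y) (at x) \<and> y \<le> 0" by auto
  qed
  then have "\<Phi> (k * s) * (k * s) powr (- \<sigma>) * (k * s) powr \<sigma> \<le> \<Phi> s * s powr (- \<sigma>) * (k * s) powr \<sigma>"
    unfolding r_def by (intro mult_right_mono) auto
  moreover have "(k * s) powr (- \<sigma>) * (k * s) powr \<sigma> = 1" "s powr (- \<sigma>) * (k * s) powr \<sigma> = k powr \<sigma>"
    using k s by (simp_all add: powr_mult powr_minus field_simps)
  ultimately have "\<Phi> (k * s) \<le> \<Phi> s * k powr \<sigma>" by (simp add: mult.assoc)
  moreover have "\<Phi> (k * s) = \<Phi> (k * t)"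
    using Phi_abs[of "k * t"] k by (simp add: s_def abs_mult)
  ultimately show ?thesis by (simp add: s_def mult.commute)
qed (simp add: Phi_0)

lemma Phi_add: "\<Phi> (s + t) \<le> 2 powr \<sigma> * (\<Phi> s + \<Phi> t)"
proof -
  have "\<Phi> (s + t) = \<Phi> (2 * ((s + t) / 2))" by (simp only: times_divide_eq_right nonzero_mult_div_cancel_left)
  also have "\<dots> \<le> 2 powr \<sigma> * \<Phi> ((s + t) / 2)" by (rule Phi_scale) simp
  also have "\<dots> \<le> 2 powr \<sigma> * (\<Phi> s + \<Phi> t)"
    by (intro mult_left_mono order_trans[OF Phi_midpoint]) (simp_all add: field_simps)
  finally show ?thesis .
qed

lemma Phi_norm_diff: "\<Phi> (norm (x - y)) \<le> 2 powr \<sigma> * (\<Phi> (norm x) + \<Phi> (norm y))"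
  by (rule order_trans[OF Phi_mono Phi_add]) (simp add: norm_triangle_ineq4)

lemma powr_le_Phi:
  obtains C where "C \<ge> 0" "\<And>t. 0 \<le> t \<Longrightarrow> t powr p \<le> \<Phi> t + C" "\<And>t. \<bar>t\<bar> \<le> \<Phi> t + C"
proof -
  obtain C where C: "\<And>t. 0 \<le> t \<Longrightarrow> t powr p \<le> \<Phi> t + C"
    using growth[of 1] by auto
  have "t \<le> t powr p + 1" if "t \<ge> 0" for t :: real
  proof (cases "t \<le> 1")
    case True
    then show ?thesis using powr_ge_zero[of t p] by linarith
  next
    case False
    then have "t powr 1 \<le> t powr p" using p_gt_1 by (intro powr_mono) auto
    then show ?thesis using False by simp
  qed
  then have "\<bar>t\<bar> \<le> \<Phi> t + (C + 1)" for t
    using C[of "\<bar>t\<bar>"] add_right_mono[of "\<bar>t\<bar> powr p" "\<Phi> t + C" 1]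
    by (metis Phi_abs abs_ge_zero add.assoc order_trans)
  moreover have "C \<ge> 0" using C[of 0] by (simp add: Phi_0)
  ultimately show ?thesis using C by (intro that[of "C + 1"]) (auto intro: order_trans[OF C])
qed

text \<open>The convexity of \<open>t \<mapsto> \<Phi> (sqrt t)\<close> makes it superadditive; combined with the
  parallelogram law this gives a Clarkson inequality.\<close>

lemma Clarkson:
  fixes x y :: "'b::real_inner"
  shows "\<Phi> (norm (x + y) / 2) + \<Phi> (norm (x - y) / 2) \<le> (\<Phi> (norm x) + \<Phi> (norm y)) / 2"
proof -
  define F where "F t = \<Phi> (sqrt t)" for t
  have F: "convex_on {0..} F" using sqrt_convex by (simp add: F_def[abs_def])
  \<comment> \<open>Since F(0) = 0, convexity puts F below its chord from 0; adding the estimates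
    for \<open>a\<close> and \<open>b\<close> gives superadditivity.\<close>
  have shrink: "F a \<le> a / (a + b) * F (a + b)" if "a \<ge> 0" "b \<ge> 0" "a + b > 0" for a b
    using convex_onD[OF F, of "a / (a + b)" 0 "a + b"] that by (simp add: F_def Phi_0)
  have super: "F a + F b \<le> F (a + b)" if "a \<ge> 0" "b \<ge> 0" for a b
  proof (cases "a + b > 0")
    case True
    have "F a + F b \<le> a / (a + b) * F (a + b) + b / (b + a) * F (b + a)"
      using True that by (intro add_mono shrink) auto
    also have "\<dots> = (a / (a + b) + b / (a + b)) * F (a + b)" by (simp only: distrib_right add.commute)
    also have "\<dots> = F (a + b)" using True by (simp flip: add_divide_distrib)
    finally show ?thesis .
  next
    case False
    then have "a = 0" "b = 0" using that by auto
    then show ?thesis by (simp add: F_def Phi_0)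
  qed
  have F_norm: "\<Phi> (norm z) = F ((norm z)\<^sup>2)" for z :: 'b by (simp add: F_def)
  have "\<Phi> (norm (x + y) / 2) + \<Phi> (norm (x - y) / 2)
      = F ((norm (x + y) / 2)\<^sup>2) + F ((norm (x - y) / 2)\<^sup>2)"
    by (simp add: F_def)
  also have "\<dots> \<le> F ((norm (x + y) / 2)\<^sup>2 + (norm (x - y) / 2)\<^sup>2)"
    by (rule super) auto
  also have "(norm (x + y) / 2)\<^sup>2 + (norm (x - y) / 2)\<^sup>2 =
      ((norm (x + y))\<^sup>2 + (norm (x - y))\<^sup>2) / 4"
    by (simp add: power_divide add_divide_distrib)
  also have "(norm (x + y))\<^sup>2 + (norm (x - y))\<^sup>2 = 2 * ((norm x)\<^sup>2 + (norm y)\<^sup>2)"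
    by (simp add: power2_norm_eq_inner inner_add_left inner_add_right inner_diff_left inner_diff_right)
  also have "2 * ((norm x)\<^sup>2 + (norm y)\<^sup>2) / 4 = ((norm x)\<^sup>2 + (norm y)\<^sup>2) / 2" by simp
  also have "F \<dots> \<le> (F ((norm x)\<^sup>2) + F ((norm y)\<^sup>2)) / 2"
    using convex_onD[OF F, of "1/2" "(norm x)\<^sup>2" "(norm y)\<^sup>2"] by (simp add: field_simps)
  finally show ?thesis by (simp add: F_norm)
qed

section \<open>Functions of finite modular and modular convergence\<close>

lemma integrable_Phi_mono:
  assumes "integrable M (\<lambda>x. \<Phi> (g x))" "f \<in> borel_measurable M" "AE x in M. \<bar>f x\<bar> \<le> \<bar>g x\<bar>"
  shows "integrable M (\<lambda>x. \<Phi> (f x))"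
proof (rule Bochner_Integration.integrable_bound[OF assms(1)])
  show "AE x in M. norm (\<Phi> (f x)) \<le> norm (\<Phi> (g x))"
    using assms(3) by eventually_elim (simp add: Phi_mono)
qed (use assms(2) in measurable)

lemma integrable_Phi_scale:
  assumes "integrable M (\<lambda>x. \<Phi> (f x))" "f \<in> borel_measurable M"
  shows "integrable M (\<lambda>x. \<Phi> (k * f x))"
proof (rule Bochner_Integration.integrable_bound)
  show "integrable M (\<lambda>x. max 1 \<bar>k\<bar> powr \<sigma> * \<Phi> (f x))"
    using assms(1) by simp
  have "\<Phi> (k * f x) \<le> max 1 \<bar>k\<bar> powr \<sigma> * \<Phi> (f x)" for x
    by (rule order_trans[OF Phi_mono Phi_scale]) (auto simp: abs_mult intro!: mult_right_mono)
  then show "AE x in M. norm (\<Phi> (k * f x)) \<le> norm (max 1 \<bar>k\<bar> powr \<sigma> * \<Phi> (f x))" by auto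
qed (use assms(2) in measurable)

lemma integrable_Phi_add:
  assumes "integrable M (\<lambda>x. \<Phi> (f x))" "integrable M (\<lambda>x. \<Phi> (g x))"
    "f \<in> borel_measurable M" "g \<in> borel_measurable M"
  shows "integrable M (\<lambda>x. \<Phi> (f x + g x))"
proof (rule Bochner_Integration.integrable_bound)
  show "integrable M (\<lambda>x. 2 powr \<sigma> * (\<Phi> (f x) + \<Phi> (g x)))"
    using assms by simp
  show "AE x in M. norm (\<Phi> (f x + g x)) \<le> norm (2 powr \<sigma> * (\<Phi> (f x) + \<Phi> (g x)))"
    using Phi_add by auto
qed (use assms in measurable)

text \<open>The weights 1/2, 1/4, ... sum to less than 1 and \<Phi>(0) = 0, so this is Jensen's
  inequality for a finite sum. The first term is split off as one half of a midpoint; the rest is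
  the same sum with shifted index.\<close>

lemma Phi_weighted_sum:
  "\<Phi> (\<Sum>k<m. (1/2) ^ Suc k * y k) \<le> (\<Sum>k<m. (1/2) ^ Suc k * \<Phi> (y k))"
proof (induction m arbitrary: y)
  case (Suc m)
  have "\<Phi> (\<Sum>k<Suc m. (1/2) ^ Suc k * y k) = \<Phi> ((y 0 + (\<Sum>k<m. (1/2) ^ Suc k * y (Suc k))) / 2)"
    by (subst sum.lessThan_Suc_shift) (simp add: sum_divide_distrib add_divide_distrib)
  also have "\<dots> \<le> (\<Phi> (y 0) + \<Phi> (\<Sum>k<m. (1/2) ^ Suc k * y (Suc k))) / 2"
    by (rule Phi_midpoint)
  also have "\<dots> \<le> (\<Phi> (y 0) + (\<Sum>k<m. (1/2) ^ Suc k * \<Phi> (y (Suc k)))) / 2"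
    using Suc.IH[of "\<lambda>k. y (Suc k)"] by simp
  also have "\<dots> = (\<Sum>k<Suc m. (1/2) ^ Suc k * \<Phi> (y k))"
    by (subst sum.lessThan_Suc_shift) (simp add: sum_divide_distrib add_divide_distrib)
  finally show ?case .
qed (simp add: Phi_0)

text \<open>Writing d_k as 2^(-k-1) times 2^(k+1) d_k, \<open>Phi_weighted_sum\<close> bounds \<Phi>
  of the sum by the sum of the rescaled \<Phi> values, whose integral is at most a geometric series.
  Summed deviations thus become a dominating function of finite modular.\<close>

lemma modular_series:
  assumes [measurable]: "\<And>k. d k \<in> borel_measurable M"
    and nonneg: "\<And>k x. 0 \<le> d k x"
    and int: "\<And>k. integrable M (\<lambda>x. \<Phi> (2 ^ Suc k * d k x))"
    and small: "\<And>k. (\<integral>x. \<Phi> (2 ^ Suc k * d k x) \<partial>M) \<le> (1/2) ^ k"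
  shows "AE x in M. summable (\<lambda>k. d k x)" "integrable M (\<lambda>x. \<Phi> (\<Sum>k. d k x))"
proof -
  define H where "H k x = \<Phi> (2 ^ Suc k * d k x)" for k x
  have [measurable]: "H k \<in> borel_measurable M" for k unfolding H_def by measurable
  have H0: "0 \<le> H k x" for k x by (simp add: H_def)
  have "(\<integral>\<^sup>+x. (\<Sum>k. ennreal (H k x)) \<partial>M) = (\<Sum>k. \<integral>\<^sup>+x. ennreal (H k x) \<partial>M)"
    by (intro nn_integral_suminf) measurable
  also have "\<dots> \<le> (\<Sum>k. ennreal ((1/2) ^ k))"
  proof (rule suminf_le)
    show "(\<integral>\<^sup>+x. ennreal (H k x) \<partial>M) \<le> ennreal ((1/2) ^ k)" for k
      using small[of k] int[of k] unfolding H_def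
      by (subst nn_integral_eq_integral) (auto intro!: ennreal_leI)
  qed auto
  also have "\<dots> = ennreal (\<Sum>k. (1/2) ^ k)"
    by (rule suminf_ennreal2) (auto intro: summable_geometric)
  finally have fin: "(\<integral>\<^sup>+x. (\<Sum>k. ennreal (H k x)) \<partial>M) < \<infinity>"
    by (rule order.strict_trans1) simp
  then have "AE x in M. (\<Sum>k. ennreal (H k x)) \<noteq> \<infinity>"
    by (intro nn_integral_noteq_infinite) auto
  then have sH: "AE x in M. summable (\<lambda>k. H k x)"
    by eventually_elim (auto intro: summable_suminf_not_top H0)
  have sum_d: "summable (\<lambda>k. d k x)" if "summable (\<lambda>k. H k x)" for x
  proof (rule summable_comparison_test_ev)
    \<comment> \<open>Terms of a convergent series are eventually below \<Phi>(1), and monotonicity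
      of \<Phi> then forces 2^(k+1) d_k(x) < 1.\<close>
    have "\<forall>\<^sub>F k in sequentially. H k x < \<Phi> 1"
      using summable_LIMSEQ_zero[OF that] Phi_pos[of 1] by (intro order_tendstoD(2)) auto
    then show "\<forall>\<^sub>F k in sequentially. norm (d k x) \<le> (1/2) ^ Suc k"
    proof eventually_elim
      case (elim k)
      have "2 ^ Suc k * d k x < 1"
      proof (rule ccontr)
        assume "\<not> 2 ^ Suc k * d k x < 1"
        then have "\<Phi> 1 \<le> H k x" unfolding H_def by (intro Phi_mono) auto
        with elim show False by simp
      qed
      then show ?case using nonneg[of k x] by (simp add: field_simps)
    qed
    show "summable (\<lambda>k. (1/2::real) ^ Suc k)" by (intro summable_Suc_iff[THEN iffD2] summable_geometric) simp
  qed
  show AEd: "AE x in M. summable (\<lambda>k. d k x)"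
    using sH by eventually_elim (rule sum_d)
  have bound: "\<Phi> (\<Sum>k. d k x) \<le> (\<Sum>k. H k x)" if s: "summable (\<lambda>k. H k x)" for x
  proof (rule LIMSEQ_le_const2)
    show "(\<lambda>m. \<Phi> (\<Sum>k<m. d k x)) \<longlonglongrightarrow> \<Phi> (\<Sum>k. d k x)"
      using continuous_on_tendsto_compose[OF Phi_cont[of UNIV] summable_LIMSEQ[OF sum_d[OF s]]] by simp
    have "\<Phi> (\<Sum>k<m. d k x) \<le> (\<Sum>k. H k x)" for m
    proof -
      have "\<Phi> (\<Sum>k<m. d k x) = \<Phi> (\<Sum>k<m. (1/2) ^ Suc k * (2 ^ Suc k * d k x))"
        by (simp add: power_one_over)
      also have "\<dots> \<le> (\<Sum>k<m. (1/2) ^ Suc k * H k x)"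
        unfolding H_def by (rule Phi_weighted_sum)
      also have "\<dots> \<le> (\<Sum>k<m. H k x)"
        by (intro sum_mono mult_left_le_one_le H0 power_le_one) auto
      also have "\<dots> \<le> (\<Sum>k. H k x)"
        by (intro sum_le_suminf s) (auto simp: H0)
      finally show ?thesis .
    qed
    then show "\<exists>N. \<forall>m\<ge>N. \<Phi> (\<Sum>k<m. d k x) \<le> (\<Sum>k. H k x)" by auto
  qed
  show "integrable M (\<lambda>x. \<Phi> (\<Sum>k. d k x))"
  proof (rule integrableI_bounded)
    have "(\<integral>\<^sup>+x. ennreal (norm (\<Phi> (\<Sum>k. d k x))) \<partial>M) \<le> (\<integral>\<^sup>+x. (\<Sum>k. ennreal (H k x)) \<partial>M)"
    proof (intro nn_integral_mono_AE)
      show "AE x in M. ennreal (norm (\<Phi> (\<Sum>k. d k x))) \<le> (\<Sum>k. ennreal (H k x))"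
        using sH
      proof eventually_elim
        case (elim x)
        then show ?case
          using bound[OF elim] by (subst suminf_ennreal2) (auto simp: H0 intro!: ennreal_leI)
      qed
    qed
    with fin show "(\<integral>\<^sup>+x. ennreal (norm (\<Phi> (\<Sum>k. d k x))) \<partial>M) < \<infinity>" by simp
  qed measurable
qed

text \<open>Leaving \<open>A\<close> free covers Cauchy differences as well as distances to a fixed
  limit, which depend on one of the two indices only.\<close>

lemma fast_subsequence:
  assumes "\<And>e::real. e > 0 \<Longrightarrow> \<exists>N. \<forall>m\<ge>N. \<forall>n\<ge>N. (A m n :: real) < e" "\<And>k. e k > 0"
  obtains r :: "nat \<Rightarrow> nat" where "strict_mono r" "\<And>k m n. m \<ge> r k \<Longrightarrow> n \<ge> r k \<Longrightarrow> A m n < e k"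
proof -
  obtain N where N: "\<And>k m n. m \<ge> N k \<Longrightarrow> n \<ge> N k \<Longrightarrow> A m n < e k"
    using assms(1)[OF assms(2)] by metis
  \<comment> \<open>The \<open>Suc\<close> makes \<open>r\<close> strictly increasing even where
    \<open>N\<close> is 0, and the last summand keeps \<open>r k\<close> above
    \<open>N k\<close>.\<close>
  define r where "r k = (\<Sum>j\<le>k. Suc (N j))" for k
  have "strict_mono r" by (auto simp: r_def strict_mono_Suc_iff)
  moreover have "N k \<le> r k" for k
  proof -
    have "Suc (N k) \<le> r k"
      unfolding r_def by (rule member_le_sum[where f="\<lambda>j. Suc (N j)"]) auto
    then show ?thesis by simp
  qed
  ultimately show ?thesis using that N by (meson order_trans)
qed

text \<open>The threshold anticipates the factor (2^(k+1))^\<sigma> by which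
  \<open>Phi_scale\<close> enlarges the modular under rescaling.\<close>

lemma modular_small_scaled:
  assumes "integrable M (\<lambda>x. \<Phi> (d x))" "d \<in> borel_measurable M"
    and "(\<integral>x. \<Phi> (d x) \<partial>M) \<le> (1/2) ^ k / (2 ^ Suc k) powr \<sigma>"
  shows "(\<integral>x. \<Phi> (2 ^ Suc k * d x) \<partial>M) \<le> (1/2) ^ k"
proof -
  have "(\<integral>x. \<Phi> (2 ^ Suc k * d x) \<partial>M) \<le> (\<integral>x. (2 ^ Suc k) powr \<sigma> * \<Phi> (d x) \<partial>M)"
    using assms by (intro integral_mono integrable_Phi_scale Phi_scale one_le_power) auto
  also have "\<dots> \<le> (2 ^ Suc k) powr \<sigma> * ((1/2) ^ k / (2 ^ Suc k) powr \<sigma>)"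
    unfolding integral_mult_right_zero using assms(3) by (intro mult_left_mono) auto
  also have "\<dots> = (1/2) ^ k" by simp
  finally show ?thesis .
qed

text \<open>A Riesz-Fischer argument for modulars: the increments of a fast subsequence meet the
  hypotheses of \<open>modular_series\<close>, so the telescoping series converges absolutely almost
  everywhere, and the norm of the first term plus the sum of the increments is the dominating
  function \<open>\<tau>\<close>.\<close>

lemma modular_Cauchy_subsequence:
  fixes w :: "nat \<Rightarrow> 'a \<Rightarrow> 'b::euclidean_space"
  assumes [measurable]: "\<And>n. w n \<in> borel_measurable M"
    and int: "\<And>n. integrable M (\<lambda>x. \<Phi> (norm (w n x)))"
    and Cauchy: "\<And>e. e > 0 \<Longrightarrow> \<exists>N. \<forall>m\<ge>N. \<forall>n\<ge>N. (\<integral>x. \<Phi> (norm (w m x - w n x)) \<partial>M) < e"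
  obtains r W \<tau> where "strict_mono (r :: nat \<Rightarrow> nat)" "W \<in> borel_measurable M"
    "\<tau> \<in> borel_measurable M" "integrable M (\<lambda>x. \<Phi> (\<tau> x))" "\<And>x. 0 \<le> \<tau> x"
    "AE x in M. (\<lambda>k. w (r k) x) \<longlonglongrightarrow> W x" "AE x in M. \<forall>k. norm (w (r k) x) \<le> \<tau> x"
    "AE x in M. norm (W x) \<le> \<tau> x"
proof -
  obtain r :: "nat \<Rightarrow> nat" where r: "strict_mono r"
    "\<And>k m n. m \<ge> r k \<Longrightarrow> n \<ge> r k \<Longrightarrow>
      (\<integral>x. \<Phi> (norm (w m x - w n x)) \<partial>M) < (1/2) ^ k / (2 ^ Suc k) powr \<sigma>"
    by (rule fast_subsequence[OF Cauchy, of "\<lambda>k. (1/2) ^ k / (2 ^ Suc k) powr \<sigma>"]) auto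
  define d where "d k x = norm (w (r (Suc k)) x - w (r k) x)" for k x
  have d_meas [measurable]: "d k \<in> borel_measurable M" for k unfolding d_def by measurable
  have d_int: "integrable M (\<lambda>x. \<Phi> (d k x))" for k
  proof (rule Bochner_Integration.integrable_bound)
    show "integrable M (\<lambda>x. 2 powr \<sigma> * (\<Phi> (norm (w (r (Suc k)) x)) + \<Phi> (norm (w (r k) x))))"
      using int by simp
    show "AE x in M. norm (\<Phi> (d k x)) \<le>
        norm (2 powr \<sigma> * (\<Phi> (norm (w (r (Suc k)) x)) + \<Phi> (norm (w (r k) x))))"
      using Phi_norm_diff by (auto simp: d_def)
  qed measurable
  have d_small: "(\<integral>x. \<Phi> (2 ^ Suc k * d k x) \<partial>M) \<le> (1/2) ^ k" for k
    using r(2)[of k "r (Suc k)" "r k"] r(1) d_int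
    by (intro modular_small_scaled) (auto simp: d_def strict_mono_less_eq)
  have ser: "AE x in M. summable (\<lambda>k. d k x)" "integrable M (\<lambda>x. \<Phi> (\<Sum>k. d k x))"
    using d_small d_int by (intro modular_series integrable_Phi_scale; auto simp: d_def)+
  define \<tau> where "\<tau> x = norm (w (r 0) x) + \<bar>\<Sum>k. d k x\<bar>" for x
  define W where "W x = lim (\<lambda>k. w (r k) x)" for x
  have conv: "(\<lambda>k. w (r k) x) \<longlonglongrightarrow> W x" "\<forall>k. norm (w (r k) x) \<le> \<tau> x"
    if s: "summable (\<lambda>k. d k x)" for x
  proof -
    have tel: "w (r n) x = w (r 0) x + (\<Sum>k<n. w (r (Suc k)) x - w (r k) x)" for n
      by (induction n) auto
    have "summable (\<lambda>k. w (r (Suc k)) x - w (r k) x)"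
      using s unfolding d_def by (rule summable_norm_cancel)
    then have "convergent (\<lambda>n. w (r 0) x + (\<Sum>k<n. w (r (Suc k)) x - w (r k) x))"
      by (intro convergent_add convergent_const) (simp add: summable_iff_convergent)
    then have "convergent (\<lambda>n. w (r n) x)" by (subst tel)
    then show "(\<lambda>k. w (r k) x) \<longlonglongrightarrow> W x" by (simp add: W_def convergent_LIMSEQ_iff)
    show "\<forall>k. norm (w (r k) x) \<le> \<tau> x"
    proof
      fix n
      have "norm (w (r n) x) \<le> norm (w (r 0) x) + norm (\<Sum>k<n. w (r (Suc k)) x - w (r k) x)"
        by (subst tel) (rule norm_triangle_ineq)
      also have "norm (\<Sum>k<n. w (r (Suc k)) x - w (r k) x) \<le> (\<Sum>k<n. d k x)"
        unfolding d_def by (rule norm_sum)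
      also have "\<dots> \<le> (\<Sum>k. d k x)"
        by (rule sum_le_suminf[OF s]) (auto simp: d_def)
      finally show "norm (w (r n) x) \<le> \<tau> x" by (simp add: \<tau>_def)
    qed
  qed
  have W_le: "norm (W x) \<le> \<tau> x" if "summable (\<lambda>k. d k x)" for x
    using conv[OF that] by (intro LIMSEQ_le_const2[OF tendsto_norm]) auto
  show ?thesis
  proof
    show "strict_mono r" by (rule r)
    show "W \<in> borel_measurable M" unfolding W_def[abs_def] by measurable
    show "\<tau> \<in> borel_measurable M" unfolding \<tau>_def[abs_def] by measurable
    show "integrable M (\<lambda>x. \<Phi> (\<tau> x))"
      unfolding \<tau>_def using ser(2) int by (intro integrable_Phi_add) auto
    show "0 \<le> \<tau> x" for x by (simp add: \<tau>_def)
    show "AE x in M. (\<lambda>k. w (r k) x) \<longlonglongrightarrow> W x" "AE x in M. \<forall>k. norm (w (r k) x) \<le> \<tau> x"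
      "AE x in M. norm (W x) \<le> \<tau> x"
      using ser(1) by (eventually_elim, use conv W_le in blast)+
  qed
qed

text \<open>The limit is prescribed here, so the distances to \<open>W\<close> are summed instead of
  the increments; almost everywhere summability makes them tend to 0.\<close>

lemma modular_convergent_subsequence:
  fixes w :: "nat \<Rightarrow> 'a \<Rightarrow> 'b::euclidean_space"
  assumes [measurable]: "\<And>n. w n \<in> borel_measurable M" "W \<in> borel_measurable M"
    and int: "\<And>n. integrable M (\<lambda>x. \<Phi> (norm (w n x - W x)))" "integrable M (\<lambda>x. \<Phi> (norm (W x)))"
    and lim: "(\<lambda>n. \<integral>x. \<Phi> (norm (w n x - W x)) \<partial>M) \<longlonglongrightarrow> 0"
  obtains r \<tau> where "strict_mono (r :: nat \<Rightarrow> nat)"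
    "\<tau> \<in> borel_measurable M" "integrable M (\<lambda>x. \<Phi> (\<tau> x))" "\<And>x. 0 \<le> \<tau> x"
    "AE x in M. (\<lambda>k. w (r k) x) \<longlonglongrightarrow> W x" "AE x in M. \<forall>k. norm (w (r k) x) \<le> \<tau> x"
    "AE x in M. norm (W x) \<le> \<tau> x"
proof -
  have "\<exists>N. \<forall>m\<ge>N. \<forall>n\<ge>N. (\<integral>x. \<Phi> (norm (w n x - W x)) \<partial>M) < e" if "e > 0" for e
    using order_tendstoD(2)[OF lim that] by (auto simp: eventually_sequentially)
  then obtain r :: "nat \<Rightarrow> nat" where r: "strict_mono r"
    "\<And>k m n. m \<ge> r k \<Longrightarrow> n \<ge> r k \<Longrightarrow>
      (\<integral>x. \<Phi> (norm (w n x - W x)) \<partial>M) < (1/2) ^ k / (2 ^ Suc k) powr \<sigma>"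
    by (rule fast_subsequence[of "\<lambda>m n. (\<integral>x. \<Phi> (norm (w n x - W x)) \<partial>M)"
          "\<lambda>k. (1/2) ^ k / (2 ^ Suc k) powr \<sigma>"]) auto
  define d where "d k x = norm (w (r k) x - W x)" for k x
  have d_meas [measurable]: "d k \<in> borel_measurable M" for k unfolding d_def by measurable
  have d_int: "integrable M (\<lambda>x. \<Phi> (d k x))" for k using int(1) by (simp add: d_def)
  have d_small: "(\<integral>x. \<Phi> (2 ^ Suc k * d k x) \<partial>M) \<le> (1/2) ^ k" for k
    using r(2)[of k "r k" "r k"] d_int by (intro modular_small_scaled) (auto simp: d_def)
  have ser: "AE x in M. summable (\<lambda>k. d k x)" "integrable M (\<lambda>x. \<Phi> (\<Sum>k. d k x))"
    using d_small d_int by (intro modular_series integrable_Phi_scale; auto simp: d_def)+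
  define \<tau> where "\<tau> x = norm (W x) + \<bar>\<Sum>k. d k x\<bar>" for x
  show ?thesis
  proof
    show "strict_mono r" by (rule r)
    show "\<tau> \<in> borel_measurable M" unfolding \<tau>_def[abs_def] by measurable
    show "integrable M (\<lambda>x. \<Phi> (\<tau> x))"
      unfolding \<tau>_def using ser(2) int by (intro integrable_Phi_add) auto
    show "0 \<le> \<tau> x" for x by (simp add: \<tau>_def)
    show "AE x in M. norm (W x) \<le> \<tau> x" by (simp add: \<tau>_def)
    show "AE x in M. (\<lambda>k. w (r k) x) \<longlonglongrightarrow> W x"
      using ser(1)
    proof eventually_elim
      case (elim x)
      then have "(\<lambda>k. d k x) \<longlonglongrightarrow> 0" by (rule summable_LIMSEQ_zero)
      then show ?case unfolding d_def by (simp add: tendsto_norm_zero_iff LIM_zero_iff)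
    qed
    show "AE x in M. \<forall>k. norm (w (r k) x) \<le> \<tau> x"
      using ser(1)
    proof eventually_elim
      case (elim x)
      show ?case
      proof
        fix k
        have "d k x \<le> (\<Sum>k. d k x)"
          using sum_le_suminf[OF elim, of "{k}"] by (simp add: d_def)
        moreover have "norm (w (r k) x) \<le> norm (W x) + d k x"
          unfolding d_def by (metis add.commute diff_add_cancel norm_triangle_ineq)
        ultimately show "norm (w (r k) x) \<le> \<tau> x" by (simp add: \<tau>_def)
      qed
    qed
  qed
qed

end

section \<open>Translation estimates, Poincare and Rellich\<close>

lemma borel_measurable_lebesgue_on:
  "f \<in> borel_measurable borel \<Longrightarrow> f \<in> borel_measurable (lebesgue_on S)"
  by (intro measurable_restrict_space1 measurable_completion) simp

lemma nn_integral_lebesgue_on_eq_lborel: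
  assumes "S \<in> sets borel" "\<And>x. x \<notin> S \<Longrightarrow> f x = 0"
  shows "(\<integral>\<^sup>+x. f x \<partial>lebesgue_on S) = (\<integral>\<^sup>+x. f x \<partial>lborel)"
proof -
  have "(\<integral>\<^sup>+x. f x \<partial>lebesgue_on S) = (\<integral>\<^sup>+x. f x * indicator S x \<partial>lebesgue)"
    using assms(1) by (intro nn_integral_restrict_space) (simp add: sets_completionI_sets)
  also have "(\<lambda>x. f x * indicator S x) = f"
    using assms(2) by (auto simp: indicator_def)
  finally show ?thesis by (simp add: nn_integral_completion)
qed

lemma finite_measure_lebesgue_on_open: "bounded S \<Longrightarrow> open S \<Longrightarrow> finite_measure (lebesgue_on S)"
  by (intro finite_measure_lebesgue_on lmeasurable_open)

section \<open>Jensen's inequality and the translation estimate\<close>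

lemma nn_integral_lborel_translate:
  fixes c :: "'a::euclidean_space"
  assumes [measurable]: "f \<in> borel_measurable borel"
  shows "(\<integral>\<^sup>+x. f (x + c) \<partial>lborel) = (\<integral>\<^sup>+x. f x \<partial>lborel)"
proof -
  have "(\<integral>\<^sup>+x. f x \<partial>lborel) = (\<integral>\<^sup>+x. f x \<partial>distr lborel borel ((+) c))"
    by (simp add: lborel_distr_plus)
  also have "\<dots> = (\<integral>\<^sup>+x. f (c + x) \<partial>lborel)"
    by (subst nn_integral_distr) auto
  finally show ?thesis by (simp add: add.commute)
qed

text \<open>Convexity enters as a supporting line at each point, which \<open>\<Phi>\<close> and the
  absolute value both supply. An infinite right-hand side is trivial; otherwise integrating the
  supporting line at the mean gives the claim.\<close>

lemma Jensen_nn_integral: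
  fixes f :: "'a \<Rightarrow> real" and \<Psi> :: "real \<Rightarrow> real"
  assumes N: "emeasure N (space N) = 1" and f: "integrable N f"
    and [measurable]: "\<Psi> \<in> borel_measurable borel"
    and tangent: "\<And>s. \<exists>c. \<forall>t. \<Psi> s + c * (t - s) \<le> \<Psi> t" and nonneg: "\<And>t. 0 \<le> \<Psi> t"
  shows "ennreal (\<Psi> (\<integral>x. f x \<partial>N)) \<le> (\<integral>\<^sup>+x. ennreal (\<Psi> (f x)) \<partial>N)"
proof (cases "(\<integral>\<^sup>+x. ennreal (\<Psi> (f x)) \<partial>N) = \<infinity>")
  case False
  interpret finite_measure N using N by (intro finite_measureI) simp
  have m1: "measure N (space N) = 1" using N by (simp add: measure_def)
  have [measurable]: "f \<in> borel_measurable N" using f by simp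
  have int: "integrable N (\<lambda>x. \<Psi> (f x))"
    using False nonneg by (intro integrableI_bounded) (auto simp: less_top)
  let ?m = "\<integral>x. f x \<partial>N"
  obtain c where c: "\<And>t. \<Psi> ?m + c * (t - ?m) \<le> \<Psi> t" using tangent by metis
  have "\<Psi> ?m = (\<integral>x. \<Psi> ?m + c * (f x - ?m) \<partial>N)"
    using f by (simp add: m1)
  also have "\<dots> \<le> (\<integral>x. \<Psi> (f x) \<partial>N)"
    using f int c by (intro integral_mono) auto
  finally have "ennreal (\<Psi> ?m) \<le> ennreal (\<integral>x. \<Psi> (f x) \<partial>N)" by (rule ennreal_leI)
  also have "\<dots> = (\<integral>\<^sup>+x. ennreal (\<Psi> (f x)) \<partial>N)"
    using int nonneg by (simp add: nn_integral_eq_integral)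
  finally show ?thesis .
qed simp

text \<open>The increment u(x + h) - u(x) is the mean of the directional derivative over the
  segment. Jensen's inequality in the parameter, Fubini and translation invariance of Lebesgue
  measure then remove the shift by \<open>t *\<^sub>R h\<close>.\<close>

lemma translation_bound:
  fixes u :: "real^'n::finite \<Rightarrow> real"
  assumes u: "smooth u" and [measurable]: "\<Psi> \<in> borel_measurable borel"
    and tangent: "\<And>s. \<exists>c. \<forall>t. \<Psi> s + c * (t - s) \<le> \<Psi> t" and nonneg: "\<And>t. 0 \<le> \<Psi> t"
    and mono: "\<And>s t. \<bar>s\<bar> \<le> \<bar>t\<bar> \<Longrightarrow> \<Psi> s \<le> \<Psi> t" and h: "norm h \<le> R"
  shows "(\<integral>\<^sup>+x. ennreal (\<Psi> (u (x + h) - u x)) \<partial>lborel) \<le>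
    (\<integral>\<^sup>+x. ennreal (\<Psi> (R * norm (grad u x))) \<partial>lborel)" (is "_ \<le> ?C")
proof -
  define N where "N = restrict_space lborel {0..1::real}"
  have N1: "emeasure N (space N) = 1"
    by (simp add: N_def emeasure_restrict_space space_restrict_space)
  interpret N: finite_measure N using N1 by (intro finite_measureI) simp
  interpret NL: pair_sigma_finite N "lborel :: (real^'n) measure" ..
  have [measurable]: "u \<in> borel_measurable borel" "grad u \<in> borel_measurable borel"
    using u by (auto intro!: borel_measurable_continuous_onI smooth_continuous smooth_continuous_grad)
  have [measurable]: "(\<lambda>t. t) \<in> borel_measurable N"
    unfolding N_def by (intro measurable_restrict_space1) simp
  let ?f = "\<lambda>x t. grad u (x + t *\<^sub>R h) \<bullet> h"
  have "(\<integral>\<^sup>+x. ennreal (\<Psi> (u (x + h) - u x)) \<partial>lborel) \<le>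
      (\<integral>\<^sup>+x. \<integral>\<^sup>+t. ennreal (\<Psi> (?f x t)) \<partial>N \<partial>lborel)"
  proof (rule nn_integral_mono)
    fix x
    have cont: "continuous_on UNIV (?f x)"
      by (intro continuous_intros continuous_on_compose2[OF smooth_continuous_grad[OF u, of UNIV]]) auto
    have line: "((\<lambda>t. x + t *\<^sub>R h) has_derivative (\<lambda>s. s *\<^sub>R h)) (at t)" for t
      by (auto intro!: derivative_eq_intros)
    have der: "((\<lambda>t. u (x + t *\<^sub>R h)) has_real_derivative ?f x t) (at t)" for t
      using has_derivative_compose[OF line smooth_has_derivative[OF u]]
      unfolding has_field_derivative_def by (simp add: mult_commute_abs)
    have F: "has_bochner_integral lborel (\<lambda>t. ?f x t * indicator {0..1} t) (u (x + 1 *\<^sub>R h) - u (x + 0 *\<^sub>R h))"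
      using cont by (intro has_bochner_integral_FTC_Icc_real der) (auto simp: continuous_on_eq_continuous_at)
    have int: "integrable N (?f x)" "(\<integral>t. ?f x t \<partial>N) = u (x + h) - u x"
      using F unfolding N_def
      by (auto simp: integrable_restrict_space integral_restrict_space has_bochner_integral_iff
          mult.commute)
    show "ennreal (\<Psi> (u (x + h) - u x)) \<le> (\<integral>\<^sup>+t. ennreal (\<Psi> (?f x t)) \<partial>N)"
      using Jensen_nn_integral[OF N1 int(1) _ tangent nonneg] unfolding int(2) by simp
  qed
  also have "\<dots> = (\<integral>\<^sup>+t. \<integral>\<^sup>+x. ennreal (\<Psi> (?f x t)) \<partial>lborel \<partial>N)"
    by (rule NL.Fubini') measurable
  also have "\<dots> \<le> (\<integral>\<^sup>+t. ?C \<partial>N)"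
  proof (rule nn_integral_mono)
    fix t
    have "(\<integral>\<^sup>+x. ennreal (\<Psi> (?f x t)) \<partial>lborel) = (\<integral>\<^sup>+x. ennreal (\<Psi> (grad u x \<bullet> h)) \<partial>lborel)"
      by (rule nn_integral_lborel_translate[where f="\<lambda>y. ennreal (\<Psi> (grad u y \<bullet> h))"]) measurable
    also have "\<dots> \<le> ?C"
    proof (intro nn_integral_mono ennreal_leI mono)
      fix x
      have "\<bar>grad u x \<bullet> h\<bar> \<le> norm (grad u x) * norm h" by (rule Cauchy_Schwarz_ineq2)
      also have "\<dots> \<le> \<bar>R * norm (grad u x)\<bar>"
        using h by (simp add: abs_mult mult.commute) (intro mult_right_mono, auto)
      finally show "\<bar>grad u x \<bullet> h\<bar> \<le> \<bar>R * norm (grad u x)\<bar>" .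
    qed
    finally show "(\<integral>\<^sup>+x. ennreal (\<Psi> (?f x t)) \<partial>lborel) \<le> ?C" .
  qed
  also have "\<dots> = ?C" using N1 by simp
  finally show ?thesis .
qed

text \<open>The translation bound is uniform over all \<open>h\<close> of norm at most
  \<open>R\<close>, so it survives averaging over a random translation with law
  \<open>N\<close>.\<close>

lemma translation_bound_averaged:
  fixes u :: "real^'n::finite \<Rightarrow> real"
  assumes u: "smooth u" and [measurable]: "\<Psi> \<in> borel_measurable borel"
    and tangent: "\<And>s. \<exists>c. \<forall>t. \<Psi> s + c * (t - s) \<le> \<Psi> t" and nonneg: "\<And>t. 0 \<le> \<Psi> t"
    and mono: "\<And>s t. \<bar>s\<bar> \<le> \<bar>t\<bar> \<Longrightarrow> \<Psi> s \<le> \<Psi> t"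
    and N: "emeasure N (space N) = 1" and sets_N [measurable_cong]: "sets N = sets borel"
    and h: "AE h in N. norm h \<le> R"
  shows "(\<integral>\<^sup>+x. \<integral>\<^sup>+h. ennreal (\<Psi> (u (x + h) - u x)) \<partial>N \<partial>lborel) \<le>
    (\<integral>\<^sup>+x. ennreal (\<Psi> (R * norm (grad u x))) \<partial>lborel)" (is "_ \<le> ?C")
proof -
  interpret N: finite_measure N using N by (intro finite_measureI) simp
  interpret NL: pair_sigma_finite N "lborel :: (real^'n) measure" ..
  have [measurable]: "u \<in> borel_measurable borel" "grad u \<in> borel_measurable borel"
    using u by (auto intro!: borel_measurable_continuous_onI smooth_continuous smooth_continuous_grad)
  have "(\<integral>\<^sup>+x. \<integral>\<^sup>+h. ennreal (\<Psi> (u (x + h) - u x)) \<partial>N \<partial>lborel) =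
      (\<integral>\<^sup>+h. \<integral>\<^sup>+x. ennreal (\<Psi> (u (x + h) - u x)) \<partial>lborel \<partial>N)"
    by (rule NL.Fubini') measurable
  also have "\<dots> \<le> (\<integral>\<^sup>+h. ?C \<partial>N)"
    using h by (intro nn_integral_mono_AE, eventually_elim)
      (rule translation_bound[OF u _ tangent nonneg mono]; simp)
  also have "\<dots> = ?C" using N by simp
  finally show ?thesis .
qed

section \<open>Averages over small cubes\<close>

definition cube_avg :: "real \<Rightarrow> (real^'n::finite) measure" where
  "cube_avg \<epsilon> = uniform_measure lborel (cbox 0 (\<chi> i. \<epsilon>))"

lemma emeasure_cube:
  assumes "\<epsilon> > 0"
  shows "emeasure lborel (cbox 0 (\<chi> i. \<epsilon>) :: (real^'n::finite) set) = ennreal (\<epsilon> ^ CARD('n))"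
proof -
  have "cbox 0 (\<chi> i. \<epsilon>) \<noteq> ({} :: (real^'n) set)"
    using assms by (auto simp: interval_ne_empty_cart)
  then have "measure lborel (cbox 0 (\<chi> i. \<epsilon>) :: (real^'n) set) = \<epsilon> ^ CARD('n)"
    using assms by (simp add: content_cbox_cart)
  then show ?thesis
    using emeasure_lborel_cbox_finite[of 0 "(\<chi> i. \<epsilon>) :: real^'n"] by (simp add: emeasure_eq_ennreal_measure)
qed

lemma sets_cube_avg [simp, measurable_cong]: "sets (cube_avg \<epsilon>) = sets borel"
  by (simp add: cube_avg_def)

lemma space_cube_avg [simp]: "space (cube_avg \<epsilon>) = UNIV"
  by (simp add: cube_avg_def)

lemma emeasure_cube_avg:
  assumes "\<epsilon> > 0" "A \<in> sets borel"
  shows "emeasure (cube_avg \<epsilon>) (A :: (real^'n::finite) set) \<le>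
    emeasure lborel A / ennreal (\<epsilon> ^ CARD('n))"
  unfolding cube_avg_def using assms
  by (subst emeasure_uniform_measure)
    (auto simp: emeasure_cube intro!: divide_right_mono_ennreal emeasure_mono)

lemma cube_avg_space:
  assumes "\<epsilon> > 0"
  shows "emeasure (cube_avg \<epsilon> :: (real^'n::finite) measure) (space (cube_avg \<epsilon>)) = 1"
  unfolding cube_avg_def using assms
  by (simp add: emeasure_uniform_measure emeasure_cube ennreal_divide_self)

lemma cube_avg_AE:
  "AE h in cube_avg \<epsilon>. norm (h :: real^'n::finite) \<le> real CARD('n) * \<epsilon>"
  unfolding cube_avg_def
proof (rule AE_uniform_measureI)
  have "norm h \<le> real CARD('n) * \<epsilon>" if "h \<in> cbox 0 (\<chi> i. \<epsilon>)" for h :: "real^'n"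
  proof -
    have "norm h \<le> (\<Sum>i\<in>UNIV. \<bar>h $ i\<bar>)" by (rule norm_le_l1_cart)
    also have "\<dots> \<le> (\<Sum>i\<in>(UNIV::'n set). \<epsilon>)"
      using that by (intro sum_mono) (auto simp: mem_box_cart)
    finally show ?thesis by simp
  qed
  then show "AE h in lborel. h \<in> cbox 0 (\<chi> i. \<epsilon>) \<longrightarrow> norm (h :: real^'n) \<le> real CARD('n) * \<epsilon>"
    by simp
qed simp

lemma nn_integral_cube_avg_le:
  fixes f :: "real^'n::finite \<Rightarrow> ennreal"
  assumes "\<epsilon> > 0" "f \<in> borel_measurable borel"
  shows "(\<integral>\<^sup>+h. f h \<partial>cube_avg \<epsilon>) \<le> (\<integral>\<^sup>+h. f h \<partial>lborel) / ennreal (\<epsilon> ^ CARD('n))"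
  unfolding cube_avg_def using assms
  by (subst nn_integral_uniform_measure)
    (auto simp: emeasure_cube intro!: divide_right_mono_ennreal nn_integral_mono
      split: split_indicator)

text \<open>Tychonoff's theorem for a product of intervals. It serves the diagonal argument and,
  with \<open>C i = 0\<close> outside a finite set, bounded sets of coefficient vectors.\<close>

lemma compact_coordinate_box: "compact {x :: nat \<Rightarrow> real. \<forall>i. \<bar>x i\<bar> \<le> C i}"
proof -
  have "compactin (product_topology (\<lambda>i. euclidean) UNIV) (PiE UNIV (\<lambda>i::nat. {- C i .. C i}))"
    by (subst compactin_PiE) (auto simp: compactin_euclidean_iff)
  moreover have "PiE UNIV (\<lambda>i::nat. {- C i .. C i}) = {x. \<forall>i. \<bar>x i\<bar> \<le> C i}"
    unfolding PiE_UNIV_domain Pi_def by (simp add: abs_le_iff minus_le_iff[of _ "C _"]) (metis minus_le_iff)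
  ultimately show ?thesis
    by (simp add: euclidean_product_topology compactin_euclidean_iff)
qed

lemma tendsto_coordinate:
  fixes f :: "'b \<Rightarrow> 'a \<Rightarrow> 'c::topological_space"
  assumes "(f \<longlongrightarrow> l) F" shows "((\<lambda>n. f n i) \<longlongrightarrow> l i) F"
  using continuous_on_tendsto_compose[OF continuous_on_product_coordinates assms] by simp

lemma diagonal_subsequence_real:
  fixes F :: "nat \<Rightarrow> nat \<Rightarrow> real"
  assumes "\<And>n i. \<bar>F n i\<bar> \<le> C i"
  obtains r :: "nat \<Rightarrow> nat" where "strict_mono r" "\<And>i. convergent (\<lambda>n. F (r n) i)"
proof -
  obtain l r where "strict_mono (r :: nat \<Rightarrow> nat)" "(F \<circ> r) \<longlonglongrightarrow> l"
    using compact_coordinate_box[of C, unfolded compact_def, rule_format, of F] assms by auto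
  then show ?thesis
    using tendsto_coordinate[of "F \<circ> r" l] by (intro that) (auto simp: convergent_def)
qed

locale domain = young \<Phi> \<phi> p \<sigma> for \<Phi> \<phi> p \<sigma> +
  fixes \<Omega> :: "(real^'n::finite) set"
  assumes open_dom: "open \<Omega>" and bounded_dom: "bounded \<Omega>"
begin

abbreviation M where "M \<equiv> lebesgue_on \<Omega>"
abbreviation \<T> where "\<T> \<equiv> test_functions \<Omega>"

sublocale M: finite_measure M
  using open_dom bounded_dom by (intro finite_measure_lebesgue_on_open)

lemma M_measurableI: "f \<in> borel_measurable borel \<Longrightarrow> f \<in> borel_measurable M"
  by (rule borel_measurable_lebesgue_on)

lemma test_borel:
  assumes "u \<in> \<T>" shows "u \<in> borel_measurable borel" "grad u \<in> borel_measurable borel"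
  using test_function_smooth[OF assms]
  by (auto intro!: borel_measurable_continuous_onI smooth_continuous smooth_continuous_grad)

lemma test_measurable:
  assumes "u \<in> \<T>" shows "u \<in> borel_measurable M" "grad u \<in> borel_measurable M"
  using test_borel[OF assms] by (auto intro: M_measurableI)

lemma integrable_bounded: 
  fixes f :: "real^'n \<Rightarrow> 'b::{banach, second_countable_topology}"
  assumes "f \<in> borel_measurable M" "\<And>x. norm (f x) \<le> B"
  shows "integrable M f"
  using assms by (intro M.integrable_const_bound[where B=B]) auto

lemma integrable_Phi_bounded:
  assumes "f \<in> borel_measurable M" "\<And>x. \<bar>f x\<bar> \<le> B"
  shows "integrable M (\<lambda>x. \<Phi> (f x))"
proof (rule integrable_bounded[where B="\<Phi> B"])
  show "norm (\<Phi> (f x)) \<le> \<Phi> B" for x using assms(2)[of x] by (simp add: Phi_mono)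
qed (use assms(1) in measurable)

lemma test_integrable:
  assumes "u \<in> \<T>"
  shows "integrable M (\<lambda>x. \<Phi> (u x))" "integrable M (\<lambda>x. \<Phi> (k * norm (grad u x)))"
    "integrable M (\<lambda>x. \<Phi> (norm (grad u x)))"
proof -
  obtain B where B: "\<And>x. \<bar>u x\<bar> \<le> B" "\<And>x. norm (grad u x) \<le> B"
    using test_function_bounded[OF assms] by metis
  note [measurable] = test_measurable[OF assms]
  show "integrable M (\<lambda>x. \<Phi> (u x))" using B by (intro integrable_Phi_bounded) auto
  show *: "integrable M (\<lambda>x. \<Phi> (norm (grad u x)))"
    using B by (intro integrable_Phi_bounded[where B=B]) auto
  show "integrable M (\<lambda>x. \<Phi> (k * norm (grad u x)))"
    by (intro integrable_Phi_scale *) auto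
qed

lemma nn_integral_test:
  assumes "u \<in> \<T>" "\<Psi> 0 = 0"
  shows "(\<integral>\<^sup>+x. ennreal (\<Psi> (u x)) \<partial>lborel) = (\<integral>\<^sup>+x. ennreal (\<Psi> (u x)) \<partial>M)"
    "(\<integral>\<^sup>+x. ennreal (\<Psi> (norm (grad u x))) \<partial>lborel) = (\<integral>\<^sup>+x. ennreal (\<Psi> (norm (grad u x))) \<partial>M)"
  using assms open_dom test_function_zero[OF assms(1)] test_function_grad_zero[OF assms(1)]
  by (auto intro!: nn_integral_lebesgue_on_eq_lborel[symmetric])

lemma nn_integral_Phi_grad:
  assumes "u \<in> \<T>"
  shows "(\<integral>\<^sup>+x. ennreal (\<Phi> (k * norm (grad u x))) \<partial>lborel) = ennreal (\<integral>x. \<Phi> (k * norm (grad u x)) \<partial>M)"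
  using nn_integral_test(2)[OF assms, of "\<lambda>t. \<Phi> (k * t)"] test_integrable(2)[OF assms, of k]
  by (simp add: Phi_0 nn_integral_eq_integral)

lemma integral_Phi_scale:
  assumes "1 \<le> k" "integrable M (\<lambda>x. \<Phi> (f x))" "f \<in> borel_measurable M"
  shows "(\<integral>x. \<Phi> (k * f x) \<partial>M) \<le> k powr \<sigma> * (\<integral>x. \<Phi> (f x) \<partial>M)"
  using integral_mono[OF integrable_Phi_scale[OF assms(2,3), of k] _ Phi_scale[OF assms(1)]] assms(2)
  by simp

lemma integral_Phi_shrink:
  assumes "0 \<le> k" "k \<le> 1" "integrable M (\<lambda>x. \<Phi> (f x))" "f \<in> borel_measurable M"
  shows "(\<integral>x. \<Phi> (k * f x) \<partial>M) \<le> k * (\<integral>x. \<Phi> (f x) \<partial>M)"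
  using integral_mono[OF integrable_Phi_scale[OF assms(3,4), of k] _ Phi_shrink[OF assms(1,2)]] assms(3)
  by simp

lemma Phi_tangent_ex: "\<exists>c. \<forall>t. \<Phi> s + c * (t - s) \<le> \<Phi> t"
  using Phi_tangent by blast

text \<open>Every point of the domain is moved out of it by one fixed translation.\<close>

lemma Poincare:
  obtains D where "D \<ge> 1"
    "\<And>u. u \<in> \<T> \<Longrightarrow> (\<integral>x. \<Phi> (u x) \<partial>M) \<le> (\<integral>x. \<Phi> (D * norm (grad u x)) \<partial>M)"
proof -
  obtain B where B: "B > 0" "\<And>x. x \<in> \<Omega> \<Longrightarrow> norm x \<le> B"
    using bounded_dom by (auto simp: bounded_pos)
  \<comment> \<open>A vector longer than the diameter of the ball of radius \<open>B\<close> about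
    0; \<open>undefined\<close> stands for an arbitrary coordinate index.\<close>
  define h :: "real^'n" where "h = (2 * B + 1) *\<^sub>R axis undefined 1"
  have h: "norm h = 2 * B + 1" using B by (simp add: h_def)
  have out: "x + h \<notin> \<Omega>" if "x \<in> \<Omega>" for x
  proof
    assume "x + h \<in> \<Omega>"
    have "norm h \<le> norm (x + h) + norm x"
      by (metis add.commute add_diff_cancel_left' norm_triangle_ineq4)
    then show False using B(2)[OF that] B(2)[OF \<open>x + h \<in> \<Omega>\<close>] h by simp
  qed
  show ?thesis
  proof (rule that)
    show "2 * B + 1 \<ge> 1" using B by simp
    fix u assume u: "u \<in> \<T>"
    have "ennreal (\<integral>x. \<Phi> (u x) \<partial>M) = (\<integral>\<^sup>+x. ennreal (\<Phi> (u x)) \<partial>lborel)"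
      using nn_integral_test(1)[where \<Psi>=\<Phi>, OF u Phi_0] test_integrable(1)[OF u] by (simp add: nn_integral_eq_integral)
    also have "\<dots> \<le> (\<integral>\<^sup>+x. ennreal (\<Phi> (u (x + h) - u x)) \<partial>lborel)"
    proof (intro nn_integral_mono ennreal_leI)
      show "\<Phi> (u x) \<le> \<Phi> (u (x + h) - u x)" for x
        using out[of x] test_function_zero[OF u] by (cases "x \<in> \<Omega>") (auto simp: Phi_even Phi_0)
    qed
    also have "\<dots> \<le> (\<integral>\<^sup>+x. ennreal (\<Phi> ((2 * B + 1) * norm (grad u x))) \<partial>lborel)"
      using h by (intro translation_bound test_function_smooth[OF u] Phi_tangent_ex Phi_mono) auto
    also have "\<dots> = ennreal (\<integral>x. \<Phi> ((2 * B + 1) * norm (grad u x)) \<partial>M)"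
      by (rule nn_integral_Phi_grad[OF u])
    finally show "(\<integral>x. \<Phi> (u x) \<partial>M) \<le> (\<integral>x. \<Phi> ((2 * B + 1) * norm (grad u x)) \<partial>M)"
      by (subst (asm) ennreal_le_iff) auto
  qed
qed

text \<open>If \<open>\<integral> \<Phi> |\<nabla>u|\<close> is small, then so is the set \<open>{u > 1/2}\<close>; hence every point of it leaves
  it under at least half of the translations in a small cube.\<close>

lemma small_set_Poincare:
  assumes "\<epsilon> > 0"
  obtains \<rho> where "\<rho> > 0"
    "\<And>u. u \<in> \<T> \<Longrightarrow> (\<integral>x. \<Phi> (norm (grad u x)) \<partial>M) \<le> \<rho> \<Longrightarrow>
      (\<integral>x. \<Phi> (max 0 (u x - 1/2)) \<partial>M) \<le> \<epsilon> * (\<integral>x. \<Phi> (norm (grad u x)) \<partial>M)"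
proof -
  obtain D where D: "D \<ge> 1"
    "\<And>u. u \<in> \<T> \<Longrightarrow> (\<integral>x. \<Phi> (u x) \<partial>M) \<le> (\<integral>x. \<Phi> (D * norm (grad u x)) \<partial>M)"
    using Poincare by metis
  define n where "n = real CARD('n)"
  have n: "n > 0" by (simp add: n_def)
  \<comment> \<open>All translations in the cube of side \<open>R\<close> have norm at most n R. The
    bound 1 allows \<open>Phi_shrink\<close>, and \<epsilon>/2 leaves a factor 2 for the half of the
    translations that is lost.\<close>
  define R where "R = min 1 (\<epsilon> / 2) / n"
  have R: "R > 0" "n * R \<le> 1" "2 * (n * R) \<le> \<epsilon>" using assms n by (auto simp: R_def)
  define v where "v = R ^ CARD('n)"
  have v: "v > 0" using R by (simp add: v_def)
  \<comment> \<open>With this value the Poincare and Chebyshev inequalities give {u > 1/2} measure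
    at most v/2, half the volume \<open>v\<close> of the cube.\<close>
  define \<rho> where "\<rho> = v * \<Phi> (1/2) / (2 * D powr \<sigma>)"
  show ?thesis
  proof (rule that)
    show "\<rho> > 0" using v Phi_pos[of "1/2"] D by (simp add: \<rho>_def)
    fix u assume u: "u \<in> \<T>" and small: "(\<integral>x. \<Phi> (norm (grad u x)) \<partial>M) \<le> \<rho>"
    note [measurable] = test_borel[OF u] test_measurable[OF u]
    have "(\<integral>x. \<Phi> (u x) \<partial>M) \<le> (\<integral>x. \<Phi> (D * norm (grad u x)) \<partial>M)" using D u by simp
    also have "\<dots> \<le> D powr \<sigma> * (\<integral>x. \<Phi> (norm (grad u x)) \<partial>M)"
      using D test_integrable[OF u] by (intro integral_Phi_scale) auto
    also have "\<dots> \<le> D powr \<sigma> * \<rho>" using small by (intro mult_left_mono) auto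
    also have "\<dots> = v * \<Phi> (1/2) / 2" using D by (simp add: \<rho>_def)
    finally have uM: "(\<integral>x. \<Phi> (u x) \<partial>M) \<le> v * \<Phi> (1/2) / 2" .
    let ?S = "{x. u x > 1/2}"
    have "ennreal (\<Phi> (1/2)) * emeasure lborel ?S = (\<integral>\<^sup>+x. ennreal (\<Phi> (1/2)) * indicator ?S x \<partial>lborel)"
      by (subst nn_integral_cmult_indicator) auto
    also have "\<dots> \<le> (\<integral>\<^sup>+x. ennreal (\<Phi> (u x)) \<partial>lborel)"
      by (intro nn_integral_mono) (auto split: split_indicator intro!: ennreal_leI Phi_mono)
    also have "\<dots> = ennreal (\<integral>x. \<Phi> (u x) \<partial>M)"
      using nn_integral_test(1)[where \<Psi>=\<Phi>, OF u Phi_0] test_integrable(1)[OF u] by (simp add: nn_integral_eq_integral)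
    also have "\<dots> \<le> ennreal (\<Phi> (1/2) * (v / 2))"
      using uM by (intro ennreal_leI) (simp add: mult.commute)
    also have "\<dots> = ennreal (\<Phi> (1/2)) * ennreal (v / 2)"
      using v by (intro ennreal_mult) auto
    finally have S: "emeasure lborel ?S \<le> ennreal (v / 2)"
      using Phi_pos[of "1/2"] by (subst (asm) ennreal_mult_le_mult_iff) auto
    have half: "emeasure (cube_avg R) {h. u (x + h) \<le> 1/2} \<ge> ennreal (1/2)" for x
    proof -
      have tr: "emeasure lborel {h. u (x + h) > 1/2} = emeasure lborel ?S"
      proof -
        have "emeasure lborel {h. u (x + h) > 1/2} = (\<integral>\<^sup>+h. indicator {h. u (x + h) > 1/2} h \<partial>lborel)"
          by (rule nn_integral_indicator[symmetric]) measurable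
        also have "\<dots> = (\<integral>\<^sup>+h. indicator ?S (h + x) \<partial>lborel)"
          by (intro nn_integral_cong) (auto simp: add.commute split: split_indicator)
        also have "\<dots> = (\<integral>\<^sup>+h. indicator ?S h \<partial>lborel)"
          by (rule nn_integral_lborel_translate) measurable
        finally show ?thesis by simp
      qed
      have "emeasure (cube_avg R) {h. u (x + h) > 1/2} \<le> emeasure lborel ?S / ennreal v"
        using emeasure_cube_avg[OF R(1), of "{h. u (x + h) > 1/2}"] unfolding tr v_def by measurable
      also have "\<dots> \<le> ennreal (v / 2) / ennreal v"
        by (rule divide_right_mono_ennreal[OF S])
      also have "\<dots> = ennreal (1/2)"
        using v by (subst divide_ennreal) auto
      finally have le: "emeasure (cube_avg R) {h. u (x + h) > 1/2} \<le> ennreal (1/2)" .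
      have un: "{h. u (x + h) \<le> 1/2} \<union> {h. u (x + h) > 1/2} = UNIV" by auto
      have "1 = emeasure (cube_avg R) ({h. u (x + h) \<le> 1/2} \<union> {h. u (x + h) > 1/2})"
        using cube_avg_space[OF R(1), where 'n='n] unfolding un space_cube_avg by simp
      also have "\<dots> \<le> emeasure (cube_avg R) {h. u (x + h) \<le> 1/2} + emeasure (cube_avg R) {h. u (x + h) > 1/2}"
        by (intro emeasure_subadditive) auto
      also have "\<dots> \<le> emeasure (cube_avg R) {h. u (x + h) \<le> 1/2} + ennreal (1/2)"
        using le by (intro add_left_mono)
      finally have "1 \<le> emeasure (cube_avg R) {h. u (x + h) \<le> 1/2} + ennreal (1/2)" .
      moreover have "(1::ennreal) = ennreal (1/2) + ennreal (1/2)"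
        by (subst ennreal_plus[symmetric]) auto
      ultimately have "ennreal (1/2) + ennreal (1/2) \<le> ennreal (1/2) + emeasure (cube_avg R) {h. u (x + h) \<le> 1/2}"
        by (simp only: add.commute)
      then show ?thesis unfolding ennreal_add_left_cancel_le by auto
    qed
    let ?w = "\<lambda>x. max 0 (u x - 1/2)"
    have "ennreal (1/2) * (\<integral>\<^sup>+x. ennreal (\<Phi> (?w x)) \<partial>lborel) = (\<integral>\<^sup>+x. ennreal (\<Phi> (?w x)) * ennreal (1/2) \<partial>lborel)"
      by (subst nn_integral_multc) (auto simp: mult.commute)
    also have "\<dots> \<le> (\<integral>\<^sup>+x. \<integral>\<^sup>+h. ennreal (\<Phi> (u (x + h) - u x)) \<partial>cube_avg R \<partial>lborel)"
    proof (rule nn_integral_mono)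
      fix x
      let ?H = "{h. u (x + h) \<le> 1/2}"
      have "ennreal (\<Phi> (?w x)) * ennreal (1/2) \<le> ennreal (\<Phi> (?w x)) * emeasure (cube_avg R) ?H"
        using half[of x] by (intro mult_left_mono) auto
      also have "\<dots> = (\<integral>\<^sup>+h. ennreal (\<Phi> (?w x)) * indicator ?H h \<partial>cube_avg R)"
        by (subst nn_integral_cmult_indicator) auto
      \<comment> \<open>Where u(x + h) <= 1/2, the increment is in absolute value at least u(x) -
        1/2.\<close>
      also have "\<dots> \<le> (\<integral>\<^sup>+h. ennreal (\<Phi> (u (x + h) - u x)) \<partial>cube_avg R)"
        by (intro nn_integral_mono) (auto split: split_indicator intro!: ennreal_leI Phi_mono)
      finally show "ennreal (\<Phi> (?w x)) * ennreal (1/2) \<le>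
        (\<integral>\<^sup>+h. ennreal (\<Phi> (u (x + h) - u x)) \<partial>cube_avg R)" .
    qed
    also have "\<dots> \<le> (\<integral>\<^sup>+x. ennreal (\<Phi> ((n * R) * norm (grad u x))) \<partial>lborel)"
      unfolding n_def using cube_avg_space[OF R(1), where 'n='n] cube_avg_AE[of R]
      by (intro translation_bound_averaged test_function_smooth[OF u] Phi_tangent_ex Phi_mono) auto
    also have "\<dots> = ennreal (\<integral>x. \<Phi> ((n * R) * norm (grad u x)) \<partial>M)"
      by (rule nn_integral_Phi_grad[OF u])
    also have "\<dots> \<le> ennreal (n * R * (\<integral>x. \<Phi> (norm (grad u x)) \<partial>M))"
      using R n test_integrable[OF u] by (intro ennreal_leI integral_Phi_shrink) auto
    finally have 1: "ennreal (1/2) * (\<integral>\<^sup>+x. ennreal (\<Phi> (?w x)) \<partial>lborel) \<le>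
      ennreal (n * R * (\<integral>x. \<Phi> (norm (grad u x)) \<partial>M))" .
    obtain B where B: "\<And>x. \<bar>u x\<bar> \<le> B" using test_function_bounded[OF u] by metis
    have "integrable M (\<lambda>x. \<Phi> (?w x))"
    proof (rule integrable_Phi_bounded[where B="B"])
      show "\<bar>?w x\<bar> \<le> B" for x using B[of x] by (auto simp: max_def)
    qed measurable
    then have "(\<integral>\<^sup>+x. ennreal (\<Phi> (?w x)) \<partial>lborel) = ennreal (\<integral>x. \<Phi> (?w x) \<partial>M)"
      using nn_integral_test(1)[OF u, of "\<lambda>t. \<Phi> (max 0 (t - 1/2))"]
      by (simp add: Phi_0 nn_integral_eq_integral)
    with 1 have "ennreal (1/2 * (\<integral>x. \<Phi> (?w x) \<partial>M)) \<le> ennreal (n * R * (\<integral>x. \<Phi> (norm (grad u x)) \<partial>M))"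
      by (subst ennreal_mult) auto
    then have "1/2 * (\<integral>x. \<Phi> (?w x) \<partial>M) \<le> n * R * (\<integral>x. \<Phi> (norm (grad u x)) \<partial>M)"
      using n R by (subst (asm) ennreal_le_iff) auto
    also have "\<dots> \<le> \<epsilon> / 2 * (\<integral>x. \<Phi> (norm (grad u x)) \<partial>M)"
      using R by (intro mult_right_mono) auto
    finally show "(\<integral>x. \<Phi> (?w x) \<partial>M) \<le> \<epsilon> * (\<integral>x. \<Phi> (norm (grad u x)) \<partial>M)" by simp
  qed
qed

section \<open>Cube means and compactness\<close>

lemma nn_integral_M_le_lborel: "(\<integral>\<^sup>+x. f x \<partial>M) \<le> (\<integral>\<^sup>+x. f x \<partial>lborel)"
proof -
  have "(\<integral>\<^sup>+x. f x \<partial>M) = (\<integral>\<^sup>+x. f x * indicator \<Omega> x \<partial>lebesgue)"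
    using open_dom by (intro nn_integral_restrict_space) (simp add: sets_completionI_sets)
  also have "\<dots> \<le> (\<integral>\<^sup>+x. f x \<partial>lebesgue)"
    by (intro nn_integral_mono) (auto split: split_indicator)
  finally show ?thesis by (simp add: nn_integral_completion)
qed

lemma tangent_abs: "\<exists>c. \<forall>t. \<bar>s\<bar> + c * (t - s) \<le> \<bar>t :: real\<bar>"
  by (rule exI[of _ "if s \<ge> 0 then 1 else -1"]) auto

lemma Phi_add4: "\<Phi> (a + b + (c + d)) \<le> (2 powr \<sigma>)\<^sup>2 * (\<Phi> a + \<Phi> b + (\<Phi> c + \<Phi> d))"
proof -
  have "\<Phi> (a + b + (c + d)) \<le> 2 powr \<sigma> * (\<Phi> (a + b) + \<Phi> (c + d))" by (rule Phi_add)
  also have "\<dots> \<le> 2 powr \<sigma> * (2 powr \<sigma> * (\<Phi> a + \<Phi> b) + 2 powr \<sigma> * (\<Phi> c + \<Phi> d))"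
    by (intro mult_left_mono add_mono Phi_add) auto
  finally show ?thesis by (simp add: power2_eq_square algebra_simps)
qed

text \<open>The bound |t| <= \<Phi>(t) + c and the finite measure of \<Omega> turn modular bounds
  into L1 bounds; for the functions themselves the modular is controlled through Poincare.\<close>

lemma test_L1_bounds:
  assumes B: "\<And>n. (\<integral>x. \<Phi> (norm (grad (u n) x)) \<partial>M) \<le> B" and u: "\<And>n. u n \<in> \<T>"
  obtains C where "C \<ge> 0" "\<And>n. (\<integral>\<^sup>+x. ennreal \<bar>u n x\<bar> \<partial>lborel) \<le> ennreal C"
    "\<And>n. (\<integral>\<^sup>+x. ennreal (norm (grad (u n) x)) \<partial>lborel) \<le> ennreal C"
proof -
  obtain c where c: "c \<ge> 0" "\<And>t. \<bar>t\<bar> \<le> \<Phi> t + c" using powr_le_Phi by metis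
  obtain D where D: "D \<ge> 1"
    "\<And>u. u \<in> \<T> \<Longrightarrow> (\<integral>x. \<Phi> (u x) \<partial>M) \<le> (\<integral>x. \<Phi> (D * norm (grad u x)) \<partial>M)"
    using Poincare by metis
  define m where "m = measure M (space M)"
  have B0: "B \<ge> 0" by (rule order_trans[OF integral_nonneg_AE B]) simp
  have L1: "(\<integral>\<^sup>+x. ennreal \<bar>f x\<bar> \<partial>M) \<le> ennreal (E + c * m)"
    if "integrable M (\<lambda>x. \<Phi> (f x))" "(\<integral>x. \<Phi> (f x) \<partial>M) \<le> E" for f E
  proof -
    have "(\<integral>\<^sup>+x. ennreal \<bar>f x\<bar> \<partial>M) \<le> (\<integral>\<^sup>+x. ennreal (\<Phi> (f x) + c) \<partial>M)"
      using c by (intro nn_integral_mono ennreal_leI) auto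
    also have "\<dots> = ennreal (\<integral>x. \<Phi> (f x) + c \<partial>M)"
      using that c by (intro nn_integral_eq_integral) auto
    also have "\<dots> \<le> ennreal (E + c * m)"
      using that by (intro ennreal_leI) (simp add: m_def mult.commute)
    finally show ?thesis .
  qed
  have uB: "(\<integral>x. \<Phi> (u n x) \<partial>M) \<le> D powr \<sigma> * B" for n
  proof -
    have "(\<integral>x. \<Phi> (u n x) \<partial>M) \<le> (\<integral>x. \<Phi> (D * norm (grad (u n) x)) \<partial>M)" using D u by simp
    also have "\<dots> \<le> D powr \<sigma> * (\<integral>x. \<Phi> (norm (grad (u n) x)) \<partial>M)"
      using D test_integrable[OF u] test_measurable[OF u] by (intro integral_Phi_scale) auto
    also have "\<dots> \<le> D powr \<sigma> * B" using B by (intro mult_left_mono) auto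
    finally show ?thesis .
  qed
  let ?C = "max (D powr \<sigma> * B) B + c * m"
  have m0: "m \<ge> 0" by (simp add: m_def)
  show ?thesis
  proof (rule that[of ?C])
    show "?C \<ge> 0" using c B0 m0 by simp
    show "(\<integral>\<^sup>+x. ennreal \<bar>u n x\<bar> \<partial>lborel) \<le> ennreal ?C" for n
      unfolding nn_integral_test(1)[OF u, of "\<lambda>t. \<bar>t\<bar>", simplified]
      using uB[of n] test_integrable[OF u] by (intro L1) auto
    show "(\<integral>\<^sup>+x. ennreal (norm (grad (u n) x)) \<partial>lborel) \<le> ennreal ?C" for n
      unfolding nn_integral_test(2)[OF u, of "\<lambda>t. t", simplified]
      using L1[of "\<lambda>x. norm (grad (u n) x)" "max (D powr \<sigma> * B) B"] B[of n] test_integrable[OF u] by auto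
  qed
qed

text \<open>Steklov means take the place of mollification: only translations of \<open>u\<close>
  enter, so \<open>translation_bound\<close> controls them.\<close>

definition cube_mean :: "real \<Rightarrow> (real^'n \<Rightarrow> real) \<Rightarrow> real^'n \<Rightarrow> real" where
  "cube_mean \<epsilon> u x = (\<integral>h. u (x + h) \<partial>cube_avg \<epsilon>)"

lemma cube_mean_integrable:
  assumes u: "u \<in> \<T>" and \<epsilon>: "\<epsilon> > 0"
  shows "integrable (cube_avg \<epsilon>) (\<lambda>h. u (x + h))"
proof -
  interpret N: finite_measure "cube_avg \<epsilon> :: (real^'n) measure"
    using cube_avg_space[OF \<epsilon>, where 'n='n] by (intro finite_measureI) simp
  note [measurable] = test_borel[OF u]
  obtain B where "\<And>x. \<bar>u x\<bar> \<le> B" using test_function_bounded[OF u] by metis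
  then show ?thesis by (intro N.integrable_const_bound[where B=B]) auto
qed

text \<open>The averaging measure has density at most \<epsilon>^(-N), so an L1 bound on
  \<open>u\<close> becomes a bound at every point.\<close>

lemma cube_mean_bound:
  assumes u: "u \<in> \<T>" and \<epsilon>: "\<epsilon> > 0" and C: "C \<ge> 0" "(\<integral>\<^sup>+x. ennreal \<bar>u x\<bar> \<partial>lborel) \<le> ennreal C"
  shows "\<bar>cube_mean \<epsilon> u x\<bar> \<le> C / \<epsilon> ^ CARD('n)"
proof -
  note [measurable] = test_borel[OF u]
  have "ennreal (norm (cube_mean \<epsilon> u x)) \<le> (\<integral>\<^sup>+h. ennreal (norm (u (x + h))) \<partial>cube_avg \<epsilon>)"
    unfolding cube_mean_def by (rule integral_norm_bound_ennreal[OF cube_mean_integrable[OF u \<epsilon>]])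
  also have "\<dots> \<le> (\<integral>\<^sup>+h. ennreal \<bar>u (h + x)\<bar> \<partial>lborel) / ennreal (\<epsilon> ^ CARD('n))"
    using nn_integral_cube_avg_le[OF \<epsilon>, of "\<lambda>h. ennreal \<bar>u (x + h)\<bar>"] by (simp add: add.commute)
  also have "(\<integral>\<^sup>+h. ennreal \<bar>u (h + x)\<bar> \<partial>lborel) = (\<integral>\<^sup>+h. ennreal \<bar>u h\<bar> \<partial>lborel)"
    by (rule nn_integral_lborel_translate) measurable
  also have "\<dots> / ennreal (\<epsilon> ^ CARD('n)) \<le> ennreal C / ennreal (\<epsilon> ^ CARD('n))"
    by (rule divide_right_mono_ennreal[OF C(2)])
  also have "\<dots> = ennreal (C / \<epsilon> ^ CARD('n))"
    using C \<epsilon> by (simp add: divide_ennreal)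
  finally show ?thesis using C \<epsilon> by (subst (asm) ennreal_le_iff) auto
qed

text \<open>The density bound is applied to u(x + h) - u(y + h), whose L1 norm in \<open>h\<close>
  is controlled by \<open>translation_bound\<close> with the absolute value as convex
  function.\<close>

lemma cube_mean_lipschitz:
  assumes u: "u \<in> \<T>" and \<epsilon>: "\<epsilon> > 0"
    and C: "C \<ge> 0" "(\<integral>\<^sup>+x. ennreal (norm (grad u x)) \<partial>lborel) \<le> ennreal C"
  shows "\<bar>cube_mean \<epsilon> u x - cube_mean \<epsilon> u y\<bar> \<le> C / \<epsilon> ^ CARD('n) * norm (x - y)"
proof -
  note [measurable] = test_borel[OF u]
  have "cube_mean \<epsilon> u x - cube_mean \<epsilon> u y = (\<integral>h. u (x + h) - u (y + h) \<partial>cube_avg \<epsilon>)"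
    unfolding cube_mean_def using cube_mean_integrable[OF u \<epsilon>] by simp
  moreover have "integrable (cube_avg \<epsilon>) (\<lambda>h. u (x + h) - u (y + h))"
    by (intro Bochner_Integration.integrable_diff cube_mean_integrable[OF u \<epsilon>])
  ultimately have "ennreal (norm (cube_mean \<epsilon> u x - cube_mean \<epsilon> u y)) \<le>
      (\<integral>\<^sup>+h. ennreal (norm (u (x + h) - u (y + h))) \<partial>cube_avg \<epsilon>)"
    by (simp only: integral_norm_bound_ennreal)
  also have "\<dots> \<le> (\<integral>\<^sup>+h. ennreal \<bar>u (h + y + (x - y)) - u (h + y)\<bar> \<partial>lborel) / ennreal (\<epsilon> ^ CARD('n))"
    using nn_integral_cube_avg_le[OF \<epsilon>, of "\<lambda>h. ennreal \<bar>u (x + h) - u (y + h)\<bar>"]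
    by (simp add: add.commute)
  also have "(\<integral>\<^sup>+h. ennreal \<bar>u (h + y + (x - y)) - u (h + y)\<bar> \<partial>lborel) =
      (\<integral>\<^sup>+h. ennreal \<bar>u (h + (x - y)) - u h\<bar> \<partial>lborel)"
    by (rule nn_integral_lborel_translate[where f="\<lambda>z. ennreal \<bar>u (z + (x - y)) - u z\<bar>"]) measurable
  also have "\<dots> / ennreal (\<epsilon> ^ CARD('n)) \<le>
      (\<integral>\<^sup>+z. ennreal \<bar>norm (x - y) * norm (grad u z)\<bar> \<partial>lborel) / ennreal (\<epsilon> ^ CARD('n))"
    by (intro divide_right_mono_ennreal translation_bound[where \<Psi>=abs] test_function_smooth[OF u] tangent_abs) auto
  also have "(\<integral>\<^sup>+z. ennreal \<bar>norm (x - y) * norm (grad u z)\<bar> \<partial>lborel) =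
      ennreal (norm (x - y)) * (\<integral>\<^sup>+z. ennreal (norm (grad u z)) \<partial>lborel)"
    by (simp add: ennreal_mult nn_integral_cmult)
  also have "\<dots> / ennreal (\<epsilon> ^ CARD('n)) \<le> ennreal (norm (x - y)) * ennreal C / ennreal (\<epsilon> ^ CARD('n))"
    by (intro divide_right_mono_ennreal mult_left_mono C) auto
  also have "\<dots> = ennreal (C / \<epsilon> ^ CARD('n) * norm (x - y))"
    using C \<epsilon> by (simp add: divide_ennreal mult.commute flip: ennreal_mult)
  finally show ?thesis using C \<epsilon> by (subst (asm) ennreal_le_iff) auto
qed

text \<open>Jensen in \<open>h\<close> and the averaged translation bound give an error of order
  \<epsilon>, uniformly over functions whose gradients have bounded modular. That N \<epsilon> is at
  most 1 lets this factor leave \<Phi> by \<open>Phi_shrink\<close>.\<close>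

lemma cube_mean_diff:
  assumes u: "u \<in> \<T>" and \<epsilon>: "\<epsilon> > 0" "real CARD('n) * \<epsilon> \<le> 1"
    and [measurable]: "cube_mean \<epsilon> u \<in> borel_measurable borel"
  shows "integrable M (\<lambda>x. \<Phi> (cube_mean \<epsilon> u x - u x))"
    "(\<integral>x. \<Phi> (cube_mean \<epsilon> u x - u x) \<partial>M) \<le> real CARD('n) * \<epsilon> * (\<integral>x. \<Phi> (norm (grad u x)) \<partial>M)"
proof -
  note [measurable] = test_borel[OF u] test_measurable[OF u]
  have [measurable]: "cube_mean \<epsilon> u \<in> borel_measurable M" by (rule M_measurableI) measurable
  have m1: "measure (cube_avg \<epsilon>) (UNIV :: (real^'n) set) = 1"
    using cube_avg_space[OF \<epsilon>(1), where 'n='n] by (simp add: measure_def)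
  interpret N: finite_measure "cube_avg \<epsilon> :: (real^'n) measure"
    using cube_avg_space[OF \<epsilon>(1), where 'n='n] by (intro finite_measureI) simp
  have eq: "cube_mean \<epsilon> u x - u x = (\<integral>h. u (x + h) - u x \<partial>cube_avg \<epsilon>)" for x
    unfolding cube_mean_def using cube_mean_integrable[OF u \<epsilon>(1)] m1 by simp
  have "(\<integral>\<^sup>+x. ennreal (\<Phi> (cube_mean \<epsilon> u x - u x)) \<partial>M) \<le>
      (\<integral>\<^sup>+x. ennreal (\<Phi> (cube_mean \<epsilon> u x - u x)) \<partial>lborel)"
    by (rule nn_integral_M_le_lborel)
  also have "\<dots> \<le> (\<integral>\<^sup>+x. \<integral>\<^sup>+h. ennreal (\<Phi> (u (x + h) - u x)) \<partial>cube_avg \<epsilon> \<partial>lborel)"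
    unfolding eq using cube_avg_space[OF \<epsilon>(1)] cube_mean_integrable[OF u \<epsilon>(1)]
    by (intro nn_integral_mono Jensen_nn_integral Phi_tangent_ex) auto
  also have "\<dots> \<le> (\<integral>\<^sup>+x. ennreal (\<Phi> ((real CARD('n) * \<epsilon>) * norm (grad u x))) \<partial>lborel)"
    using cube_avg_space[OF \<epsilon>(1), where 'n='n] cube_avg_AE[of \<epsilon>]
    by (intro translation_bound_averaged test_function_smooth[OF u] Phi_tangent_ex Phi_mono) auto
  also have "\<dots> = ennreal (\<integral>x. \<Phi> ((real CARD('n) * \<epsilon>) * norm (grad u x)) \<partial>M)"
    by (rule nn_integral_Phi_grad[OF u])
  also have "\<dots> \<le> ennreal (real CARD('n) * \<epsilon> * (\<integral>x. \<Phi> (norm (grad u x)) \<partial>M))"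
    using \<epsilon> test_integrable[OF u] by (intro ennreal_leI integral_Phi_shrink) auto
  finally have le: "(\<integral>\<^sup>+x. ennreal (\<Phi> (cube_mean \<epsilon> u x - u x)) \<partial>M) \<le>
      ennreal (real CARD('n) * \<epsilon> * (\<integral>x. \<Phi> (norm (grad u x)) \<partial>M))" .
  show int: "integrable M (\<lambda>x. \<Phi> (cube_mean \<epsilon> u x - u x))"
    using le by (intro integrableI_bounded) (auto intro: order.strict_trans1)
  show "(\<integral>x. \<Phi> (cube_mean \<epsilon> u x - u x) \<partial>M) \<le> real CARD('n) * \<epsilon> * (\<integral>x. \<Phi> (norm (grad u x)) \<partial>M)"
    using le \<epsilon> unfolding nn_integral_eq_integral[OF int AE_I2[OF Phi_nonneg]]
    by (subst (asm) ennreal_le_iff) auto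
qed

text \<open>A Frechet-Kolmogorov argument. At each fixed scale the cube means are equibounded and
  equi-Lipschitz, so one subsequence makes them converge everywhere for all scales; dominated
  convergence gives modular convergence of the means, and \<open>cube_mean_diff\<close> compares
  them with \<open>u n\<close>.\<close>

lemma Rellich:
  assumes u: "\<And>n. u n \<in> \<T>" and B: "\<And>n. (\<integral>x. \<Phi> (norm (grad (u n) x)) \<partial>M) \<le> B"
  obtains r :: "nat \<Rightarrow> nat" where "strict_mono r"
    "\<And>e. e > 0 \<Longrightarrow> \<exists>N. \<forall>m\<ge>N. \<forall>n\<ge>N. (\<integral>x. \<Phi> (u (r m) x - u (r n) x) \<partial>M) < e"
proof -
  obtain C where C: "C \<ge> 0" "\<And>n. (\<integral>\<^sup>+x. ennreal \<bar>u n x\<bar> \<partial>lborel) \<le> ennreal C"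
    "\<And>n. (\<integral>\<^sup>+x. ennreal (norm (grad (u n) x)) \<partial>lborel) \<le> ennreal C"
    by (rule test_L1_bounds[of u B, OF B u]) (rule that)
  define \<epsilon> where "\<epsilon> j = inverse (real (Suc j))" for j
  have \<epsilon>: "\<epsilon> j > 0" for j by (simp add: \<epsilon>_def)
  define A where "A j n = cube_mean (\<epsilon> j) (u n)" for j n
  define K where "K j = C / \<epsilon> j ^ CARD('n)" for j
  have K: "K j \<ge> 0" for j using C \<epsilon>[of j] by (simp add: K_def)
  have A_bd: "\<bar>A j n x\<bar> \<le> K j" for j n x
    unfolding A_def K_def by (rule cube_mean_bound[OF u \<epsilon> C(1,2)])
  have A_lip: "\<bar>A j n x - A j n y\<bar> \<le> K j * norm (x - y)" for j n x y
    unfolding A_def K_def by (rule cube_mean_lipschitz[OF u \<epsilon> C(1,3)])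
  have [measurable]: "A j n \<in> borel_measurable borel" for j n
  proof (intro borel_measurable_continuous_onI lipschitz_on_continuous_on)
    show "(K j)-lipschitz_on UNIV (A j n)"
      using A_lip K by (intro lipschitz_onI) (auto simp: dist_norm)
  qed
  have [measurable]: "A j n \<in> borel_measurable M" for j n by (rule M_measurableI) measurable
  note [measurable] = test_measurable[OF u]
  obtain S :: "(real^'n) set" where S: "countable S" "\<And>X. open X \<Longrightarrow> X \<noteq> {} \<Longrightarrow> \<exists>d\<in>S. d \<in> X"
    using countable_dense_exists by metis
  have S0: "S \<noteq> {}" using S(2)[of UNIV] by auto
  \<comment> \<open>One index \<open>i\<close> codes a scale together with a point of the dense set
    \<open>S\<close>, so a single extraction serves all scales.\<close>
  define F where "F n i = A (fst (prod_decode i)) n (from_nat_into S (snd (prod_decode i)))" for n i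
  obtain r :: "nat \<Rightarrow> nat" where r: "strict_mono r" "\<And>i. convergent (\<lambda>n. F (r n) i)"
    by (rule diagonal_subsequence_real[of F "\<lambda>i. K (fst (prod_decode i))"]) (auto simp: F_def A_bd)
  have conv_S: "convergent (\<lambda>n. A j (r n) s)" if "s \<in> S" for j s
    using r(2)[of "prod_encode (j, to_nat_on S s)"] that S(1) by (simp add: F_def)
  have conv: "convergent (\<lambda>n. A j (r n) x)" for j x
  proof (rule Cauchy_convergent, rule metric_CauchyI)
    fix e :: real assume e: "e > 0"
    define d where "d = e / (3 * (K j + 1))"
    have d: "d > 0" using e K[of j] by (simp add: d_def)
    then obtain s where s: "s \<in> S" "dist x s < d"
      using S(2)[of "ball x d"] by auto
    have "K j * norm (x - s) \<le> (K j + 1) * d"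
      using s K[of j] by (intro mult_mono) (auto simp: dist_norm)
    also have "\<dots> = e / 3"
    proof -
      have cancel: "k * (e / (3 * k)) = e / 3" if "k > 0" for k :: real using that by simp
      show ?thesis unfolding d_def by (rule cancel) (use K[of j] in simp)
    qed
    finally have near: "\<bar>A j n x - A j n s\<bar> \<le> e / 3" for n using A_lip[of j n x s] by simp
    have "Cauchy (\<lambda>n. A j (r n) s)" using conv_S[OF s(1)] by (rule convergent_Cauchy)
    then obtain N where N: "\<And>m n. m \<ge> N \<Longrightarrow> n \<ge> N \<Longrightarrow> dist (A j (r m) s) (A j (r n) s) < e / 3"
      using e unfolding Cauchy_def by (meson divide_pos_pos zero_less_numeral)
    have "dist (A j (r m) x) (A j (r n) x) < e" if "m \<ge> N" "n \<ge> N" for m n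
      using N[OF that] near[of "r m"] near[of "r n"] unfolding dist_real_def by linarith
    then show "\<exists>N. \<forall>m\<ge>N. \<forall>n\<ge>N. dist (A j (r m) x) (A j (r n) x) < e" by blast
  qed
  define L where "L j x = lim (\<lambda>n. A j (r n) x)" for j x
  have L: "(\<lambda>n. A j (r n) x) \<longlonglongrightarrow> L j x" for j x
    using conv by (simp add: L_def convergent_LIMSEQ_iff)
  have [measurable]: "L j \<in> borel_measurable M" for j
    unfolding L_def[abs_def] by measurable
  have L_bd: "\<bar>L j x\<bar> \<le> K j" for j x
    using A_bd by (intro LIMSEQ_le_const2[OF tendsto_rabs[OF L]]) auto
  have AL_int: "integrable M (\<lambda>x. \<Phi> (A j n x - L j x))" for j n
  proof (rule integrable_Phi_bounded[where B="2 * K j"])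
    show "\<bar>A j n x - L j x\<bar> \<le> 2 * K j" for x
      using A_bd[of j n x] L_bd[of j x] by linarith
  qed measurable
  have AL: "(\<lambda>n. \<integral>x. \<Phi> (A j (r n) x - L j x) \<partial>M) \<longlonglongrightarrow> 0" for j
  proof -
    have "(\<lambda>n. \<integral>x. \<Phi> (A j (r n) x - L j x) \<partial>M) \<longlonglongrightarrow> (\<integral>x. 0 \<partial>M)"
    proof (rule integral_dominated_convergence[where w="\<lambda>x. \<Phi> (2 * K j)"])
      show "AE x in M. (\<lambda>n. \<Phi> (A j (r n) x - L j x)) \<longlonglongrightarrow> 0"
      proof (rule AE_I2)
        fix x
        have "(\<lambda>n. \<Phi> (A j (r n) x - L j x)) \<longlonglongrightarrow> \<Phi> 0"
          using L by (intro continuous_on_tendsto_compose[OF Phi_cont[of UNIV]]) (auto simp: LIM_zero)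
        then show "(\<lambda>n. \<Phi> (A j (r n) x - L j x)) \<longlonglongrightarrow> 0" by (simp add: Phi_0)
      qed
      show "AE x in M. norm (\<Phi> (A j (r n) x - L j x)) \<le> \<Phi> (2 * K j)" for n
      proof (rule AE_I2)
        show "norm (\<Phi> (A j (r n) x - L j x)) \<le> \<Phi> (2 * K j)" for x
          using A_bd[of j "r n" x] L_bd[of j x] by (simp add: Phi_mono)
      qed
    qed auto
    then show ?thesis by simp
  qed
  have B0: "B \<ge> 0" by (rule order_trans[OF integral_nonneg_AE B]) simp
  define \<kappa> where "\<kappa> = (2 powr \<sigma>)\<^sup>2"
  have \<kappa>: "\<kappa> > 0" by (simp add: \<kappa>_def)
  show ?thesis
  proof (rule that[OF r(1)])
    fix e :: real assume e: "e > 0"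
    define n0 where "n0 = real CARD('n)"
    have n0: "n0 > 0" by (simp add: n0_def)
    \<comment> \<open>This \<open>d\<close> makes the averaging errors at most
      \<open>\<delta>\<close>; four terms of that size, as in \<open>Phi_add4\<close>, add up to
      \<open>e / 2\<close> after multiplication by \<open>\<kappa>\<close>. The summand 1 in B + 1
      avoids division by zero.\<close>
    define d where "d = min 1 (e / (8 * \<kappa> * (B + 1))) / n0"
    have "d > 0" using e \<kappa> B0 n0 by (simp add: d_def)
    then obtain j where j: "\<epsilon> j < d"
      using reals_Archimedean[of d] by (auto simp: \<epsilon>_def)
    have j1: "n0 * \<epsilon> j \<le> 1" "n0 * \<epsilon> j \<le> e / (8 * \<kappa> * (B + 1))"
      using j n0 by (auto simp: d_def field_simps)
    define \<delta> where "\<delta> = e / (8 * \<kappa>)"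
    have \<delta>: "\<delta> > 0" using e \<kappa> by (simp add: \<delta>_def)
    have diff: "integrable M (\<lambda>x. \<Phi> (A j n x - u n x))" "(\<integral>x. \<Phi> (A j n x - u n x) \<partial>M) \<le> \<delta>" for n
    proof -
      show "integrable M (\<lambda>x. \<Phi> (A j n x - u n x))"
        unfolding A_def using j1 \<epsilon> u by (intro cube_mean_diff) (auto simp: n0_def simp flip: A_def)
      have "(\<integral>x. \<Phi> (A j n x - u n x) \<partial>M) \<le> n0 * \<epsilon> j * (\<integral>x. \<Phi> (norm (grad (u n) x)) \<partial>M)"
        unfolding A_def n0_def using j1 \<epsilon> u by (intro cube_mean_diff) (auto simp: n0_def simp flip: A_def)
      also have "\<dots> \<le> e / (8 * \<kappa> * (B + 1)) * (B + 1)"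
        using j1 B[of n] B0 e \<kappa> by (intro mult_mono) auto
      also have "\<dots> = \<delta>" using B0 by (simp add: \<delta>_def)
      finally show "(\<integral>x. \<Phi> (A j n x - u n x) \<partial>M) \<le> \<delta>" .
    qed
    obtain N where N: "\<And>n. n \<ge> N \<Longrightarrow> (\<integral>x. \<Phi> (A j (r n) x - L j x) \<partial>M) < \<delta>"
      using order_tendstoD(2)[OF AL \<delta>] by (auto simp: eventually_sequentially)
    have "(\<integral>x. \<Phi> (u (r m) x - u (r n) x) \<partial>M) < e" if "m \<ge> N" "n \<ge> N" for m n
    proof -
      let ?R = "\<lambda>x. \<kappa> * (\<Phi> (A j (r m) x - u (r m) x) + \<Phi> (A j (r m) x - L j x) +
            (\<Phi> (A j (r n) x - L j x) + \<Phi> (A j (r n) x - u (r n) x)))"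
      have R_int: "integrable M ?R" using diff AL_int by simp
      have le: "\<Phi> (u (r m) x - u (r n) x) \<le> ?R x" for x
        using Phi_add4[of "- (A j (r m) x - u (r m) x)" "A j (r m) x - L j x"
            "- (A j (r n) x - L j x)" "A j (r n) x - u (r n) x"]
        unfolding Phi_even \<kappa>_def by simp
      have "(\<integral>x. \<Phi> (u (r m) x - u (r n) x) \<partial>M) \<le> (\<integral>x. ?R x \<partial>M)"
        using le test_integrable(1)[OF test_function_diff[OF u u]] R_int by (intro integral_mono)
      also have "\<dots> = \<kappa> * ((\<integral>x. \<Phi> (A j (r m) x - u (r m) x) \<partial>M) + (\<integral>x. \<Phi> (A j (r m) x - L j x) \<partial>M) +
            ((\<integral>x. \<Phi> (A j (r n) x - L j x) \<partial>M) + (\<integral>x. \<Phi> (A j (r n) x - u (r n) x) \<partial>M)))"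
        using diff AL_int by simp
      also have "\<dots> \<le> \<kappa> * (\<delta> + \<delta> + (\<delta> + \<delta>))"
        using diff(2)[of "r m"] diff(2)[of "r n"] N[OF that(1)] N[OF that(2)] \<kappa>
        by (intro mult_left_mono add_mono) auto
      also have "\<dots> = e / 2" using \<kappa> by (simp add: \<delta>_def)
      also have "\<dots> < e" using e by simp
      finally show ?thesis .
    qed
    then show "\<exists>N. \<forall>m\<ge>N. \<forall>n\<ge>N. (\<integral>x. \<Phi> (u (r m) x - u (r n) x) \<partial>M) < e" by blast
  qed
qed

end

section \<open>Critical points of functions of finitely many variables\<close>

text \<open>Coefficient vectors of all dimensions live in the one type of sequences, so paths,
  compactness and continuity need a single topology.\<close>

definition coords :: "nat set \<Rightarrow> (nat \<Rightarrow> real) set" where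
  "coords B = {x. \<forall>i. i \<notin> B \<longrightarrow> x i = 0}"

definition unit_coord :: "nat \<Rightarrow> nat \<Rightarrow> real" where
  "unit_coord i j = (if j = i then 1 else 0)"

lemma continuous_on_coordinate: "continuous_on S f \<Longrightarrow> continuous_on S (\<lambda>x. f x (i::'i) :: real)"
  by (rule continuous_on_product_then_coordinatewise)

lemma closed_coords: "closed (coords B)"
proof -
  have "coords B = (\<Inter>i\<in>-B. {x. x i = 0})" by (auto simp: coords_def)
  moreover have "closed {x::nat \<Rightarrow> real. x i = 0}" for i
    by (intro closed_Collect_eq continuous_on_coordinate continuous_intros)
  ultimately show ?thesis by (simp add: closed_INT)
qed

text \<open>\<open>f\<close> stands for a difference of convex functions, and \<open>D a b y\<close>
  for its derivative in direction \<open>y\<close> with the convex part taken at \<open>a\<close>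
  and the subtracted part at \<open>b\<close>. Then \<open>desc\<close> only expresses tangent
  inequalities, and \<open>D x x\<close> is the derivative.\<close>

locale descent =
  fixes B :: "nat set" and f :: "(nat \<Rightarrow> real) \<Rightarrow> real"
    and D :: "(nat \<Rightarrow> real) \<Rightarrow> (nat \<Rightarrow> real) \<Rightarrow> (nat \<Rightarrow> real) \<Rightarrow> real"
  assumes contf: "continuous_on UNIV f"
    and contD: "continuous_on UNIV (\<lambda>(a, b, c). D a b c)"
    and desc: "0 \<le> s \<Longrightarrow> f (\<lambda>i. x i - s * y i) \<le> f x - s * D (\<lambda>i. x i - s * y i) x y"
    and finB: "finite B"
    and lin: "y \<in> coords B \<Longrightarrow> D x x y = (\<Sum>i\<in>B. y i * D x x (unit_coord i))"
    and compact_sublevel: "compact {x \<in> coords B. f x \<le> c}"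
begin

lemma continuous_D:
  assumes "continuous_on S a" "continuous_on S b" "continuous_on S c"
  shows "continuous_on S (\<lambda>z. D (a z) (b z) (c z))"
proof -
  have "continuous_on S (\<lambda>z. (\<lambda>(a, b, c). D a b c) (a z, b z, c z))"
    by (rule continuous_on_compose2[OF contD]) (auto intro!: continuous_intros assms)
  then show ?thesis by simp
qed

text \<open>At a minimum, \<open>desc\<close> shows that the slope with first argument x - s y is at
  most 0 for s > 0. As s tends to 0 continuity gives D x x y <= 0, and linearity in \<open>y\<close>
  gives the opposite sign.\<close>

lemma minimizer:
  assumes x0: "x0 \<in> coords B"
  obtains x where "x \<in> coords B" "f x \<le> f x0" "\<And>y. y \<in> coords B \<Longrightarrow> D x x y = 0"
proof -
  let ?K = "{x \<in> coords B. f x \<le> f x0}"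
  have "\<exists>x\<in>?K. \<forall>y\<in>?K. f x \<le> f y"
    using x0 by (intro continuous_attains_inf compact_sublevel continuous_on_subset[OF contf]) auto
  then obtain x where x: "x \<in> coords B" "f x \<le> f x0" "\<And>y. y \<in> ?K \<Longrightarrow> f x \<le> f y" by auto
  have min: "f x \<le> f y" if "y \<in> coords B" for y
    using x(2) x(3)[of y] that by (cases "f y \<le> f x0") auto
  have le: "D x x y \<le> 0" if y: "y \<in> coords B" for y
  proof -
    have "((\<lambda>s. D (\<lambda>i. x i - s * y i) x y) \<longlongrightarrow> D (\<lambda>i. x i - 0 * y i) x y) (at_right 0)"
    proof (rule continuous_on_tendsto_compose[where f="\<lambda>s. D (\<lambda>i. x i - s * y i) x y" and s=UNIV])
      show "continuous_on UNIV (\<lambda>s. D (\<lambda>i. x i - s * y i) x y)"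
        by (intro continuous_D continuous_on_coordinatewise_then_product continuous_intros)
    qed (auto intro: tendsto_intros)
    moreover have "\<forall>\<^sub>F s in at_right 0. D (\<lambda>i. x i - s * y i) x y \<le> 0"
    proof -
      have "D (\<lambda>i. x i - s * y i) x y \<le> 0" if "s > 0" for s
      proof -
        have "(\<lambda>i. x i - s * y i) \<in> coords B" using x(1) y by (auto simp: coords_def)
        then have "f x \<le> f x - s * D (\<lambda>i. x i - s * y i) x y"
          using min desc[of s x y] that by force
        then show ?thesis using that by (simp add: mult_le_0_iff)
      qed
      then show ?thesis by (simp add: eventually_at_filter)
    qed
    ultimately show ?thesis using tendsto_upperbound by fastforce
  qed
  have "D x x y = 0" if y: "y \<in> coords B" for y
  proof -
    have "(\<lambda>i. - y i) \<in> coords B" using y by (auto simp: coords_def)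
    from le[OF this] lin[OF this, of x] have "- D x x y \<le> 0"
      using lin[OF y, of x] by (simp add: sum_negf)
    with le[OF y] show ?thesis by simp
  qed
  with x that show ?thesis by blast
qed

text \<open>If there were no critical point with value in \<open>[\<delta>/2, m]\<close>, then the continuous deformation
  \<open>x \<mapsto> x - t \<theta>(x) \<nabla>f(x)\<close> would lower the maximum of \<open>f\<close> along any admissible path by a fixed
  amount as long as this maximum exceeds \<open>3\<delta>/4\<close>.\<close>

lemma mountain_pass:
  fixes \<gamma>0 :: "real \<Rightarrow> nat \<Rightarrow> real"
  assumes \<delta>: "\<delta> > 0"
    and path: "continuous_on {0..1} \<gamma>0" "\<And>t. t \<in> {0..1} \<Longrightarrow> \<gamma>0 t \<in> coords B"
      "\<And>t. t \<in> {0..1} \<Longrightarrow> f (\<gamma>0 t) \<le> m" "f (\<gamma>0 0) \<le> 0" "f (\<gamma>0 1) \<le> 0"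
    and barrier: "\<And>\<gamma> :: real \<Rightarrow> nat \<Rightarrow> real. continuous_on {0..1} \<gamma> \<Longrightarrow> (\<And>t. t \<in> {0..1} \<Longrightarrow> \<gamma> t \<in> coords B) \<Longrightarrow>
      \<gamma> 0 = \<gamma>0 0 \<Longrightarrow> \<gamma> 1 = \<gamma>0 1 \<Longrightarrow> \<exists>t\<in>{0..1}. \<delta> \<le> f (\<gamma> t)"
  obtains x where "x \<in> coords B" "\<delta> / 2 \<le> f x" "f x \<le> m" "\<And>y. y \<in> coords B \<Longrightarrow> D x x y = 0"
proof (rule ccontr)
  assume neg: "\<not> thesis"
  note critical = that
  define g where "g x i = (if i \<in> B then D x x (unit_coord i) else 0)" for x i
  have g_coords: "g x \<in> coords B" for x by (simp add: g_def coords_def)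
  have contg: "continuous_on UNIV g"
  proof (rule continuous_on_coordinatewise_then_product)
    fix i
    have "continuous_on UNIV (\<lambda>x. D x x (unit_coord i))"
      by (intro continuous_D continuous_intros)
    then show "continuous_on UNIV (\<lambda>x. g x i)"
      by (cases "i \<in> B") (simp_all add: g_def)
  qed
  have Dg: "D x x (g x) = (\<Sum>i\<in>B. (g x i)\<^sup>2)" for x
    using lin[OF g_coords, of x x] by (simp add: g_def power2_eq_square)
  define K where "K = {x \<in> coords B. f x \<le> m} \<inter> {x. \<delta> / 2 \<le> f x}"
  have compK: "compact K"
    unfolding K_def by (intro compact_Int_closed compact_sublevel closed_Collect_le contf continuous_intros)
  obtain t0 where t0: "t0 \<in> {0..1}" "\<delta> \<le> f (\<gamma>0 t0)" using barrier[of \<gamma>0] path by auto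
  then have m\<delta>: "\<delta> \<le> m" using path(3)[OF t0(1)] by simp
  have neK: "K \<noteq> {}" using t0 path \<delta> by (force simp: K_def)
  have posK: "D x x (g x) > 0" if "x \<in> K" for x
  proof (rule ccontr)
    assume "\<not> ?thesis"
    then have "(\<Sum>i\<in>B. (g x i)\<^sup>2) = 0" using Dg by (simp add: sum_nonneg antisym)
    then have "\<forall>i\<in>B. g x i = 0" using finB by (simp add: sum_nonneg_eq_0_iff)
    then have "D x x y = 0" if "y \<in> coords B" for y
      using lin[OF that, of x] by (simp add: g_def)
    then show False using neg critical[of x] \<open>x \<in> K\<close> by (auto simp: K_def)
  qed
  have "\<exists>x\<in>K. \<forall>y\<in>K. D x x (g x) \<le> D y y (g y)"
    by (intro continuous_attains_inf compK neK continuous_D continuous_on_subset[OF contg] continuous_intros) auto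
  then obtain b0 where b0: "b0 > 0" "\<And>y. y \<in> K \<Longrightarrow> b0 \<le> D y y (g y)" using posK by metis
  define \<beta> where "\<beta> = b0 / 2"
  have \<beta>: "\<beta> > 0" using b0 by (simp add: \<beta>_def)
  \<comment> \<open>Uniform continuity of \<open>H\<close> on the compact product of
    \<open>K\<close> and [0, 1] yields one step length \<open>t\<close> along which the slope stays
    above \<beta>, half of its lower bound \<open>b0\<close> on \<open>K\<close>.\<close>
  define H where "H z = D (\<lambda>i. fst z i - snd z * g (fst z) i) (fst z) (g (fst z))" for z :: "(nat \<Rightarrow> real) \<times> real"
  have contgf: "continuous_on S (\<lambda>z. g (fst z))" for S :: "((nat \<Rightarrow> real) \<times> real) set"
    by (rule continuous_on_compose2[OF contg]) (auto intro: continuous_intros)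
  have "continuous_on (K \<times> {0..1}) H"
    unfolding H_def
    by (intro continuous_D contgf continuous_on_coordinatewise_then_product continuous_on_diff
        continuous_on_mult continuous_on_coordinate[OF contgf] continuous_on_coordinate[OF continuous_on_fst]
        continuous_on_fst continuous_on_snd continuous_on_id)
  then have "uniformly_continuous_on (K \<times> {0..1}) H"
    by (intro compact_uniformly_continuous compact_Times compK) auto
  then obtain d where d: "d > 0"
    "\<And>z z'. z \<in> K \<times> {0..1} \<Longrightarrow> z' \<in> K \<times> {0..1} \<Longrightarrow> dist z' z < d \<Longrightarrow> dist (H z') (H z) < \<beta>"
    using \<beta> unfolding uniformly_continuous_on_def by metis
  define t where "t = min 1 (d / 2)"
  have t: "t > 0" "t \<le> 1" "t < d" using d(1) by (auto simp: t_def)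
  have low: "D (\<lambda>i. x i - s * g x i) x (g x) \<ge> \<beta>" if "x \<in> K" "0 \<le> s" "s \<le> t" for x s
  proof -
    have "dist (x, s) (x, 0) < d" using that t by (simp add: dist_Pair_Pair)
    then have "dist (H (x, s)) (H (x, 0)) < \<beta>" using that t by (intro d(2)) auto
    then show ?thesis using b0(2)[OF that(1)] by (auto simp: H_def dist_real_def \<beta>_def abs_if split: if_splits)
  qed
  \<comment> \<open>The cut-off is 0 up to level \<delta>/2, which keeps the endpoints of the path
    fixed, and 1 from level 3\<delta>/4 on, where every step gains t \<beta>.\<close>
  define \<theta> where "\<theta> x = min 1 (max 0 ((f x - \<delta> / 2) / (\<delta> / 4)))" for x
  have \<theta>: "0 \<le> \<theta> x" "\<theta> x \<le> 1" for x by (auto simp: \<theta>_def)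
  have cont\<theta>: "continuous_on UNIV \<theta>"
    unfolding \<theta>_def[abs_def] using \<delta> by (intro continuous_intros contf) auto
  define \<eta> where "\<eta> x i = x i - t * \<theta> x * g x i" for x i
  have cont\<eta>: "continuous_on UNIV \<eta>"
    unfolding \<eta>_def[abs_def]
    by (intro continuous_on_coordinatewise_then_product continuous_intros continuous_on_product_coordinates continuous_on_coordinate[OF contg] cont\<theta>)
  have \<eta>_coords: "\<eta> x \<in> coords B" if "x \<in> coords B" for x
    using that g_coords[of x] by (simp add: \<eta>_def coords_def)
  have \<theta>0: "\<theta> x = 0" if "f x \<le> \<delta> / 2" for x
  proof -
    have "(f x - \<delta> / 2) / (\<delta> / 4) \<le> 0" using that \<delta> by (intro divide_nonpos_pos) auto
    then show ?thesis by (simp add: \<theta>_def max_absorb1)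
  qed
  have \<eta>_id: "\<eta> x = x" if "f x \<le> \<delta> / 2" for x
    using \<theta>0[OF that] by (simp add: \<eta>_def[abs_def])
  have \<eta>_desc: "f (\<eta> x) \<le> f x - t * \<theta> x * \<beta>" if x: "x \<in> coords B" "f x \<le> m" for x
  proof (cases "f x \<le> \<delta> / 2")
    case True
    then show ?thesis using \<eta>_id[OF True] \<theta>0[OF True] by simp
  next
    case False
    then have xK: "x \<in> K" using x by (simp add: K_def)
    have t\<theta>: "0 \<le> t * \<theta> x" "t * \<theta> x \<le> t" using t \<theta>[of x] by (auto simp: mult_left_le)
    have "f (\<eta> x) \<le> f x - t * \<theta> x * D (\<lambda>i. x i - t * \<theta> x * g x i) x (g x)"
      unfolding \<eta>_def[abs_def] by (rule desc[OF t\<theta>(1)])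
    also have "\<dots> \<le> f x - t * \<theta> x * \<beta>"
      using low[OF xK t\<theta>] t\<theta> by (intro diff_left_mono mult_left_mono) auto
    finally show ?thesis .
  qed
  have \<theta>1: "\<theta> x = 1" if "3 * \<delta> / 4 \<le> f x" for x
  proof -
    have "1 \<le> (f x - \<delta> / 2) / (\<delta> / 4)" using that \<delta> by (simp add: field_simps)
    then show ?thesis by (simp add: \<theta>_def)
  qed
  have "\<exists>\<gamma> :: real \<Rightarrow> nat \<Rightarrow> real. continuous_on {0..1} \<gamma> \<and> (\<forall>s\<in>{0..1}. \<gamma> s \<in> coords B \<and> f (\<gamma> s) \<le> max (3 * \<delta> / 4) (m - k * (t * \<beta>)))
      \<and> \<gamma> 0 = \<gamma>0 0 \<and> \<gamma> 1 = \<gamma>0 1" for k :: nat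
  proof (induction k)
    case 0
    then show ?case by (rule exI[of _ \<gamma>0]) (use path in \<open>auto simp: le_max_iff_disj\<close>)
  next
    case (Suc k)
    then obtain \<gamma> :: "real \<Rightarrow> nat \<Rightarrow> real" where \<gamma>: "continuous_on {0..1} \<gamma>" "\<gamma> 0 = \<gamma>0 0" "\<gamma> 1 = \<gamma>0 1"
      "\<And>s. s \<in> {0..1} \<Longrightarrow> \<gamma> s \<in> coords B"
      "\<And>s. s \<in> {0..1} \<Longrightarrow> f (\<gamma> s) \<le> max (3 * \<delta> / 4) (m - k * (t * \<beta>))" by blast
    show ?case
    proof (intro exI[of _ "\<lambda>s. \<eta> (\<gamma> s)"] conjI ballI)
      show "continuous_on {0..1} (\<lambda>s. \<eta> (\<gamma> s))"
        by (rule continuous_on_compose2[OF cont\<eta> \<gamma>(1)]) auto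
      show "\<eta> (\<gamma> 0) = \<gamma>0 0" "\<eta> (\<gamma> 1) = \<gamma>0 1"
        using path \<delta> unfolding \<gamma>(2,3) by (auto intro!: \<eta>_id)
      fix s :: real assume s: "s \<in> {0..1}"
      show "\<eta> (\<gamma> s) \<in> coords B" using \<gamma>(4)[OF s] by (rule \<eta>_coords)
      have "f (\<gamma> s) \<le> m"
      proof -
        have "real k * (t * \<beta>) \<ge> 0" using t \<beta> by simp
        then have "max (3 * \<delta> / 4) (m - k * (t * \<beta>)) \<le> m" using m\<delta> \<delta> by simp
        with \<gamma>(5)[OF s] show ?thesis by linarith
      qed
      from \<eta>_desc[OF \<gamma>(4)[OF s] this] have dd: "f (\<eta> (\<gamma> s)) \<le> f (\<gamma> s) - t * \<theta> (\<gamma> s) * \<beta>" .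
      show "f (\<eta> (\<gamma> s)) \<le> max (3 * \<delta> / 4) (m - real (Suc k) * (t * \<beta>))"
      proof (cases "3 * \<delta> / 4 \<le> f (\<gamma> s)")
        case True
        have "f (\<eta> (\<gamma> s)) \<le> max (3 * \<delta> / 4) (m - k * (t * \<beta>)) - t * \<beta>"
          using dd \<gamma>(5)[OF s] unfolding \<theta>1[OF True] by simp
        moreover have "t * \<beta> > 0" using t \<beta> by simp
        moreover have "m - real (Suc k) * (t * \<beta>) = m - k * (t * \<beta>) - t * \<beta>"
          by (simp add: distrib_right)
        ultimately show ?thesis by linarith
      next
        case False
        have "t * \<theta> (\<gamma> s) * \<beta> \<ge> 0" using t \<theta> \<beta> by simp
        then show ?thesis using dd False by linarith
      qed
    qed
  qed note paths = this
  \<comment> \<open>So many steps push the maximum of \<open>f\<close> along the path down to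
    3\<delta>/4, below the barrier \<delta>.\<close>
  obtain k :: nat where k: "m < real k * (t * \<beta>)"
    using reals_Archimedean3[of "t * \<beta>"] t \<beta> by auto
  obtain \<gamma> :: "real \<Rightarrow> nat \<Rightarrow> real" where \<gamma>: "continuous_on {0..1} \<gamma>" "\<gamma> 0 = \<gamma>0 0" "\<gamma> 1 = \<gamma>0 1"
      "\<And>s. s \<in> {0..1} \<Longrightarrow> \<gamma> s \<in> coords B"
      "\<And>s. s \<in> {0..1} \<Longrightarrow> f (\<gamma> s) \<le> max (3 * \<delta> / 4) (m - k * (t * \<beta>))"
    using paths[of k] by blast
  obtain s where "s \<in> {0..1}" "\<delta> \<le> f (\<gamma> s)" using barrier[OF \<gamma>(1,4,2,3)] by auto
  then show False using \<gamma>(5)[of s] k \<delta> by auto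
qed

end

text \<open>Dependent generators would allow unbounded coefficients for one and the same function
  and spoil compact sublevel sets. The induction on \<open>n\<close> keeps \<open>Z n\<close> only
  when it lies outside the span of the generators kept so far.\<close>

lemma independent_generators:
  fixes Z :: "nat \<Rightarrow> 'a \<Rightarrow> real"
  obtains B where "B \<subseteq> {..<n}"
    "\<And>x. \<exists>y\<in>coords B. \<forall>z. (\<Sum>i<n. x i * Z i z) = (\<Sum>i\<in>B. y i * Z i z)"
    "\<And>y. y \<in> coords B \<Longrightarrow> (\<And>z. (\<Sum>i\<in>B. y i * Z i z) = 0) \<Longrightarrow> y = (\<lambda>i. 0)"
proof -
  have "\<exists>B\<subseteq>{..<n}. (\<forall>x. \<exists>y\<in>coords B. \<forall>z. (\<Sum>i<n. x i * Z i z) = (\<Sum>i\<in>B. y i * Z i z)) \<and>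
    (\<forall>y\<in>coords B. (\<forall>z. (\<Sum>i\<in>B. y i * Z i z) = 0) \<longrightarrow> y = (\<lambda>i. 0))"
  proof (induction n)
    case 0
    then show ?case by (auto simp: coords_def)
  next
    case (Suc n)
    then obtain B where B: "B \<subseteq> {..<n}"
      "\<And>x. \<exists>y\<in>coords B. \<forall>z. (\<Sum>i<n. x i * Z i z) = (\<Sum>i\<in>B. y i * Z i z)"
      "\<And>y. y \<in> coords B \<Longrightarrow> (\<And>z. (\<Sum>i\<in>B. y i * Z i z) = 0) \<Longrightarrow> y = (\<lambda>i. 0)" by metis
    have finB: "finite B" using B(1) finite_subset by blast
    have nB: "n \<notin> B" using B(1) by auto
    show ?case
    proof (cases "\<exists>c\<in>coords B. \<forall>z. Z n z = (\<Sum>i\<in>B. c i * Z i z)")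
      case True
      then obtain c where c: "c \<in> coords B" "\<And>z. Z n z = (\<Sum>i\<in>B. c i * Z i z)" by auto
      have "\<exists>y\<in>coords B. \<forall>z. (\<Sum>i<Suc n. x i * Z i z) = (\<Sum>i\<in>B. y i * Z i z)" for x
      proof -
        obtain y where y: "y \<in> coords B" "\<And>z. (\<Sum>i<n. x i * Z i z) = (\<Sum>i\<in>B. y i * Z i z)"
          using B(2)[of x] by auto
        show ?thesis
        proof (intro bexI[of _ "\<lambda>i. y i + x n * c i"] allI)
          show "(\<lambda>i. y i + x n * c i) \<in> coords B" using y(1) c(1) by (simp add: coords_def)
          show "(\<Sum>i<Suc n. x i * Z i z) = (\<Sum>i\<in>B. (y i + x n * c i) * Z i z)" for z
            using y(2)[of z] c(2)[of z] by (simp add: distrib_right sum.distrib sum_distrib_left mult.assoc)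
        qed
      qed
      with B show ?thesis by (intro exI[of _ B]) auto
    next
      case False
      have rep: "\<exists>y\<in>coords (insert n B). \<forall>z. (\<Sum>i<Suc n. x i * Z i z) = (\<Sum>i\<in>insert n B. y i * Z i z)" for x
      proof -
        obtain y where y: "y \<in> coords B" "\<And>z. (\<Sum>i<n. x i * Z i z) = (\<Sum>i\<in>B. y i * Z i z)"
          using B(2)[of x] by auto
        show ?thesis
        proof (intro bexI[of _ "y(n := x n)"] allI)
          show "y(n := x n) \<in> coords (insert n B)" using y(1) by (auto simp: coords_def)
          have "(\<Sum>i\<in>B. (y(n := x n)) i * Z i z) = (\<Sum>i\<in>B. y i * Z i z)" for z
            using nB by (intro sum.cong) auto
          then show "(\<Sum>i<Suc n. x i * Z i z) = (\<Sum>i\<in>insert n B. (y(n := x n)) i * Z i z)" for z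
            using y(2)[of z] finB nB by simp
        qed
      qed
      have ind: "y = (\<lambda>i. 0)"
        if y: "y \<in> coords (insert n B)" "\<And>z. (\<Sum>i\<in>insert n B. y i * Z i z) = 0" for y
      proof -
        have sum0: "y n * Z n z + (\<Sum>i\<in>B. y i * Z i z) = 0" for z using y(2)[of z] finB nB by simp
        have yn: "y n = 0"
        proof (rule ccontr)
          assume n0: "y n \<noteq> 0"
          define c where "c i = (if i \<in> B then - y i / y n else 0)" for i
          have "Z n z = (\<Sum>i\<in>B. c i * Z i z)" for z
          proof -
            have "(\<Sum>i\<in>B. c i * Z i z) = (\<Sum>i\<in>B. - (y i * Z i z) / y n)"
              by (intro sum.cong) (auto simp: c_def)
            also have "\<dots> = - (\<Sum>i\<in>B. y i * Z i z) / y n"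
              by (simp add: sum_divide_distrib sum_negf)
            also have "\<dots> = Z n z" using sum0[of z] n0 by (simp add: field_simps)
            finally show ?thesis ..
          qed
          moreover have "c \<in> coords B" by (simp add: c_def coords_def)
          ultimately show False using False by blast
        qed
        have "y \<in> coords B" using y(1) yn by (auto simp: coords_def)
        moreover have "(\<Sum>i\<in>B. y i * Z i z) = 0" for z using sum0[of z] yn by simp
        ultimately show ?thesis by (rule B(3))
      qed
      have "insert n B \<subseteq> {..<Suc n}" using B(1) by auto
      with rep ind show ?thesis by (intro exI[of _ "insert n B"]) simp
    qed
  qed
  with that show ?thesis by metis
qed

section \<open>The energy functional on finite-dimensional spaces of test functions\<close>

text \<open>The powers are cut off at negative arguments because Galerkin approximations may change
  sign; \<open>limit_nonneg\<close> makes the cut-off disappear in the limit.\<close>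

definition pos_pow :: "real \<Rightarrow> real \<Rightarrow> real" where
  "pos_pow r t = max 0 t powr (r - 1)"

definition pos_prim :: "real \<Rightarrow> real \<Rightarrow> real" where
  "pos_prim r t = max 0 t powr r / r"

text \<open>Convexity of t_+^r / r. The power rule is used only on t > 0, so a point
  \<open>b\<close> on the other side is handled by the crude bound a^r / r <= a^r.\<close>

lemma pos_prim_tangent:
  assumes r: "1 < r" shows "pos_prim r a + pos_pow r a * (b - a) \<le> pos_prim r b"
proof -
  consider "a \<le> 0" | "a > 0" "b \<le> 0" | "a > 0" "b > 0" by linarith
  then show ?thesis
  proof cases
    case 1
    then show ?thesis using r by (simp add: pos_prim_def pos_pow_def max_absorb1)
  next
    case 2
    have "a powr r / r + a powr (r - 1) * (b - a) \<le> a powr r + a powr (r - 1) * (- a)"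
      using 2 r by (intro add_mono mult_left_mono) (auto simp: divide_le_eq mult_left_le)
    also have "\<dots> = 0" using 2 by (simp add: powr_diff)
    finally show ?thesis using 2 by (simp add: pos_prim_def pos_pow_def max_absorb1 max_absorb2)
  next
    case 3
    have d: "((\<lambda>x. x powr r / r) has_real_derivative x powr (r - 1)) (at x)" if "x \<in> {0<..}" for x
      using that r by (auto intro!: derivative_eq_intros simp: powr_diff)
    have "convex_on {0<..} (\<lambda>x. x powr r / r)"
      using r by (intro convex_on_realI[OF _ d]) (auto intro: powr_mono2)
    then have "b powr r / r - a powr r / r \<ge> a powr (r - 1) * (b - a)"
      using 3 d[of a] by (intro convex_on_imp_above_tangent[where A="{0<..}"])
        (auto simp: interior_open has_field_derivative_at_within)
    then show ?thesis using 3 by (simp add: pos_prim_def pos_pow_def max_absorb2)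
  qed
qed

lemma pos_pow_cont: "1 < r \<Longrightarrow> continuous_on S (pos_pow r)"
  unfolding pos_pow_def[abs_def] by (intro continuous_on_powr' continuous_intros) auto

lemma pos_prim_cont: "1 < r \<Longrightarrow> continuous_on S (pos_prim r)"
  unfolding pos_prim_def[abs_def]
  by (intro continuous_on_divide continuous_on_powr' continuous_intros) auto

lemma pos_pow_nonneg: "0 \<le> pos_pow r t" by (simp add: pos_pow_def)

lemma pos_prim_nonneg: "0 < r \<Longrightarrow> 0 \<le> pos_prim r t" by (simp add: pos_prim_def)

lemma pos_pow_measurable [measurable]: "pos_pow r \<in> borel_measurable borel"
  unfolding pos_pow_def[abs_def] by measurable

lemma pos_prim_measurable [measurable]: "pos_prim r \<in> borel_measurable borel"
  unfolding pos_prim_def[abs_def] by measurable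

lemma powr_le_one_plus: "0 \<le> (t::real) \<Longrightarrow> 0 \<le> r \<Longrightarrow> r \<le> s \<Longrightarrow> t powr r \<le> 1 + t powr s"
proof (cases "t \<le> 1")
  case True
  assume "0 \<le> t" "0 \<le> r"
  then have "t powr r \<le> 1" using True by (simp add: powr_le1)
  then show ?thesis using powr_ge_zero[of t s] by linarith
next
  case False
  assume "r \<le> s"
  then have "t powr r \<le> t powr s" using False by (intro powr_mono) auto
  then show ?thesis by simp
qed

context young
begin

text \<open>This is the vector field of the equation, written with \<phi> so that its norm is
  \<phi>(|\<xi>|) at every \<xi>, including 0.\<close>

definition flux :: "'b::real_inner \<Rightarrow> 'b" where
  "flux \<xi> = (\<phi> (norm \<xi>) / norm \<xi>) *\<^sub>R \<xi>"

lemma norm_flux: "norm (flux \<xi>) = \<phi> (norm \<xi>)"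
  by (cases "\<xi> = 0") (simp_all add: flux_def phi_0 phi_nonneg)

lemma flux_self: "flux \<xi> \<bullet> \<xi> = \<phi> (norm \<xi>) * norm \<xi>"
  by (cases "\<xi> = 0") (simp_all add: flux_def flip: power2_norm_eq_inner, simp add: power2_eq_square)

lemma flux_inner_le: "\<bar>flux \<xi> \<bullet> \<eta>\<bar> \<le> \<phi> (norm \<xi>) * norm \<eta>"
  using Cauchy_Schwarz_ineq2[of "flux \<xi>" \<eta>] by (simp add: norm_flux)

text \<open>The field \<open>flux\<close> is the gradient of \<Phi>(|\<xi>|); Cauchy-Schwarz reduces
  the supporting hyperplane to the supporting line \<open>Phi_tangent\<close>.\<close>

lemma flux_tangent: "\<Phi> (norm \<xi>) + flux \<xi> \<bullet> (\<eta> - \<xi>) \<le> \<Phi> (norm \<eta>)"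
proof -
  have "flux \<xi> \<bullet> (\<eta> - \<xi>) \<le> \<phi> (norm \<xi>) * (norm \<eta> - norm \<xi>)"
    using flux_inner_le[of \<xi> \<eta>] by (simp add: inner_diff_right flux_self right_diff_distrib)
  then show ?thesis using Phi_tangent[of "norm \<xi>" "norm \<eta>"] by linarith
qed

lemma flux_cont: "continuous_on S (flux :: 'b::real_inner \<Rightarrow> 'b)"
proof -
  have phi_isCont: "isCont \<phi> t" for t
    using phi_cont by (simp add: continuous_on_eq_continuous_at)
  have "isCont flux \<xi>" for \<xi> :: 'b
  proof (cases "\<xi> = 0")
    case True
    have "((\<lambda>\<xi>::'b. \<phi> (norm \<xi>)) \<longlongrightarrow> \<phi> 0) (at 0)"
      using phi_isCont by (intro isCont_tendsto_compose[where g=\<phi>] tendsto_norm_zero) auto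
    then have "((\<lambda>\<xi>::'b. norm (flux \<xi>)) \<longlongrightarrow> 0) (at 0)" by (simp add: norm_flux phi_0)
    then have "((flux :: 'b \<Rightarrow> 'b) \<longlongrightarrow> 0) (at 0)" by (rule tendsto_norm_zero_cancel)
    then show ?thesis using True by (simp add: isCont_def flux_def)
  next
    case False
    have "isCont (\<lambda>\<xi>. \<phi> (norm \<xi>)) \<xi>"
      by (rule isCont_o2[OF _ phi_isCont]) (intro continuous_intros)
    then show ?thesis using False
      unfolding flux_def[abs_def] by (intro continuous_intros) auto
  qed
  then show ?thesis by (simp add: continuous_at_imp_continuous_on)
qed

lemma flux_measurable [measurable]: "flux \<in> borel_measurable (borel :: 'b::euclidean_space measure)"
  by (intro borel_measurable_continuous_onI flux_cont)

end

section \<open>Dominated convergence of the terms of the energy\<close>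

context domain
begin

definition dominator :: "(real^'n \<Rightarrow> real) \<Rightarrow> bool" where
  "dominator \<tau> \<longleftrightarrow> \<tau> \<in> borel_measurable M \<and> (\<forall>x. 0 \<le> \<tau> x) \<and> integrable M (\<lambda>x. \<Phi> (\<tau> x))"

text \<open>The common mode of convergence: all terms of the energy and of its variation are
  continuous along it, and modular convergence yields it along a subsequence.\<close>

definition dlim :: "(real^'n \<Rightarrow> real) \<Rightarrow> (nat \<Rightarrow> real^'n \<Rightarrow> 'b) \<Rightarrow> (real^'n \<Rightarrow> 'b::euclidean_space) \<Rightarrow> bool" where
  "dlim \<tau> f F \<longleftrightarrow> (\<forall>k. f k \<in> borel_measurable M) \<and> F \<in> borel_measurable M \<and>
     (AE x in M. (\<lambda>k. f k x) \<longlonglongrightarrow> F x) \<and> (AE x in M. \<forall>k. norm (f k x) \<le> \<tau> x)"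

lemma dominator_const: "0 \<le> c \<Longrightarrow> dominator (\<lambda>x. c)"
  by (simp add: dominator_def)

lemma dominator_add:
  "dominator \<tau> \<Longrightarrow> dominator \<tau>' \<Longrightarrow> dominator (\<lambda>x. \<tau> x + \<tau>' x)"
  by (auto simp: dominator_def intro!: integrable_Phi_add)

lemma dlim_mono:
  assumes "dlim \<tau> f F" "\<And>x. \<tau> x \<le> \<tau>' x" shows "dlim \<tau>' f F"
proof -
  have "AE x in M. \<forall>k. norm (f k x) \<le> \<tau> x" using assms(1) by (simp add: dlim_def)
  then have "AE x in M. \<forall>k. norm (f k x) \<le> \<tau>' x"
    by eventually_elim (meson assms(2) order_trans)
  then show ?thesis using assms(1) by (simp add: dlim_def)
qed

lemma dlim_const:
  "F \<in> borel_measurable M \<Longrightarrow> AE x in M. norm (F x) \<le> \<tau> x \<Longrightarrow> dlim \<tau> (\<lambda>k. F) F"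
  by (simp add: dlim_def)

lemma dlim_limit_bound:
  assumes "dlim \<tau> f F" shows "AE x in M. norm (F x) \<le> \<tau> x"
proof -
  have "AE x in M. (\<lambda>k. f k x) \<longlonglongrightarrow> F x" "AE x in M. \<forall>k. norm (f k x) \<le> \<tau> x"
    using assms by (auto simp: dlim_def)
  then show ?thesis
    by eventually_elim (auto intro: LIMSEQ_le_const2[OF tendsto_norm])
qed

text \<open>A joint integrand \<open>h\<close> of two values treats flux times direction, powers
  times direction and \<Phi> of differences at once.\<close>

lemma dlim_integral:
  fixes h :: "'b::euclidean_space \<times> 'c::euclidean_space \<Rightarrow> real"
  assumes w: "dlim \<tau> w W" and v: "dlim \<tau> v V" and h: "continuous_on UNIV h"
    and bound: "\<And>x a c. norm a \<le> \<tau> x \<Longrightarrow> norm c \<le> \<tau> x \<Longrightarrow> \<bar>h (a, c)\<bar> \<le> b x"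
    and b: "integrable M b"
  shows "(\<lambda>k. \<integral>x. h (w k x, v k x) \<partial>M) \<longlonglongrightarrow> (\<integral>x. h (W x, V x) \<partial>M)"
    "integrable M (\<lambda>x. h (W x, V x))"
proof -
  have [measurable]: "h \<in> borel_measurable (borel \<Otimes>\<^sub>M borel)"
    using borel_measurable_continuous_onI[OF h] by (simp add: borel_prod)
  have [measurable]: "w k \<in> borel_measurable M" "v k \<in> borel_measurable M" "W \<in> borel_measurable M"
    "V \<in> borel_measurable M" for k
    using w v by (auto simp: dlim_def)
  have lim: "AE x in M. (\<lambda>k. h (w k x, v k x)) \<longlonglongrightarrow> h (W x, V x)"
  proof -
    have "AE x in M. (\<lambda>k. w k x) \<longlonglongrightarrow> W x" "AE x in M. (\<lambda>k. v k x) \<longlonglongrightarrow> V x"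
      using w v by (auto simp: dlim_def)
    then show ?thesis
    proof eventually_elim
      case (elim x)
      then have "(\<lambda>k. (w k x, v k x)) \<longlonglongrightarrow> (W x, V x)" by (rule tendsto_Pair)
      then show ?case using continuous_on_tendsto_compose[OF h] by simp
    qed
  qed
  have bd: "AE x in M. norm (h (w k x, v k x)) \<le> b x" for k
  proof -
    have "AE x in M. \<forall>k. norm (w k x) \<le> \<tau> x" "AE x in M. \<forall>k. norm (v k x) \<le> \<tau> x"
      using w v by (auto simp: dlim_def)
    then show ?thesis by eventually_elim (simp add: bound)
  qed
  show "(\<lambda>k. \<integral>x. h (w k x, v k x) \<partial>M) \<longlonglongrightarrow> (\<integral>x. h (W x, V x) \<partial>M)"
    by (rule integral_dominated_convergence[OF _ _ b lim bd]) measurable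
  show "integrable M (\<lambda>x. h (W x, V x))"
    by (rule integrable_dominated_convergence[OF _ _ b lim bd]) measurable
qed

text \<open>Both arguments lie below \<open>\<tau>\<close>, so the integrand is at most
  \<phi>(\<tau>) \<tau>, and the upper index bounds this by \<sigma> \<Phi>(\<tau>). This is why
  finite modulars suffice for testing the equation.\<close>

lemma dlim_flux:
  assumes "dominator \<tau>" "dlim \<tau> w W" "dlim \<tau> v V"
  shows "(\<lambda>k. \<integral>x. flux (w k x) \<bullet> v k x \<partial>M) \<longlonglongrightarrow> (\<integral>x. flux (W x) \<bullet> V x \<partial>M)"
    "integrable M (\<lambda>x. flux (W x) \<bullet> V x)"
proof -
  have "continuous_on UNIV (\<lambda>z::'a \<times> 'a. flux (fst z) \<bullet> snd z)"
    by (intro continuous_intros continuous_on_compose2[OF flux_cont[of UNIV]]) auto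
  moreover have "\<bar>flux a \<bullet> c\<bar> \<le> \<sigma> * \<Phi> (\<tau> x)" if "norm a \<le> \<tau> x" "norm c \<le> \<tau> x" for a c :: 'a and x
  proof -
    have t: "0 \<le> \<tau> x" using assms(1) by (simp add: dominator_def)
    have "\<bar>flux a \<bullet> c\<bar> \<le> \<phi> (norm a) * norm c" by (rule flux_inner_le)
    also have "\<dots> \<le> \<phi> (\<tau> x) * \<tau> x" using that t phi_le phi_nonneg by (intro mult_mono) auto
    also have "\<dots> \<le> \<sigma> * \<Phi> (\<tau> x)" using mult_phi_le[OF t] by (simp add: mult.commute)
    finally show ?thesis .
  qed
  moreover have "integrable M (\<lambda>x. \<sigma> * \<Phi> (\<tau> x))" using assms(1) by (simp add: dominator_def)
  ultimately show "(\<lambda>k. \<integral>x. flux (w k x) \<bullet> v k x \<partial>M) \<longlonglongrightarrow> (\<integral>x. flux (W x) \<bullet> V x \<partial>M)"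
    "integrable M (\<lambda>x. flux (W x) \<bullet> V x)"
    using dlim_integral[OF assms(2,3), of "\<lambda>z. flux (fst z) \<bullet> snd z" "\<lambda>x. \<sigma> * \<Phi> (\<tau> x)"] by auto
qed

text \<open>One majorant for all exponents up to \<open>p\<close>: an intermediate power is at most
  1 plus the \<open>p\<close>-th power, and \<open>growth\<close> bounds the latter by \<Phi> plus a
  constant.\<close>

lemma dominator_powr_bound:
  assumes "dominator \<tau>"
  obtains b where "integrable M b" "\<And>x r. 0 \<le> r \<Longrightarrow> r \<le> p \<Longrightarrow> \<tau> x powr r \<le> b x"
proof -
  obtain C where C: "\<And>t. 0 \<le> t \<Longrightarrow> t powr p \<le> \<Phi> t + C" using powr_le_Phi by metis
  have t: "0 \<le> \<tau> x" for x using assms by (simp add: dominator_def)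
  show ?thesis
  proof (rule that[of "\<lambda>x. \<Phi> (\<tau> x) + (C + 1)"])
    show "integrable M (\<lambda>x. \<Phi> (\<tau> x) + (C + 1))"
      using assms by (intro Bochner_Integration.integrable_add) (auto simp: dominator_def)
    show "\<tau> x powr r \<le> \<Phi> (\<tau> x) + (C + 1)" if "0 \<le> r" "r \<le> p" for x r
      using powr_le_one_plus[OF t that] C[OF t, of x] by (smt (verit))
  qed
qed

lemma dlim_pow:
  assumes d: "dominator \<tau>" "dlim \<tau> w W" "dlim \<tau> v V" and r: "1 < r" "r \<le> p"
  shows "(\<lambda>k. \<integral>x. pos_pow r (w k x) * v k x \<partial>M) \<longlonglongrightarrow> (\<integral>x. pos_pow r (W x) * V x \<partial>M)"
    "integrable M (\<lambda>x. pos_pow r (W x) * V x)"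
proof -
  obtain b where b: "integrable M b" "\<And>x r. 0 \<le> r \<Longrightarrow> r \<le> p \<Longrightarrow> \<tau> x powr r \<le> b x"
    using dominator_powr_bound[OF d(1)] by metis
  have "continuous_on UNIV (\<lambda>z. pos_pow r (fst z) * snd z)"
    using r by (intro continuous_intros continuous_on_compose2[OF pos_pow_cont[of r UNIV]]) auto
  moreover have "\<bar>pos_pow r a * c\<bar> \<le> b x" if "norm a \<le> \<tau> x" "norm c \<le> \<tau> x" for a c x
  proof -
    have t: "0 \<le> \<tau> x" using d(1) by (simp add: dominator_def)
    have "\<bar>pos_pow r a * c\<bar> = pos_pow r a * \<bar>c\<bar>" by (simp add: abs_mult pos_pow_nonneg)
    also have "\<dots> \<le> \<tau> x powr (r - 1) * \<tau> x"
      using that t r unfolding pos_pow_def by (intro mult_mono powr_mono2) auto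
    also have "\<dots> = \<tau> x powr r" using t by (cases "\<tau> x = 0") (auto simp: powr_diff)
    also have "\<dots> \<le> b x" using b(2) r by simp
    finally show ?thesis .
  qed
  ultimately show "(\<lambda>k. \<integral>x. pos_pow r (w k x) * v k x \<partial>M) \<longlonglongrightarrow> (\<integral>x. pos_pow r (W x) * V x \<partial>M)"
    "integrable M (\<lambda>x. pos_pow r (W x) * V x)"
    using dlim_integral[OF d(2,3), of "\<lambda>z. pos_pow r (fst z) * snd z" b] b(1) by auto
qed

lemma dlim_prim:
  assumes d: "dominator \<tau>" "dlim \<tau> w W" and r: "1 < r" "r \<le> p"
  shows "(\<lambda>k. \<integral>x. pos_prim r (w k x) \<partial>M) \<longlonglongrightarrow> (\<integral>x. pos_prim r (W x) \<partial>M)"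
    "integrable M (\<lambda>x. pos_prim r (W x))"
proof -
  obtain b where b: "integrable M b" "\<And>x r. 0 \<le> r \<Longrightarrow> r \<le> p \<Longrightarrow> \<tau> x powr r \<le> b x"
    using dominator_powr_bound[OF d(1)] by metis
  have "continuous_on UNIV (\<lambda>z::real \<times> real. pos_prim r (fst z))"
    using r by (intro continuous_intros continuous_on_compose2[OF pos_prim_cont[of r UNIV]]) auto
  moreover have "\<bar>pos_prim r a\<bar> \<le> b x" if "norm a \<le> \<tau> x" for a x
  proof -
    have t: "0 \<le> \<tau> x" using d(1) by (simp add: dominator_def)
    have "\<bar>pos_prim r a\<bar> \<le> max 0 a powr r"
      using r by (simp add: pos_prim_def divide_le_eq mult_left_le mult_le_cancel_left1)
    also have "\<dots> \<le> \<tau> x powr r" using that t r by (intro powr_mono2) auto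
    also have "\<dots> \<le> b x" using b(2) r by simp
    finally show ?thesis .
  qed
  ultimately show "(\<lambda>k. \<integral>x. pos_prim r (w k x) \<partial>M) \<longlonglongrightarrow> (\<integral>x. pos_prim r (W x) \<partial>M)"
    "integrable M (\<lambda>x. pos_prim r (W x))"
    using dlim_integral[OF d(2,2), of "\<lambda>z. pos_prim r (fst z)" b] b(1) by auto
qed

lemma dlim_Phi:
  fixes W :: "real^'n \<Rightarrow> 'b::euclidean_space"
  assumes d: "dominator \<tau>" "dlim \<tau> w W"
  shows "(\<lambda>k. \<integral>x. \<Phi> (norm (w k x)) \<partial>M) \<longlonglongrightarrow> (\<integral>x. \<Phi> (norm (W x)) \<partial>M)"
    "integrable M (\<lambda>x. \<Phi> (norm (W x)))" "(\<lambda>k. \<integral>x. \<Phi> (norm (w k x - W x)) \<partial>M) \<longlonglongrightarrow> 0"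
proof -
  have "continuous_on UNIV (\<lambda>z::'b \<times> 'b. \<Phi> (norm (fst z)))"
    by (intro continuous_intros continuous_on_compose2[OF Phi_cont[of UNIV]]) auto
  moreover have "\<bar>\<Phi> (norm a)\<bar> \<le> \<Phi> (\<tau> x)" if "norm a \<le> \<tau> x" for a :: 'b and x
    using that by (simp add: Phi_mono)
  moreover have "integrable M (\<lambda>x. \<Phi> (\<tau> x))" using d(1) by (simp add: dominator_def)
  ultimately show "(\<lambda>k. \<integral>x. \<Phi> (norm (w k x)) \<partial>M) \<longlonglongrightarrow> (\<integral>x. \<Phi> (norm (W x)) \<partial>M)"
    "integrable M (\<lambda>x. \<Phi> (norm (W x)))"
    using dlim_integral[OF d(2,2), of "\<lambda>z. \<Phi> (norm (fst z))" "\<lambda>x. \<Phi> (\<tau> x)"] by auto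
  have "W \<in> borel_measurable M" using d(2) by (simp add: dlim_def)
  then have WW: "dlim \<tau> (\<lambda>k. W) W" using dlim_limit_bound[OF d(2)] by (rule dlim_const)
  have "continuous_on UNIV (\<lambda>z::'b \<times> 'b. \<Phi> (norm (fst z - snd z)))"
    by (intro continuous_intros continuous_on_compose2[OF Phi_cont[of UNIV]]) auto
  moreover have "\<bar>\<Phi> (norm (a - c))\<bar> \<le> \<Phi> (2 * \<tau> x)" if "norm a \<le> \<tau> x" "norm c \<le> \<tau> x" for a c :: 'b and x
  proof -
    have "norm (a - c) \<le> 2 * \<tau> x" using norm_triangle_ineq4[of a c] that by linarith
    then show ?thesis by (simp add: Phi_mono)
  qed
  moreover have "integrable M (\<lambda>x. \<Phi> (2 * \<tau> x))"
    using d(1) by (intro integrable_Phi_scale) (auto simp: dominator_def)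
  ultimately show "(\<lambda>k. \<integral>x. \<Phi> (norm (w k x - W x)) \<partial>M) \<longlonglongrightarrow> 0"
    using dlim_integral(1)[OF d(2) WW, of "\<lambda>z. \<Phi> (norm (fst z - snd z))" "\<lambda>x. \<Phi> (2 * \<tau> x)"]
    by (simp add: Phi_0)
qed

lemma test_dlim_const:
  assumes "u \<in> \<T>"
  obtains c where "c \<ge> 0" "dlim (\<lambda>x. c) (\<lambda>k. u) u" "dlim (\<lambda>x. c) (\<lambda>k. grad u) (grad u)"
proof -
  obtain B where "B > 0" "\<And>x. \<bar>u x\<bar> \<le> B" "\<And>x. norm (grad u x) \<le> B"
    using test_function_bounded[OF assms] by metis
  then show ?thesis using test_measurable[OF assms]
    by (intro that[of B] dlim_const) auto
qed

lemma test_pair_integrable: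
  assumes "u \<in> \<T>" "v \<in> \<T>"
  shows "integrable M (\<lambda>x. flux (grad u x) \<bullet> grad v x)"
    "1 < r \<Longrightarrow> r \<le> p \<Longrightarrow> integrable M (\<lambda>x. pos_pow r (u x) * v x)"
    "1 < r \<Longrightarrow> r \<le> p \<Longrightarrow> integrable M (\<lambda>x. pos_prim r (u x))"
proof -
  obtain c where c: "c \<ge> 0" "dlim (\<lambda>x. c) (\<lambda>k. u) u" "dlim (\<lambda>x. c) (\<lambda>k. grad u) (grad u)"
    using test_dlim_const[OF assms(1)] by metis
  obtain d where d: "d \<ge> 0" "dlim (\<lambda>x. d) (\<lambda>k. v) v" "dlim (\<lambda>x. d) (\<lambda>k. grad v) (grad v)"
    using test_dlim_const[OF assms(2)] by metis
  have "dominator (\<lambda>x. max c d)" using c by (intro dominator_const) auto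
  moreover have "dlim (\<lambda>x. max c d) (\<lambda>k. u) u" "dlim (\<lambda>x. max c d) (\<lambda>k. grad u) (grad u)"
    "dlim (\<lambda>x. max c d) (\<lambda>k. v) v" "dlim (\<lambda>x. max c d) (\<lambda>k. grad v) (grad v)"
    using c d by (auto intro: dlim_mono)
  ultimately show "integrable M (\<lambda>x. flux (grad u x) \<bullet> grad v x)"
    "1 < r \<Longrightarrow> r \<le> p \<Longrightarrow> integrable M (\<lambda>x. pos_pow r (u x) * v x)"
    "1 < r \<Longrightarrow> r \<le> p \<Longrightarrow> integrable M (\<lambda>x. pos_prim r (u x))"
    by (auto intro: dlim_flux(2) dlim_pow(2) dlim_prim(2))
qed

end

locale energy = domain \<Phi> \<phi> p \<sigma> \<Omega> for \<Phi> \<phi> p \<sigma> and \<Omega> :: "(real^'n::finite) set" +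
  fixes q \<mu> :: real
  assumes q: "1 < q" "q < p" and mu: "0 < \<mu>"
begin

text \<open>The gradient is a separate argument, so that \<open>J\<close> can be evaluated at a
  limit \<open>W\<close> of gradients before \<open>W\<close> is known to be a weak
  gradient.\<close>

definition J :: "(real^'n \<Rightarrow> real) \<Rightarrow> (real^'n \<Rightarrow> real^'n) \<Rightarrow> real" where
  "J u w = (\<integral>x. \<Phi> (norm (w x)) \<partial>M) - \<mu> * (\<integral>x. pos_prim p (u x) \<partial>M) + \<mu> * (\<integral>x. pos_prim q (u x) \<partial>M)"

text \<open>The first variation of \<open>J\<close>, with the concave term evaluated at a second point \<open>u'\<close>, so
  that it bounds the finite differences of \<open>J\<close>.\<close>

definition EL :: "(real^'n \<Rightarrow> real) \<Rightarrow> (real^'n \<Rightarrow> real^'n) \<Rightarrow> (real^'n \<Rightarrow> real) \<Rightarrow>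
    (real^'n \<Rightarrow> real) \<Rightarrow> (real^'n \<Rightarrow> real^'n) \<Rightarrow> real" where
  "EL u w u' v dv = (\<integral>x. flux (w x) \<bullet> dv x \<partial>M) - \<mu> * (\<integral>x. pos_pow p (u' x) * v x \<partial>M)
     + \<mu> * (\<integral>x. pos_pow q (u x) * v x \<partial>M)"

lemma dlim_J:
  assumes "dominator \<tau>" "dlim \<tau> u U" "dlim \<tau> w W"
  shows "(\<lambda>k. J (u k) (w k)) \<longlonglongrightarrow> J U W"
  unfolding J_def using q p_gt_1 assms
  by (intro tendsto_intros dlim_Phi(1)[OF assms(1,3)] dlim_prim(1)[OF assms(1,2)]) auto

lemma dlim_EL:
  assumes "dominator \<tau>" "dlim \<tau> u U" "dlim \<tau> w W" "dlim \<tau> u' U'" "dlim \<tau> v V" "dlim \<tau> dv dV"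
  shows "(\<lambda>k. EL (u k) (w k) (u' k) (v k) (dv k)) \<longlonglongrightarrow> EL U W U' V dV"
  unfolding EL_def using q p_gt_1
  by (intro tendsto_intros dlim_flux(1)[OF assms(1,3,6)] dlim_pow(1)[OF assms(1,4,5)]
      dlim_pow(1)[OF assms(1,2,5)]) auto

text \<open>The convex terms, with \<Phi> and with q, lie above their tangents at the new point
  \<open>w\<close>; the primitive of the subtracted p-term lies above its tangent at the old point
  \<open>u\<close>. These three inequalities replace differentiability of J.\<close>

lemma J_descent:
  assumes u: "u \<in> \<T>" and v: "v \<in> \<T>" and s: "0 \<le> s"
  defines "w \<equiv> \<lambda>x. u x - s * v x"
  shows "J w (grad w) \<le> J u (grad u) - s * EL w (grad w) u v (grad v)"
proof -
  have w: "w \<in> \<T>" unfolding w_def by (intro test_function_diff test_function_cmult u v)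
  have gw: "grad w x = grad u x - s *\<^sub>R grad v x" for x
    unfolding w_def using u v
    by (simp add: grad_diff grad_cmult test_function_smooth smooth_mult smooth_const)
  note int = test_integrable(3)[OF u] test_integrable(3)[OF w] test_pair_integrable[OF w v]
    test_pair_integrable[OF u v]
  have 1: "(\<integral>x. \<Phi> (norm (grad w x)) + s * (flux (grad w x) \<bullet> grad v x) \<partial>M) \<le> (\<integral>x. \<Phi> (norm (grad u x)) \<partial>M)"
  proof (rule integral_mono)
    show "\<Phi> (norm (grad w x)) + s * (flux (grad w x) \<bullet> grad v x) \<le> \<Phi> (norm (grad u x))" for x
      using flux_tangent[of "grad w x" "grad u x"] by (simp add: gw inner_simps)
  qed (use int in auto)
  have 2: "(\<integral>x. pos_prim p (u x) - s * (pos_pow p (u x) * v x) \<partial>M) \<le> (\<integral>x. pos_prim p (w x) \<partial>M)"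
  proof (rule integral_mono)
    show "pos_prim p (u x) - s * (pos_pow p (u x) * v x) \<le> pos_prim p (w x)" for x
      using pos_prim_tangent[OF p_gt_1, of "u x" "w x"] by (simp add: w_def algebra_simps)
  qed (use int p_gt_1 in auto)
  have 3: "(\<integral>x. pos_prim q (w x) + s * (pos_pow q (w x) * v x) \<partial>M) \<le> (\<integral>x. pos_prim q (u x) \<partial>M)"
  proof (rule integral_mono)
    show "pos_prim q (w x) + s * (pos_pow q (w x) * v x) \<le> pos_prim q (u x)" for x
      using pos_prim_tangent[OF q(1), of "w x" "u x"] by (simp add: w_def algebra_simps)
  qed (use int q in auto)
  have 1: "(\<integral>x. \<Phi> (norm (grad w x)) \<partial>M) + s * (\<integral>x. flux (grad w x) \<bullet> grad v x \<partial>M) \<le> (\<integral>x. \<Phi> (norm (grad u x)) \<partial>M)"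
    using 1 int by simp
  have 2: "\<mu> * ((\<integral>x. pos_prim p (u x) \<partial>M) - s * (\<integral>x. pos_pow p (u x) * v x \<partial>M)) \<le> \<mu> * (\<integral>x. pos_prim p (w x) \<partial>M)"
    using 2 int p_gt_1 mu by (intro mult_left_mono) auto
  have 3: "\<mu> * ((\<integral>x. pos_prim q (w x) \<partial>M) + s * (\<integral>x. pos_pow q (w x) * v x \<partial>M)) \<le> \<mu> * (\<integral>x. pos_prim q (u x) \<partial>M)"
    using 3 int q mu by (intro mult_left_mono) auto
  show ?thesis using 1 2 3 unfolding J_def EL_def by (simp add: algebra_simps)
qed

lemma J_coercive:
  obtains C where "\<And>u. u \<in> \<T> \<Longrightarrow> (\<integral>x. \<Phi> (norm (grad u x)) \<partial>M) / 2 - C \<le> J u (grad u)"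
proof -
  obtain D where D: "D \<ge> 1"
    "\<And>u. u \<in> \<T> \<Longrightarrow> (\<integral>x. \<Phi> (u x) \<partial>M) \<le> (\<integral>x. \<Phi> (D * norm (grad u x)) \<partial>M)"
    using Poincare by metis
  \<comment> \<open>The constant lets the p-term use up exactly half of the modular of
    \<open>w\<close> once D^p and \<mu> are multiplied back.\<close>
  define c where "c = 1 / (2 * \<mu> * D powr p)"
  have c: "c > 0" using mu D by (simp add: c_def)
  obtain C where C: "\<And>t. t \<ge> 0 \<Longrightarrow> t powr p \<le> c * \<Phi> t + C" using growth[OF c] by metis
  have C0: "C \<ge> 0" using C[of 0] by (simp add: Phi_0)
  show ?thesis
  proof (rule that[of "\<mu> * D powr p * C * measure M (space M)"])
    fix u assume u: "u \<in> \<T>"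
    \<comment> \<open>Dividing \<open>u\<close> by \<open>D\<close> moves the constant of the
      Poincare inequality out of \<Phi>: its right-hand side for \<open>w\<close> is the gradient
      modular of \<open>u\<close> itself.\<close>
    define w where "w x = inverse D * u x" for x
    have w: "w \<in> \<T>" unfolding w_def[abs_def] by (rule test_function_cmult[OF u])
    have gw: "D * norm (grad w x) = norm (grad u x)" for x
      unfolding w_def[abs_def] using D by (simp add: grad_cmult[OF test_function_smooth[OF u]])
    have pt: "\<mu> * pos_prim p (u x) \<le> \<Phi> (w x) / 2 + \<mu> * D powr p * C" for x
    proof -
      have "max 0 (u x) = D * max 0 (w x)" using D by (auto simp: w_def max_def zero_le_mult_iff)
      then have "max 0 (u x) powr p = D powr p * max 0 (w x) powr p"
        using D by (simp add: powr_mult)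
      moreover have "pos_prim p (u x) \<le> max 0 (u x) powr p"
        using p_gt_1 by (simp add: pos_prim_def divide_le_eq mult_left_le mult_le_cancel_left1)
      ultimately have "\<mu> * pos_prim p (u x) \<le> \<mu> * (D powr p * max 0 (w x) powr p)"
        using mu by simp
      also have "\<dots> \<le> \<mu> * (D powr p * (c * \<Phi> (max 0 (w x)) + C))"
        using C[of "max 0 (w x)"] mu D by (intro mult_left_mono) auto
      also have "\<dots> = \<Phi> (max 0 (w x)) / 2 + \<mu> * D powr p * C"
        using mu D by (simp add: c_def field_simps)
      also have "\<Phi> (max 0 (w x)) \<le> \<Phi> (w x)" by (rule Phi_mono) auto
      finally show ?thesis by simp
    qed
    have "\<mu> * (\<integral>x. pos_prim p (u x) \<partial>M) = (\<integral>x. \<mu> * pos_prim p (u x) \<partial>M)" by simp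
    also have "\<dots> \<le> (\<integral>x. \<Phi> (w x) / 2 + \<mu> * D powr p * C \<partial>M)"
      using pt test_pair_integrable(3)[OF u u] p_gt_1 test_integrable(1)[OF w] by (intro integral_mono) auto
    also have "\<dots> = (\<integral>x. \<Phi> (w x) \<partial>M) / 2 + \<mu> * D powr p * C * measure M (space M)"
      using test_integrable(1)[OF w] by (simp add: mult.commute)
    also have "(\<integral>x. \<Phi> (w x) \<partial>M) \<le> (\<integral>x. \<Phi> (norm (grad u x)) \<partial>M)" using D(2)[OF w] by (simp add: gw)
    finally have "\<mu> * (\<integral>x. pos_prim p (u x) \<partial>M) \<le>
      (\<integral>x. \<Phi> (norm (grad u x)) \<partial>M) / 2 + \<mu> * D powr p * C * measure M (space M)" by simp
    moreover have "\<mu> * (\<integral>x. pos_prim q (u x) \<partial>M) \<ge> 0"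
      using mu q by (intro mult_nonneg_nonneg integral_nonneg_AE AE_I2 pos_prim_nonneg) auto
    ultimately show "(\<integral>x. \<Phi> (norm (grad u x)) \<partial>M) / 2 - \<mu> * D powr p * C * measure M (space M) \<le> J u (grad u)"
      unfolding J_def by linarith
  qed
qed

text \<open>The nonlinearity can lower the energy only where u > 1, and there it is at most C
  \<Phi>(u - 1/2). By \<open>small_set_Poincare\<close> this costs at most half of the gradient
  modular once the latter is small.\<close>

lemma J_barrier:
  obtains \<rho> where "\<rho> > 0" "\<And>u. u \<in> \<T> \<Longrightarrow> (\<integral>x. \<Phi> (norm (grad u x)) \<partial>M) \<le> \<rho> \<Longrightarrow>
    (\<integral>x. \<Phi> (norm (grad u x)) \<partial>M) / 2 \<le> J u (grad u)"
proof -
  obtain C0 where C0: "C0 \<ge> 0" "\<And>t. 0 \<le> t \<Longrightarrow> t powr p \<le> \<Phi> t + C0" using powr_le_Phi by metis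
  \<comment> \<open>The factor 2^p comes from t <= 2 (t - 1/2) for t >= 1, and C0 / \<Phi>(1/2)
    turns the additive constant \<open>C0\<close> into a multiple of \<Phi>(s) for s >= 1/2.\<close>
  define C where "C = 2 powr p * (1 + C0 / \<Phi> (1/2))"
  have \<Phi>12: "\<Phi> (1/2) > 0" by (rule Phi_pos) simp
  have C: "C > 0" using C0 \<Phi>12 by (simp add: C_def add_pos_nonneg)
  have pt: "pos_prim p t - pos_prim q t \<le> C * \<Phi> (max 0 (t - 1/2))" for t
  proof (cases "t \<le> 1")
    case True
    have "pos_prim p t \<le> pos_prim q t"
      unfolding pos_prim_def
    proof (rule frac_le)
      show "max 0 t powr p \<le> max 0 t powr q" using True q by (cases "t \<le> 0") (auto intro: powr_mono')
    qed (use q in auto)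
    moreover have "C * \<Phi> (max 0 (t - 1/2)) \<ge> 0" using C by simp
    ultimately show ?thesis by linarith
  next
    case False
    define s where "s = t - 1/2"
    have s: "s \<ge> 1/2" "t \<le> 2 * s" using False by (auto simp: s_def)
    have "pos_prim p t - pos_prim q t \<le> pos_prim p t" using q by (simp add: pos_prim_nonneg)
    also have "\<dots> \<le> t powr p"
      using p_gt_1 False by (simp add: pos_prim_def divide_le_eq mult_left_le mult_le_cancel_left1)
    also have "\<dots> \<le> (2 * s) powr p" using s False p_gt_1 by (intro powr_mono2) auto
    also have "\<dots> = 2 powr p * s powr p" using s by (simp add: powr_mult)
    also have "\<dots> \<le> 2 powr p * (\<Phi> s + C0)" using C0(2)[of s] s by (intro mult_left_mono) auto
    also have "\<dots> \<le> 2 powr p * (\<Phi> s + C0 / \<Phi> (1/2) * \<Phi> s)"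
    proof -
      have "C0 = C0 / \<Phi> (1/2) * \<Phi> (1/2)" using \<Phi>12 by simp
      also have "\<dots> \<le> C0 / \<Phi> (1/2) * \<Phi> s"
        using C0 s \<Phi>12 by (intro mult_left_mono Phi_mono) auto
      finally show ?thesis by (intro mult_left_mono) auto
    qed
    also have "\<dots> = C * \<Phi> s" by (simp add: C_def algebra_simps)
    finally show ?thesis using s by (simp add: s_def max_absorb2)
  qed
  define \<epsilon> where "\<epsilon> = 1 / (2 * \<mu> * C)"
  have \<epsilon>: "\<epsilon> > 0" using mu C by (simp add: \<epsilon>_def)
  obtain \<rho> where \<rho>: "\<rho> > 0" "\<And>u. u \<in> \<T> \<Longrightarrow> (\<integral>x. \<Phi> (norm (grad u x)) \<partial>M) \<le> \<rho> \<Longrightarrow>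
      (\<integral>x. \<Phi> (max 0 (u x - 1/2)) \<partial>M) \<le> \<epsilon> * (\<integral>x. \<Phi> (norm (grad u x)) \<partial>M)"
    using small_set_Poincare[OF \<epsilon>] by metis
  show ?thesis
  proof (rule that[OF \<rho>(1)])
    fix u assume u: "u \<in> \<T>" and small: "(\<integral>x. \<Phi> (norm (grad u x)) \<partial>M) \<le> \<rho>"
    note [measurable] = test_measurable[OF u]
    obtain B where B: "\<And>x. \<bar>u x\<bar> \<le> B" using test_function_bounded[OF u] by metis
    have int: "integrable M (\<lambda>x. \<Phi> (max 0 (u x - 1/2)))"
    proof (rule integrable_Phi_bounded[where B=B])
      show "\<bar>max 0 (u x - 1/2)\<bar> \<le> B" for x using B[of x] by (auto simp: max_def)
    qed measurable
    note int' = test_pair_integrable(3)[OF u u]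
    have "\<mu> * ((\<integral>x. pos_prim p (u x) \<partial>M) - (\<integral>x. pos_prim q (u x) \<partial>M)) =
        \<mu> * (\<integral>x. pos_prim p (u x) - pos_prim q (u x) \<partial>M)"
      using int' q p_gt_1 by simp
    also have "\<dots> \<le> \<mu> * (\<integral>x. C * \<Phi> (max 0 (u x - 1/2)) \<partial>M)"
      using pt int int' q p_gt_1 mu by (intro mult_left_mono integral_mono) auto
    also have "\<dots> \<le> \<mu> * (C * (\<epsilon> * (\<integral>x. \<Phi> (norm (grad u x)) \<partial>M)))"
      using \<rho>(2)[OF u small] mu C by (auto intro!: mult_left_mono)
    also have "\<dots> = (\<integral>x. \<Phi> (norm (grad u x)) \<partial>M) / 2" using mu C by (simp add: \<epsilon>_def)
    finally show "(\<integral>x. \<Phi> (norm (grad u x)) \<partial>M) / 2 \<le> J u (grad u)"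
      unfolding J_def by (simp add: right_diff_distrib)
  qed
qed

end

section \<open>Galerkin approximation\<close>

lemma continuous_on_UNIV_sequentiallyI:
  fixes f :: "'a::metric_space \<Rightarrow> 'b::topological_space"
  assumes "\<And>x a. x \<longlonglongrightarrow> a \<Longrightarrow> (\<lambda>n. f (x n)) \<longlonglongrightarrow> f a"
  shows "continuous_on UNIV f"
  unfolding continuous_on_sequentially using assms by (simp add: comp_def)

lemma tendsto_equi_lipschitz:
  fixes f :: "nat \<Rightarrow> 'a::real_normed_vector \<Rightarrow> 'b::real_normed_vector"
  assumes lip: "\<And>j x y. norm (f j x - f j y) \<le> K * norm (x - y)" "\<And>x y. norm (g x - g y) \<le> K * norm (x - y)"
    and dense: "\<And>x e. e > 0 \<Longrightarrow> \<exists>d\<in>S. norm (x - d) < e"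
    and conv: "\<And>d. d \<in> S \<Longrightarrow> (\<lambda>j. f j d) \<longlonglongrightarrow> g d"
  shows "(\<lambda>j. f j x) \<longlonglongrightarrow> g x"
proof (rule LIMSEQ_I)
  fix e :: real assume e: "e > 0"
  define \<eta> where "\<eta> = e / (3 * (\<bar>K\<bar> + 1))"
  have \<eta>: "\<eta> > 0" using e by (simp add: \<eta>_def add_nonneg_pos)
  obtain d where d: "d \<in> S" "norm (x - d) < \<eta>" using dense[OF \<eta>] by metis
  have "K * norm (x - d) \<le> (\<bar>K\<bar> + 1) * \<eta>"
    using d(2) \<eta> by (intro mult_mono) auto
  also have "\<dots> = e / 3"
  proof -
    have cancel: "k * (e / (3 * k)) = e / 3" if "k > 0" for k :: real using that by simp
    show ?thesis unfolding \<eta>_def by (rule cancel) simp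
  qed
  finally have K: "K * norm (x - d) \<le> e / 3" .
  obtain N where N: "\<And>j. j \<ge> N \<Longrightarrow> norm (f j d - g d) < e / 3"
    using LIMSEQ_D[OF conv[OF d(1)], of "e / 3"] e by auto
  have "norm (f j x - g x) < e" if "j \<ge> N" for j
  proof -
    have "f j x - g x = (f j x - f j d) + (f j d - g d) + (g d - g x)" by simp
    then have "norm (f j x - g x) \<le> norm (f j x - f j d) + norm (f j d - g d) + norm (g d - g x)"
      by (metis norm_triangle_ineq norm_triangle_mono order_refl)
    then show ?thesis
      using lip(1)[of j x d] lip(2)[of x d] N[OF that] K by (simp add: norm_minus_commute)
  qed
  then show "\<exists>N. \<forall>j\<ge>N. norm (f j x - g x) < e" by blast
qed

text \<open>A uniformly bounded, equi-Lipschitz class of test functions embeds into the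
  second countable space of sequences of values on a countable dense set.\<close>

lemma countable_dense_test_functions:
  fixes \<Omega> :: "(real^'n::finite) set"
  assumes e: "e \<in> test_functions \<Omega>"
  obtains Z :: "nat \<Rightarrow> real^'n \<Rightarrow> real" where "Z 0 = e" "\<And>i. Z i \<in> test_functions \<Omega>"
    "\<And>\<zeta>. \<zeta> \<in> test_functions \<Omega> \<Longrightarrow> \<exists>s c. c \<ge> 0 \<and> (\<forall>x. (\<lambda>j::nat. Z (s j) x) \<longlonglongrightarrow> \<zeta> x) \<and>
       (\<forall>x. (\<lambda>j. grad (Z (s j)) x) \<longlonglongrightarrow> grad \<zeta> x) \<and>
       (\<forall>j x. \<bar>Z (s j) x\<bar> \<le> c) \<and> (\<forall>j x. norm (grad (Z (s j)) x) \<le> c)"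
proof -
  \<comment> \<open>Within one class, convergence on a dense set implies convergence everywhere, for
    functions and gradients alike; and every test function belongs to some class.\<close>
  define T where "T k = {\<zeta> \<in> test_functions \<Omega>. (\<forall>x. \<bar>\<zeta> x\<bar> \<le> real k \<and> norm (grad \<zeta> x) \<le> real k) \<and>
    (\<forall>x y. norm (grad \<zeta> x - grad \<zeta> y) \<le> real k * norm (x - y))}" for k :: nat
  obtain S :: "(real^'n) set" where S: "countable S" "\<And>X. open X \<Longrightarrow> X \<noteq> {} \<Longrightarrow> \<exists>d\<in>S. d \<in> X"
    using countable_dense_exists by metis
  have S0: "S \<noteq> {}" using S(2)[of UNIV] by auto
  have dense: "\<exists>d\<in>S. norm (x - d) < e" if "e > 0" for x e
    using S(2)[of "ball x e"] that by (auto simp: dist_norm)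
  define E where "E \<zeta> i = (\<zeta> (from_nat_into S i), grad \<zeta> (from_nat_into S i))"
    for \<zeta> :: "real^'n \<Rightarrow> real" and i :: nat
  have "\<exists>C\<subseteq>T k. countable C \<and> E ` T k \<subseteq> closure (E ` C)" for k
  proof -
    obtain D where D: "countable D" "D \<subseteq> E ` T k" "E ` T k \<subseteq> closure D"
      by (rule separable[of "E ` T k"])
    obtain C where "C \<subseteq> T k" "countable C" "E ` C = D"
      using countable_subset_image[of D E "T k"] D by metis
    with D show ?thesis by auto
  qed
  then obtain C where C: "\<And>k. C k \<subseteq> T k" "\<And>k. countable (C k)" "\<And>k. E ` T k \<subseteq> closure (E ` C k)"
    by metis
  define A where "A = insert e (\<Union>k. C k)"
  have A: "countable A" "A \<noteq> {}" "A \<subseteq> test_functions \<Omega>"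
    using C e by (auto simp: A_def T_def)
  \<comment> \<open>The index is shifted by one to put \<open>e\<close> first; it then lies in every
    Galerkin space.\<close>
  define Z where "Z i = (case i of 0 \<Rightarrow> e | Suc j \<Rightarrow> from_nat_into A j)" for i
  show ?thesis
  proof (rule that[of Z])
    show "Z 0 = e" by (simp add: Z_def)
    show "Z i \<in> test_functions \<Omega>" for i
      using from_nat_into[OF A(2)] A(3) e by (auto simp: Z_def split: nat.split)
    fix \<zeta> assume \<zeta>: "\<zeta> \<in> test_functions \<Omega>"
    obtain B1 where B1: "\<And>x. \<bar>\<zeta> x\<bar> \<le> B1" "\<And>x. norm (grad \<zeta> x) \<le> B1"
      using test_function_bounded[OF \<zeta>] by metis
    obtain B2 where B2: "\<And>x y. norm (grad \<zeta> x - grad \<zeta> y) \<le> B2 * norm (x - y)"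
      using test_function_grad_lipschitz[OF \<zeta>] by metis
    obtain k :: nat where k: "max B1 B2 \<le> real k" using real_arch_simple by blast
    have \<zeta>k: "\<zeta> \<in> T k"
      unfolding T_def using \<zeta> k
      by (auto intro!: order_trans[OF B1(1)] order_trans[OF B1(2)] order_trans[OF B2] mult_right_mono)
    then have "E \<zeta> \<in> closure (E ` C k)" using C(3) by blast
    then obtain y where y: "\<And>j. y j \<in> E ` C k" "y \<longlonglongrightarrow> E \<zeta>"
      by (auto simp: closure_sequential)
    then have "\<forall>j. \<exists>z. z \<in> C k \<and> y j = E z" by blast
    then obtain z where z: "\<And>j. z j \<in> C k" "\<And>j. y j = E (z j)" by metis
    have zT: "z j \<in> T k" for j using z(1) C(1) by blast
    have lim: "(\<lambda>j. E (z j) i) \<longlonglongrightarrow> E \<zeta> i" for i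
      using tendsto_coordinate[OF y(2), of i] by (simp add: z(2))
    have lim_S: "(\<lambda>j. z j d) \<longlonglongrightarrow> \<zeta> d" "(\<lambda>j. grad (z j) d) \<longlonglongrightarrow> grad \<zeta> d" if "d \<in> S" for d
    proof -
      have "from_nat_into S (to_nat_on S d) = d" using that S(1) by simp
      then show "(\<lambda>j. z j d) \<longlonglongrightarrow> \<zeta> d" "(\<lambda>j. grad (z j) d) \<longlonglongrightarrow> grad \<zeta> d"
        using tendsto_fst[OF lim, of "to_nat_on S d"] tendsto_snd[OF lim, of "to_nat_on S d"]
        by (simp_all add: E_def)
    qed
    have lipT: "norm (f x - f y) \<le> real k * norm (x - y)" if "f \<in> T k" for f x y
      using that smooth_lipschitz[of f "real k" x y] test_function_smooth[of f \<Omega>] by (simp add: T_def)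
    have glipT: "norm (grad f x - grad f y) \<le> real k * norm (x - y)" if "f \<in> T k" for f x y
      using that by (simp add: T_def)
    have "(\<lambda>j. z j x) \<longlonglongrightarrow> \<zeta> x" for x
      by (rule tendsto_equi_lipschitz[where K="real k" and S=S, OF lipT[OF zT] lipT[OF \<zeta>k] dense lim_S(1)])
    moreover have "(\<lambda>j. grad (z j) x) \<longlonglongrightarrow> grad \<zeta> x" for x
      by (rule tendsto_equi_lipschitz[where K="real k" and S=S, OF glipT[OF zT] glipT[OF \<zeta>k] dense lim_S(2)])
    moreover have "Z (Suc (to_nat_on A (z j))) = z j" for j
    proof -
      have "z j \<in> A" using z(1) by (auto simp: A_def)
      then show ?thesis using A(1) by (simp add: Z_def)
    qed
    ultimately show "\<exists>s c. c \<ge> 0 \<and> (\<forall>x. (\<lambda>j::nat. Z (s j) x) \<longlonglongrightarrow> \<zeta> x) \<and>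
       (\<forall>x. (\<lambda>j. grad (Z (s j)) x) \<longlonglongrightarrow> grad \<zeta> x) \<and>
       (\<forall>j x. \<bar>Z (s j) x\<bar> \<le> c) \<and> (\<forall>j x. norm (grad (Z (s j)) x) \<le> c)"
      using zT by (intro exI[of _ "\<lambda>j. Suc (to_nat_on A (z j))"] exI[of _ "real k"]) (simp add: T_def)
  qed
qed

definition comb :: "(nat \<Rightarrow> real^'n::finite \<Rightarrow> real) \<Rightarrow> nat set \<Rightarrow> (nat \<Rightarrow> real) \<Rightarrow> real^'n \<Rightarrow> real" where
  "comb Z B x z = (\<Sum>i\<in>B. x i * Z i z)"

lemma comb_diff: "comb Z B (\<lambda>i. x i - s * y i) = (\<lambda>z. comb Z B x z - s * comb Z B y z)"
  by (simp add: comb_def fun_eq_iff left_diff_distrib sum_subtractf sum_distrib_left mult.assoc)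

lemma comb_scale: "comb Z B (\<lambda>i. s * y i) = (\<lambda>z. s * comb Z B y z)"
  by (simp add: comb_def fun_eq_iff sum_distrib_left mult.assoc)

lemma comb_unit: "finite B \<Longrightarrow> i \<in> B \<Longrightarrow> comb Z B (unit_coord i) = Z i"
  by (simp add: comb_def unit_coord_def fun_eq_iff if_distrib[of "\<lambda>c. c * _"] cong: if_cong)

lemma comb_mono:
  assumes "finite C" "B \<subseteq> C" shows "comb Z B x = comb Z C (\<lambda>i. if i \<in> B then x i else 0)"
proof
  fix z
  have "(\<Sum>i\<in>C. (if i \<in> B then x i else 0) * Z i z) = (\<Sum>i\<in>B. (if i \<in> B then x i else 0) * Z i z)"
    using assms by (intro sum.mono_neutral_right) auto
  then show "comb Z B x z = comb Z C (\<lambda>i. if i \<in> B then x i else 0) z"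
    by (simp add: comb_def)
qed

lemma comb_test_function:
  "finite B \<Longrightarrow> (\<And>i. Z i \<in> test_functions \<Omega>) \<Longrightarrow> comb Z B x \<in> test_functions \<Omega>"
  unfolding comb_def[abs_def] by (rule test_function_sum)

lemma grad_comb:
  assumes "finite B" "\<And>i. Z i \<in> test_functions \<Omega>"
  shows "grad (comb Z B x) z = (\<Sum>i\<in>B. x i *\<^sub>R grad (Z i) z)"
  unfolding comb_def[abs_def] using assms by (intro grad_sum test_function_smooth)

context domain
begin

text \<open>By continuity the points of \<Omega> with nonzero value form an open set, and an open
  null set is empty.\<close>

lemma AE_zero_test_function:
  assumes u: "u \<in> \<T>" and AE: "AE x in M. u x = 0" shows "u z = 0"
proof -
  have "AE x in lebesgue. x \<in> \<Omega> \<longrightarrow> u x = 0"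
    using AE open_dom by (subst (asm) AE_restrict_space_iff) (auto simp: sets_completionI_sets)
  then have "negligible {x. \<not> (x \<in> \<Omega> \<longrightarrow> u x = 0)}"
    by (simp add: negligible_iff_null_sets AE_iff_null_sets completion.AE_iff_null_sets eventually_ae_filter)
      (metis (mono_tags, lifting) completion.complete2)
  moreover have "open {x. \<not> (x \<in> \<Omega> \<longrightarrow> u x = 0)}"
  proof -
    have "{x. \<not> (x \<in> \<Omega> \<longrightarrow> u x = 0)} = \<Omega> \<inter> {x. u x \<noteq> 0}" by auto
    moreover have "open {x. u x \<noteq> 0}"
      using smooth_continuous[OF test_function_smooth[OF u]] by (intro open_Collect_neq continuous_intros) auto
    ultimately show ?thesis using open_dom by auto
  qed
  ultimately have "{x. \<not> (x \<in> \<Omega> \<longrightarrow> u x = 0)} = {}" using open_not_negligible by blast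
  then show ?thesis using test_function_zero[OF u] by blast
qed

end

context energy
begin

abbreviation Jt where "Jt u \<equiv> J u (grad u)"

abbreviation energy_int where "energy_int u \<equiv> (\<integral>x. \<Phi> (norm (grad u x)) \<partial>M)"

lemma energy_int_nonneg: "0 \<le> energy_int u"
  by (rule integral_nonneg_AE) simp

text \<open>Poincare first gives u = 0 almost everywhere. With independent generators this makes the
  gradient modular positive on the unit sphere of coefficients.\<close>

lemma zero_energy_int:
  assumes u: "u \<in> \<T>" and 0: "energy_int u = 0" shows "u z = 0"
proof -
  note [measurable] = test_measurable[OF u]
  obtain D where D: "D \<ge> 1"
    "\<And>u. u \<in> \<T> \<Longrightarrow> (\<integral>x. \<Phi> (u x) \<partial>M) \<le> (\<integral>x. \<Phi> (D * norm (grad u x)) \<partial>M)"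
    using Poincare by metis
  have "(\<integral>x. \<Phi> (u x) \<partial>M) \<le> D powr \<sigma> * energy_int u"
    using D(2)[OF u] integral_Phi_scale[OF D(1) test_integrable(3)[OF u]] by simp
  then have "(\<integral>x. \<Phi> (u x) \<partial>M) = 0" using 0 by (intro antisym integral_nonneg_AE) auto
  then have "AE x in M. \<Phi> (u x) = 0"
    using test_integrable(1)[OF u] by (subst (asm) integral_nonneg_eq_0_iff_AE) auto
  then have "AE x in M. u x = 0" by simp
  then show ?thesis by (rule AE_zero_test_function[OF u])
qed

text \<open>Convergent coefficients are bounded, so a constant dominates all combinations and their
  gradients; continuity of \<open>J\<close> and \<open>EL\<close> in the coefficients becomes
  dominated convergence.\<close>

lemma comb_dlim:
  assumes B: "finite B" and Z: "\<And>i. Z i \<in> \<T>" and a: "a \<longlonglongrightarrow> b"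
  obtains c where "c \<ge> 0" "dlim (\<lambda>x. c) (\<lambda>k. comb Z B (a k)) (comb Z B b)"
    "dlim (\<lambda>x. c) (\<lambda>k. grad (comb Z B (a k))) (grad (comb Z B b))"
proof -
  have coord: "(\<lambda>k. a k i) \<longlonglongrightarrow> b i" for i by (rule tendsto_coordinate[OF a])
  have "\<exists>K. \<forall>k. \<bar>a k i\<bar> \<le> K" for i
    using convergent_imp_Bseq[OF convergentI[OF coord[of i]]] by (auto simp: Bseq_def)
  then obtain K where K: "\<And>i k. \<bar>a k i\<bar> \<le> K i" by metis
  have K0: "K i \<ge> 0" for i using K[of 0 i] by linarith
  have "\<exists>L. \<forall>x. \<bar>Z i x\<bar> \<le> L \<and> norm (grad (Z i) x) \<le> L" for i
    using test_function_bounded[OF Z[of i]] by metis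
  then obtain L where L: "\<And>i x. \<bar>Z i x\<bar> \<le> L i" "\<And>i x. norm (grad (Z i) x) \<le> L i" by metis
  define c where "c = (\<Sum>i\<in>B. K i * L i)"
  have L0: "L i \<ge> 0" for i using L(1)[of i 0] by linarith
  have "c \<ge> 0" unfolding c_def using K0 L0 by (intro sum_nonneg mult_nonneg_nonneg)
  moreover have "\<bar>comb Z B (a k) x\<bar> \<le> c" for k x
    unfolding comb_def c_def using K L K0
    by (intro order_trans[OF sum_abs] sum_mono) (auto simp: abs_mult intro!: mult_mono)
  moreover have "norm (grad (comb Z B (a k)) x) \<le> c" for k x
    unfolding grad_comb[OF B Z] c_def using K L K0
    by (intro order_trans[OF norm_sum] sum_mono) (auto intro!: mult_mono)
  moreover have "(\<lambda>k. comb Z B (a k) x) \<longlonglongrightarrow> comb Z B b x" for x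
    unfolding comb_def by (intro tendsto_intros coord)
  moreover have "(\<lambda>k. grad (comb Z B (a k)) x) \<longlonglongrightarrow> grad (comb Z B b) x" for x
    unfolding grad_comb[OF B Z] by (intro tendsto_intros coord)
  moreover have "comb Z B y \<in> borel_measurable M" "grad (comb Z B y) \<in> borel_measurable M" for y
    using test_measurable[OF comb_test_function[OF B Z]] by auto
  ultimately show ?thesis by (intro that[of c]) (auto simp: dlim_def)
qed

lemma continuous_Jt_comb:
  assumes "finite B" "\<And>i. Z i \<in> \<T>"
  shows "continuous_on UNIV (\<lambda>x. Jt (comb Z B x))" "continuous_on UNIV (\<lambda>x. energy_int (comb Z B x))"
proof -
  show "continuous_on UNIV (\<lambda>x. Jt (comb Z B x))"
  proof (rule continuous_on_UNIV_sequentiallyI)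
    fix a b assume a: "a \<longlonglongrightarrow> (b :: nat \<Rightarrow> real)"
    show "(\<lambda>n. Jt (comb Z B (a n))) \<longlonglongrightarrow> Jt (comb Z B b)"
      by (rule comb_dlim[OF assms a]) (rule dlim_J[OF dominator_const])
  qed
  show "continuous_on UNIV (\<lambda>x. energy_int (comb Z B x))"
  proof (rule continuous_on_UNIV_sequentiallyI)
    fix a b assume a: "a \<longlonglongrightarrow> (b :: nat \<Rightarrow> real)"
    show "(\<lambda>n. energy_int (comb Z B (a n))) \<longlonglongrightarrow> energy_int (comb Z B b)"
      by (rule comb_dlim[OF assms a]) (rule dlim_Phi(1)[OF dominator_const])
  qed
qed

lemma continuous_EL_comb:
  assumes "finite B" "\<And>i. Z i \<in> \<T>"
  shows "continuous_on UNIV (\<lambda>(a, b, c). EL (comb Z B a) (grad (comb Z B a)) (comb Z B b)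
    (comb Z B c) (grad (comb Z B c)))"
proof (rule continuous_on_UNIV_sequentiallyI)
  fix x :: "nat \<Rightarrow> (nat \<Rightarrow> real) \<times> (nat \<Rightarrow> real) \<times> (nat \<Rightarrow> real)" and y
  assume xy: "x \<longlonglongrightarrow> y"
  obtain a b c where y: "y = (a, b, c)" by (cases y)
  have l: "(\<lambda>n. fst (x n)) \<longlonglongrightarrow> a" "(\<lambda>n. fst (snd (x n))) \<longlonglongrightarrow> b" "(\<lambda>n. snd (snd (x n))) \<longlonglongrightarrow> c"
    using tendsto_fst[OF xy] tendsto_fst[OF tendsto_snd[OF xy]] tendsto_snd[OF tendsto_snd[OF xy]]
    by (simp_all add: y)
  obtain c1 where c1: "c1 \<ge> 0" "dlim (\<lambda>x. c1) (\<lambda>k. comb Z B (fst (x k))) (comb Z B a)"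
    "dlim (\<lambda>x. c1) (\<lambda>k. grad (comb Z B (fst (x k)))) (grad (comb Z B a))"
    by (rule comb_dlim[OF assms l(1)])
  obtain c2 where c2: "c2 \<ge> 0" "dlim (\<lambda>x. c2) (\<lambda>k. comb Z B (fst (snd (x k)))) (comb Z B b)"
    by (rule comb_dlim[OF assms l(2)])
  obtain c3 where c3: "c3 \<ge> 0" "dlim (\<lambda>x. c3) (\<lambda>k. comb Z B (snd (snd (x k)))) (comb Z B c)"
    "dlim (\<lambda>x. c3) (\<lambda>k. grad (comb Z B (snd (snd (x k))))) (grad (comb Z B c))"
    by (rule comb_dlim[OF assms l(3)])
  define d where "d = max c1 (max c2 c3)"
  have "(\<lambda>k. EL (comb Z B (fst (x k))) (grad (comb Z B (fst (x k)))) (comb Z B (fst (snd (x k))))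
      (comb Z B (snd (snd (x k)))) (grad (comb Z B (snd (snd (x k)))))) \<longlonglongrightarrow>
      EL (comb Z B a) (grad (comb Z B a)) (comb Z B b) (comb Z B c) (grad (comb Z B c))"
    by (rule dlim_EL[where \<tau>="\<lambda>x. d"])
      (use c1 c2 c3 in \<open>auto simp: d_def intro: dlim_mono dominator_const\<close>)
  then show "(\<lambda>n. case x n of (a, b, c) \<Rightarrow> EL (comb Z B a) (grad (comb Z B a)) (comb Z B b)
    (comb Z B c) (grad (comb Z B c))) \<longlonglongrightarrow> (case y of (a, b, c) \<Rightarrow> EL (comb Z B a) (grad (comb Z B a)) (comb Z B b)
    (comb Z B c) (grad (comb Z B c)))"
    by (simp add: y case_prod_beta)
qed

lemma EL_comb_linear:
  assumes B: "finite B" and Z: "\<And>i. Z i \<in> \<T>" and u: "u \<in> \<T>" "u' \<in> \<T>"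
  shows "EL u (grad u) u' (comb Z B y) (grad (comb Z B y)) =
    (\<Sum>i\<in>B. y i * EL u (grad u) u' (Z i) (grad (Z i)))"
proof -
  have 1: "(\<integral>x. flux (grad u x) \<bullet> grad (comb Z B y) x \<partial>M) = (\<Sum>i\<in>B. y i * (\<integral>x. flux (grad u x) \<bullet> grad (Z i) x \<partial>M))"
    unfolding grad_comb[OF B Z] inner_sum_right inner_scaleR_right
    using test_pair_integrable(1)[OF u(1) Z] by (subst Bochner_Integration.integral_sum) auto
  have 2: "(\<integral>x. pos_pow r (v x) * comb Z B y x \<partial>M) = (\<Sum>i\<in>B. y i * (\<integral>x. pos_pow r (v x) * Z i x \<partial>M))"
    if "v \<in> \<T>" "1 < r" "r \<le> p" for v r
  proof -
    have "(\<integral>x. pos_pow r (v x) * comb Z B y x \<partial>M) = (\<integral>x. (\<Sum>i\<in>B. y i * (pos_pow r (v x) * Z i x)) \<partial>M)"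
      by (simp add: comb_def sum_distrib_left mult.left_commute)
    also have "\<dots> = (\<Sum>i\<in>B. y i * (\<integral>x. pos_pow r (v x) * Z i x \<partial>M))"
      using test_pair_integrable(2)[OF that(1) Z that(2,3)] by (subst Bochner_Integration.integral_sum) auto
    finally show ?thesis .
  qed
  show ?thesis
    unfolding EL_def 1 using q p_gt_1
    by (simp add: 2 u sum_distrib_left sum.distrib sum_subtractf right_diff_distrib distrib_left mult.left_commute)
qed

text \<open>On the unit sphere \<open>S\<close> of the maximum norm the gradient modular has a
  positive lower bound b. For a vector of norm t > 1, \<open>Phi_shrink\<close> raises this to t b,
  and \<open>J_coercive\<close> turns a bound on J into a bound on t.\<close>

lemma compact_sublevel_comb:
  assumes B: "finite B" and Z: "\<And>i. Z i \<in> \<T>"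
    and indep: "\<And>y. y \<in> coords B \<Longrightarrow> (\<And>z. comb Z B y z = 0) \<Longrightarrow> y = (\<lambda>i. 0)"
  shows "compact {x \<in> coords B. Jt (comb Z B x) \<le> c}"
proof -
  obtain C where C: "\<And>u. u \<in> \<T> \<Longrightarrow> energy_int u / 2 - C \<le> Jt u" using J_coercive by metis
  have T: "comb Z B x \<in> \<T>" for x by (rule comb_test_function[OF B Z])
  define S where "S = {x. \<forall>i. \<bar>x i\<bar> \<le> (if i \<in> B then 1 else 0)} \<inter> (\<Union>i\<in>B. {x :: nat \<Rightarrow> real. \<bar>x i\<bar> = 1})"
  have compS: "compact S"
    unfolding S_def using B
    by (intro compact_Int_closed compact_coordinate_box closed_UN ballI closed_Collect_eq continuous_intros
        continuous_on_product_coordinates) auto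
  have S_coords: "x \<in> coords B" if "x \<in> S" for x
    using that by (auto simp: S_def coords_def split: if_splits)
  have posS: "energy_int (comb Z B x) > 0" if x: "x \<in> S" for x
  proof (rule ccontr)
    assume "\<not> ?thesis"
    then have "energy_int (comb Z B x) = 0" using energy_int_nonneg[of "comb Z B x"] by linarith
    then have "x = (\<lambda>i. 0)" using zero_energy_int[OF T] S_coords[OF x] by (intro indep) auto
    then show False using x by (auto simp: S_def)
  qed
  have "\<exists>b>0. \<forall>x\<in>S. b \<le> energy_int (comb Z B x)"
  \<comment> \<open>The sphere is empty when \<open>B\<close> is empty; any positive bound then
    serves.\<close>
  proof (cases "S = {}")
    case False
    have "\<exists>x\<in>S. \<forall>y\<in>S. energy_int (comb Z B x) \<le> energy_int (comb Z B y)"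
      using False by (intro continuous_attains_inf compS continuous_on_subset[OF continuous_Jt_comb(2)[OF B Z]]) auto
    then show ?thesis using posS by blast
  qed (auto intro: zero_less_one)
  then obtain b where b: "b > 0" "\<And>x. x \<in> S \<Longrightarrow> b \<le> energy_int (comb Z B x)" by metis
  define R where "R = max 1 (2 * (c + C) / b)"
  have bound: "\<bar>x i\<bar> \<le> (if i \<in> B then R else 0)" if x: "x \<in> coords B" "Jt (comb Z B x) \<le> c" for x i
  proof (cases "i \<in> B")
    case True
    define t where "t = Max ((\<lambda>i. \<bar>x i\<bar>) ` B)"
    have le_t: "\<bar>x j\<bar> \<le> t" if "j \<in> B" for j
      unfolding t_def using B that by (intro Max_ge) auto
    have "t \<in> (\<lambda>i. \<bar>x i\<bar>) ` B" unfolding t_def using B True by (intro Max_in) auto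
    then obtain j where j: "j \<in> B" "\<bar>x j\<bar> = t" by auto
    have "t \<le> R"
    proof (cases "t \<le> 1")
      case False
      define y where "y i = inverse t * x i" for i
      have "y \<in> S"
        unfolding S_def y_def using False le_t j x(1)
        by (auto simp: abs_mult coords_def field_simps intro!: bexI[of _ j])
      have comb_y: "comb Z B y = (\<lambda>z. inverse t * comb Z B x z)"
        unfolding y_def[abs_def] by (rule comb_scale)
      have gy: "grad (comb Z B y) z = inverse t *\<^sub>R grad (comb Z B x) z" for z
        unfolding comb_y by (rule grad_cmult[OF test_function_smooth[OF T]])
      have "b \<le> energy_int (comb Z B y)" using b(2) \<open>y \<in> S\<close> by simp
      also have "\<dots> = (\<integral>z. \<Phi> (inverse t * norm (grad (comb Z B x) z)) \<partial>M)"
        using False by (simp add: gy)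
      also have "\<dots> \<le> inverse t * energy_int (comb Z B x)"
        using False test_integrable[OF T] test_measurable[OF T]
        by (intro integral_Phi_shrink) (auto simp: field_simps)
      also have "\<dots> \<le> inverse t * (2 * (c + C))"
        using C[OF T, of x] x(2) False by (intro mult_left_mono) auto
      finally have "t * b \<le> 2 * (c + C)" using False by (simp add: field_simps)
      then show ?thesis using b(1) by (simp add: R_def field_simps le_max_iff_disj)
    qed (simp add: R_def)
    with le_t[OF True] True show ?thesis by simp
  next
    case False
    then show ?thesis using x(1) by (simp add: coords_def)
  qed
  have eq: "{x \<in> coords B. Jt (comb Z B x) \<le> c} =
    {x. \<forall>i. \<bar>x i\<bar> \<le> (if i \<in> B then R else 0)} \<inter> (coords B \<inter> {x. Jt (comb Z B x) \<le> c})"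
    using bound by blast
  show ?thesis
    unfolding eq by (intro compact_Int_closed compact_coordinate_box closed_Int closed_coords
        closed_Collect_le continuous_Jt_comb[OF B Z] continuous_intros)
qed

text \<open>The bounds \<open>\<delta>\<close> and \<open>m\<close> are independent of
  \<open>n\<close>: the barrier \<rho> holds for all test functions, and the segment from 0 to
  \<open>Z 0\<close> lies in every Galerkin space.\<close>

lemma Galerkin_critical_points:
  assumes Z: "\<And>i. Z i \<in> \<T>" and neg: "Jt (Z 0) < 0"
  obtains \<delta> m where "\<delta> > 0"
    "\<And>n. n > 0 \<Longrightarrow> \<exists>x. Jt (comb Z {..<n} x) \<le> Jt (Z 0) \<and>
      (\<forall>y. EL (comb Z {..<n} x) (grad (comb Z {..<n} x)) (comb Z {..<n} x) (comb Z {..<n} y) (grad (comb Z {..<n} y)) = 0)"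
    "\<And>n. n > 0 \<Longrightarrow> \<exists>x. \<delta> \<le> Jt (comb Z {..<n} x) \<and> Jt (comb Z {..<n} x) \<le> m \<and>
      (\<forall>y. EL (comb Z {..<n} x) (grad (comb Z {..<n} x)) (comb Z {..<n} x) (comb Z {..<n} y) (grad (comb Z {..<n} y)) = 0)"
proof -
  obtain \<rho> where \<rho>: "\<rho> > 0" "\<And>u. u \<in> \<T> \<Longrightarrow> energy_int u \<le> \<rho> \<Longrightarrow> energy_int u / 2 \<le> Jt u"
    using J_barrier by metis
  let ?e = "Z 0"
  \<comment> \<open>Inside the barrier region J is nonnegative, so a point of negative energy lies
    beyond it.\<close>
  have e\<rho>: "energy_int ?e > \<rho>"
    using \<rho>(2)[OF Z, of 0] neg energy_int_nonneg[of ?e] by force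
  \<comment> \<open>An upper bound for J along the segment: the subtracted p-term is dropped, and
    the two others do not decrease as t grows to 1.\<close>
  define m where "m = energy_int ?e + \<mu> * (\<integral>x. pos_prim q (?e x) \<partial>M)"
  have segment: "Jt (\<lambda>z. t * ?e z) \<le> m" if t: "0 \<le> t" "t \<le> 1" for t
  proof -
    have te: "(\<lambda>z. t * ?e z) \<in> \<T>" by (rule test_function_cmult[OF Z])
    have g: "grad (\<lambda>z. t * ?e z) x = t *\<^sub>R grad ?e x" for x
      by (rule grad_cmult[OF test_function_smooth[OF Z]])
    have "energy_int (\<lambda>z. t * ?e z) \<le> energy_int ?e"
    proof (rule integral_mono)
      show "\<Phi> (norm (grad (\<lambda>z. t * ?e z) x)) \<le> \<Phi> (norm (grad ?e x))" for x
        using t by (intro Phi_mono) (simp add: g mult_left_le_one_le)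
    qed (use test_integrable[OF te] test_integrable[OF Z] in auto)
    moreover have "(\<integral>x. pos_prim q (t * ?e x) \<partial>M) \<le> (\<integral>x. pos_prim q (?e x) \<partial>M)"
    proof (rule integral_mono)
      show "pos_prim q (t * ?e x) \<le> pos_prim q (?e x)" for x
      proof -
        have "max 0 (t * ?e x) \<le> max 0 (?e x)"
          using t by (cases "?e x \<ge> 0") (auto simp: mult_left_le_one_le mult_nonneg_nonpos max_absorb1)
        then show ?thesis
          using q unfolding pos_prim_def by (intro divide_right_mono powr_mono2) auto
      qed
    qed (use test_pair_integrable(3)[OF te te] test_pair_integrable(3)[OF Z Z] q in auto)
    then have "\<mu> * (\<integral>x. pos_prim q (t * ?e x) \<partial>M) \<le> \<mu> * (\<integral>x. pos_prim q (?e x) \<partial>M)"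
      using mu by (intro mult_left_mono) auto
    moreover have "\<mu> * (\<integral>x. pos_prim p (t * ?e x) \<partial>M) \<ge> 0"
      using mu p_gt_1 by (intro mult_nonneg_nonneg integral_nonneg_AE AE_I2 pos_prim_nonneg) auto
    ultimately show ?thesis unfolding J_def m_def by linarith
  qed
  have "(\<exists>x. Jt (comb Z {..<n} x) \<le> Jt (Z 0) \<and>
      (\<forall>y. EL (comb Z {..<n} x) (grad (comb Z {..<n} x)) (comb Z {..<n} x) (comb Z {..<n} y) (grad (comb Z {..<n} y)) = 0))
    \<and> (\<exists>x. \<rho> / 2 / 2 \<le> Jt (comb Z {..<n} x) \<and> Jt (comb Z {..<n} x) \<le> m \<and>
      (\<forall>y. EL (comb Z {..<n} x) (grad (comb Z {..<n} x)) (comb Z {..<n} x) (comb Z {..<n} y) (grad (comb Z {..<n} y)) = 0))"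
    if n: "n > 0" for n
  proof -
    obtain B where B: "B \<subseteq> {..<n}"
      "\<And>x. \<exists>y\<in>coords B. \<forall>z. (\<Sum>i<n. x i * Z i z) = (\<Sum>i\<in>B. y i * Z i z)"
      "\<And>y. y \<in> coords B \<Longrightarrow> (\<And>z. (\<Sum>i\<in>B. y i * Z i z) = 0) \<Longrightarrow> y = (\<lambda>i. 0)"
      using independent_generators by blast
    have finB: "finite B" using B(1) finite_subset by blast
    have rep: "\<exists>y\<in>coords B. comb Z {..<n} x = comb Z B y" for x
      using B(2)[of x] by (simp add: comb_def[abs_def] fun_eq_iff)
    have rep': "\<exists>y. comb Z B x = comb Z {..<n} y" for x
      using comb_mono[OF _ B(1), of Z x] by auto
    let ?u = "comb Z B"
    have T: "?u x \<in> \<T>" for x by (rule comb_test_function[OF finB Z])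
    interpret descent B "\<lambda>x. Jt (?u x)" "\<lambda>a b c. EL (?u a) (grad (?u a)) (?u b) (?u c) (grad (?u c))"
    proof
      show "continuous_on UNIV (\<lambda>x. Jt (?u x))" by (rule continuous_Jt_comb[OF finB Z])
      show "continuous_on UNIV (\<lambda>(a, b, c). EL (?u a) (grad (?u a)) (?u b) (?u c) (grad (?u c)))"
        by (rule continuous_EL_comb[OF finB Z])
      show "Jt (?u (\<lambda>i. x i - s * y i)) \<le> Jt (?u x) - s * EL (?u (\<lambda>i. x i - s * y i))
          (grad (?u (\<lambda>i. x i - s * y i))) (?u x) (?u y) (grad (?u y))" if "0 \<le> s" for s x y
        unfolding comb_diff by (rule J_descent[OF T T that])
      show "finite B" by (rule finB)
      show "EL (?u x) (grad (?u x)) (?u x) (?u y) (grad (?u y)) = (\<Sum>i\<in>B. y i *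
          EL (?u x) (grad (?u x)) (?u x) (?u (unit_coord i)) (grad (?u (unit_coord i))))" for x y
        by (rule trans[OF EL_comb_linear[OF finB Z T T]], rule sum.cong) (simp_all add: comb_unit[OF finB])
      show "compact {x \<in> coords B. Jt (?u x) \<le> c}" for c
        using B(3) by (intro compact_sublevel_comb finB Z) (auto simp: comb_def)
    qed
    have transfer: "\<exists>x. P (Jt (comb Z {..<n} x)) \<and>
      (\<forall>y. EL (comb Z {..<n} x) (grad (comb Z {..<n} x)) (comb Z {..<n} x) (comb Z {..<n} y) (grad (comb Z {..<n} y)) = 0)"
      if x: "P (Jt (?u x))" "\<And>y. y \<in> coords B \<Longrightarrow> EL (?u x) (grad (?u x)) (?u x) (?u y) (grad (?u y)) = 0" for P x
    proof -
      obtain x' where x': "?u x = comb Z {..<n} x'" using rep' by blast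
      have "EL (?u x) (grad (?u x)) (?u x) (comb Z {..<n} y) (grad (comb Z {..<n} y)) = 0" for y
        using rep[of y] x(2) by auto
      with x(1) show ?thesis unfolding x' by blast
    qed
    obtain y0 where y0: "y0 \<in> coords B" "?e = ?u y0"
      using rep[of "unit_coord 0"] n by (auto simp: comb_unit)
    obtain x where x: "Jt (?u x) \<le> Jt (?u y0)"
      "\<And>y. y \<in> coords B \<Longrightarrow> EL (?u x) (grad (?u x)) (?u x) (?u y) (grad (?u y)) = 0"
      by (rule minimizer[OF y0(1)]) (rule that)
    have 1: "\<exists>x. Jt (comb Z {..<n} x) \<le> Jt (Z 0) \<and>
      (\<forall>y. EL (comb Z {..<n} x) (grad (comb Z {..<n} x)) (comb Z {..<n} x) (comb Z {..<n} y) (grad (comb Z {..<n} y)) = 0)"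
      using transfer[of "\<lambda>j. j \<le> Jt (Z 0)"] x unfolding y0(2)[symmetric] by blast
    define \<gamma>0 where "\<gamma>0 t i = t * y0 i" for t i
    have u\<gamma>: "?u (\<gamma>0 t) = (\<lambda>z. t * ?e z)" for t
      unfolding \<gamma>0_def[abs_def] y0(2) by (rule comb_scale)
    have J0: "Jt (\<lambda>z. 0) = 0"
    proof -
      have "grad (\<lambda>z. 0) x = 0" for x :: "real^'n" by (rule grad_eqI) simp
      then show ?thesis using q p_gt_1 by (simp add: J_def Phi_0 pos_prim_def)
    qed
    obtain x where x: "\<rho> / 2 / 2 \<le> Jt (?u x)" "Jt (?u x) \<le> m"
      "\<And>y. y \<in> coords B \<Longrightarrow> EL (?u x) (grad (?u x)) (?u x) (?u y) (grad (?u y)) = 0"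
    proof (rule mountain_pass[of "\<rho> / 2" \<gamma>0 m])
      show "\<rho> / 2 > 0" using \<rho> by simp
      show "continuous_on {0..1} \<gamma>0"
        unfolding \<gamma>0_def[abs_def] by (intro continuous_on_coordinatewise_then_product continuous_intros)
      show "\<gamma>0 t \<in> coords B" for t using y0(1) by (simp add: \<gamma>0_def coords_def)
      show "Jt (?u (\<gamma>0 t)) \<le> m" if "t \<in> {0..1}" for t
        using segment[of t] that by (simp add: u\<gamma>)
      show "Jt (?u (\<gamma>0 0)) \<le> 0" "Jt (?u (\<gamma>0 1)) \<le> 0"
        using J0 neg by (simp_all add: u\<gamma>)
      fix \<gamma> :: "real \<Rightarrow> nat \<Rightarrow> real"
      assume \<gamma>: "continuous_on {0..1} \<gamma>" "\<gamma> 0 = \<gamma>0 0" "\<gamma> 1 = \<gamma>0 1"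
      \<comment> \<open>By continuity every admissible path crosses the level \<rho> of the gradient
        modular, where J is at least \<rho>/2; \<open>mountain_pass\<close> then halves this once
        more.\<close>
      have "\<exists>t\<ge>0. t \<le> 1 \<and> energy_int (?u (\<gamma> t)) = \<rho>"
      proof (rule IVT')
        show "energy_int (?u (\<gamma> 0)) \<le> \<rho>"
        proof -
          have "grad (\<lambda>z. 0) x = 0" for x :: "real^'n" by (rule grad_eqI) simp
          then show ?thesis using \<rho>(1) by (simp add: \<gamma> u\<gamma> Phi_0)
        qed
        show "\<rho> \<le> energy_int (?u (\<gamma> 1))" using e\<rho> by (simp add: \<gamma> u\<gamma>)
        show "continuous_on {0..1} (\<lambda>t. energy_int (?u (\<gamma> t)))"
          by (rule continuous_on_compose2[OF continuous_Jt_comb(2)[OF finB Z] \<gamma>(1)]) auto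
      qed simp
      then obtain t where t: "t \<in> {0..1}" "energy_int (?u (\<gamma> t)) = \<rho>" by auto
      then have "\<rho> / 2 \<le> Jt (?u (\<gamma> t))" using \<rho>(2)[OF T, of "\<gamma> t"] by simp
      with t(1) show "\<exists>t\<in>{0..1}. \<rho> / 2 \<le> Jt (?u (\<gamma> t))" by blast
    qed (rule that)
    have 2: "\<exists>x. (\<rho> / 2 / 2 \<le> Jt (comb Z {..<n} x) \<and> Jt (comb Z {..<n} x) \<le> m) \<and>
      (\<forall>y. EL (comb Z {..<n} x) (grad (comb Z {..<n} x)) (comb Z {..<n} x) (comb Z {..<n} y) (grad (comb Z {..<n} y)) = 0)"
      using transfer[of "\<lambda>j. \<rho> / 2 / 2 \<le> j \<and> j \<le> m" x] x by blast
    show ?thesis using 1 2 by blast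
  qed note * = this
  show ?thesis
    by (rule that[of "\<rho> / 2 / 2" m]) (use \<rho>(1) * in auto)
qed

lemma dlim_subseq:
  assumes "dlim \<tau> f F" "strict_mono r" shows "dlim \<tau> (\<lambda>k. f (r k)) F"
proof -
  have "AE x in M. (\<lambda>k. f k x) \<longlonglongrightarrow> F x" "AE x in M. \<forall>k. norm (f k x) \<le> \<tau> x"
    using assms(1) by (auto simp: dlim_def)
  then have "AE x in M. (\<lambda>k. f (r k) x) \<longlonglongrightarrow> F x" "AE x in M. \<forall>k. norm (f (r k) x) \<le> \<tau> x"
    using LIMSEQ_subseq_LIMSEQ[OF _ assms(2)] by (auto simp: comp_def elim!: AE_mp)
  then show ?thesis using assms(1) by (simp add: dlim_def)
qed

text \<open>Strong convergence of the approximate critical points: for \<open>k \<le> l\<close> the function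
  \<open>v\<^sub>k - v\<^sub>l\<close> is admissible in the equation of \<open>v\<^sub>l\<close>, which bounds \<open>\<integral> \<Phi> |\<nabla>(v\<^sub>k + v\<^sub>l)/2|\<close>
  from below, and Clarkson's inequality turns this into a bound on \<open>\<nabla>(v\<^sub>k - v\<^sub>l)\<close>.\<close>

lemma Galerkin_gradient_difference:
  assumes v: "vk \<in> \<T>" "vl \<in> \<T>"
    and crit: "EL vl (grad vl) vl (\<lambda>x. vk x - vl x) (grad (\<lambda>x. vk x - vl x)) = 0"
    and \<beta>: "\<mu> * (\<integral>x. (pos_pow p (vl x) + pos_pow q (vl x)) * \<bar>vk x - vl x\<bar> \<partial>M) \<le> \<beta>"
  shows "(\<integral>x. \<Phi> (norm (grad vk x - grad vl x)) \<partial>M) \<le>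
    2 powr \<sigma> * ((energy_int vk - energy_int vl) / 2 + \<beta> / 2)"
proof -
  let ?d = "\<lambda>x. vk x - vl x"
  have d: "?d \<in> \<T>" by (rule test_function_diff[OF v])
  have gd: "grad ?d x = grad vk x - grad vl x" for x
    using v by (simp add: grad_diff test_function_smooth)
  have s: "(\<lambda>x. vk x + vl x) \<in> \<T>" by (rule test_function_add[OF v])
  have gs: "grad (\<lambda>x. vk x + vl x) x = grad vk x + grad vl x" for x
    using v by (simp add: grad_add test_function_smooth)
  have int_s: "integrable M (\<lambda>x. \<Phi> (norm (grad vk x + grad vl x) / 2))"
    using test_integrable(2)[OF s, of "1/2"] by (simp add: gs)
  have int_d: "integrable M (\<lambda>x. \<Phi> (norm (grad vk x - grad vl x) / 2))"
    using test_integrable(2)[OF d, of "1/2"] by (simp add: gd)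
  note int = test_integrable(3)[OF v(1)] test_integrable(3)[OF v(2)]
  have "(\<integral>x. \<Phi> (norm (grad vk x + grad vl x) / 2) + \<Phi> (norm (grad vk x - grad vl x) / 2) \<partial>M) \<le>
      (\<integral>x. (\<Phi> (norm (grad vk x)) + \<Phi> (norm (grad vl x))) / 2 \<partial>M)"
    using int_s int_d int by (intro integral_mono Clarkson) auto
  then have 1: "(\<integral>x. \<Phi> (norm (grad vk x + grad vl x) / 2) \<partial>M) + (\<integral>x. \<Phi> (norm (grad vk x - grad vl x) / 2) \<partial>M)
      \<le> (energy_int vk + energy_int vl) / 2"
    using int_s int_d int by simp
  have "(\<integral>x. \<Phi> (norm (grad vl x)) + (flux (grad vl x) \<bullet> grad ?d x) / 2 \<partial>M) \<le>
      (\<integral>x. \<Phi> (norm (grad vk x + grad vl x) / 2) \<partial>M)"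
  proof (rule integral_mono)
    fix x
    have "(1/2) *\<^sub>R (grad vk x + grad vl x) - grad vl x = (1/2) *\<^sub>R grad ?d x"
      unfolding gd by (simp add: algebra_simps flip: scaleR_left_distrib)
    then show "\<Phi> (norm (grad vl x)) + (flux (grad vl x) \<bullet> grad ?d x) / 2 \<le>
      \<Phi> (norm (grad vk x + grad vl x) / 2)"
      using flux_tangent[of "grad vl x" "(1/2) *\<^sub>R (grad vk x + grad vl x)"] by simp
  qed (use int int_s test_pair_integrable(1)[OF v(2) d] in auto)
  then have 2: "energy_int vl + (\<integral>x. flux (grad vl x) \<bullet> grad ?d x \<partial>M) / 2 \<le>
      (\<integral>x. \<Phi> (norm (grad vk x + grad vl x) / 2) \<partial>M)"
    using int test_pair_integrable(1)[OF v(2) d] by simp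
  note pint = test_pair_integrable(2)[OF v(2) d, of p] test_pair_integrable(2)[OF v(2) d, of q]
  have pint': "integrable M (\<lambda>x. pos_pow r (vl x) * \<bar>?d x\<bar>)" if "1 < r" "r \<le> p" for r
    using integrable_abs[OF test_pair_integrable(2)[OF v(2) d that]]
    by (simp add: abs_mult pos_pow_nonneg)
  have "\<mu> * (\<integral>x. pos_pow q (vl x) * ?d x \<partial>M) - \<mu> * (\<integral>x. pos_pow p (vl x) * ?d x \<partial>M) =
      \<mu> * (\<integral>x. pos_pow q (vl x) * ?d x - pos_pow p (vl x) * ?d x \<partial>M)"
    using pint q p_gt_1 by (simp add: right_diff_distrib)
  also have "\<dots> \<le> \<mu> * (\<integral>x. (pos_pow p (vl x) + pos_pow q (vl x)) * \<bar>?d x\<bar> \<partial>M)"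
  proof (intro mult_left_mono integral_mono)
    show "pos_pow q (vl x) * ?d x - pos_pow p (vl x) * ?d x \<le> (pos_pow p (vl x) + pos_pow q (vl x)) * \<bar>?d x\<bar>" for x
    proof -
      have "pos_pow q (vl x) * ?d x \<le> pos_pow q (vl x) * \<bar>?d x\<bar>"
        by (intro mult_left_mono pos_pow_nonneg) auto
      moreover have "pos_pow p (vl x) * (- ?d x) \<le> pos_pow p (vl x) * \<bar>?d x\<bar>"
        by (intro mult_left_mono pos_pow_nonneg) auto
      ultimately show ?thesis by (simp add: distrib_right algebra_simps)
    qed
  qed (use pint pint' q p_gt_1 mu in \<open>auto simp: distrib_right\<close>)
  finally have 3: "- (\<integral>x. flux (grad vl x) \<bullet> grad ?d x \<partial>M) \<le> \<beta>"
    using crit \<beta> unfolding EL_def by linarith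
  have half: "(\<integral>x. \<Phi> (norm (grad vk x - grad vl x) / 2) \<partial>M) \<le> (energy_int vk - energy_int vl) / 2 + \<beta> / 2"
  proof -
    have arith: "s + d \<le> (a + b) / 2 \<Longrightarrow> b + f / 2 \<le> s \<Longrightarrow> - f \<le> \<beta> \<Longrightarrow> d \<le> (a - b) / 2 + \<beta> / 2"
      for s d a b f :: real by (simp add: field_simps)
    show ?thesis by (rule arith[OF 1 2 3])
  qed
  have "(\<integral>x. \<Phi> (norm (grad vk x - grad vl x)) \<partial>M) = (\<integral>x. \<Phi> (2 * (norm (grad vk x - grad vl x) / 2)) \<partial>M)"
    by simp
  also have "\<dots> \<le> 2 powr \<sigma> * (\<integral>x. \<Phi> (norm (grad vk x - grad vl x) / 2) \<partial>M)"
    using int_d test_measurable[OF v(1)] test_measurable[OF v(2)] by (intro integral_Phi_scale) auto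
  also have "\<dots> \<le> 2 powr \<sigma> * ((energy_int vk - energy_int vl) / 2 + \<beta> / 2)"
    using half by (intro mult_left_mono) auto
  finally show ?thesis .
qed

text \<open>The bound in \<open>Galerkin_gradient_difference\<close> is small only if the two
  gradient modulars are close, so besides strong convergence of the functions a subsequence with
  convergent gradient modulars is extracted. The gradients are then Cauchy in modular, and a last
  subsequence converges below a dominator.\<close>

lemma Galerkin_limit:
  assumes Z: "\<And>i. Z i \<in> \<T>" and u: "\<And>n. u n = comb Z {..<Suc n} (x n)"
    and crit: "\<And>n y. EL (u n) (grad (u n)) (u n) (comb Z {..<Suc n} y) (grad (comb Z {..<Suc n} y)) = 0"
    and J: "\<And>n. Jt (u n) \<le> m"
  obtains r :: "nat \<Rightarrow> nat" and \<tau> U W where "strict_mono r" "dominator \<tau>" "dlim \<tau> (\<lambda>k. u (r k)) U"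
    "dlim \<tau> (\<lambda>k. grad (u (r k))) W" "\<And>i. EL U W U (Z i) (grad (Z i)) = 0"
proof -
  have T: "u n \<in> \<T>" for n unfolding u by (intro comb_test_function Z) auto
  note meas = test_measurable[OF T]
  obtain C where C: "\<And>u. u \<in> \<T> \<Longrightarrow> energy_int u / 2 - C \<le> Jt u" using J_coercive by metis
  define E where "E = 2 * (m + C)"
  have E: "energy_int (u n) \<le> E" for n using C[OF T, of n] J[of n] by (simp add: E_def)
  obtain r1 :: "nat \<Rightarrow> nat" where r1: "strict_mono r1"
    "\<And>e. e > 0 \<Longrightarrow> \<exists>N. \<forall>m\<ge>N. \<forall>n\<ge>N. (\<integral>x. \<Phi> (u (r1 m) x - u (r1 n) x) \<partial>M) < e"
    by (rule Rellich[OF T E]) (rule that)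
  obtain r2 U \<tau>1 where r2: "strict_mono (r2 :: nat \<Rightarrow> nat)" "U \<in> borel_measurable M"
    "\<tau>1 \<in> borel_measurable M" "integrable M (\<lambda>x. \<Phi> (\<tau>1 x))" "\<And>x. 0 \<le> \<tau>1 x"
    "AE x in M. (\<lambda>k. u (r1 (r2 k)) x) \<longlonglongrightarrow> U x" "AE x in M. \<forall>k. norm (u (r1 (r2 k)) x) \<le> \<tau>1 x"
    by (rule modular_Cauchy_subsequence[of "\<lambda>n. u (r1 n)" M])
      (use meas r1(2) test_integrable(1)[OF T] in auto)
  have \<tau>1: "dominator \<tau>1" using r2 by (simp add: dominator_def)
  have U1: "dlim \<tau>1 (\<lambda>k. u (r1 (r2 k))) U" using r2 meas by (simp add: dlim_def)
  have "bounded (range (\<lambda>k. energy_int (u (r1 (r2 k)))))"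
    using E energy_int_nonneg by (intro boundedI[where B=E]) auto
  then obtain \<iota> r3 where r3: "strict_mono (r3 :: nat \<Rightarrow> nat)"
    "((\<lambda>k. energy_int (u (r1 (r2 k)))) \<circ> r3) \<longlonglongrightarrow> \<iota>"
    using bounded_imp_convergent_subsequence by blast
  define s where "s k = r1 (r2 (r3 k))" for k
  have s: "strict_mono s"
    unfolding s_def using r1(1) r2(1) r3(1) by (auto simp: strict_mono_def)
  define v where "v k = u (s k)" for k
  have vT: "v k \<in> \<T>" for k by (simp add: v_def T)
  have v_lim: "dlim \<tau>1 v U"
    using dlim_subseq[OF U1 r3(1)] by (simp add: v_def[abs_def] s_def)
  have v_energy: "(\<lambda>k. energy_int (v k)) \<longlonglongrightarrow> \<iota>"
    using r3(2) by (simp add: comp_def v_def s_def)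
  let ?\<tau>2 = "\<lambda>x. \<tau>1 x + \<tau>1 x"
  have \<tau>2: "dominator ?\<tau>2" by (rule dominator_add[OF \<tau>1 \<tau>1])
  have \<tau>1_lim: "dlim ?\<tau>2 (\<lambda>k. \<tau>1) \<tau>1" using r2 by (intro dlim_const) auto
  have diff_lim: "dlim ?\<tau>2 (\<lambda>k x. \<bar>v k x - U x\<bar>) (\<lambda>x. 0)"
    unfolding dlim_def
  proof (intro conjI allI)
    show "(\<lambda>x. \<bar>v k x - U x\<bar>) \<in> borel_measurable M" for k
      using v_lim by (intro borel_measurable_abs borel_measurable_diff) (auto simp: dlim_def)
    have lim: "AE x in M. (\<lambda>k. v k x) \<longlonglongrightarrow> U x" and bd: "AE x in M. \<forall>k. norm (v k x) \<le> \<tau>1 x"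
      using v_lim by (auto simp: dlim_def)
    show "AE x in M. (\<lambda>k. \<bar>v k x - U x\<bar>) \<longlonglongrightarrow> 0"
      using lim by eventually_elim (simp add: tendsto_rabs_zero_iff LIM_zero_iff)
    show "AE x in M. \<forall>k. norm \<bar>v k x - U x\<bar> \<le> ?\<tau>2 x"
      using bd dlim_limit_bound[OF v_lim]
    proof eventually_elim
      case (elim x)
      show ?case
      proof
        fix k
        have "\<bar>v k x\<bar> \<le> \<tau>1 x" "\<bar>U x\<bar> \<le> \<tau>1 x" using elim by auto
        then show "norm \<bar>v k x - U x\<bar> \<le> ?\<tau>2 x" by simp
      qed
    qed
  qed simp
  \<comment> \<open>The powers are taken at the dominating function, so that
    \<open>\<beta> k + \<beta> l\<close> controls the lower order terms for all pairs
    \<open>k\<close>, \<open>l\<close>.\<close>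
  define \<beta> where "\<beta> k = \<mu> * (\<integral>x. pos_pow p (\<tau>1 x) * \<bar>v k x - U x\<bar> \<partial>M) +
    \<mu> * (\<integral>x. pos_pow q (\<tau>1 x) * \<bar>v k x - U x\<bar> \<partial>M)" for k
  have pq: "1 < p" "p \<le> p" "1 < q" "q \<le> p" using q p_gt_1 by auto
  have "\<beta> \<longlonglongrightarrow> \<mu> * (\<integral>x. pos_pow p (\<tau>1 x) * 0 \<partial>M) + \<mu> * (\<integral>x. pos_pow q (\<tau>1 x) * 0 \<partial>M)"
    unfolding \<beta>_def[abs_def]
    by (intro tendsto_intros dlim_pow(1)[OF \<tau>2 \<tau>1_lim diff_lim] pq)
  then have \<beta>_lim: "\<beta> \<longlonglongrightarrow> 0" by simp
  have \<beta>_int: "integrable M (\<lambda>x. pos_pow r (\<tau>1 x) * \<bar>v k x - U x\<bar>)" if "1 < r" "r \<le> p" for r k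
  proof (rule dlim_pow(2)[OF \<tau>2 \<tau>1_lim _ that])
    have "AE x in M. \<forall>k. norm \<bar>v k x - U x\<bar> \<le> ?\<tau>2 x" "(\<lambda>x. \<bar>v k x - U x\<bar>) \<in> borel_measurable M"
      using diff_lim by (auto simp: dlim_def)
    then show "dlim ?\<tau>2 (\<lambda>j x. \<bar>v k x - U x\<bar>) (\<lambda>x. \<bar>v k x - U x\<bar>)"
      by (intro dlim_const) (auto elim: AE_mp)
  qed
  have pow_mono: "pos_pow r a \<le> pos_pow r b" if "a \<le> b" "1 < r" for r a b
    unfolding pos_pow_def using that by (intro powr_mono2) auto
  have \<beta>_bound: "\<mu> * (\<integral>x. (pos_pow p (v l x) + pos_pow q (v l x)) * \<bar>v k x - v l x\<bar> \<partial>M) \<le> \<beta> k + \<beta> l" for k l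
  proof -
    have "(\<integral>x. (pos_pow p (v l x) + pos_pow q (v l x)) * \<bar>v k x - v l x\<bar> \<partial>M) \<le>
      (\<integral>x. (pos_pow p (\<tau>1 x) * \<bar>v k x - U x\<bar> + pos_pow p (\<tau>1 x) * \<bar>v l x - U x\<bar>) +
        (pos_pow q (\<tau>1 x) * \<bar>v k x - U x\<bar> + pos_pow q (\<tau>1 x) * \<bar>v l x - U x\<bar>) \<partial>M)"
    proof (rule integral_mono_AE)
      show "integrable M (\<lambda>x. (pos_pow p (v l x) + pos_pow q (v l x)) * \<bar>v k x - v l x\<bar>)"
        using integrable_abs[OF test_pair_integrable(2)[OF vT test_function_diff[OF vT vT], of p l k l]]
          integrable_abs[OF test_pair_integrable(2)[OF vT test_function_diff[OF vT vT], of q l k l]] pq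
        by (simp add: abs_mult pos_pow_nonneg distrib_right)
      have "AE x in M. \<forall>k. norm (v k x) \<le> \<tau>1 x" using v_lim by (simp add: dlim_def)
      then show "AE x in M. (pos_pow p (v l x) + pos_pow q (v l x)) * \<bar>v k x - v l x\<bar> \<le>
        (pos_pow p (\<tau>1 x) * \<bar>v k x - U x\<bar> + pos_pow p (\<tau>1 x) * \<bar>v l x - U x\<bar>) +
        (pos_pow q (\<tau>1 x) * \<bar>v k x - U x\<bar> + pos_pow q (\<tau>1 x) * \<bar>v l x - U x\<bar>)"
      proof eventually_elim
        case (elim x)
        have "v l x \<le> \<tau>1 x" using elim by (metis abs_le_D1 real_norm_def)
        then have "(pos_pow p (v l x) + pos_pow q (v l x)) * \<bar>v k x - v l x\<bar> \<le>
          (pos_pow p (\<tau>1 x) + pos_pow q (\<tau>1 x)) * (\<bar>v k x - U x\<bar> + \<bar>v l x - U x\<bar>)"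
          using pq by (intro mult_mono add_mono pow_mono) (auto simp: pos_pow_nonneg)
        then show ?case by (simp add: algebra_simps)
      qed
    qed (use \<beta>_int pq in auto)
    also have "\<dots> = ((\<integral>x. pos_pow p (\<tau>1 x) * \<bar>v k x - U x\<bar> \<partial>M) + (\<integral>x. pos_pow p (\<tau>1 x) * \<bar>v l x - U x\<bar> \<partial>M)) +
        ((\<integral>x. pos_pow q (\<tau>1 x) * \<bar>v k x - U x\<bar> \<partial>M) + (\<integral>x. pos_pow q (\<tau>1 x) * \<bar>v l x - U x\<bar> \<partial>M))"
      using \<beta>_int pq by simp
    finally have "\<mu> * (\<integral>x. (pos_pow p (v l x) + pos_pow q (v l x)) * \<bar>v k x - v l x\<bar> \<partial>M) \<le> \<mu> * \<dots>"
      using mu by (intro mult_left_mono) auto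
    then show ?thesis by (simp add: \<beta>_def distrib_left)
  qed
  have v_span: "\<exists>y. (\<lambda>x. v k x - v l x) = comb Z {..<Suc (s l)} y" if "k \<le> l" for k l
  proof -
    have sub: "{..<Suc (s k)} \<subseteq> {..<Suc (s l)}"
      using that s by (simp add: strict_mono_less_eq)
    obtain y where y: "v k = comb Z {..<Suc (s l)} y"
      using comb_mono[OF _ sub, of Z "x (s k)"] unfolding v_def u by blast
    have "(\<lambda>x. v k x - v l x) = comb Z {..<Suc (s l)} (\<lambda>i. y i - 1 * x (s l) i)"
      unfolding comb_diff y by (simp add: v_def u)
    then show ?thesis by blast
  qed
  have grad_diff_le: "(\<integral>x. \<Phi> (norm (grad (v k) x - grad (v l) x)) \<partial>M) \<le>
      2 powr \<sigma> * ((energy_int (v k) - energy_int (v l)) / 2 + (\<beta> k + \<beta> l) / 2)" if kl: "k \<le> l" for k l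
  proof (rule Galerkin_gradient_difference[OF vT vT _ \<beta>_bound])
    obtain y where y: "(\<lambda>x. v k x - v l x) = comb Z {..<Suc (s l)} y" using v_span[OF kl] by blast
    show "EL (v l) (grad (v l)) (v l) (\<lambda>x. v k x - v l x) (grad (\<lambda>x. v k x - v l x)) = 0"
      unfolding y unfolding v_def by (rule crit)
  qed
  have grad_Cauchy: "\<exists>N. \<forall>k\<ge>N. \<forall>l\<ge>N. (\<integral>x. \<Phi> (norm (grad (v k) x - grad (v l) x)) \<partial>M) < e" if e: "e > 0" for e
  proof -
    define \<eta> where "\<eta> = e / (2 * 2 powr \<sigma>)"
    have \<eta>: "\<eta> > 0" using e by (simp add: \<eta>_def)
    have "\<forall>\<^sub>F k in sequentially. \<bar>energy_int (v k) - \<iota>\<bar> < \<eta> / 2"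
      using tendstoD[OF v_energy, of "\<eta> / 2"] \<eta> by (simp add: dist_real_def)
    moreover have "\<forall>\<^sub>F k in sequentially. \<beta> k < \<eta>" using order_tendstoD(2)[OF \<beta>_lim \<eta>] .
    ultimately have "\<forall>\<^sub>F k in sequentially. \<bar>energy_int (v k) - \<iota>\<bar> < \<eta> / 2 \<and> \<beta> k < \<eta>"
      by eventually_elim simp
    then obtain N where N: "\<And>k. k \<ge> N \<Longrightarrow> \<bar>energy_int (v k) - \<iota>\<bar> < \<eta> / 2 \<and> \<beta> k < \<eta>"
      by (auto simp: eventually_sequentially)
    have small: "(\<integral>x. \<Phi> (norm (grad (v k) x - grad (v l) x)) \<partial>M) < e" if "k \<ge> N" "l \<ge> N" "k \<le> l" for k l
    proof -
      have "(energy_int (v k) - energy_int (v l)) / 2 + (\<beta> k + \<beta> l) / 2 < 2 * \<eta>"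
      proof -
        have arith: "\<bar>a - i\<bar> < \<eta> / 2 \<and> c < \<eta> \<Longrightarrow> \<bar>b - i\<bar> < \<eta> / 2 \<and> d < \<eta> \<Longrightarrow> (a - b) / 2 + (c + d) / 2 < 2 * \<eta>"
          for a b c d i :: real using \<eta> by (auto simp: abs_if field_simps split: if_splits)
        show ?thesis by (rule arith[OF N[OF that(1)] N[OF that(2)]])
      qed
      then have "2 powr \<sigma> * ((energy_int (v k) - energy_int (v l)) / 2 + (\<beta> k + \<beta> l) / 2) < 2 powr \<sigma> * (2 * \<eta>)"
        by (intro mult_strict_left_mono) auto
      also have "\<dots> = e" by (simp add: \<eta>_def)
      finally show ?thesis using grad_diff_le[OF that(3)] by linarith
    qed
    have "(\<integral>x. \<Phi> (norm (grad (v k) x - grad (v l) x)) \<partial>M) < e" if "k \<ge> N" "l \<ge> N" for k l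
      using small[of k l] small[of l k] that by (cases "k \<le> l") (auto simp: norm_minus_commute)
    then show ?thesis by blast
  qed
  obtain r4 W \<tau>3 where r4: "strict_mono (r4 :: nat \<Rightarrow> nat)" "W \<in> borel_measurable M"
    "\<tau>3 \<in> borel_measurable M" "integrable M (\<lambda>x. \<Phi> (\<tau>3 x))" "\<And>x. 0 \<le> \<tau>3 x"
    "AE x in M. (\<lambda>k. grad (v (r4 k)) x) \<longlonglongrightarrow> W x" "AE x in M. \<forall>k. norm (grad (v (r4 k)) x) \<le> \<tau>3 x"
    by (rule modular_Cauchy_subsequence[of "\<lambda>n. grad (v n)" M])
      (use test_measurable[OF vT] grad_Cauchy test_integrable(3)[OF vT] in auto)
  have \<tau>3: "dominator \<tau>3" using r4 by (simp add: dominator_def)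
  have W3: "dlim \<tau>3 (\<lambda>k. grad (v (r4 k))) W" using r4 test_measurable[OF vT] by (simp add: dlim_def)
  define \<tau> where "\<tau> x = \<tau>1 x + \<tau>3 x" for x
  have \<tau>: "dominator \<tau>" unfolding \<tau>_def[abs_def] by (rule dominator_add[OF \<tau>1 \<tau>3])
  have U: "dlim \<tau> (\<lambda>k. v (r4 k)) U"
    by (rule dlim_mono[OF dlim_subseq[OF v_lim r4(1)]]) (simp add: \<tau>_def r4)
  have W: "dlim \<tau> (\<lambda>k. grad (v (r4 k))) W"
    by (rule dlim_mono[OF W3]) (simp add: \<tau>_def r2)
  show ?thesis
  proof (rule that[of "\<lambda>k. s (r4 k)" \<tau> U W])
    show "strict_mono (\<lambda>k. s (r4 k))" using s r4(1) by (auto simp: strict_mono_def)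
    show "dominator \<tau>" by (rule \<tau>)
    show "dlim \<tau> (\<lambda>k. u (s (r4 k))) U" "dlim \<tau> (\<lambda>k. grad (u (s (r4 k)))) W"
      using U W by (simp_all add: v_def)
    fix i
    obtain c where c: "c \<ge> 0" "dlim (\<lambda>x. c) (\<lambda>k. Z i) (Z i)" "dlim (\<lambda>x. c) (\<lambda>k. grad (Z i)) (grad (Z i))"
      using test_dlim_const[OF Z] by metis
    let ?\<tau> = "\<lambda>x. \<tau> x + c"
    have \<tau>0: "0 \<le> \<tau> x" for x using \<tau> by (simp add: dominator_def)
    have "(\<lambda>k. EL (v (r4 k)) (grad (v (r4 k))) (v (r4 k)) (Z i) (grad (Z i))) \<longlonglongrightarrow> EL U W U (Z i) (grad (Z i))"
      by (rule dlim_EL[where \<tau>="?\<tau>"])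
        (use c \<tau>0 in \<open>auto intro: dominator_add \<tau> dominator_const dlim_mono[OF U] dlim_mono[OF W]
          dlim_mono[OF c(2)] dlim_mono[OF c(3)]\<close>)
    \<comment> \<open>\<open>Z i\<close> belongs to the span of the first \<open>Suc n\<close>
      functions as soon as \<open>i \<le> n\<close>, hence is admissible in the equations of all
      later approximations.\<close>
    moreover have "\<forall>\<^sub>F k in sequentially. EL (v (r4 k)) (grad (v (r4 k))) (v (r4 k)) (Z i) (grad (Z i)) = 0"
      unfolding eventually_sequentially
    proof (intro exI[of _ i] allI impI)
      fix k assume "i \<le> k"
      also have "k \<le> s (r4 k)" using strict_mono_imp_increasing[of "\<lambda>k. s (r4 k)" k] s r4(1)
        by (auto simp: strict_mono_def)
      finally have "i \<in> {..<Suc (s (r4 k))}" by simp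
      then have "Z i = comb Z {..<Suc (s (r4 k))} (unit_coord i)" by (simp only: comb_unit finite_lessThan)
      then show "EL (v (r4 k)) (grad (v (r4 k))) (v (r4 k)) (Z i) (grad (Z i)) = 0"
        by (simp only: v_def crit)
    qed
    ultimately show "EL U W U (Z i) (grad (Z i)) = 0"
      by (rule LIMSEQ_unique[OF _ tendsto_eventually])
  qed
qed

text \<open>First density step: bounded pointwise convergence of functions and gradients is a
  \<open>dlim\<close> below \<tau> + c, so the equation passes from the countable family to any test
  function.\<close>

lemma EL_test_function:
  assumes U: "dominator \<tau>" "dlim \<tau> u U" "dlim \<tau> w W" and Z: "\<And>i. Z i \<in> \<T>" "\<zeta> \<in> \<T>"
    and EL: "\<And>i. EL U W U (Z i) (grad (Z i)) = 0"
    and s: "0 \<le> c" "\<And>x. (\<lambda>j::nat. Z (s j) x) \<longlonglongrightarrow> \<zeta> x" "\<And>x. (\<lambda>j. grad (Z (s j)) x) \<longlonglongrightarrow> grad \<zeta> x"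
      "\<And>j x. \<bar>Z (s j) x\<bar> \<le> c" "\<And>j x. norm (grad (Z (s j)) x) \<le> c"
  shows "EL U W U \<zeta> (grad \<zeta>) = 0"
proof -
  let ?\<tau> = "\<lambda>x. \<tau> x + c"
  have \<tau>0: "0 \<le> \<tau> x" for x using U by (simp add: dominator_def)
  have const: "dlim ?\<tau> (\<lambda>k. U) U" "dlim ?\<tau> (\<lambda>k. W) W"
    using dlim_limit_bound[OF U(2)] dlim_limit_bound[OF U(3)] U s(1)
    by (auto simp: dlim_def elim!: AE_mp)
  have Z1: "dlim ?\<tau> (\<lambda>j. Z (s j)) \<zeta>" "dlim ?\<tau> (\<lambda>j. grad (Z (s j))) (grad \<zeta>)"
    using s test_measurable[OF Z(1)] test_measurable[OF Z(2)] \<tau>0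
    by (auto simp: dlim_def intro!: AE_I2 add_increasing)
  have "(\<lambda>j. EL U W U (Z (s j)) (grad (Z (s j)))) \<longlonglongrightarrow> EL U W U \<zeta> (grad \<zeta>)"
    by (rule dlim_EL[where \<tau>="?\<tau>"]) (use const Z1 U s in \<open>auto intro: dominator_add dominator_const\<close>)
  then show ?thesis by (simp add: EL LIMSEQ_const_iff)
qed

end

section \<open>Weak derivatives\<close>

text \<open>The positive and negative parts of the function are densities of two measures. They
  agree on boxes, an intersection-stable generator of the Borel sets, hence everywhere.\<close>

lemma AE_zero_if_box_integrals_zero:
  fixes F :: "'a::euclidean_space \<Rightarrow> real"
  assumes F: "integrable lebesgue F" and box0: "\<And>a b. (\<integral>x. indicator (box a b) x * F x \<partial>lebesgue) = 0"
  shows "AE x in lebesgue. F x = 0"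
proof -
  \<comment> \<open>Uniqueness of measures concerns Borel sets, so a Borel representative
    \<open>G\<close> replaces the Lebesgue measurable \<open>F\<close>.\<close>
  obtain G where G [measurable]: "G \<in> borel_measurable lborel" and FG: "AE x in lborel. F x = G x"
    using completion_ex_borel_measurable_real[of F lborel] F by auto
  have FG': "AE x in lebesgue. F x = G x" using FG by (rule AE_completion)
  have Gl [measurable]: "G \<in> borel_measurable lebesgue" by (intro measurable_completion G)
  have Gint: "integrable lborel G"
    using F integrable_cong_AE[OF _ Gl FG'] by (simp add: integrable_completion borel_measurable_integrable)
  have Gbox: "(\<integral>x. indicator (box a b) x * G x \<partial>lborel) = 0" for a b
  proof -
    have "(\<integral>x. indicator (box a b) x * G x \<partial>lborel) = (\<integral>x. indicator (box a b) x * G x \<partial>lebesgue)"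
      by (subst integral_completion) auto
    also have "\<dots> = (\<integral>x. indicator (box a b) x * F x \<partial>lebesgue)"
    proof (rule integral_cong_AE)
      show "(\<lambda>x. indicator (box a b) x * G x) \<in> borel_measurable lebesgue"
        by (intro measurable_completion) measurable
      have "(\<lambda>x. indicator (box a b) x :: real) \<in> borel_measurable lebesgue"
        by (intro measurable_completion) measurable
      then show "(\<lambda>x. indicator (box a b) x * F x) \<in> borel_measurable lebesgue"
        using F by (intro borel_measurable_times) auto
      show "AE x in lebesgue. indicator (box a b) x * G x = indicator (box a b) x * F x"
        using FG' by eventually_elim simp
    qed
    finally show ?thesis using box0 by simp
  qed
  let ?P = "density lborel (\<lambda>x. ennreal (G x))" and ?N = "density lborel (\<lambda>x. ennreal (- G x))"
  have fin: "(\<integral>\<^sup>+x. ennreal (G x) * indicator X x \<partial>lborel) < \<infinity>"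
    "(\<integral>\<^sup>+x. ennreal (- G x) * indicator X x \<partial>lborel) < \<infinity>" for X
  proof -
    have "(\<integral>\<^sup>+x. ennreal (norm (G x)) \<partial>lborel) < \<infinity>" using Gint by (simp add: integrable_iff_bounded)
    moreover have "(\<integral>\<^sup>+x. ennreal (G x) * indicator X x \<partial>lborel) \<le> (\<integral>\<^sup>+x. ennreal (norm (G x)) \<partial>lborel)"
      "(\<integral>\<^sup>+x. ennreal (- G x) * indicator X x \<partial>lborel) \<le> (\<integral>\<^sup>+x. ennreal (norm (G x)) \<partial>lborel)"
      by (auto intro!: nn_integral_mono ennreal_leI split: split_indicator)
    ultimately show "(\<integral>\<^sup>+x. ennreal (G x) * indicator X x \<partial>lborel) < \<infinity>"
      "(\<integral>\<^sup>+x. ennreal (- G x) * indicator X x \<partial>lborel) < \<infinity>"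
      by (auto intro: order.strict_trans1)
  qed
  have eq_box: "emeasure ?P (box a b) = emeasure ?N (box a b)" for a b
  proof -
    have ind: "ennreal (indicator (box a b) x * G x) = ennreal (G x) * indicator (box a b) x"
      "ennreal (- (indicator (box a b) x * G x)) = ennreal (- G x) * indicator (box a b) x" for x
      by (auto split: split_indicator)
    have "integrable lborel (\<lambda>x. indicator (box a b) x * G x)"
      using integrable_mult_indicator[OF _ Gint, of "box a b"] by simp
    from real_lebesgue_integral_def[OF this]
    have "enn2real (\<integral>\<^sup>+x. ennreal (G x) * indicator (box a b) x \<partial>lborel) =
        enn2real (\<integral>\<^sup>+x. ennreal (- G x) * indicator (box a b) x \<partial>lborel)"
      unfolding Gbox ind by simp
    then have "(\<integral>\<^sup>+x. ennreal (G x) * indicator (box a b) x \<partial>lborel) =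
        (\<integral>\<^sup>+x. ennreal (- G x) * indicator (box a b) x \<partial>lborel)"
      using fin[of "box a b"] by (metis ennreal_enn2real infinity_ennreal_def)
    then show ?thesis by (simp add: emeasure_density)
  qed
  have "?P = ?N"
  proof (rule measure_eqI_generator_eq)
    let ?E = "range (\<lambda>(a, b). box a b::'a set)"
    show "Int_stable ?E" by (auto simp: Int_stable_def box_Int_box)
    show "?E \<subseteq> Pow UNIV" "sets ?P = sigma_sets UNIV ?E" "sets ?N = sigma_sets UNIV ?E"
      by (simp_all add: borel_eq_box)
    let ?A = "\<lambda>n::nat. box (- (real n *\<^sub>R One)) (real n *\<^sub>R One) :: 'a set"
    show "range ?A \<subseteq> ?E" "(\<Union>i. ?A i) = UNIV" unfolding UN_box_eq_UNIV by auto
    show "emeasure ?P (?A i) \<noteq> \<infinity>" for i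
      using fin(1)[of "?A i"] by (simp add: emeasure_density)
    show "emeasure ?P X = emeasure ?N X" if "X \<in> ?E" for X using that eq_box by auto
  qed
  then have "AE x in lborel. ennreal (G x) = ennreal (- G x)"
    by (subst (asm) sigma_finite_measure.density_unique_iff[OF sigma_finite_lborel]) auto
  then have "AE x in lborel. G x = 0"
  proof eventually_elim
    case (elim x)
    then show ?case by (cases "G x \<ge> 0") (auto simp: ennreal_neg ennreal_eq_0_iff)
  qed
  then have "AE x in lebesgue. G x = 0" by (rule AE_completion)
  with FG' show ?thesis by eventually_elim simp
qed

lemma integrable_lebesgue_on_iff:
  fixes f :: "'a::euclidean_space \<Rightarrow> real"
  assumes "S \<in> sets borel"
  shows "integrable (lebesgue_on S) f \<longleftrightarrow> integrable lebesgue (\<lambda>x. indicator S x * f x)"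
    "(\<integral>x. f x \<partial>lebesgue_on S) = (\<integral>x. indicator S x * f x \<partial>lebesgue)"
  using assms by (auto simp: integrable_restrict_space integral_restrict_space sets_completionI_sets)

lemma indicator_borel_lebesgue:
  "S \<in> sets borel \<Longrightarrow> (indicator S :: 'a::euclidean_space \<Rightarrow> real) \<in> borel_measurable lebesgue"
  by (intro measurable_completion) simp

lemma locally_integrable_mult_test:
  assumes "open \<Omega>" "locally_integrable \<Omega> g" "\<zeta> \<in> test_functions \<Omega>"
  shows "integrable (lebesgue_on \<Omega>) (\<lambda>x. g x * \<zeta> x)"
proof -
  obtain K where K: "smooth \<zeta>" "compact K" "K \<subseteq> \<Omega>" "\<And>x. x \<notin> K \<Longrightarrow> \<zeta> x = 0"
    using test_functionE[OF assms(3)] by metis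
  obtain B where B: "\<And>x. \<bar>\<zeta> x\<bar> \<le> B" using test_function_bounded[OF assms(3)] by metis
  have Kb: "K \<in> sets borel" using K(2) by (simp add: borel_closed compact_imp_closed)
  have gK: "integrable lebesgue (\<lambda>x. indicator K x * g x)"
    using assms(2) K integrable_lebesgue_on_iff(1)[OF Kb] by (auto simp: locally_integrable_def)
  have [measurable]: "\<zeta> \<in> borel_measurable lebesgue"
    by (intro measurable_completion) (simp add: borel_measurable_continuous_onI smooth_continuous[OF K(1)])
  have "integrable lebesgue (\<lambda>x. \<zeta> x * (indicator K x * g x))"
  proof (rule Bochner_Integration.integrable_bound)
    show "integrable lebesgue (\<lambda>x. B * (indicator K x * g x))" using gK by simp
    have "B \<ge> 0" using B[of 0] by linarith
    then show "AE x in lebesgue. norm (\<zeta> x * (indicator K x * g x)) \<le> norm (B * (indicator K x * g x))"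
      using B by (auto simp: abs_mult intro!: mult_right_mono)
  qed (use gK in measurable)
  moreover have "(\<lambda>x. \<zeta> x * (indicator K x * g x)) = (\<lambda>x. indicator \<Omega> x * (g x * \<zeta> x))"
    using K by (auto simp: fun_eq_iff split: split_indicator)
  ultimately show ?thesis using assms(1) by (simp add: integrable_lebesgue_on_iff)
qed

text \<open>Bump functions tend to indicators of boxes, so all integrals of \<open>f\<close> over
  boxes in \<Omega> vanish. Since \<open>f\<close> is only locally integrable,
  \<open>AE_zero_if_box_integrals_zero\<close> is applied to one box at a time, and countably many
  closed boxes cover \<Omega>.\<close>

lemma fundamental_lemma_variations:
  assumes \<Omega>: "open \<Omega>" and f: "locally_integrable \<Omega> f"
    and zero: "\<And>\<zeta>. \<zeta> \<in> test_functions \<Omega> \<Longrightarrow> (\<integral>x. f x * \<zeta> x \<partial>lebesgue_on \<Omega>) = 0"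
  shows "AE x in lebesgue_on \<Omega>. f x = 0"
proof -
  have cbox_int: "integrable lebesgue (\<lambda>x. indicator (cbox c d) x * f x)" if "cbox c d \<subseteq> \<Omega>" for c d
    using f that integrable_lebesgue_on_iff(1)[of "cbox c d" f] by (auto simp: locally_integrable_def)
  have box0: "(\<integral>x. indicator (box c d) x * f x \<partial>lebesgue) = 0" if cd: "cbox c d \<subseteq> \<Omega>" for c d
  proof -
    let ?h = "\<lambda>x. indicator (cbox c d) x * f x"
    have h: "integrable lebesgue ?h" by (rule cbox_int[OF cd])
    have bm: "box_bump c d k \<in> borel_measurable lebesgue" for k
      by (intro measurable_completion)
        (simp add: borel_measurable_continuous_onI smooth_continuous[OF smooth_box_bump])
    have "(\<lambda>k. \<integral>x. ?h x * box_bump c d k x \<partial>lebesgue) \<longlonglongrightarrow> (\<integral>x. ?h x * indicator (box c d) x \<partial>lebesgue)"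
    proof (rule integral_dominated_convergence[where w="\<lambda>x. norm (?h x)"])
      show "integrable lebesgue (\<lambda>x. norm (?h x))" using h by (rule integrable_norm)
      show "AE x in lebesgue. (\<lambda>k. ?h x * box_bump c d k x) \<longlonglongrightarrow> ?h x * indicator (box c d) x"
        by (intro AE_I2 tendsto_intros box_bump_tendsto)
      show "AE x in lebesgue. norm (?h x * box_bump c d k x) \<le> norm (?h x)" for k
        using box_bump_bounds[of c d k] by (auto simp: abs_mult intro!: mult_left_le)
      show "(\<lambda>x. ?h x * indicator (box c d) x) \<in> borel_measurable lebesgue"
        by (rule borel_measurable_times[OF borel_measurable_integrable[OF h] indicator_borel_lebesgue]) simp
      show "(\<lambda>x. ?h x * box_bump c d k x) \<in> borel_measurable lebesgue" for k
        by (rule borel_measurable_times[OF borel_measurable_integrable[OF h] bm])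
    qed
    moreover have "(\<integral>x. ?h x * box_bump c d k x \<partial>lebesgue) = 0" for k
    proof -
      have "(\<lambda>x. ?h x * box_bump c d k x) = (\<lambda>x. indicator \<Omega> x * (f x * box_bump c d k x))"
        using cd box_bump_outside[of _ c d k] box_subset_cbox[of c d]
        by (auto simp: fun_eq_iff split: split_indicator)
      then show ?thesis
        using zero[OF box_bump_test_function[OF cd]] \<Omega> by (simp add: integrable_lebesgue_on_iff)
    qed
    ultimately have "(\<integral>x. ?h x * indicator (box c d) x \<partial>lebesgue) = 0"
      by (simp add: LIMSEQ_const_iff)
    moreover have "(\<lambda>x. ?h x * indicator (box c d) x) = (\<lambda>x. indicator (box c d) x * f x)"
      using box_subset_cbox[of c d] by (auto simp: fun_eq_iff split: split_indicator)
    ultimately show ?thesis by simp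
  qed
  have AE_cbox: "AE x in lebesgue. x \<in> cbox c d \<longrightarrow> f x = 0" if cd: "cbox c d \<subseteq> \<Omega>" for c d
  proof -
    have "AE x in lebesgue. indicator (box c d) x * f x = 0"
    proof (rule AE_zero_if_box_integrals_zero)
      have "(\<lambda>x. indicator (box c d) x * f x) = (\<lambda>x. indicator (box c d) x *\<^sub>R (indicator (cbox c d) x * f x))"
        using box_subset_cbox[of c d] by (auto simp: fun_eq_iff split: split_indicator)
      then show "integrable lebesgue (\<lambda>x. indicator (box c d) x * f x)"
        using integrable_mult_indicator[OF _ cbox_int[OF cd], of "box c d"] by simp
      fix a b
      obtain a' b' where ab: "box a b \<inter> box c d = box a' b'" using box_Int_box[of a b c d] by blast
      have "(\<lambda>x. indicator (box a b) x * (indicator (box c d) x * f x)) = (\<lambda>x. indicator (box a' b') x * f x)"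
        unfolding ab[symmetric] by (auto simp: fun_eq_iff split: split_indicator)
      moreover have "(\<integral>x. indicator (box a' b') x * f x \<partial>lebesgue) = 0"
      proof (cases "box a' b' = {}")
        case False
        have "box a' b' \<subseteq> cbox c d" using ab box_subset_cbox[of c d] by auto
        then have "cbox a' b' \<subseteq> cbox c d"
          unfolding closure_box[OF False, symmetric] by (rule closure_minimal[OF _ closed_cbox])
        then show ?thesis using cd by (intro box0) auto
      qed simp
      ultimately show "(\<integral>x. indicator (box a b) x * (indicator (box c d) x * f x) \<partial>lebesgue) = 0" by simp
    qed
    \<comment> \<open>The argument yields open boxes, the cover consists of closed ones; the
      difference is a null set.\<close>
    moreover have "AE x in lebesgue. x \<notin> cbox c d - box c d"
      using negligible_frontier_interval[of c d] by (intro AE_not_in) (simp add: negligible_iff_null_sets)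
    ultimately show ?thesis by eventually_elim auto
  qed
  obtain \<D> where \<D>: "countable \<D>" "\<D> \<subseteq> Pow \<Omega>" "\<And>X. X \<in> \<D> \<Longrightarrow> \<exists>a b. X = cbox a b" "\<Union>\<D> = \<Omega>"
    using open_countable_Union_open_cbox[OF \<Omega>] by metis
  have "AE x in lebesgue. \<forall>X\<in>\<D>. x \<in> X \<longrightarrow> f x = 0"
  proof (subst AE_ball_countable[OF \<D>(1)], intro ballI)
    fix X assume X: "X \<in> \<D>"
    then obtain a b where "X = cbox a b" using \<D>(3) by blast
    then show "AE x in lebesgue. x \<in> X \<longrightarrow> f x = 0" using AE_cbox[of a b] X \<D>(2) by auto
  qed
  then have "AE x in lebesgue. x \<in> \<Omega> \<longrightarrow> f x = 0" unfolding \<D>(4)[symmetric] by eventually_elim auto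
  then show ?thesis using \<Omega> by (subst AE_restrict_space_iff) (auto simp: sets_completionI_sets)
qed

lemma locally_integrable_diff:
  "locally_integrable \<Omega> f \<Longrightarrow> locally_integrable \<Omega> g \<Longrightarrow> locally_integrable \<Omega> (\<lambda>x. f x - g x)"
  by (simp add: locally_integrable_def)

text \<open>Letting \<open>u\<close> and \<open>u'\<close> agree only almost everywhere makes the
  lemma show as well that weak derivatives do not depend on the representative.\<close>

lemma has_weak_partial_unique:
  assumes \<Omega>: "open \<Omega>" and g: "has_weak_partial \<Omega> i u g" and g': "has_weak_partial \<Omega> i u' g'"
    and eq: "AE x in lebesgue_on \<Omega>. u x = u' x"
  shows "AE x in lebesgue_on \<Omega>. g x = g' x"
proof -
  have li: "locally_integrable \<Omega> g" "locally_integrable \<Omega> g'" "locally_integrable \<Omega> u" "locally_integrable \<Omega> u'"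
    using g g' by (auto simp: has_weak_partial_def)
  have "AE x in lebesgue_on \<Omega>. g x - g' x = 0"
  proof (rule fundamental_lemma_variations[OF \<Omega> locally_integrable_diff[OF li(1,2)]])
    fix \<zeta> assume \<zeta>: "\<zeta> \<in> test_functions \<Omega>"
    note int = locally_integrable_mult_test[OF \<Omega> li(1) \<zeta>] locally_integrable_mult_test[OF \<Omega> li(2) \<zeta>]
    have "(\<integral>x. u x * partial_deriv i \<zeta> x \<partial>lebesgue_on \<Omega>) = (\<integral>x. u' x * partial_deriv i \<zeta> x \<partial>lebesgue_on \<Omega>)"
    proof (rule integral_cong_AE)
      show "(\<lambda>x. u x * partial_deriv i \<zeta> x) \<in> borel_measurable (lebesgue_on \<Omega>)"
        "(\<lambda>x. u' x * partial_deriv i \<zeta> x) \<in> borel_measurable (lebesgue_on \<Omega>)"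
        using locally_integrable_mult_test[OF \<Omega> li(3) test_function_partial_deriv[OF \<zeta>]]
          locally_integrable_mult_test[OF \<Omega> li(4) test_function_partial_deriv[OF \<zeta>]] by auto
      show "AE x in lebesgue_on \<Omega>. u x * partial_deriv i \<zeta> x = u' x * partial_deriv i \<zeta> x"
        using eq by eventually_elim simp
    qed
    then have "(\<integral>x. g x * \<zeta> x \<partial>lebesgue_on \<Omega>) = (\<integral>x. g' x * \<zeta> x \<partial>lebesgue_on \<Omega>)"
      using g g' \<zeta> by (simp add: has_weak_partial_def)
    then show "(\<integral>x. (g x - g' x) * \<zeta> x \<partial>lebesgue_on \<Omega>) = 0"
      using int by (simp add: left_diff_distrib)
  qed
  then show ?thesis by simp
qed

text \<open>The choice inside \<open>weak_grad\<close> is arbitrary, but any gradient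
  \<open>w\<close> known from elsewhere agrees with it almost everywhere.\<close>

lemma weak_grad_AE:
  assumes \<Omega>: "open \<Omega>" and w: "\<And>i. has_weak_partial \<Omega> i u (\<lambda>x. w x $ i)"
    and eq: "AE x in lebesgue_on \<Omega>. u x = u' x" and ex: "\<And>i. \<exists>g. has_weak_partial \<Omega> i u' g"
  shows "AE x in lebesgue_on \<Omega>. weak_grad \<Omega> u' x = w x"
proof -
  have "AE x in lebesgue_on \<Omega>. \<forall>i\<in>UNIV. (SOME g. has_weak_partial \<Omega> i u' g) x = w x $ i"
  proof (subst AE_ball_countable, simp, intro ballI)
    fix i
    have "AE x in lebesgue_on \<Omega>. w x $ i = (SOME g. has_weak_partial \<Omega> i u' g) x"
      by (rule has_weak_partial_unique[OF \<Omega> w someI_ex[OF ex] eq])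
    then show "AE x in lebesgue_on \<Omega>. (SOME g. has_weak_partial \<Omega> i u' g) x = w x $ i"
      by eventually_elim simp
  qed
  then show ?thesis by eventually_elim (simp add: weak_grad_def vec_eq_iff)
qed

text \<open>An open set is a countable union of compact subsets, and on each of them integrability
  contains measurability.\<close>

lemma locally_integrable_measurable:
  assumes \<Omega>: "open \<Omega>" and f: "locally_integrable \<Omega> f"
  shows "f \<in> borel_measurable (lebesgue_on \<Omega>)"
proof -
  obtain C where C: "\<And>n::nat. compact (C n)" "\<And>n. C n \<subseteq> \<Omega>" "\<Union>(range C) = \<Omega>"
    using open_Union_compact_subsets[OF \<Omega>] by metis
  show ?thesis
  proof (rule measurable_piecewise_restrict[of "range C"])
    have b: "C n \<in> sets lebesgue" for n
      using C(1)[of n] by (simp add: borel_closed compact_imp_closed sets_completionI_sets)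
    have \<Omega>b: "\<Omega> \<in> sets lebesgue" using \<Omega> by (simp add: sets_completionI_sets)
    show "countable (range C)" by simp
    show "space (lebesgue_on \<Omega>) \<subseteq> \<Union>(range C)" using C(3) by (simp add: space_restrict_space)
    fix S assume "S \<in> range C"
    then obtain n where S: "S = C n" by auto
    show "S \<inter> space (lebesgue_on \<Omega>) \<in> sets (lebesgue_on \<Omega>)"
      using b[of n] C(2)[of n] \<Omega>b by (auto simp: S sets_restrict_space space_restrict_space)
    have "restrict_space (lebesgue_on \<Omega>) S = lebesgue_on S"
      using b[of n] \<Omega>b C(2)[of n] by (subst restrict_restrict_space) (auto simp: S Int_absorb1)
    then show "f \<in> borel_measurable (restrict_space (lebesgue_on \<Omega>) S)"
      using f C S by (auto simp: locally_integrable_def)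
  qed
qed

lemma has_weak_partial_diff:
  assumes \<Omega>: "open \<Omega>" and g: "has_weak_partial \<Omega> i u g" and g': "has_weak_partial \<Omega> i u' g'"
  shows "has_weak_partial \<Omega> i (\<lambda>x. u x - u' x) (\<lambda>x. g x - g' x)"
  unfolding has_weak_partial_def
proof (intro conjI ballI)
  have li: "locally_integrable \<Omega> g" "locally_integrable \<Omega> g'" "locally_integrable \<Omega> u" "locally_integrable \<Omega> u'"
    using g g' by (auto simp: has_weak_partial_def)
  show "locally_integrable \<Omega> (\<lambda>x. u x - u' x)" "locally_integrable \<Omega> (\<lambda>x. g x - g' x)"
    using li by (auto intro: locally_integrable_diff)
  fix \<zeta> assume \<zeta>: "\<zeta> \<in> test_functions \<Omega>"
  note int = locally_integrable_mult_test[OF \<Omega> li(1) \<zeta>] locally_integrable_mult_test[OF \<Omega> li(2) \<zeta>]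
    locally_integrable_mult_test[OF \<Omega> li(3) test_function_partial_deriv[OF \<zeta>]]
    locally_integrable_mult_test[OF \<Omega> li(4) test_function_partial_deriv[OF \<zeta>]]
  show "(\<integral>x. (u x - u' x) * partial_deriv i \<zeta> x \<partial>lebesgue_on \<Omega>) =
      - (\<integral>x. (g x - g' x) * \<zeta> x \<partial>lebesgue_on \<Omega>)"
    using int g g' \<zeta> by (simp add: left_diff_distrib has_weak_partial_def)
qed

lemma integrable_imp_locally_integrable:
  assumes \<Omega>: "open \<Omega>" and f: "integrable (lebesgue_on \<Omega>) f"
  shows "locally_integrable \<Omega> f"
  unfolding locally_integrable_def
proof (intro allI impI)
  fix K assume K: "compact K \<and> K \<subseteq> \<Omega>"
  then have Kb: "K \<in> sets borel" by (simp add: borel_closed compact_imp_closed)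
  have "integrable lebesgue (\<lambda>x. indicator \<Omega> x * f x)"
    using f \<Omega> by (simp add: integrable_lebesgue_on_iff)
  then have "integrable lebesgue (\<lambda>x. indicator K x *\<^sub>R (indicator \<Omega> x * f x))"
    using Kb by (intro integrable_mult_indicator) (auto simp: sets_completionI_sets)
  moreover have "(\<lambda>x. indicator K x *\<^sub>R (indicator \<Omega> x * f x)) = (\<lambda>x. indicator K x * f x)"
    using K by (auto simp: fun_eq_iff split: split_indicator)
  ultimately show "integrable (lebesgue_on K) f" using Kb by (simp add: integrable_lebesgue_on_iff)
qed

lemma test_function_mult:
  assumes "f \<in> test_functions \<Omega>" "smooth g"
  shows "(\<lambda>x. f x * g x) \<in> test_functions \<Omega>"
  by (rule test_functionE[OF assms(1)]) (auto intro!: test_functionI smooth_mult assms)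

section \<open>Weak gradients of limits of test functions\<close>

context domain
begin

lemma integral_M_lborel:
  fixes f :: "real^'n \<Rightarrow> real"
  assumes "f \<in> borel_measurable borel" "\<And>x. x \<notin> \<Omega> \<Longrightarrow> f x = 0"
  shows "(\<integral>x. f x \<partial>M) = (\<integral>x. f x \<partial>lborel)"
proof -
  have "(\<lambda>x. indicator \<Omega> x * f x) = f" using assms(2) by (auto simp: fun_eq_iff split: split_indicator)
  then show ?thesis
    using open_dom assms(1) by (simp add: integrable_lebesgue_on_iff(2) integral_completion)
qed

text \<open>Difference quotients of \<open>F\<close> have integral 0 by translation invariance; the
  Lipschitz bound dominates them by a constant on a ball, and dominated convergence gives the
  derivative.\<close>

lemma integral_partial_deriv_test:
  assumes F: "F \<in> \<T>" shows "(\<integral>x. partial_deriv i F x \<partial>M) = 0"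
proof -
  have [measurable]: "F \<in> borel_measurable borel" "partial_deriv i F \<in> borel_measurable borel"
    using test_borel(1)[OF F] test_borel(1)[OF test_function_partial_deriv[OF F]] by auto
  obtain B where B: "B > 0" "\<And>x. \<bar>F x\<bar> \<le> B" "\<And>x. norm (grad F x) \<le> B"
    using test_function_bounded[OF F] by metis
  obtain R where R: "R > 0" "\<And>x. x \<in> \<Omega> \<Longrightarrow> norm x \<le> R"
    using bounded_dom by (auto simp: bounded_pos)
  \<comment> \<open>The increments \<open>t k\<close> are at most 1, so the ball of radius R + 1
    contains the supports of all difference quotients.\<close>
  have ball_int: "integrable lborel (\<lambda>x. B * indicator (cball 0 (R + 1)) x :: real)"
    by (intro integrable_mult_right integrable_real_indicator) (simp_all add: emeasure_bounded_finite[unfolded infinity_ennreal_def])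
  have F_int: "integrable lborel F"
  proof (rule Bochner_Integration.integrable_bound[OF ball_int])
    have "\<bar>F x\<bar> \<le> \<bar>B * indicator (cball 0 (R + 1)) x\<bar>" for x
      using B R(2)[of x] test_function_zero[OF F, of x] by (cases "x \<in> \<Omega>") (auto split: split_indicator)
    then show "AE x in lborel. norm (F x) \<le> norm (B * indicator (cball 0 (R + 1)) x)" by simp
  qed simp
  define t where "t k = inverse (real (Suc k))" for k
  have t: "0 < t k" "t k \<le> 1" for k by (auto simp: t_def inverse_le_1_iff)
  define e :: "real^'n" where "e = axis i 1"
  define D where "D k x = (F (x + t k *\<^sub>R e) - F x) / t k" for k x
  have tr: "integrable lborel (\<lambda>x. F (x + c))" "(\<integral>x. F (x + c) \<partial>lborel) = (\<integral>x. F x \<partial>lborel)" for c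
  proof -
    have "integrable (distr lborel borel ((+) c)) F" using F_int by (simp add: lborel_distr_plus)
    then show "integrable lborel (\<lambda>x. F (x + c))"
      by (subst (asm) integrable_distr_eq) (auto simp: add.commute)
    have "(\<integral>x. F x \<partial>lborel) = (\<integral>x. F x \<partial>distr lborel borel ((+) c))" by (simp add: lborel_distr_plus)
    also have "\<dots> = (\<integral>x. F (c + x) \<partial>lborel)" by (subst integral_distr) auto
    finally show "(\<integral>x. F (x + c) \<partial>lborel) = (\<integral>x. F x \<partial>lborel)" by (simp add: add.commute)
  qed
  have D0: "(\<integral>x. D k x \<partial>lborel) = 0" for k
    using tr F_int unfolding D_def by simp
  have "(\<lambda>k. \<integral>x. D k x \<partial>lborel) \<longlonglongrightarrow> (\<integral>x. partial_deriv i F x \<partial>lborel)"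
  proof (rule integral_dominated_convergence[OF _ _ ball_int])
    show "D k \<in> borel_measurable lborel" for k unfolding D_def by measurable
    show "AE x in lborel. (\<lambda>k. D k x) \<longlonglongrightarrow> partial_deriv i F x"
    proof (rule AE_I2)
      fix x
      have line: "((\<lambda>s. x + s *\<^sub>R e) has_derivative (\<lambda>s. s *\<^sub>R e)) (at 0)"
        by (auto intro!: derivative_eq_intros)
      have "((\<lambda>s. F (x + s *\<^sub>R e)) has_real_derivative grad F x \<bullet> e) (at 0)"
        using has_derivative_compose[OF line, of F "\<lambda>h. grad F x \<bullet> h"] smooth_has_derivative[OF test_function_smooth[OF F], of x]
        unfolding has_field_derivative_def by (simp add: mult_commute_abs)
      then have "((\<lambda>s. (F (x + s *\<^sub>R e) - F x) / s) \<longlongrightarrow> grad F x \<bullet> e) (at 0)"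
        by (simp add: DERIV_def)
      moreover have "filterlim t (at 0) sequentially"
        using t LIMSEQ_inverse_real_of_nat unfolding t_def[abs_def] by (intro filterlim_atI) auto
      ultimately show "(\<lambda>k. D k x) \<longlonglongrightarrow> partial_deriv i F x"
        unfolding D_def by (auto dest: filterlim_compose simp: e_def inner_axis grad_def)
    qed
    show "AE x in lborel. norm (D k x) \<le> B * indicator (cball 0 (R + 1)) x" for k
    proof (rule AE_I2)
      fix x
      have te: "norm (t k *\<^sub>R e) = t k" using t[of k] by (simp add: e_def)
      have "\<bar>F (x + t k *\<^sub>R e) - F x\<bar> \<le> B * t k"
        using smooth_lipschitz[OF test_function_smooth[OF F] B(3), of "x + t k *\<^sub>R e" x] te by simp
      then have "\<bar>D k x\<bar> \<le> B" using t[of k] by (simp add: D_def abs_divide divide_le_eq)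
      moreover have "D k x = 0" if "x \<notin> cball 0 (R + 1)"
      proof -
        have nx: "norm x > R + 1" using that by simp
        have "norm (x + t k *\<^sub>R e) \<ge> norm x - norm (t k *\<^sub>R e)" by (metis norm_diff_ineq)
        then have "norm (x + t k *\<^sub>R e) > R" using nx t(2)[of k] te by linarith
        then have "x + t k *\<^sub>R e \<notin> \<Omega>" "x \<notin> \<Omega>" using R nx by (fastforce simp: not_le[symmetric])+
        then show ?thesis using test_function_zero[OF F] by (simp add: D_def)
      qed
      ultimately show "norm (D k x) \<le> B * indicator (cball 0 (R + 1)) x"
        by (cases "x \<in> cball 0 (R + 1)") auto
    qed
  qed simp
  then have "(\<integral>x. partial_deriv i F x \<partial>lborel) = 0" by (simp add: D0 LIMSEQ_const_iff)
  then show ?thesis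
    using test_function_zero[OF test_function_partial_deriv[OF F]] by (subst integral_M_lborel) auto
qed

lemma integrable_test_mult:
  assumes "f \<in> \<T>" "g \<in> \<T>" shows "integrable M (\<lambda>x. f x * g x)"
proof -
  have fg: "(\<lambda>x. f x * g x) \<in> \<T>" by (rule test_function_mult[OF assms(1) test_function_smooth[OF assms(2)]])
  obtain B where B: "\<And>x. \<bar>f x * g x\<bar> \<le> B" using test_function_bounded[OF fg] by metis
  then show ?thesis using test_measurable[OF fg] by (intro integrable_bounded[where B=B]) auto
qed

lemma integration_by_parts_test:
  assumes "f \<in> \<T>" "g \<in> \<T>"
  shows "(\<integral>x. f x * partial_deriv i g x \<partial>M) = - (\<integral>x. partial_deriv i f x * g x \<partial>M)"
proof -
  have fg: "(\<lambda>x. f x * g x) \<in> \<T>" by (rule test_function_mult[OF assms(1) test_function_smooth[OF assms(2)]])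
  have "partial_deriv i (\<lambda>x. f x * g x) x = f x * partial_deriv i g x + partial_deriv i f x * g x" for x
    using partial_deriv_eqI[OF has_derivative_mult[OF
          smooth_has_derivative[OF test_function_smooth[OF assms(1)]]
          smooth_has_derivative[OF test_function_smooth[OF assms(2)]]]]
    by (simp add: inner_axis grad_def)
  then have "(\<integral>x. f x * partial_deriv i g x + partial_deriv i f x * g x \<partial>M) = 0"
    using integral_partial_deriv_test[OF fg, of i] by simp
  then show ?thesis
    using integrable_test_mult[OF assms(1) test_function_partial_deriv[OF assms(2)]]
      integrable_test_mult[OF test_function_partial_deriv[OF assms(1)] assms(2)] by simp
qed

lemma dominated_integrable:
  fixes f :: "real^'n \<Rightarrow> real"
  assumes \<tau>: "dominator \<tau>" and f: "f \<in> borel_measurable M" "AE x in M. \<bar>f x\<bar> \<le> \<tau> x"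
  shows "integrable M f"
proof -
  obtain C where C: "\<And>t. \<bar>t\<bar> \<le> \<Phi> t + C" using powr_le_Phi by metis
  show ?thesis
  proof (rule Bochner_Integration.integrable_bound)
    show "integrable M (\<lambda>x. \<Phi> (\<tau> x) + C)" using \<tau> by (simp add: dominator_def)
    show "AE x in M. norm (f x) \<le> norm (\<Phi> (\<tau> x) + C)"
      using f(2)
    proof eventually_elim
      case (elim x)
      have "\<tau> x \<le> \<Phi> (\<tau> x) + C" using C[of "\<tau> x"] by linarith
      with elim show ?case by simp
    qed
  qed (rule f)
qed

lemma dlim_integral_mult:
  fixes U :: "real^'n \<Rightarrow> real"
  assumes \<tau>: "dominator \<tau>" and u: "dlim \<tau> u U" and f: "f \<in> \<T>"
  shows "(\<lambda>k. \<integral>x. u k x * f x \<partial>M) \<longlonglongrightarrow> (\<integral>x. U x * f x \<partial>M)"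
proof -
  obtain B where B: "B > 0" "\<And>x. \<bar>f x\<bar> \<le> B" using test_function_bounded[OF f] by metis
  note [measurable] = test_measurable[OF f]
  have [measurable]: "u k \<in> borel_measurable M" "U \<in> borel_measurable M" for k using u by (auto simp: dlim_def)
  have \<tau>int: "integrable M \<tau>" using \<tau> by (intro dominated_integrable[OF \<tau>]) (auto simp: dominator_def)
  show ?thesis
  proof (rule integral_dominated_convergence[where w="\<lambda>x. B * \<tau> x"])
    show "integrable M (\<lambda>x. B * \<tau> x)" using \<tau>int by simp
    have "AE x in M. (\<lambda>k. u k x) \<longlonglongrightarrow> U x" using u by (simp add: dlim_def)
    then show "AE x in M. (\<lambda>k. u k x * f x) \<longlonglongrightarrow> U x * f x" by eventually_elim (intro tendsto_intros)
    have "AE x in M. \<forall>k. norm (u k x) \<le> \<tau> x" using u by (simp add: dlim_def)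
    then show "AE x in M. norm (u k x * f x) \<le> B * \<tau> x" for k
    proof eventually_elim
      case (elim x)
      have "\<bar>u k x\<bar> * \<bar>f x\<bar> \<le> \<tau> x * B" using elim B by (intro mult_mono) (auto intro: order_trans[OF norm_ge_zero])
      then show ?case by (simp add: abs_mult mult.commute)
    qed
  qed measurable
qed

lemma dlim_nth:
  assumes "dlim \<tau> w (W :: real^'n \<Rightarrow> real^'m::finite)" shows "dlim \<tau> (\<lambda>k x. w k x $ i) (\<lambda>x. W x $ i)"
  unfolding dlim_def
proof (intro conjI allI)
  have [measurable]: "w k \<in> borel_measurable M" "W \<in> borel_measurable M" for k
    using assms by (auto simp: dlim_def)
  have [measurable]: "(\<lambda>x::real^'m. x $ i) \<in> borel_measurable borel"
    by (intro borel_measurable_continuous_onI continuous_intros)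
  show "(\<lambda>x. w k x $ i) \<in> borel_measurable M" for k by measurable
  show "(\<lambda>x. W x $ i) \<in> borel_measurable M" by measurable
  have "AE x in M. (\<lambda>k. w k x) \<longlonglongrightarrow> W x" using assms by (simp add: dlim_def)
  then show "AE x in M. (\<lambda>k. w k x $ i) \<longlonglongrightarrow> W x $ i" by eventually_elim (intro tendsto_intros)
  have "AE x in M. \<forall>k. norm (w k x) \<le> \<tau> x" using assms by (simp add: dlim_def)
  then show "AE x in M. \<forall>k. norm (w k x $ i) \<le> \<tau> x"
    by eventually_elim (auto intro: order_trans[OF component_le_norm_cart])
qed

text \<open>Integration by parts for test functions passes to the limit on both sides; this
  identifies \<open>W\<close> as the weak gradient of \<open>U\<close>.\<close>

lemma dlim_has_weak_partial:
  assumes \<tau>: "dominator \<tau>" and u: "\<And>k. u k \<in> \<T>" "dlim \<tau> u U" "dlim \<tau> (\<lambda>k. grad (u k)) W"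
  shows "has_weak_partial \<Omega> i U (\<lambda>x. W x $ i)"
  unfolding has_weak_partial_def
proof (intro conjI ballI)
  have loc: "locally_integrable \<Omega> F" if "dlim \<tau> f F" for f and F :: "real^'n \<Rightarrow> real"
    using dlim_limit_bound[OF that] that
    by (intro integrable_imp_locally_integrable[OF open_dom] dominated_integrable[OF \<tau>]) (auto simp: dlim_def)
  have W: "dlim \<tau> (\<lambda>k x. partial_deriv i (u k) x) (\<lambda>x. W x $ i)"
    using dlim_nth[OF u(3), of i] by (simp add: grad_nth)
  show "locally_integrable \<Omega> U" "locally_integrable \<Omega> (\<lambda>x. W x $ i)"
    using loc[OF u(2)] loc[OF W] by auto
  fix \<zeta> assume \<zeta>: "\<zeta> \<in> \<T>"
  have "(\<lambda>k. \<integral>x. u k x * partial_deriv i \<zeta> x \<partial>M) \<longlonglongrightarrow> (\<integral>x. U x * partial_deriv i \<zeta> x \<partial>M)"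
    by (rule dlim_integral_mult[OF \<tau> u(2) test_function_partial_deriv[OF \<zeta>]])
  moreover have "(\<lambda>k. - (\<integral>x. partial_deriv i (u k) x * \<zeta> x \<partial>M)) \<longlonglongrightarrow> - (\<integral>x. W x $ i * \<zeta> x \<partial>M)"
    by (intro tendsto_minus dlim_integral_mult[OF \<tau> W \<zeta>])
  ultimately show "(\<integral>x. U x * partial_deriv i \<zeta> x \<partial>M) = - (\<integral>x. W x $ i * \<zeta> x \<partial>M)"
    unfolding integration_by_parts_test[OF u(1) \<zeta>] by (rule LIMSEQ_unique)
qed

lemma test_has_weak_partial:
  assumes "u \<in> \<T>" shows "has_weak_partial \<Omega> i u (\<lambda>x. grad u x $ i)"
proof -
  obtain c where "c \<ge> 0" "dlim (\<lambda>x. c) (\<lambda>k. u) u" "dlim (\<lambda>x. c) (\<lambda>k. grad u) (grad u)"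
    using test_dlim_const[OF assms] by metis
  then show ?thesis using assms by (intro dlim_has_weak_partial[OF dominator_const]) auto
qed

end

section \<open>Membership in the Orlicz--Sobolev space\<close>

lemma luxemburg_norm_cong_AE:
  assumes "AE x in lebesgue_on \<Omega>. u x = v x"
  shows "luxemburg_norm F \<Omega> u = luxemburg_norm F \<Omega> v"
proof -
  have "(\<integral>\<^sup>+x. ennreal (F (u x / k)) \<partial>lebesgue_on \<Omega>) = (\<integral>\<^sup>+x. ennreal (F (v x / k)) \<partial>lebesgue_on \<Omega>)" for k
    by (rule nn_integral_cong_AE) (use assms in \<open>eventually_elim, simp\<close>)
  then show ?thesis by (simp add: luxemburg_norm_def)
qed

context domain
begin

lemma luxemburg_less_modular:
  assumes [measurable]: "u \<in> borel_measurable M" and less: "luxemburg_norm \<Phi> \<Omega> u < e"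
  obtains k where "k > 0" "ennreal k < e" "integrable M (\<lambda>x. \<Phi> (u x))" "integrable M (\<lambda>x. \<Phi> (u x / k))"
    "(\<integral>x. \<Phi> (u x / k) \<partial>M) \<le> 1"
proof -
  obtain k where k: "k > 0" "(\<integral>\<^sup>+x. ennreal (\<Phi> (u x / k)) \<partial>M) \<le> 1" "ennreal k < e"
    using less unfolding luxemburg_norm_def Inf_less_iff by auto
  have int: "integrable M (\<lambda>x. \<Phi> (u x / k))"
    using k(2) by (intro integrableI_bounded) (auto intro: order.strict_trans1)
  have "integrable M (\<lambda>x. \<Phi> (k * (u x / k)))" by (intro integrable_Phi_scale int) measurable
  then have "integrable M (\<lambda>x. \<Phi> (u x))" using k(1) by simp
  moreover have "(\<integral>x. \<Phi> (u x / k) \<partial>M) \<le> 1"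
  proof -
    have "ennreal (\<integral>x. \<Phi> (u x / k) \<partial>M) \<le> ennreal 1"
      using k(2) by (simp add: nn_integral_eq_integral[OF int, symmetric])
    then show ?thesis by (subst (asm) ennreal_le_iff) auto
  qed
  ultimately show ?thesis using k int that by blast
qed

lemma luxemburg_le:
  assumes "k > 0" "integrable M (\<lambda>x. \<Phi> (u x / k))" "(\<integral>x. \<Phi> (u x / k) \<partial>M) \<le> 1"
  shows "luxemburg_norm \<Phi> \<Omega> u \<le> ennreal k"
proof -
  have "(\<integral>\<^sup>+x. ennreal (\<Phi> (u x / k)) \<partial>M) = ennreal (\<integral>x. \<Phi> (u x / k) \<partial>M)"
    using assms(2) by (intro nn_integral_eq_integral) auto
  also have "\<dots> \<le> 1" using assms(3) by (simp add: ennreal_le_1)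
  finally show ?thesis unfolding luxemburg_norm_def using assms(1) by (intro Inf_lower) auto
qed

text \<open>By doubling, integrability of \<Phi>(u/k) for one k gives that of \<Phi>(u). Conversely
  the maximum of 1 and the modular of \<open>u\<close> is admissible in the norm by
  \<open>Phi_shrink\<close>.\<close>

lemma orlicz_space_iff:
  "u \<in> orlicz_space \<Phi> \<Omega> \<longleftrightarrow> u \<in> borel_measurable M \<and> integrable M (\<lambda>x. \<Phi> (u x))"
proof (intro iffI conjI)
  assume u: "u \<in> orlicz_space \<Phi> \<Omega>"
  then show m: "u \<in> borel_measurable M" by (simp add: orlicz_space_def)
  have "luxemburg_norm \<Phi> \<Omega> u < \<infinity>" using u by (simp add: orlicz_space_def)
  then show "integrable M (\<lambda>x. \<Phi> (u x))" by (rule luxemburg_less_modular[OF m])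
next
  assume u: "u \<in> borel_measurable M \<and> integrable M (\<lambda>x. \<Phi> (u x))"
  define k where "k = max 1 (\<integral>x. \<Phi> (u x) \<partial>M)"
  have k: "k \<ge> 1" "(\<integral>x. \<Phi> (u x) \<partial>M) \<le> k" by (auto simp: k_def)
  have int: "integrable M (\<lambda>x. \<Phi> (u x / k))"
    using integrable_Phi_scale[of M u "inverse k"] u by (simp add: divide_inverse mult.commute)
  have "(\<integral>x. \<Phi> (u x / k) \<partial>M) \<le> inverse k * (\<integral>x. \<Phi> (u x) \<partial>M)"
    using integral_Phi_shrink[of "inverse k" u] u k by (simp add: divide_inverse mult.commute inverse_le_1_iff)
  also have "\<dots> \<le> inverse k * k" using k by (intro mult_left_mono) auto
  also have "\<dots> = 1" using k by simp
  finally have "luxemburg_norm \<Phi> \<Omega> u \<le> ennreal k" using k int by (intro luxemburg_le) auto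
  then show "u \<in> orlicz_space \<Phi> \<Omega>"
    using u by (auto simp: orlicz_space_def intro: order.strict_trans1)
qed

lemma weak_grad_measurable:
  assumes "\<And>i. \<exists>g. has_weak_partial \<Omega> i v g"
  shows "weak_grad \<Omega> v \<in> borel_measurable M"
proof -
  have "(\<lambda>x. weak_grad \<Omega> v x \<bullet> b) \<in> borel_measurable M" if bB: "b \<in> Basis" for b
  proof -
    obtain i where b: "b = axis i 1" using bB by (auto simp: Basis_vec_def)
    have "locally_integrable \<Omega> (SOME g. has_weak_partial \<Omega> i v g)"
      using someI_ex[OF assms[of i]] unfolding has_weak_partial_def[of _ _ _ "SOME g. has_weak_partial \<Omega> i v g"]
      by blast
    from locally_integrable_measurable[OF open_dom this]
    show ?thesis by (simp add: b inner_axis weak_grad_def)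
  qed
  then show ?thesis by (subst borel_measurable_euclidean_space) auto
qed

text \<open>Division by \<open>e\<close> enlarges a modular by at most the fixed factor
  (1/e)^\<sigma>, so the result is eventually below 1.\<close>

lemma modular_tendsto_0_luxemburg:
  fixes f :: "nat \<Rightarrow> real^'n \<Rightarrow> real"
  assumes f: "\<And>k. f k \<in> borel_measurable M" "\<And>k. integrable M (\<lambda>x. \<Phi> (f k x))"
    and lim: "(\<lambda>k. \<integral>x. \<Phi> (f k x) \<partial>M) \<longlonglongrightarrow> 0" and e: "0 < e" "e \<le> 1"
  shows "\<forall>\<^sub>F k in sequentially. luxemburg_norm \<Phi> \<Omega> (f k) \<le> ennreal e"
proof -
  have "(\<lambda>k. (1 / e) powr \<sigma> * (\<integral>x. \<Phi> (f k x) \<partial>M)) \<longlonglongrightarrow> (1 / e) powr \<sigma> * 0"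
    by (intro tendsto_intros lim)
  then have "\<forall>\<^sub>F k in sequentially. (1 / e) powr \<sigma> * (\<integral>x. \<Phi> (f k x) \<partial>M) < 1"
    by (intro order_tendstoD(2)[where y="(1 / e) powr \<sigma> * 0"]) auto
  then show ?thesis
  proof eventually_elim
    case (elim k)
    have "(\<integral>x. \<Phi> (1 / e * f k x) \<partial>M) \<le> (1 / e) powr \<sigma> * (\<integral>x. \<Phi> (f k x) \<partial>M)"
      using e f by (intro integral_Phi_scale) auto
    moreover have "integrable M (\<lambda>x. \<Phi> (1 / e * f k x))" by (intro integrable_Phi_scale f)
    ultimately show ?case using elim e by (intro luxemburg_le) auto
  qed
qed

text \<open>The modulars of U - u_k and of the gradient differences tend to 0 along a
  \<open>dlim\<close>, hence so do the norms, and the test functions \<open>u k\<close> show that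
  \<open>U\<close> lies in the closure.\<close>

lemma limit_in_W01L:
  assumes \<tau>: "dominator \<tau>" and u: "\<And>k. u k \<in> \<T>" "dlim \<tau> u U" "dlim \<tau> (\<lambda>k. grad (u k)) W"
  shows "U \<in> W01L \<Phi> \<Omega>" "AE x in M. weak_grad \<Omega> U x = W x"
proof -
  have wp: "has_weak_partial \<Omega> i U (\<lambda>x. W x $ i)" for i by (rule dlim_has_weak_partial[OF \<tau> u])
  have Wm [measurable]: "W \<in> borel_measurable M" and Um [measurable]: "U \<in> borel_measurable M"
    using u by (auto simp: dlim_def)
  note [measurable] = test_measurable[OF u(1)]
  show "AE x in M. weak_grad \<Omega> U x = W x"
    using wp by (intro weak_grad_AE[OF open_dom wp]) auto
  have U_int: "integrable M (\<lambda>x. \<Phi> (U x))" and W_int: "integrable M (\<lambda>x. \<Phi> (norm (W x)))"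
    using dlim_Phi(2)[OF \<tau> u(2)] dlim_Phi(2)[OF \<tau> u(3)] by auto
  have Wi_meas: "(\<lambda>x. W x $ i) \<in> borel_measurable M" for i
    using dlim_nth[OF u(3), of i] by (simp add: dlim_def)
  have "(\<lambda>x. W x $ i) \<in> orlicz_space \<Phi> \<Omega>" for i
    unfolding orlicz_space_iff using Wi_meas
    by (auto intro!: integrable_Phi_mono[OF W_int] simp: component_le_norm_cart)
  moreover have "U \<in> orlicz_space \<Phi> \<Omega>" using U_int by (simp add: orlicz_space_iff)
  ultimately have W1: "U \<in> W1L \<Phi> \<Omega>" using wp by (auto simp: W1L_def)
  have diff_grad: "AE x in M. weak_grad \<Omega> (\<lambda>x. U x - u k x) x = W x - grad (u k) x" for k
  proof -
    have "has_weak_partial \<Omega> i (\<lambda>x. U x - u k x) (\<lambda>x. (W x - grad (u k) x) $ i)" for i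
      using has_weak_partial_diff[OF open_dom wp test_has_weak_partial[OF u(1)]] by simp
    then show ?thesis by (intro weak_grad_AE[OF open_dom]) auto
  qed
  have lim1: "(\<lambda>k. \<integral>x. \<Phi> (U x - u k x) \<partial>M) \<longlonglongrightarrow> 0"
    using dlim_Phi(3)[OF \<tau> u(2)] unfolding norm_minus_commute[of "u _ _"] by simp
  have lim2: "(\<lambda>k. \<integral>x. \<Phi> (norm (W x - grad (u k) x)) \<partial>M) \<longlonglongrightarrow> 0"
    using dlim_Phi(3)[OF \<tau> u(3)] by (simp add: norm_minus_commute)
  have int1: "integrable M (\<lambda>x. \<Phi> (U x - u k x))" for k
    using integrable_Phi_add[OF U_int test_integrable(1)[OF test_function_cmult[OF u(1), of "-1"]]] by simp
  have int2: "integrable M (\<lambda>x. \<Phi> (norm (W x - grad (u k) x)))" for k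
  proof (rule integrable_Phi_mono)
    show "integrable M (\<lambda>x. \<Phi> (norm (W x) + norm (grad (u k) x)))"
      by (intro integrable_Phi_add W_int test_integrable(3)[OF u(1)]) measurable
    show "AE x in M. \<bar>norm (W x - grad (u k) x)\<bar> \<le> \<bar>norm (W x) + norm (grad (u k) x)\<bar>"
      by (simp add: norm_triangle_ineq4)
  qed measurable
  have "\<exists>\<zeta>\<in>\<T>. W1L_norm \<Phi> \<Omega> (\<lambda>x. U x - \<zeta> x) < \<epsilon>" if \<epsilon>: "\<epsilon> > 0" for \<epsilon>
  proof -
    \<comment> \<open>The tolerance is an extended real and may be infinite; it is cut down to a
      real \<open>r\<close> not exceeding 1, as \<open>modular_tendsto_0_luxemburg\<close>
      needs.\<close>
    define r where "r = enn2real (min \<epsilon> 1)"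
    have r: "ennreal r = min \<epsilon> 1" unfolding r_def by (rule ennreal_enn2real) (simp add: min_less_iff_disj)
    have r0: "0 < r" using \<epsilon> r by (metis ennreal_0 ennreal_less_zero_iff min_less_iff_conj zero_less_one)
    have r1: "r \<le> 1" using r by (metis ennreal_1 ennreal_le_iff min.cobounded2 zero_le_one)
    have "\<forall>\<^sub>F k in sequentially. luxemburg_norm \<Phi> \<Omega> (\<lambda>x. U x - u k x) \<le> ennreal (r / 3)"
      using r0 r1 int1 lim1 by (intro modular_tendsto_0_luxemburg) auto
    moreover have "\<forall>\<^sub>F k in sequentially. luxemburg_norm \<Phi> \<Omega> (\<lambda>x. norm (W x - grad (u k) x)) \<le> ennreal (r / 3)"
      using r0 r1 int2 lim2 by (intro modular_tendsto_0_luxemburg) auto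
    ultimately have "\<forall>\<^sub>F k in sequentially. W1L_norm \<Phi> \<Omega> (\<lambda>x. U x - u k x) < \<epsilon>"
    proof eventually_elim
      case (elim k)
      have "luxemburg_norm \<Phi> \<Omega> (\<lambda>x. norm (weak_grad \<Omega> (\<lambda>x. U x - u k x) x)) =
          luxemburg_norm \<Phi> \<Omega> (\<lambda>x. norm (W x - grad (u k) x))"
        by (rule luxemburg_norm_cong_AE) (use diff_grad[of k] in \<open>eventually_elim, simp\<close>)
      then have "W1L_norm \<Phi> \<Omega> (\<lambda>x. U x - u k x) \<le> ennreal (r / 3) + ennreal (r / 3)"
        unfolding W1L_norm_def using elim by (simp add: add_mono)
      also have "\<dots> = ennreal (2 * r / 3)" using r0 by (subst ennreal_plus[symmetric]) auto
      also have "\<dots> < ennreal r" using r0 by (intro ennreal_lessI) auto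
      also have "\<dots> \<le> \<epsilon>" by (simp add: r)
      finally show ?case .
    qed
    then obtain k where "W1L_norm \<Phi> \<Omega> (\<lambda>x. U x - u k x) < \<epsilon>"
      by (auto simp: eventually_sequentially)
    then show ?thesis using u(1) by blast
  qed
  with W1 show "U \<in> W01L \<Phi> \<Omega>" by (simp add: W01L_def)
qed

lemma W1L_D:
  assumes "v \<in> W1L \<Phi> \<Omega>"
  obtains "v \<in> borel_measurable M" "integrable M (\<lambda>x. \<Phi> (v x))"
    "\<And>i. has_weak_partial \<Omega> i v (\<lambda>x. weak_grad \<Omega> v x $ i)" "weak_grad \<Omega> v \<in> borel_measurable M"
    "integrable M (\<lambda>x. \<Phi> (norm (weak_grad \<Omega> v x)))"
proof -
  have v: "v \<in> borel_measurable M" "integrable M (\<lambda>x. \<Phi> (v x))"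
    using assms by (auto simp: W1L_def orlicz_space_iff)
  have "\<forall>i. \<exists>g. g \<in> orlicz_space \<Phi> \<Omega> \<and> has_weak_partial \<Omega> i v g"
    using assms by (auto simp: W1L_def)
  then obtain g where g: "\<And>i. g i \<in> orlicz_space \<Phi> \<Omega>" "\<And>i. has_weak_partial \<Omega> i v (g i)" by metis
  have wp: "has_weak_partial \<Omega> i v (\<lambda>x. weak_grad \<Omega> v x $ i)" for i
    using someI_ex[of "has_weak_partial \<Omega> i v"] g(2)[of i] by (auto simp: weak_grad_def)
  have m [measurable]: "weak_grad \<Omega> v \<in> borel_measurable M" using g(2) by (intro weak_grad_measurable) blast
  have g_meas [measurable]: "g i \<in> borel_measurable M" and g_int: "integrable M (\<lambda>x. \<Phi> (g i x))" for i
    using g(1) by (auto simp: orlicz_space_iff)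
  have sum_int: "integrable M (\<lambda>x. \<Phi> (\<Sum>i\<in>S. \<bar>g i x\<bar>))" if "finite S" for S
    using that
  proof induction
    case (insert i S)
    have "integrable M (\<lambda>x. \<Phi> (\<bar>g i x\<bar> + (\<Sum>i\<in>S. \<bar>g i x\<bar>)))"
      using g_int insert by (intro integrable_Phi_add) auto
    then show ?case using insert by simp
  qed (simp add: Phi_0)
  have eq: "AE x in M. \<forall>i\<in>UNIV. weak_grad \<Omega> v x $ i = g i x"
    by (subst AE_ball_countable, simp, intro ballI has_weak_partial_unique[OF open_dom wp g(2)]) simp
  have "integrable M (\<lambda>x. \<Phi> (norm (weak_grad \<Omega> v x)))"
  proof (rule integrable_Phi_mono[OF sum_int[of UNIV]])
    show "AE x in M. \<bar>norm (weak_grad \<Omega> v x)\<bar> \<le> \<bar>\<Sum>i\<in>UNIV. \<bar>g i x\<bar>\<bar>"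
      using eq
    proof eventually_elim
      case (elim x)
      have "norm (weak_grad \<Omega> v x) \<le> (\<Sum>i\<in>UNIV. \<bar>weak_grad \<Omega> v x $ i\<bar>)" by (rule norm_le_l1_cart)
      then show ?case using elim by simp
    qed
  qed auto
  with v wp m that show ?thesis by blast
qed

text \<open>Converse of \<open>limit_in_W01L\<close>. Approximations in norm converge in modular;
  one subsequence gives dominated almost everywhere convergence of the functions, a further one that
  of the gradients.\<close>

lemma W01L_approximation:
  assumes v: "v \<in> W01L \<Phi> \<Omega>"
  obtains \<zeta> \<tau> where "\<And>k. \<zeta> k \<in> \<T>" "dominator \<tau>" "dlim \<tau> \<zeta> v" "dlim \<tau> (\<lambda>k. grad (\<zeta> k)) (weak_grad \<Omega> v)"
proof -
  have vW: "v \<in> W1L \<Phi> \<Omega>" using v by (simp add: W01L_def)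
  have vm [measurable]: "v \<in> borel_measurable M" and v_int: "integrable M (\<lambda>x. \<Phi> (v x))"
    and wp: "\<And>i. has_weak_partial \<Omega> i v (\<lambda>x. weak_grad \<Omega> v x $ i)"
    and wm [measurable]: "weak_grad \<Omega> v \<in> borel_measurable M"
    and w_int: "integrable M (\<lambda>x. \<Phi> (norm (weak_grad \<Omega> v x)))"
    by (rule W1L_D[OF vW], assumption)+
  define t where "t k = inverse (real (Suc k))" for k
  have t: "0 < t k" "t k \<le> 1" for k by (auto simp: t_def inverse_le_1_iff)
  have "\<exists>\<zeta>\<in>\<T>. W1L_norm \<Phi> \<Omega> (\<lambda>x. v x - \<zeta> x) < ennreal (t k)" for k
    using v t[of k] by (simp add: W01L_def)
  then obtain \<zeta> where \<zeta>: "\<And>k. \<zeta> k \<in> \<T>" "\<And>k. W1L_norm \<Phi> \<Omega> (\<lambda>x. v x - \<zeta> k x) < ennreal (t k)"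
    by metis
  note [measurable] = test_measurable[OF \<zeta>(1)]
  have diff_grad: "AE x in M. weak_grad \<Omega> (\<lambda>x. v x - \<zeta> k x) x = weak_grad \<Omega> v x - grad (\<zeta> k) x" for k
  proof -
    have "has_weak_partial \<Omega> i (\<lambda>x. v x - \<zeta> k x) (\<lambda>x. (weak_grad \<Omega> v x - grad (\<zeta> k) x) $ i)" for i
      using has_weak_partial_diff[OF open_dom wp test_has_weak_partial[OF \<zeta>(1)]] by simp
    then show ?thesis by (intro weak_grad_AE[OF open_dom]) auto
  qed
  \<comment> \<open>A norm below \<open>t k\<close>, which is at most 1, bounds the modular by the
    same number: \<open>Phi_shrink\<close> lets an admissible factor below 1 leave \<Phi>.\<close>
  have small: "integrable M (\<lambda>x. \<Phi> (f x)) \<and> (\<integral>x. \<Phi> (f x) \<partial>M) \<le> t k"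
    if [measurable]: "f \<in> borel_measurable M" and less: "luxemburg_norm \<Phi> \<Omega> f < ennreal (t k)" for f k
  proof (rule luxemburg_less_modular[OF that])
    fix c assume c: "c > 0" "ennreal c < ennreal (t k)" "integrable M (\<lambda>x. \<Phi> (f x))"
      "integrable M (\<lambda>x. \<Phi> (f x / c))" "(\<integral>x. \<Phi> (f x / c) \<partial>M) \<le> 1"
    have ct: "c < t k" using c(1,2) by (simp add: ennreal_less_iff)
    have "(\<integral>x. \<Phi> (f x) \<partial>M) = (\<integral>x. \<Phi> (c * (f x / c)) \<partial>M)" using c(1) by simp
    also have "\<dots> \<le> c * (\<integral>x. \<Phi> (f x / c) \<partial>M)"
      using c ct t[of k] by (intro integral_Phi_shrink) auto
    also have "\<dots> \<le> c * 1" using c by (intro mult_left_mono) auto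
    finally show ?thesis using c(3) ct by simp
  qed
  have part1: "integrable M (\<lambda>x. \<Phi> (v x - \<zeta> k x)) \<and> (\<integral>x. \<Phi> (v x - \<zeta> k x) \<partial>M) \<le> t k" for k
    using \<zeta>(2)[of k] by (intro small) (auto simp: W1L_norm_def intro: order.strict_trans1[rotated] simp: le_iff_add)
  have part2: "integrable M (\<lambda>x. \<Phi> (norm (weak_grad \<Omega> v x - grad (\<zeta> k) x))) \<and>
      (\<integral>x. \<Phi> (norm (weak_grad \<Omega> v x - grad (\<zeta> k) x)) \<partial>M) \<le> t k" for k
  proof (rule small)
    have "luxemburg_norm \<Phi> \<Omega> (\<lambda>x. norm (weak_grad \<Omega> v x - grad (\<zeta> k) x)) =
        luxemburg_norm \<Phi> \<Omega> (\<lambda>x. norm (weak_grad \<Omega> (\<lambda>x. v x - \<zeta> k x) x))"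
      by (rule luxemburg_norm_cong_AE) (use diff_grad[of k] in \<open>eventually_elim, simp\<close>)
    also have "\<dots> \<le> W1L_norm \<Phi> \<Omega> (\<lambda>x. v x - \<zeta> k x)" by (simp add: W1L_norm_def)
    finally show "luxemburg_norm \<Phi> \<Omega> (\<lambda>x. norm (weak_grad \<Omega> v x - grad (\<zeta> k) x)) < ennreal (t k)"
      using \<zeta>(2)[of k] by (rule order.strict_trans1)
  qed measurable
  have t_lim: "t \<longlonglongrightarrow> 0" unfolding t_def[abs_def] by (rule LIMSEQ_inverse_real_of_nat)
  have swap: "\<Phi> (\<zeta> k x - v x) = \<Phi> (v x - \<zeta> k x)" for k x
    using Phi_even[of "v x - \<zeta> k x"] by simp
  have lim1: "(\<lambda>k. \<integral>x. \<Phi> (norm (\<zeta> k x - v x)) \<partial>M) \<longlonglongrightarrow> 0"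
  proof (rule tendsto_sandwich[OF _ _ tendsto_const t_lim])
    show "\<forall>\<^sub>F k in sequentially. 0 \<le> (\<integral>x. \<Phi> (norm (\<zeta> k x - v x)) \<partial>M)" by simp
    show "\<forall>\<^sub>F k in sequentially. (\<integral>x. \<Phi> (norm (\<zeta> k x - v x)) \<partial>M) \<le> t k"
      using part1 by (simp add: swap)
  qed
  obtain r1 \<tau>1 where r1: "strict_mono (r1 :: nat \<Rightarrow> nat)"
    "\<tau>1 \<in> borel_measurable M" "integrable M (\<lambda>x. \<Phi> (\<tau>1 x))" "\<And>x. 0 \<le> \<tau>1 x"
    "AE x in M. (\<lambda>k. \<zeta> (r1 k) x) \<longlonglongrightarrow> v x" "AE x in M. \<forall>k. norm (\<zeta> (r1 k) x) \<le> \<tau>1 x"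
    by (rule modular_convergent_subsequence[of \<zeta> M v])
      (use lim1 part1 v_int in \<open>auto simp: swap\<close>)
  have \<tau>1: "dominator \<tau>1" using r1 by (simp add: dominator_def)
  have d1: "dlim \<tau>1 (\<lambda>k. \<zeta> (r1 k)) v" using r1 by (simp add: dlim_def)
  have lim2: "(\<lambda>k. \<integral>x. \<Phi> (norm (grad (\<zeta> (r1 k)) x - weak_grad \<Omega> v x)) \<partial>M) \<longlonglongrightarrow> 0"
  proof (rule tendsto_sandwich[OF _ _ tendsto_const LIMSEQ_subseq_LIMSEQ[OF t_lim r1(1), unfolded comp_def]])
    show "\<forall>\<^sub>F k in sequentially. 0 \<le> (\<integral>x. \<Phi> (norm (grad (\<zeta> (r1 k)) x - weak_grad \<Omega> v x)) \<partial>M)" by simp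
    show "\<forall>\<^sub>F k in sequentially. (\<integral>x. \<Phi> (norm (grad (\<zeta> (r1 k)) x - weak_grad \<Omega> v x)) \<partial>M) \<le> t (r1 k)"
      using part2 by (simp add: norm_minus_commute[of "grad _ _"])
  qed
  obtain r2 \<tau>2 where r2: "strict_mono (r2 :: nat \<Rightarrow> nat)"
    "\<tau>2 \<in> borel_measurable M" "integrable M (\<lambda>x. \<Phi> (\<tau>2 x))" "\<And>x. 0 \<le> \<tau>2 x"
    "AE x in M. (\<lambda>k. grad (\<zeta> (r1 (r2 k))) x) \<longlonglongrightarrow> weak_grad \<Omega> v x"
    "AE x in M. \<forall>k. norm (grad (\<zeta> (r1 (r2 k))) x) \<le> \<tau>2 x"
    by (rule modular_convergent_subsequence[of "\<lambda>k. grad (\<zeta> (r1 k))" M "weak_grad \<Omega> v"])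
      (use lim2 part2 w_int in \<open>auto simp: norm_minus_commute[of "grad _ _"]\<close>)
  have \<tau>2: "dominator \<tau>2" using r2 by (simp add: dominator_def)
  have d2: "dlim \<tau>2 (\<lambda>k. grad (\<zeta> (r1 (r2 k)))) (weak_grad \<Omega> v)" using r2 by (simp add: dlim_def)
  show ?thesis
  proof (rule that[of "\<lambda>k. \<zeta> (r1 (r2 k))" "\<lambda>x. \<tau>1 x + \<tau>2 x"])
    show "dominator (\<lambda>x. \<tau>1 x + \<tau>2 x)" by (rule dominator_add[OF \<tau>1 \<tau>2])
    have ds: "dlim \<tau>1 (\<lambda>k. \<zeta> (r1 (r2 k))) v"
    proof -
      have "AE x in M. (\<lambda>k. \<zeta> (r1 (r2 k)) x) \<longlonglongrightarrow> v x"
        using r1(5) LIMSEQ_subseq_LIMSEQ[OF _ r2(1)] by (auto simp: comp_def elim!: AE_mp)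
      moreover have "AE x in M. \<forall>k. norm (\<zeta> (r1 (r2 k)) x) \<le> \<tau>1 x"
        using r1(6) by eventually_elim simp
      ultimately show ?thesis by (simp add: dlim_def)
    qed
    show "dlim (\<lambda>x. \<tau>1 x + \<tau>2 x) (\<lambda>k. \<zeta> (r1 (r2 k))) v" by (rule dlim_mono[OF ds]) (simp add: r2)
    show "dlim (\<lambda>x. \<tau>1 x + \<tau>2 x) (\<lambda>k. grad (\<zeta> (r1 (r2 k)))) (weak_grad \<Omega> v)"
      by (rule dlim_mono[OF d2]) (simp add: r1)
  qed (rule \<zeta>)
qed

lemma dlim_cong_AE:
  assumes "dlim \<tau> f F" "G \<in> borel_measurable M" "AE x in M. G x = F x"
  shows "dlim \<tau> f G"
proof -
  have "AE x in M. (\<lambda>k. f k x) \<longlonglongrightarrow> F x" using assms(1) by (simp add: dlim_def)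
  then have "AE x in M. (\<lambda>k. f k x) \<longlonglongrightarrow> G x" using assms(3) by eventually_elim simp
  then show ?thesis using assms by (simp add: dlim_def)
qed

end

lemma square_mult_exp_le: "0 < (t::real) \<Longrightarrow> exp (- 1 / t) / t\<^sup>2 \<le> 2"
proof -
  assume t: "0 < t"
  have "(1 / t)\<^sup>2 / 2 \<le> exp (1 / t)"
    using exp_lower_Taylor_quadratic[of "1 / t"] t by (simp add: power2_eq_square) (smt (verit) divide_pos_pos)
  then have "(1 / t)\<^sup>2 * exp (- 1 / t) \<le> 2 * exp (1 / t) * exp (- 1 / t)"
    by (intro mult_right_mono) auto
  also have "\<dots> = 2" by (simp add: exp_minus field_simps)
  finally show ?thesis by (simp add: power_divide)
qed

text \<open>The upper bound keeps the gradient of the bump function composed with -u_k below twice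
  the gradient of u_k, hence below a dominator.\<close>

lemma bump_deriv_1_bounds: "0 \<le> bump_deriv (Suc 0) t" "bump_deriv (Suc 0) t \<le> 2"
  using square_mult_exp_le[of t] by (auto simp: bump_deriv_1)

section \<open>Nonnegativity of the limits and the equation on the whole space\<close>

context energy
begin

text \<open>The equation is tested with \<open>\<eta>(-u\<^sub>k)\<close>, where \<open>\<eta> = bump_deriv 0\<close> is smooth, increasing and
  vanishes exactly on the nonpositive numbers. In the limit the right-hand side vanishes, so
  \<open>\<nabla>\<eta>(-u\<^sub>k) \<rightarrow> 0\<close> and, by the Poincare inequality, \<open>\<eta>(-U) = 0\<close>.\<close>

lemma limit_nonneg:
  assumes \<tau>: "dominator \<tau>" and u: "\<And>k. u k \<in> \<T>" "dlim \<tau> u U" "dlim \<tau> (\<lambda>k. grad (u k)) W"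
    and EL: "\<And>\<zeta>. \<zeta> \<in> \<T> \<Longrightarrow> EL U W U \<zeta> (grad \<zeta>) = 0"
  shows "AE x in M. 0 \<le> U x"
proof -
  have \<tau>0: "0 \<le> \<tau> x" for x using \<tau> by (simp add: dominator_def)
  have [measurable]: "U \<in> borel_measurable M" "W \<in> borel_measurable M"
    using u by (auto simp: dlim_def)
  have \<eta>_cont: "continuous_on UNIV (bump_deriv j)" for j
    using bump_deriv_deriv by (meson DERIV_isCont continuous_at_imp_continuous_on)
  have [measurable]: "bump_deriv j \<in> borel_measurable borel" for j
    by (intro borel_measurable_continuous_onI \<eta>_cont)
  define \<zeta> where "\<zeta> k x = bump_deriv 0 (- u k x)" for k x
  have nu: "(\<lambda>x. - u k x) \<in> \<T>" for k using test_function_cmult[OF u(1), of "-1"] by simp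
  have \<zeta>: "\<zeta> k \<in> \<T>" for k
    unfolding \<zeta>_def[abs_def]
    by (rule test_function_compose[where H=bump_deriv, OF bump_deriv_deriv _ nu]) (simp add: bump_deriv_0)
  have g\<zeta>: "grad (\<zeta> k) x = - bump_deriv (Suc 0) (- u k x) *\<^sub>R grad (u k) x" for k x
  proof -
    have "grad (\<zeta> k) x = bump_deriv (Suc 0) (- u k x) *\<^sub>R grad (\<lambda>x. - u k x) x"
      unfolding \<zeta>_def[abs_def] by (rule grad_compose[OF bump_deriv_deriv test_function_smooth[OF nu]])
    also have "grad (\<lambda>x. - u k x) x = - grad (u k) x"
      using grad_cmult[OF test_function_smooth[OF u(1)], of "-1"] by simp
    finally show ?thesis by simp
  qed
  define Z where "Z x = bump_deriv 0 (- U x)" for x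
  define dZ where "dZ x = - bump_deriv (Suc 0) (- U x) *\<^sub>R W x" for x
  have Zm [measurable]: "Z \<in> borel_measurable M" "dZ \<in> borel_measurable M"
    unfolding Z_def dZ_def by measurable
  \<comment> \<open>Twice \<tau> covers the gradients, because \<eta>' is at most 2, and 1 covers
    \<eta>.\<close>
  let ?\<tau> = "\<lambda>x. (\<tau> x + \<tau> x) + 1"
  have \<tau>': "dominator ?\<tau>" by (intro dominator_add \<tau> dominator_const) simp
  have Ulim: "AE x in M. (\<lambda>k. u k x) \<longlonglongrightarrow> U x" and Wlim: "AE x in M. (\<lambda>k. grad (u k) x) \<longlonglongrightarrow> W x"
    and Wbd: "AE x in M. \<forall>k. norm (grad (u k) x) \<le> \<tau> x"
    using u by (auto simp: dlim_def)
  have Zlim: "dlim ?\<tau> \<zeta> Z"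
    unfolding dlim_def
  proof (intro conjI allI)
    show "AE x in M. (\<lambda>k. \<zeta> k x) \<longlonglongrightarrow> Z x"
      using Ulim
    proof eventually_elim
      case (elim x)
      then show ?case unfolding \<zeta>_def Z_def
        by (intro continuous_on_tendsto_compose[OF \<eta>_cont[of 0]] tendsto_minus) auto
    qed
    have "norm (\<zeta> k x) \<le> ?\<tau> x" for k x
      using bump_deriv_0_bounds[of "- u k x"] \<tau>0[of x] by (simp add: \<zeta>_def)
    then show "AE x in M. \<forall>k. norm (\<zeta> k x) \<le> ?\<tau> x" by simp
  qed (use test_measurable[OF \<zeta>] in auto)
  have dZlim: "dlim ?\<tau> (\<lambda>k. grad (\<zeta> k)) dZ"
    unfolding dlim_def
  proof (intro conjI allI)
    show "AE x in M. (\<lambda>k. grad (\<zeta> k) x) \<longlonglongrightarrow> dZ x"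
      using Ulim Wlim
    proof eventually_elim
      case (elim x)
      then show ?case unfolding g\<zeta> dZ_def
        by (intro tendsto_scaleR tendsto_minus continuous_on_tendsto_compose[OF \<eta>_cont[of "Suc 0"]]) auto
    qed
    show "AE x in M. \<forall>k. norm (grad (\<zeta> k) x) \<le> ?\<tau> x"
      using Wbd
    proof eventually_elim
      case (elim x)
      show ?case
      proof
        fix k
        have "norm (grad (\<zeta> k) x) \<le> 2 * \<tau> x"
          unfolding g\<zeta> using bump_deriv_1_bounds[of "- u k x"] elim by (auto intro: mult_mono)
        then show "norm (grad (\<zeta> k) x) \<le> ?\<tau> x" by simp
      qed
    qed
  qed (use test_measurable[OF \<zeta>] in auto)
  have Uc: "dlim ?\<tau> (\<lambda>k. U) U" "dlim ?\<tau> (\<lambda>k. W) W"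
  proof -
    have le: "\<tau> x \<le> ?\<tau> x" for x using \<tau>0[of x] by simp
    have "AE x in M. norm (U x) \<le> ?\<tau> x"
      using dlim_limit_bound[OF u(2)] by eventually_elim (rule order_trans[OF _ le])
    then show "dlim ?\<tau> (\<lambda>k. U) U" by (intro dlim_const) auto
    have "AE x in M. norm (W x) \<le> ?\<tau> x"
      using dlim_limit_bound[OF u(3)] by eventually_elim (rule order_trans[OF _ le])
    then show "dlim ?\<tau> (\<lambda>k. W) W" by (intro dlim_const) auto
  qed
  have "(\<lambda>k. EL U W U (\<zeta> k) (grad (\<zeta> k))) \<longlonglongrightarrow> EL U W U Z dZ"
    by (rule dlim_EL[OF \<tau>' Uc Uc(1) Zlim dZlim])
  then have "EL U W U Z dZ = 0" by (simp add: EL[OF \<zeta>] LIMSEQ_const_iff)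
  moreover have "pos_pow r (U x) * Z x = 0" if "r > 1" for r x
    using that by (cases "U x \<le> 0") (auto simp: pos_pow_def Z_def bump_deriv_0 max_absorb1)
  ultimately have flux0: "(\<integral>x. flux (W x) \<bullet> dZ x \<partial>M) = 0"
    using q p_gt_1 by (simp add: EL_def)
  \<comment> \<open>The integrand has one sign, so its vanishing integral makes it vanish almost
    everywhere; \<phi> is positive away from 0, which leaves \<open>dZ x = 0\<close>.\<close>
  have neg: "- (flux (W x) \<bullet> dZ x) = bump_deriv (Suc 0) (- U x) * (\<phi> (norm (W x)) * norm (W x))" for x
    by (simp add: dZ_def flux_self)
  have "AE x in M. - (flux (W x) \<bullet> dZ x) = 0"
  proof (subst integral_nonneg_eq_0_iff_AE[symmetric])
    show "integrable M (\<lambda>x. - (flux (W x) \<bullet> dZ x))"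
      using dlim_flux(2)[OF \<tau>' Uc(2) dZlim] by simp
    show "AE x in M. 0 \<le> - (flux (W x) \<bullet> dZ x)"
      unfolding neg using bump_deriv_1_bounds phi_nonneg by simp
    show "(\<integral>x. - (flux (W x) \<bullet> dZ x) \<partial>M) = 0" using flux0 by simp
  qed
  then have dZ0: "AE x in M. dZ x = 0"
  proof eventually_elim
    case (elim x)
    then show ?case unfolding neg using phi_pos[of "norm (W x)"] by (auto simp: dZ_def)
  qed
  obtain D where D: "D \<ge> 1"
    "\<And>u. u \<in> \<T> \<Longrightarrow> (\<integral>x. \<Phi> (u x) \<partial>M) \<le> (\<integral>x. \<Phi> (D * norm (grad u x)) \<partial>M)"
    using Poincare by metis
  have "(\<integral>x. \<Phi> (norm (Z x)) \<partial>M) \<le> D powr \<sigma> * (\<integral>x. \<Phi> (norm (dZ x)) \<partial>M)"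
  proof (rule LIMSEQ_le)
    show "(\<lambda>k. \<integral>x. \<Phi> (norm (\<zeta> k x)) \<partial>M) \<longlonglongrightarrow> (\<integral>x. \<Phi> (norm (Z x)) \<partial>M)"
      by (rule dlim_Phi(1)[OF \<tau>' Zlim])
    show "(\<lambda>k. D powr \<sigma> * (\<integral>x. \<Phi> (norm (grad (\<zeta> k) x)) \<partial>M)) \<longlonglongrightarrow> D powr \<sigma> * (\<integral>x. \<Phi> (norm (dZ x)) \<partial>M)"
      by (intro tendsto_mult_left dlim_Phi(1)[OF \<tau>' dZlim])
    have "(\<integral>x. \<Phi> (norm (\<zeta> k x)) \<partial>M) \<le> D powr \<sigma> * (\<integral>x. \<Phi> (norm (grad (\<zeta> k) x)) \<partial>M)" for k
      using D(2)[OF \<zeta>[of k]] integral_Phi_scale[OF D(1) test_integrable(3)[OF \<zeta>[of k]]] test_measurable[OF \<zeta>[of k]]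
      by simp
    then show "\<exists>N. \<forall>k\<ge>N. (\<integral>x. \<Phi> (norm (\<zeta> k x)) \<partial>M) \<le> D powr \<sigma> * (\<integral>x. \<Phi> (norm (grad (\<zeta> k) x)) \<partial>M)"
      by blast
  qed
  also have "(\<integral>x. \<Phi> (norm (dZ x)) \<partial>M) = 0"
    by (rule integral_eq_zero_AE) (use dZ0 in \<open>eventually_elim, simp add: Phi_0\<close>)
  finally have "(\<integral>x. \<Phi> (norm (Z x)) \<partial>M) = 0" by (intro antisym integral_nonneg_AE) auto
  then have "AE x in M. \<Phi> (norm (Z x)) = 0"
    using dlim_Phi(2)[OF \<tau>' Zlim] by (subst (asm) integral_nonneg_eq_0_iff_AE) auto
  then show ?thesis
  proof eventually_elim
    case (elim x)
    then have "Z x = 0" by simp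
    then show ?case by (cases "U x < 0") (auto simp: Z_def bump_deriv_0)
  qed
qed

text \<open>Weak solutions in the terms of this locale, with powers of the positive part in place of
  powers of \<open>U\<close>; \<open>critical_limit_weak_solution\<close> translates.\<close>

definition critical_limit :: "(real^'n \<Rightarrow> real) \<Rightarrow> bool" where
  "critical_limit U \<longleftrightarrow> U \<in> W01L \<Phi> \<Omega> \<and> (AE x in M. 0 \<le> U x) \<and>
     (\<forall>v\<in>W01L \<Phi> \<Omega>. integrable M (\<lambda>x. flux (weak_grad \<Omega> U x) \<bullet> weak_grad \<Omega> v x) \<and>
        integrable M (\<lambda>x. pos_pow p (U x) * v x) \<and> integrable M (\<lambda>x. pos_pow q (U x) * v x) \<and>
        EL U (weak_grad \<Omega> U) U v (weak_grad \<Omega> v) = 0)"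

text \<open>Second density step: \<open>W01L_approximation\<close> provides a \<open>dlim\<close>
  for every \<open>v\<close> of the space, along which the equation passes from test functions to
  \<open>v\<close>. Convergence of the energies is recorded because their sign separates the
  solutions.\<close>

lemma critical_limitI:
  assumes \<tau>: "dominator \<tau>" and u: "\<And>k. u k \<in> \<T>" "dlim \<tau> u U" "dlim \<tau> (\<lambda>k. grad (u k)) W"
    and EL: "\<And>\<zeta>. \<zeta> \<in> \<T> \<Longrightarrow> EL U W U \<zeta> (grad \<zeta>) = 0"
  shows "critical_limit U" "(\<lambda>k. J (u k) (grad (u k))) \<longlonglongrightarrow> J U (weak_grad \<Omega> U)"
proof -
  have UW: "U \<in> W01L \<Phi> \<Omega>" and wg: "AE x in M. weak_grad \<Omega> U x = W x"
    using limit_in_W01L[OF \<tau> u] by auto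
  have wm [measurable]: "weak_grad \<Omega> U \<in> borel_measurable M"
    by (rule W1L_D[of U]) (use UW in \<open>auto simp: W01L_def\<close>)
  have [measurable]: "W \<in> borel_measurable M" using u by (simp add: dlim_def)
  have u3: "dlim \<tau> (\<lambda>k. grad (u k)) (weak_grad \<Omega> U)" by (rule dlim_cong_AE[OF u(3) wm wg])
  show "(\<lambda>k. J (u k) (grad (u k))) \<longlonglongrightarrow> J U (weak_grad \<Omega> U)" by (rule dlim_J[OF \<tau> u(2) u3])
  have EL': "EL U (weak_grad \<Omega> U) U \<zeta> (grad \<zeta>) = 0" if \<zeta>: "\<zeta> \<in> \<T>" for \<zeta>
  proof -
    note [measurable] = test_measurable[OF \<zeta>]
    have "(\<integral>x. flux (weak_grad \<Omega> U x) \<bullet> grad \<zeta> x \<partial>M) = (\<integral>x. flux (W x) \<bullet> grad \<zeta> x \<partial>M)"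
      by (rule integral_cong_AE, measurable) (use wg in \<open>eventually_elim, simp\<close>)
    then show ?thesis using EL[OF \<zeta>] by (simp add: EL_def)
  qed
  have "integrable M (\<lambda>x. flux (weak_grad \<Omega> U x) \<bullet> weak_grad \<Omega> v x) \<and>
        integrable M (\<lambda>x. pos_pow p (U x) * v x) \<and> integrable M (\<lambda>x. pos_pow q (U x) * v x) \<and>
        EL U (weak_grad \<Omega> U) U v (weak_grad \<Omega> v) = 0" if v: "v \<in> W01L \<Phi> \<Omega>" for v
  proof -
    obtain \<zeta> \<tau>2 where \<zeta>: "\<And>k. \<zeta> k \<in> \<T>" "dominator \<tau>2" "dlim \<tau>2 \<zeta> v"
      "dlim \<tau>2 (\<lambda>k. grad (\<zeta> k)) (weak_grad \<Omega> v)"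
      using W01L_approximation[OF v] by metis
    let ?\<tau> = "\<lambda>x. \<tau> x + \<tau>2 x"
    have d: "dominator ?\<tau>" by (rule dominator_add[OF \<tau> \<zeta>(2)])
    have le: "\<tau> x \<le> ?\<tau> x" "\<tau>2 x \<le> ?\<tau> x" for x using \<tau> \<zeta>(2) by (auto simp: dominator_def)
    have Uc: "dlim ?\<tau> (\<lambda>k. U) U"
      using dlim_limit_bound[OF u(2)] u(2) by (intro dlim_mono[OF dlim_const le(1)]) (auto simp: dlim_def)
    have Wc: "dlim ?\<tau> (\<lambda>k. weak_grad \<Omega> U) (weak_grad \<Omega> U)"
      using dlim_limit_bound[OF u3] by (intro dlim_mono[OF dlim_const le(1)]) auto
    have vl: "dlim ?\<tau> \<zeta> v" "dlim ?\<tau> (\<lambda>k. grad (\<zeta> k)) (weak_grad \<Omega> v)"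
      using dlim_mono[OF \<zeta>(3) le(2)] dlim_mono[OF \<zeta>(4) le(2)] by auto
    have "(\<lambda>k. EL U (weak_grad \<Omega> U) U (\<zeta> k) (grad (\<zeta> k))) \<longlonglongrightarrow> EL U (weak_grad \<Omega> U) U v (weak_grad \<Omega> v)"
      by (rule dlim_EL[OF d Uc Wc Uc vl])
    then have "EL U (weak_grad \<Omega> U) U v (weak_grad \<Omega> v) = 0" by (simp add: EL'[OF \<zeta>(1)] LIMSEQ_const_iff)
    then show ?thesis
      using dlim_flux(2)[OF d Wc vl(2)] dlim_pow(2)[OF d Uc vl(1)] q p_gt_1 by auto
  qed
  then show "critical_limit U"
    using UW limit_nonneg[OF \<tau> u EL] by (auto simp: critical_limit_def)
qed

text \<open>In all dimensions the energies are at most J(e) for the first family of critical points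
  and at least \<delta> for the second, so the limits have energies of opposite sign.\<close>

lemma two_critical_limits:
  assumes e: "e \<in> \<T>" and neg: "Jt e < 0"
  obtains U V where "critical_limit U" "critical_limit V" "J U (weak_grad \<Omega> U) < 0" "J V (weak_grad \<Omega> V) > 0"
proof -
  obtain Z :: "nat \<Rightarrow> real^'n \<Rightarrow> real" where Z0: "Z 0 = e" and Z: "\<And>i. Z i \<in> \<T>"
    and dense: "\<And>\<zeta>. \<zeta> \<in> \<T> \<Longrightarrow> \<exists>s c. c \<ge> 0 \<and> (\<forall>x. (\<lambda>j::nat. Z (s j) x) \<longlonglongrightarrow> \<zeta> x) \<and>
       (\<forall>x. (\<lambda>j. grad (Z (s j)) x) \<longlonglongrightarrow> grad \<zeta> x) \<and>
       (\<forall>j x. \<bar>Z (s j) x\<bar> \<le> c) \<and> (\<forall>j x. norm (grad (Z (s j)) x) \<le> c)"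
    by (rule countable_dense_test_functions[OF e]) blast
  have negZ: "Jt (Z 0) < 0" using neg by (simp add: Z0)
  have limit: "\<exists>U r. critical_limit U \<and> strict_mono (r :: nat \<Rightarrow> nat) \<and>
      (\<lambda>k. Jt (comb Z {..<Suc (r k)} (x (r k)))) \<longlonglongrightarrow> J U (weak_grad \<Omega> U)"
    if crit: "\<And>n y. EL (comb Z {..<Suc n} (x n)) (grad (comb Z {..<Suc n} (x n))) (comb Z {..<Suc n} (x n))
        (comb Z {..<Suc n} y) (grad (comb Z {..<Suc n} y)) = 0"
      and bd: "\<And>n. Jt (comb Z {..<Suc n} (x n)) \<le> m" for x m
  proof -
    define u where "u n = comb Z {..<Suc n} (x n)" for n
    have T: "u n \<in> \<T>" for n unfolding u_def by (intro comb_test_function Z) auto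
    obtain r :: "nat \<Rightarrow> nat" and \<tau> U W where r: "strict_mono r" and \<tau>: "dominator \<tau>"
      and U: "dlim \<tau> (\<lambda>k. u (r k)) U" "dlim \<tau> (\<lambda>k. grad (u (r k))) W"
      and EL: "\<And>i. EL U W U (Z i) (grad (Z i)) = 0"
      by (rule Galerkin_limit[OF Z u_def, of m]) (use crit bd in \<open>auto simp: u_def\<close>)
    have "EL U W U \<zeta> (grad \<zeta>) = 0" if \<zeta>: "\<zeta> \<in> \<T>" for \<zeta>
    proof -
      obtain s c where s: "c \<ge> 0" "\<And>x. (\<lambda>j::nat. Z (s j) x) \<longlonglongrightarrow> \<zeta> x"
        "\<And>x. (\<lambda>j. grad (Z (s j)) x) \<longlonglongrightarrow> grad \<zeta> x"
        "\<And>j x. \<bar>Z (s j) x\<bar> \<le> c" "\<And>j x. norm (grad (Z (s j)) x) \<le> c"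
        using dense[OF \<zeta>] by blast
      show ?thesis by (rule EL_test_function[where Z=Z and s=s and \<zeta>=\<zeta> and c=c, OF \<tau> U Z \<zeta> EL s])
    qed
    from critical_limitI[OF \<tau> T U this] show ?thesis using r unfolding u_def by blast
  qed
  obtain \<delta> m where \<delta>: "\<delta> > 0"
    and min: "\<And>n. n > 0 \<Longrightarrow> \<exists>x. Jt (comb Z {..<n} x) \<le> Jt (Z 0) \<and>
      (\<forall>y. EL (comb Z {..<n} x) (grad (comb Z {..<n} x)) (comb Z {..<n} x) (comb Z {..<n} y) (grad (comb Z {..<n} y)) = 0)"
    and mp: "\<And>n. n > 0 \<Longrightarrow> \<exists>x. \<delta> \<le> Jt (comb Z {..<n} x) \<and> Jt (comb Z {..<n} x) \<le> m \<and>
      (\<forall>y. EL (comb Z {..<n} x) (grad (comb Z {..<n} x)) (comb Z {..<n} x) (comb Z {..<n} y) (grad (comb Z {..<n} y)) = 0)"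
    by (rule Galerkin_critical_points[where Z=Z, OF Z negZ]) blast
  obtain x1 where x1: "\<And>n. Jt (comb Z {..<Suc n} (x1 n)) \<le> Jt (Z 0)"
    "\<And>n y. EL (comb Z {..<Suc n} (x1 n)) (grad (comb Z {..<Suc n} (x1 n))) (comb Z {..<Suc n} (x1 n))
        (comb Z {..<Suc n} y) (grad (comb Z {..<Suc n} y)) = 0"
    using min[OF zero_less_Suc] by metis
  obtain x2 where x2: "\<And>n. \<delta> \<le> Jt (comb Z {..<Suc n} (x2 n))" "\<And>n. Jt (comb Z {..<Suc n} (x2 n)) \<le> m"
    "\<And>n y. EL (comb Z {..<Suc n} (x2 n)) (grad (comb Z {..<Suc n} (x2 n))) (comb Z {..<Suc n} (x2 n))
        (comb Z {..<Suc n} y) (grad (comb Z {..<Suc n} y)) = 0"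
    using mp[OF zero_less_Suc] by metis
  obtain U and r :: "nat \<Rightarrow> nat" where U: "critical_limit U" "strict_mono r"
    "(\<lambda>k. Jt (comb Z {..<Suc (r k)} (x1 (r k)))) \<longlonglongrightarrow> J U (weak_grad \<Omega> U)"
    using limit[OF x1(2,1)] by blast
  obtain V and s :: "nat \<Rightarrow> nat" where V: "critical_limit V" "strict_mono s"
    "(\<lambda>k. Jt (comb Z {..<Suc (s k)} (x2 (s k)))) \<longlonglongrightarrow> J V (weak_grad \<Omega> V)"
    using limit[OF x2(3,2)] by blast
  have "J U (weak_grad \<Omega> U) \<le> Jt (Z 0)" using x1(1) by (intro LIMSEQ_le_const2[OF U(3)]) auto
  moreover have "\<delta> \<le> J V (weak_grad \<Omega> V)" using x2(1) by (intro LIMSEQ_le_const[OF V(3)]) auto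
  ultimately show ?thesis using that U V negZ \<delta> by simp
qed

text \<open>The energy depends only on the almost everywhere class, so functions of different energy
  cannot agree almost everywhere.\<close>

lemma J_cong_AE:
  assumes U: "U \<in> W01L \<Phi> \<Omega>" and V: "V \<in> W01L \<Phi> \<Omega>" and eq: "AE x in M. U x = V x"
  shows "J U (weak_grad \<Omega> U) = J V (weak_grad \<Omega> V)"
proof -
  have Ud: "U \<in> borel_measurable M" "\<And>i. has_weak_partial \<Omega> i U (\<lambda>x. weak_grad \<Omega> U x $ i)"
    "weak_grad \<Omega> U \<in> borel_measurable M"
    by (rule W1L_D[of U]; use U in \<open>simp add: W01L_def\<close>)+
  have Vd: "V \<in> borel_measurable M" "\<And>i. has_weak_partial \<Omega> i V (\<lambda>x. weak_grad \<Omega> V x $ i)"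
    "weak_grad \<Omega> V \<in> borel_measurable M"
    by (rule W1L_D[of V]; use V in \<open>simp add: W01L_def\<close>)+
  note [measurable] = Ud(1,3) Vd(1,3)
  have grads: "AE x in M. weak_grad \<Omega> V x = weak_grad \<Omega> U x"
    using Vd(2) by (intro weak_grad_AE[OF open_dom Ud(2) eq]) blast
  have 1: "(\<integral>x. \<Phi> (norm (weak_grad \<Omega> U x)) \<partial>M) = (\<integral>x. \<Phi> (norm (weak_grad \<Omega> V x)) \<partial>M)"
    by (rule integral_cong_AE, measurable) (use grads in \<open>eventually_elim, simp\<close>)
  have 2: "(\<integral>x. pos_prim r (U x) \<partial>M) = (\<integral>x. pos_prim r (V x) \<partial>M)" for r
    by (rule integral_cong_AE, measurable) (use eq in \<open>eventually_elim, simp\<close>)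
  show ?thesis unfolding J_def 1 2 ..
qed

lemma zero_in_W01L: "(\<lambda>x. 0) \<in> W01L \<Phi> \<Omega>" "J (\<lambda>x. 0) (weak_grad \<Omega> (\<lambda>x. 0)) = 0"
proof -
  let ?z = "\<lambda>x::real^'n. 0 :: real"
  obtain c where c: "c \<ge> 0" "dlim (\<lambda>x. c) (\<lambda>k. ?z) ?z" "dlim (\<lambda>x. c) (\<lambda>k. grad ?z) (grad ?z)"
    using test_dlim_const[OF zero_test_function] by metis
  note l = limit_in_W01L[OF dominator_const[OF c(1)] zero_test_function c(2,3)]
  have g: "grad ?z x = 0" for x by (rule grad_eqI) simp
  show "?z \<in> W01L \<Phi> \<Omega>" by (rule l(1))
  have "(\<integral>x. \<Phi> (norm (weak_grad \<Omega> ?z x)) \<partial>M) = 0"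
    by (rule integral_eq_zero_AE) (use l(2) in \<open>eventually_elim, simp add: g Phi_0\<close>)
  then show "J ?z (weak_grad \<Omega> ?z) = 0" using q p_gt_1 by (simp add: J_def pos_prim_def)
qed

end

section \<open>The main theorem\<close>

lemma Phi_zero: "Phi a 0 = 0"
  by (simp add: Phi_def flip: zero_ereal_def)

lemma Phi_has_derivative:
  assumes cont: "continuous_on UNIV (phi a)"
  shows "(Phi a has_real_derivative phi a t) (at t)"
proof -
  \<comment> \<open>The extra 1 makes \<open>t\<close> an interior point of [-b, b], so the
    derivative within this interval is a full derivative.\<close>
  define b where "b = \<bar>t\<bar> + 1"
  have b: "- b \<le> 0" "0 \<le> b" "- b < t" "t < b" by (auto simp: b_def)
  have "((\<lambda>u. LBINT y=ereal 0..ereal u. phi a y) has_vector_derivative phi a t) (at t within {- b..b})"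
    using b by (intro interval_integral_FTC2 continuous_on_subset[OF cont]) auto
  then have "(Phi a has_vector_derivative phi a t) (at t within {- b..b})"
    by (simp add: Phi_def[abs_def] zero_ereal_def)
  then have "(Phi a has_vector_derivative phi a t) (at t)"
    using b by (subst (asm) at_within_interior) auto
  then show ?thesis by (simp add: has_real_derivative_iff_has_vector_derivative)
qed

text \<open>The strict inequality p < \<phi>_0 leaves room for an exponent s in between. Then
  \<Phi>(t) t^(-s) is nondecreasing, so \<Phi> grows at least like t^s and t^p is of smaller order;
  \<sigma> is a real number above \<phi>^0.\<close>

lemma Phi_young:
  assumes odd: "\<And>t. phi a (- t) = - phi a t" and mono: "strict_mono (phi a)"
    and homeo: "\<exists>\<psi>. homeomorphism UNIV UNIV (phi a) \<psi>"
    and upper: "phi_upper a < \<infinity>" and convex: "convex_on {0..} (\<lambda>t. Phi a (sqrt t))"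
    and p: "1 < p" "ereal p < phi_lower a"
  obtains \<sigma> where "young (Phi a) (phi a) p \<sigma>"
proof -
  have cont: "continuous_on UNIV (phi a)" using homeo by (auto simp: homeomorphism_def)
  note deriv = Phi_has_derivative[OF cont]
  have phi0: "phi a 0 = 0" by (simp add: phi_def)
  have phi_pos: "phi a t > 0" if "t > 0" for t using mono that phi0 by (metis strict_monoD)
  have Phi_pos: "Phi a t > 0" if "t > 0" for t
  proof -
    have "Phi a 0 < Phi a t"
    proof (rule DERIV_pos_imp_increasing_open[OF that])
      show "\<exists>y. (Phi a has_real_derivative y) (at x) \<and> y > 0" if "0 < x" "x < t" for x
        using deriv phi_pos[OF that(1)] by blast
      show "continuous_on {0..t} (Phi a)"
        using deriv by (meson DERIV_isCont continuous_at_imp_continuous_on)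
    qed
    then show ?thesis by (simp add: Phi_zero)
  qed
  obtain \<sigma> where \<sigma>: "phi_upper a < ereal \<sigma>" using ereal_dense2[OF upper] by auto
  obtain s where s: "ereal p < ereal s" "ereal s < phi_lower a" using ereal_dense2[OF p(2)] by auto
  have ps: "p < s" using s(1) by simp
  have up: "t * phi a t \<le> \<sigma> * Phi a t" if t: "t > 0" for t
  proof -
    have "ereal (t * phi a t / Phi a t) \<le> phi_upper a"
      unfolding phi_upper_def using t by (intro SUP_upper) auto
    then have "t * phi a t / Phi a t \<le> \<sigma>" using \<sigma> by (metis ereal_less_eq(3) less_imp_le order_trans)
    then show ?thesis using Phi_pos[OF t] by (simp add: divide_le_eq)
  qed
  have low: "s * Phi a t \<le> t * phi a t" if t: "t > 0" for t
  proof -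
    have "phi_lower a \<le> ereal (t * phi a t / Phi a t)"
      unfolding phi_lower_def using t by (intro INF_lower) auto
    then have "s \<le> t * phi a t / Phi a t" using s(2) by (metis ereal_less_eq(3) less_imp_le order_trans)
    then show ?thesis using Phi_pos[OF t] by (simp add: le_divide_eq)
  qed
  have power: "Phi a 1 * t powr s \<le> Phi a t" if t: "t \<ge> 1" for t
  proof -
    define r where "r x = Phi a x * x powr (- s)" for x
    have "r 1 \<le> r t"
    proof (rule DERIV_nonneg_imp_nondecreasing[of 1 t r])
      fix x :: real assume "1 \<le> x" "x \<le> t"
      then have x: "x > 0" by simp
      have "(r has_real_derivative (phi a x * x powr (- s) + Phi a x * (- s * x powr (- s - 1)))) (at x)"
        unfolding r_def using x
        by (auto intro!: derivative_eq_intros deriv simp: powr_diff)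
      moreover have "phi a x * x powr (- s) + Phi a x * (- s * x powr (- s - 1)) =
          x powr (- s - 1) * (x * phi a x - s * Phi a x)"
        using x by (simp add: powr_diff field_simps)
      moreover have "\<dots> \<ge> 0" using low[OF x] by (intro mult_nonneg_nonneg) auto
      ultimately show "\<exists>y. (r has_real_derivative y) (at x) \<and> 0 \<le> y" by auto
    qed (rule t)
    then have "Phi a 1 * t powr s \<le> Phi a t * t powr (- s) * t powr s"
      by (intro mult_right_mono) (auto simp: r_def)
    also have "\<dots> = Phi a t" using t by (simp add: mult.assoc flip: powr_add)
    finally show ?thesis .
  qed
  have growth: "\<exists>C. \<forall>t\<ge>0. t powr p \<le> c * Phi a t + C" if c: "c > 0" for c
  proof -
    \<comment> \<open>Beyond T the factor t^(p - s) has fallen below c \<Phi>(1); up to T the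
      constant T^p suffices.\<close>
    define T where "T = max 1 ((c * Phi a 1) powr (- 1 / (s - p)))"
    have P1: "Phi a 1 > 0" by (rule Phi_pos) simp
    have Phi_nonneg: "Phi a t \<ge> 0" if "t \<ge> 0" for t
      using that Phi_pos[of t] by (cases "t = 0") (auto simp: Phi_zero)
    have "t powr p \<le> c * Phi a t + T powr p" if t: "t \<ge> 0" for t
    proof (cases "t \<le> T")
      case True
      then have "t powr p \<le> T powr p" using t p by (intro powr_mono2) auto
      then show ?thesis using c Phi_nonneg[OF t] by (simp add: add_increasing)
    next
      case False
      then have t1: "t \<ge> 1" "t \<ge> (c * Phi a 1) powr (- 1 / (s - p))" by (auto simp: T_def)
      have "t powr (p - s) \<le> ((c * Phi a 1) powr (- 1 / (s - p))) powr (p - s)"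
        using t1 ps c P1 by (intro powr_mono2') auto
      also have "\<dots> = (c * Phi a 1) powr ((- 1 / (s - p)) * (p - s))" by (simp add: powr_powr)
      also have "(- 1 / (s - p)) * (p - s) = 1" using ps by (simp add: field_simps)
      finally have "t powr (p - s) \<le> c * Phi a 1" using c P1 by simp
      then have "t powr (p - s) * t powr s \<le> c * Phi a 1 * t powr s" by (intro mult_right_mono) auto
      also have "\<dots> \<le> c * Phi a t" using power[OF t1(1)] c by (simp add: mult.assoc)
      finally have "t powr p \<le> c * Phi a t" using t1 by (simp flip: powr_add)
      then show ?thesis using powr_ge_zero[of T p] by linarith
    qed
    then show ?thesis by blast
  qed
  have "young (Phi a) (phi a) p \<sigma>"
    by unfold_locales (use cont odd mono deriv Phi_zero up p growth convex in auto)
  then show ?thesis by (rule that)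
qed

context domain
begin

text \<open>Scaling a bump by R multiplies the two integrals by R^q and R^p, and p > q makes the
  second one win for large R.\<close>

lemma nontrivial_test_function:
  assumes ne: "\<Omega> \<noteq> {}" and q: "1 < q" "q < p"
  obtains e where "e \<in> \<T>" "(\<integral>x. pos_prim q (e x) \<partial>M) < (\<integral>x. pos_prim p (e x) \<partial>M)"
proof -
  obtain x0 where x0: "x0 \<in> \<Omega>" using ne by blast
  obtain c d where cd: "x0 \<in> box c d" "cbox c d \<subseteq> \<Omega>"
    using open_contains_cbox[OF open_dom x0] by metis
  let ?b = "box_bump c d 1"
  have b: "?b \<in> \<T>" by (rule box_bump_test_function[OF cd(2)])
  have b0: "0 \<le> ?b x" for x by (rule box_bump_bounds)
  have scale: "(\<integral>x. pos_prim r (R * ?b x) \<partial>M) = R powr r * (\<integral>x. pos_prim r (?b x) \<partial>M)"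
    if "R > 0" for r R
  proof -
    have "pos_prim r (R * ?b x) = R powr r * pos_prim r (?b x)" for x
      using that b0[of x] by (simp add: pos_prim_def max_absorb2 powr_mult)
    then show ?thesis by simp
  qed
  define A where "A r = (\<integral>x. pos_prim r (?b x) \<partial>M)" for r
  have Aq: "A q \<ge> 0" unfolding A_def using q by (intro integral_nonneg_AE AE_I2 pos_prim_nonneg) simp
  have Ap: "A p > 0"
  proof (rule ccontr)
    assume "\<not> A p > 0"
    moreover have "A p \<ge> 0" unfolding A_def using p_gt_1 by (intro integral_nonneg_AE AE_I2 pos_prim_nonneg) simp
    ultimately have "A p = 0" by simp
    then have "AE x in M. pos_prim p (?b x) = 0"
      unfolding A_def using test_pair_integrable(3)[OF b b] p_gt_1
      by (subst (asm) integral_nonneg_eq_0_iff_AE) (auto simp: pos_prim_nonneg)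
    then have "AE x in M. ?b x = 0"
      by eventually_elim (use b0 p_gt_1 in \<open>auto simp: pos_prim_def max_absorb2\<close>)
    then have "?b x0 = 0" by (rule AE_zero_test_function[OF b])
    then show False using box_bump_inside[OF cd(1), of 1] by simp
  qed
  \<comment> \<open>The summand 1 in \<open>A q + 1\<close> makes the final inequality
    strict.\<close>
  define R where "R = max 1 (((A q + 1) / A p) powr (1 / (p - q)))"
  have R: "R \<ge> 1" by (simp add: R_def)
  have "(A q + 1) / A p = (((A q + 1) / A p) powr (1 / (p - q))) powr (p - q)"
    using Aq Ap q by (simp add: powr_powr)
  also have "\<dots> \<le> R powr (p - q)" using q by (intro powr_mono2) (auto simp: R_def)
  finally have "A q + 1 \<le> R powr (p - q) * A p" using Ap by (simp add: divide_le_eq)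
  then have "R powr q * A q < R powr q * (R powr (p - q) * A p)"
    using R by (intro mult_strict_left_mono) auto
  also have "\<dots> = R powr p * A p" using R by (simp add: mult.assoc[symmetric] powr_add[symmetric])
  finally have less: "R powr q * A q < R powr p * A p" .
  have R0: "R > 0" using R by simp
  have "(\<integral>x. pos_prim q (R * ?b x) \<partial>M) < (\<integral>x. pos_prim p (R * ?b x) \<partial>M)"
    unfolding scale[OF R0] A_def[symmetric] by (rule less)
  then show ?thesis using that[OF test_function_cmult[OF b]] by blast
qed

end

lemma (in energy) critical_limit_weak_solution:
  assumes flux_eq: "\<And>\<xi>::real^'n. flux \<xi> = a (norm \<xi>) *\<^sub>R \<xi>" and \<Phi>: "\<Phi> = Phi a"
    and U: "critical_limit U"
  shows "weak_solution \<Omega> a p q \<mu> U"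
proof -
  have UW: "U \<in> W01L (Phi a) \<Omega>" and U0: "AE x in M. 0 \<le> U x"
    using U[unfolded critical_limit_def] by (auto simp: \<Phi>)
  have Um [measurable]: "U \<in> borel_measurable M"
    using UW by (auto simp: W01L_def W1L_def orlicz_space_def)
  have "integrable M (\<lambda>x. (a (norm (weak_grad \<Omega> U x)) *\<^sub>R weak_grad \<Omega> U x) \<bullet> weak_grad \<Omega> v x) \<and>
        integrable M (\<lambda>x. U x powr (p - 1) * v x) \<and> integrable M (\<lambda>x. U x powr (q - 1) * v x) \<and>
        (\<integral>x. (a (norm (weak_grad \<Omega> U x)) *\<^sub>R weak_grad \<Omega> U x) \<bullet> weak_grad \<Omega> v x \<partial>M)
          - \<mu> * (\<integral>x. U x powr (p - 1) * v x \<partial>M) + \<mu> * (\<integral>x. U x powr (q - 1) * v x \<partial>M) = 0"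
    if v: "v \<in> W01L (Phi a) \<Omega>" for v
  proof -
    have [measurable]: "v \<in> borel_measurable M"
      using v by (auto simp: W01L_def W1L_def orlicz_space_def)
    have ae: "AE x in M. U x powr (r - 1) * v x = pos_pow r (U x) * v x" for r
      using U0 by eventually_elim (simp add: pos_pow_def max_absorb2)
    have int: "integrable M (\<lambda>x. U x powr (r - 1) * v x) \<longleftrightarrow> integrable M (\<lambda>x. pos_pow r (U x) * v x)" for r
      by (rule integrable_cong_AE[OF _ _ ae]) measurable
    have eq: "(\<integral>x. U x powr (r - 1) * v x \<partial>M) = (\<integral>x. pos_pow r (U x) * v x \<partial>M)" for r
      by (rule integral_cong_AE[OF _ _ ae]) measurable
    show ?thesis
      using U[unfolded critical_limit_def EL_def] v unfolding int eq flux_eq[symmetric] \<Phi> by blast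
  qed
  then show ?thesis using UW U0 by (auto simp: weak_solution_def)
qed

theorem theorem1:
  fixes \<Omega> :: "(real^'n::finite) set" and a :: "real \<Rightarrow> real" and p q :: real
  assumes "CARD('n) \<ge> 3"
    and "smooth_bounded_domain \<Omega>"
    and "\<And>t. phi a (- t) = - phi a t"
    and "strict_mono (phi a)"
    and "\<exists>\<psi>. homeomorphism UNIV UNIV (phi a) \<psi>"
    and "1 < phi_lower a" and "phi_lower a \<le> phi_upper a" and "phi_upper a < \<infinity>"
    and "convex_on {0..} (\<lambda>t. Phi a (sqrt t))"
    and "1 < q" and "q < p" and "ereal p < phi_lower a"
    and "phi_upper a < min (ereal (real CARD('n)))
           (ereal (real CARD('n)) * phi_lower a / (ereal (real CARD('n)) - phi_lower a))"
  shows "\<exists>\<mu>\<^sub>0>0. \<forall>\<mu>>\<mu>\<^sub>0. \<exists>u v.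
           weak_solution \<Omega> a p q \<mu> u \<and> weak_solution \<Omega> a p q \<mu> v \<and>
           \<not> (AE x in lebesgue_on \<Omega>. u x = 0) \<and>
           \<not> (AE x in lebesgue_on \<Omega>. v x = 0) \<and>
           \<not> (AE x in lebesgue_on \<Omega>. u x = v x)"
proof -
  have p: "1 < p" using assms(10,11) by simp
  obtain \<sigma> where "young (Phi a) (phi a) p \<sigma>"
    using Phi_young[OF assms(3,4,5,8,9) p assms(12)] by blast
  then interpret Y: young "Phi a" "phi a" p \<sigma> .
  have \<Omega>: "open \<Omega>" "bounded \<Omega>" "\<Omega> \<noteq> {}" using assms(2) by (auto simp: smooth_bounded_domain_def)
  interpret D: domain "Phi a" "phi a" p \<sigma> \<Omega> by unfold_locales (rule \<Omega>)+
  have flux_eq: "Y.flux \<xi> = a (norm \<xi>) *\<^sub>R \<xi>" for \<xi> :: "real^'n"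
    by (cases "\<xi> = 0") (simp_all add: Y.flux_def phi_def)
  obtain e where e: "e \<in> test_functions \<Omega>"
    "(\<integral>x. pos_prim q (e x) \<partial>lebesgue_on \<Omega>) < (\<integral>x. pos_prim p (e x) \<partial>lebesgue_on \<Omega>)"
    using D.nontrivial_test_function[OF \<Omega>(3) assms(10,11)] by blast
  define G where "G = (\<integral>x. pos_prim p (e x) \<partial>lebesgue_on \<Omega>) - (\<integral>x. pos_prim q (e x) \<partial>lebesgue_on \<Omega>)"
  have G: "G > 0" using e(2) by (simp add: G_def)
  define I where "I = (\<integral>x. Phi a (norm (grad e x)) \<partial>lebesgue_on \<Omega>)"
  have I: "I \<ge> 0" unfolding I_def by (intro integral_nonneg_AE AE_I2 Y.Phi_nonneg)
  show ?thesis
  \<comment> \<open>Since J(e) = I - \<mu> G, the energy of \<open>e\<close> is negative for \<mu> >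
    I / G; the summand 1 keeps the threshold positive when I = 0.\<close>
  proof (intro exI[of _ "I / G + 1"] conjI allI impI)
    show "0 < I / G + 1" using I G by (simp add: add_nonneg_pos)
    fix \<mu> assume \<mu>: "I / G + 1 < \<mu>"
    then have \<mu>0: "0 < \<mu>" and \<mu>G: "I < \<mu> * G"
      using I G by (auto simp: field_simps add_nonneg_pos intro: le_less_trans[of 0 "I / G + 1"])
    interpret energy "Phi a" "phi a" p \<sigma> \<Omega> q \<mu>
      by unfold_locales (use assms(10,11) \<mu>0 in auto)
    have "J e (grad e) = I - \<mu> * G" by (simp add: J_def I_def G_def right_diff_distrib)
    then have neg: "J e (grad e) < 0" using \<mu>G by simp
    obtain U V where U: "critical_limit U" "J U (weak_grad \<Omega> U) < 0"
      and V: "critical_limit V" "J V (weak_grad \<Omega> V) > 0"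
      using two_critical_limits[OF e(1) neg] by blast
    have W: "U \<in> W01L (Phi a) \<Omega>" "V \<in> W01L (Phi a) \<Omega>"
      using U(1) V(1) by (auto simp: critical_limit_def)
    \<comment> \<open>The zero function has energy 0, so the three energies of \<open>U\<close>, 0
      and \<open>V\<close> are negative, zero and positive, and the functions are pairwise
      distinct.\<close>
    have "\<not> (AE x in lebesgue_on \<Omega>. U x = 0)"
      using J_cong_AE[OF W(1) zero_in_W01L(1)] zero_in_W01L(2) U(2) by auto
    moreover have "\<not> (AE x in lebesgue_on \<Omega>. V x = 0)"
      using J_cong_AE[OF W(2) zero_in_W01L(1)] zero_in_W01L(2) V(2) by auto
    moreover have "\<not> (AE x in lebesgue_on \<Omega>. U x = V x)"
      using J_cong_AE[OF W] U(2) V(2) by auto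
    moreover have "weak_solution \<Omega> a p q \<mu> U" "weak_solution \<Omega> a p q \<mu> V"
      using critical_limit_weak_solution[OF flux_eq refl] U(1) V(1) by auto
    ultimately show "\<exists>u v. weak_solution \<Omega> a p q \<mu> u \<and> weak_solution \<Omega> a p q \<mu> v \<and>
           \<not> (AE x in lebesgue_on \<Omega>. u x = 0) \<and> \<not> (AE x in lebesgue_on \<Omega>. v x = 0) \<and>
           \<not> (AE x in lebesgue_on \<Omega>. u x = v x)" by blast
  qed
qed

end
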